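(* Let $\alpha>0$, $0<p,q\le\infty$, $0<s<\infty$. Let $\delta_0=\delta_0(\alpha,p,q)\in(0,\frac12]$ be a number for which the atomic decomposition property (AD) of the context holds, fix $0<\delta<\delta_0$, and let $\mathcal P_\delta$ be a $\delta$-pocket tiling of $\mathbb C$ with centers $\zeta_Q$. Then, for every $R>C_{\mathrm{out}}\delta$, the following assertions are equivalent for a positive Borel measure $\mu$ on $\mathbb C$: (i) $\mu$ is a vanishing $s$-Carleson measure for $\mathcal F_\alpha^{p,q}$, i.e. the embedding $i_\mu:\mathcal F_\alpha^{p,q}\to L^s_\alpha(\mu)$, $i_\mu f=f$, is compact. (ii) The sequence $u_{\mu,R}$ satisfies: (a) if $0<q\le s$, then $\|(u_{\mu,R})_k\|_{\ell^{p_s^*}}\to0$ as $k\to\infty$; (b) if $s<q\le\infty$, then $u_{\mu,R}\in\ell^{p_s^*,q_s^*}$. (iii) The function $U_{\mu,R}$ satisfies: (a) if $0<q\le s$, then $\|U_{\mu,R}\|_{L^{p_s^*}(A_k)}\to0$ as $k\to\infty$; (b) if $s<q\le\infty$, then $U_{\mu,R}\in L_{\mathrm{sh}}^{p_s^*,q_s^*}(\mathbb C)$.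
   Context: Convention: $\frac1\infty=0$; $X\asymp Y$ means $C^{-1}Y\le X\le CY$. Compactness of an operator between (quasi-)normed spaces means that the image of the unit ball is relatively compact. Mixed-norm Fock spaces. For an entire function $f$ and $r\ge0$, $M_p(f,r):=\left(\frac1{2\pi}\int_0^{2\pi}|f(re^{i\theta})|^p\,d\theta\right)^{1/p}$ for $0<p<\infty$, and $M_\infty(f,r):=\sup_{\theta}|f(re^{i\theta})|$. Put $\|f\|_{\mathcal F_\alpha^{p,q}}:=\left(\int_0^\infty M_p(f,r)^q\,\alpha q\,e^{-\frac{\alpha q}{2}r^2}r\,dr\right)^{1/q}$ for $0<q<\infty$ and $\|f\|_{\mathcal F_\alpha^{p,\infty}}:=\sup_{r\ge0}M_p(f,r)e^{-\frac{\alpha}{2}r^2}$. $\mathcal F_\alpha^{p,q}$ is the set of entire $f$ with finite (quasi-)norm. Kernels: $\kappa_w(z):=e^{\alpha\overline w z-\frac{\alpha}{2}|w|^2}$. $\delta$-pocket tiling. Let $\delta\in(0,\frac12]$, $N_\delta:=\lceil\delta^{-1}\rceil$, $A_k:=\{z\in\mathbb C:k\le|z|<k+1\}$, $k\ge0$. For $k\ge0$, $0\le\nu\le N_\delta-1$ let $N_{\delta,0,\nu}:=2\nu+1$ and $N_{\delta,k,\nu}:=(2k+1)N_\delta$ if $k\ge1$; $\theta_{k,\nu,\mu}:=2\pi\mu/N_{\delta,k,\nu}$. For $0\le\nu\le N_\delta$ let $r_{0,\nu}:=\nu/N_\delta$ and $r_{k,\nu}:=\left(k^2+\frac{\nu}{N_\delta}(2k+1)\right)^{1/2}$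 if $k\ge1$. The pockets are $Q_{k,\nu,\mu}:=\{re^{i\theta}:r\in[r_{k,\nu},r_{k,\nu+1}),\ \theta\in[\theta_{k,\nu,\mu},\theta_{k,\nu,\mu+1})\}$ ($k\ge0$, $0\le\nu\le N_\delta-1$, $0\le\mu\le N_{\delta,k,\nu}-1$), with centers $\zeta_{k,\nu,\mu}:=\frac{r_{k,\nu}+r_{k,\nu+1}}2\exp\left(i\,\frac{\theta_{k,\nu,\mu}+\theta_{k,\nu,\mu+1}}2\right)$. $\mathcal P_\delta$ is the family of all pockets $Q$, with centers $\zeta_Q$; $\mathcal P_{\delta,k}:=\{Q\in\mathcal P_\delta:Q\subset A_k\}$. Fix absolute constants $0<c_{\mathrm{in}}<C_{\mathrm{out}}<\infty$ (for instance $c_{\mathrm{in}}=\frac1{32}$, $C_{\mathrm{out}}=4$) with $B(\zeta_Q,c_{\mathrm{in}}\delta)\subset Q\subset B(\zeta_Q,C_{\mathrm{out}}\delta)$ for all $Q\in\mathcal P_\delta$, $\delta\in(0,\frac12]$; $B(z,R)$ is the open Euclidean disc. Property (AD) for $\delta_0$: for every $\delta\in(0,\delta_0)$, the map $c\mapsto\sum_{Q\in\mathcal P_\delta}c_Q\kappa_{\zeta_Q}$ is bounded from $\ell_w^{p,q}$ to $\mathcal F_\alpha^{p,q}$, is onto, and $\|f\|_{\mathcal F_\alpha^{p,q}}\asymp\inf\{\|c\|_{\ell_w^{p,q}}:f=\sum_Qc_Q\kappa_{\zeta_Q}\}$ with constants depending only on $\alpha,p,q,\delta$. Here $\ell_w^{p,q}$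 is the space of $c=(c_Q)$ for which $\left((1+k)^{\frac1q-\frac1p}\|(c_Q)_{Q\in\mathcal P_{\delta,k}}\|_{\ell^p}\right)_{k\ge0}\in\ell^q$, with the $\ell^q$-(quasi-)norm of that sequence. (Such a $\delta_0$ exists.) Measures. $L^s_\alpha(\mu)$ is the space of measurable $f$ with $\|f\|^s_{L^s_\alpha(\mu)}:=\int_{\mathbb C}|f(z)|^se^{-\frac{\alpha s}2|z|^2}d\mu(z)<\infty$. Ball masses: $U_{\mu,R}(\zeta):=\|\kappa_\zeta\|_{\mathcal F_\alpha^{p,q}}^{-s}\,\mu(B(\zeta,R))$ for $\zeta\in\mathbb C$, and $u_{\mu,R}(Q):=U_{\mu,R}(\zeta_Q)$ for $Q\in\mathcal P_\delta$. Exponents: $p_s^*:=\infty$ if $0<p\le s$, $p_s^*:=\frac p{p-s}$ if $s<p<\infty$, $p_s^*:=1$ if $p=\infty$; $q_s^*$ is defined from $q$ in the same way. Shell norms: for $c=(c_Q)_{Q\in\mathcal P_\delta}$ let $c_k:=(c_Q)_{Q\in\mathcal P_{\delta,k}}$; $\|c\|_{\ell^{p_s^*,q_s^*}}:=\left\|\left(\|c_k\|_{\ell^{p_s^*}}\right)_{k\ge0}\right\|_{\ell^{q_s^*}}$ and $\|F\|_{L_{\mathrm{sh}}^{p_s^*,q_s^*}}:=\left\|\left(\|F\|_{L^{p_s^*}(A_k)}\right)_{k\ge0}\right\|_{\ell^{q_s^*}}$, where $L^{p_s^*}(A_k)$ is taken with respect to Lebesgue area measure; the corresponding spaces consist of sequences/measurable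 functions with finite norm.
   Formalization: In (ii)(a) and (iii)(a) every shell norm is also required to be finite; this is automatic for locally finite μ, and without it the claim fails, e.g. for an infinite point mass at 0 when q ≤ s. *)

theory Defs
  imports "HOL-Complex_Analysis.Complex_Analysis" "HOL-Probability.Essential_Supremum"
begin

text \<open>Exponents \<open>p, q \<in> (0,\<infinity>]\<close> are positive elements of \<^typ>\<open>ennreal\<close>, so that
  \<open>1 / \<infinity> = 0\<close> holds by computation.  All (quasi-)norms are \<^typ>\<open>ennreal\<close>-valued, and
  the ball masses of a measure are allowed to be infinite.\<close>

section \<open>Powers and \<open>L\<^sup>p\<close> norms with values in the extended nonnegative reals\<close>

text \<open>Only used with exponents \<open>a > 0\<close>.\<close>
definition enn_powr :: "ennreal \<Rightarrow> real \<Rightarrow> ennreal" where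
  "enn_powr x a = (if x = \<infinity> then \<infinity> else ennreal (enn2real x powr a))"

definition Lp_enorm :: "ennreal \<Rightarrow> 'a measure \<Rightarrow> ('a \<Rightarrow> ennreal) \<Rightarrow> ennreal" where
  "Lp_enorm p M F =
    (if p = \<infinity> then esssup M F
     else enn_powr (\<integral>\<^sup>+x. enn_powr (F x) (enn2real p) \<partial>M) (1 / enn2real p))"

abbreviation lp_enorm :: "ennreal \<Rightarrow> 'i set \<Rightarrow> ('i \<Rightarrow> ennreal) \<Rightarrow> ennreal" where
  "lp_enorm p I c \<equiv> Lp_enorm p (count_space I) c"

lemma lp_enorm_infinity: "lp_enorm \<infinity> I c = (SUP i\<in>I. c i)"
proof -
  have "Inf {z. \<forall>i\<in>I. c i \<le> z} = (SUP i\<in>I. c i)"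
    by (intro antisym Inf_lower SUP_least Inf_greatest) (auto intro: SUP_upper)
  then show ?thesis
    by (simp add: Lp_enorm_def esssup_eq_AE AE_count_space)
qed

definition star_exponent :: "real \<Rightarrow> ennreal \<Rightarrow> ennreal" where
  "star_exponent s p =
    (if p \<le> ennreal s then \<infinity> else if p = \<infinity> then 1 else p / (p - ennreal s))"

section \<open>Mixed-norm Fock spaces\<close>

definition integral_mean :: "ennreal \<Rightarrow> (complex \<Rightarrow> complex) \<Rightarrow> real \<Rightarrow> ennreal" where
  "integral_mean p f r =
    (if p = \<infinity> then (SUP \<theta>. ennreal (cmod (f (of_real r * cis \<theta>))))
     else enn_powr
       (ennreal (1 / (2 * pi)) *
         (\<integral>\<^sup>+\<theta>\<in>{0..2 * pi}. ennreal (cmod (f (of_real r * cis \<theta>)) powr enn2real p) \<partial>lborel))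
       (1 / enn2real p))"

definition fock_norm :: "real \<Rightarrow> ennreal \<Rightarrow> ennreal \<Rightarrow> (complex \<Rightarrow> complex) \<Rightarrow> ennreal" where
  "fock_norm \<alpha> p q f =
    (if q = \<infinity> then (SUP r\<in>{0..}. integral_mean p f r * ennreal (exp (- (\<alpha> / 2) * r\<^sup>2)))
     else enn_powr
       (\<integral>\<^sup>+r\<in>{0..}. enn_powr (integral_mean p f r) (enn2real q) *
           ennreal (\<alpha> * enn2real q * exp (- (\<alpha> * enn2real q / 2) * r\<^sup>2) * r) \<partial>lborel)
       (1 / enn2real q))"

definition fock_space :: "real \<Rightarrow> ennreal \<Rightarrow> ennreal \<Rightarrow> (complex \<Rightarrow> complex) set" where
  "fock_space \<alpha> p q = {f. f holomorphic_on UNIV \<and> fock_norm \<alpha> p q f < \<infinity>}"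

definition kernel :: "real \<Rightarrow> complex \<Rightarrow> complex \<Rightarrow> complex" where
  "kernel \<alpha> w z = exp (of_real \<alpha> * cnj w * z - of_real (\<alpha> / 2 * (cmod w)\<^sup>2))"

section \<open>The pocket tiling\<close>

definition annulus :: "nat \<Rightarrow> complex set" where
  "annulus k = {z. real k \<le> cmod z \<and> cmod z < real k + 1}"

definition num_radial :: "real \<Rightarrow> nat" where
  "num_radial \<delta> = nat \<lceil>1 / \<delta>\<rceil>"

definition num_angular :: "real \<Rightarrow> nat \<Rightarrow> nat \<Rightarrow> nat" where
  "num_angular \<delta> k \<nu> = (if k = 0 then 2 * \<nu> + 1 else (2 * k + 1) * num_radial \<delta>)"

definition pocket_angle :: "real \<Rightarrow> nat \<Rightarrow> nat \<Rightarrow> nat \<Rightarrow> real" where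
  "pocket_angle \<delta> k \<nu> m = 2 * pi * real m / real (num_angular \<delta> k \<nu>)"

definition pocket_radius :: "real \<Rightarrow> nat \<Rightarrow> nat \<Rightarrow> real" where
  "pocket_radius \<delta> k \<nu> =
    (if k = 0 then real \<nu> / real (num_radial \<delta>)
     else sqrt ((real k)\<^sup>2 + real \<nu> / real (num_radial \<delta>) * (2 * real k + 1)))"

text \<open>Pockets are nonempty and pairwise disjoint, so the tiling is represented by the set of
  its index triples \<open>(k, \<nu>, m)\<close>, and a family \<open>(c\<^sub>Q)\<close> by a function on triples.\<close>

type_synonym pocket_index = "nat \<times> nat \<times> nat"

definition tiling :: "real \<Rightarrow> pocket_index set" where
  "tiling \<delta> = {(k, \<nu>, m). \<nu> < num_radial \<delta> \<and> m < num_angular \<delta> k \<nu>}"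

definition pocket :: "real \<Rightarrow> pocket_index \<Rightarrow> complex set" where
  "pocket \<delta> = (\<lambda>(k, \<nu>, m). {of_real r * cis \<theta> | r \<theta>.
     pocket_radius \<delta> k \<nu> \<le> r \<and> r < pocket_radius \<delta> k (Suc \<nu>) \<and>
     pocket_angle \<delta> k \<nu> m \<le> \<theta> \<and> \<theta> < pocket_angle \<delta> k \<nu> (Suc m)})"

definition pocket_center :: "real \<Rightarrow> pocket_index \<Rightarrow> complex" where
  "pocket_center \<delta> = (\<lambda>(k, \<nu>, m).
     of_real ((pocket_radius \<delta> k \<nu> + pocket_radius \<delta> k (Suc \<nu>)) / 2) *
     cis ((pocket_angle \<delta> k \<nu> m + pocket_angle \<delta> k \<nu> (Suc m)) / 2))"

definition tiling_shell :: "real \<Rightarrow> nat \<Rightarrow> pocket_index set" where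
  "tiling_shell \<delta> k = {Q \<in> tiling \<delta>. pocket \<delta> Q \<subseteq> annulus k}"

definition pocket_ball_constants :: "real \<Rightarrow> real \<Rightarrow> bool" where
  "pocket_ball_constants c_in C_out \<longleftrightarrow> 0 < c_in \<and> c_in < C_out \<and>
    (\<forall>\<delta>. 0 < \<delta> \<and> \<delta> \<le> 1 / 2 \<longrightarrow> (\<forall>Q\<in>tiling \<delta>.
       ball (pocket_center \<delta> Q) (c_in * \<delta>) \<subseteq> pocket \<delta> Q \<and>
       pocket \<delta> Q \<subseteq> ball (pocket_center \<delta> Q) (C_out * \<delta>)))"

section \<open>Atomic decomposition\<close>

definition weighted_norm ::
  "real \<Rightarrow> ennreal \<Rightarrow> ennreal \<Rightarrow> (pocket_index \<Rightarrow> complex) \<Rightarrow> ennreal" where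
  "weighted_norm \<delta> p q c = lp_enorm q UNIV
     (\<lambda>k. ennreal ((1 + real k) powr (enn2real (1 / q) - enn2real (1 / p))) *
          lp_enorm p (tiling_shell \<delta> k) (\<lambda>Q. ennreal (cmod (c Q))))"

definition weighted_space ::
  "real \<Rightarrow> ennreal \<Rightarrow> ennreal \<Rightarrow> (pocket_index \<Rightarrow> complex) set" where
  "weighted_space \<delta> p q = {c. weighted_norm \<delta> p q c < \<infinity>}"

text \<open>\<open>f = \<Sum>\<^sub>Q c\<^sub>Q \<kappa>\<^sub>\<zeta>\<^sub>Q\<close>, with unconditional convergence of the series at every point.\<close>
definition synthesizes ::
  "real \<Rightarrow> real \<Rightarrow> (pocket_index \<Rightarrow> complex) \<Rightarrow> (complex \<Rightarrow> complex) \<Rightarrow> bool" where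
  "synthesizes \<alpha> \<delta> c f \<longleftrightarrow>
    (\<forall>z. ((\<lambda>Q. c Q * kernel \<alpha> (pocket_center \<delta> Q) z) has_sum f z) (tiling \<delta>))"

definition atomic_decomposition :: "real \<Rightarrow> ennreal \<Rightarrow> ennreal \<Rightarrow> real \<Rightarrow> bool" where
  "atomic_decomposition \<alpha> p q \<delta>\<^sub>0 \<longleftrightarrow> (\<forall>\<delta>. 0 < \<delta> \<and> \<delta> < \<delta>\<^sub>0 \<longrightarrow>
     (\<exists>C>0. \<forall>c\<in>weighted_space \<delta> p q. \<exists>f\<in>fock_space \<alpha> p q.
        synthesizes \<alpha> \<delta> c f \<and> fock_norm \<alpha> p q f \<le> ennreal C * weighted_norm \<delta> p q c) \<and>
     (\<forall>f\<in>fock_space \<alpha> p q. \<exists>c\<in>weighted_space \<delta> p q. synthesizes \<alpha> \<delta> c f) \<and>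
     (\<exists>C>0. \<forall>f\<in>fock_space \<alpha> p q.
        let quotient_norm =
          (INF c\<in>{c \<in> weighted_space \<delta> p q. synthesizes \<alpha> \<delta> c f}. weighted_norm \<delta> p q c)
        in ennreal (inverse C) * quotient_norm \<le> fock_norm \<alpha> p q f \<and>
           fock_norm \<alpha> p q f \<le> ennreal C * quotient_norm))"

section \<open>Compact operators and Carleson embeddings\<close>

text \<open>The topology of a (quasi-)(semi)norm \<open>N\<close> on \<open>V\<close>.  Functions that agree almost everywhere
  are not identified; they are topologically indistinguishable here, so that passing to classes
  would not change compactness.\<close>
definition quasinorm_topology :: "'a::minus set \<Rightarrow> ('a \<Rightarrow> ennreal) \<Rightarrow> 'a topology" where
  "quasinorm_topology V N =
    topology (\<lambda>U. U \<subseteq> V \<and> (\<forall>f\<in>U. \<exists>e>0. \<forall>g\<in>V. N (g - f) < e \<longrightarrow> g \<in> U))"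

lemma openin_quasinorm_topology:
  "openin (quasinorm_topology V N) U \<longleftrightarrow>
    U \<subseteq> V \<and> (\<forall>f\<in>U. \<exists>e>0. \<forall>g\<in>V. N (g - f) < e \<longrightarrow> g \<in> U)"
proof -
  let ?P = "\<lambda>U. U \<subseteq> V \<and> (\<forall>f\<in>U. \<exists>e>0. \<forall>g\<in>V. N (g - f) < e \<longrightarrow> g \<in> U)"
  have "?P (S \<inter> T)" if "?P S" "?P T" for S T
  proof (intro conjI ballI)
    show "S \<inter> T \<subseteq> V" using that by blast
    fix f assume "f \<in> S \<inter> T"
    then obtain d e where "d > 0" "\<forall>g\<in>V. N (g - f) < d \<longrightarrow> g \<in> S"
      "e > 0" "\<forall>g\<in>V. N (g - f) < e \<longrightarrow> g \<in> T"
      using \<open>?P S\<close> \<open>?P T\<close> by blast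
    then show "\<exists>e>0. \<forall>g\<in>V. N (g - f) < e \<longrightarrow> g \<in> S \<inter> T"
      by (intro exI[of _ "min d e"]) auto
  qed
  moreover have "?P (\<Union>K)" if "\<forall>S\<in>K. ?P S" for K
    using that by (fastforce simp: Sup_le_iff)
  ultimately have "istopology ?P"
    unfolding istopology_def by blast
  then show ?thesis
    unfolding quasinorm_topology_def by (simp add: topology_inverse')
qed

lemma topspace_quasinorm_topology: "topspace (quasinorm_topology V N) = V"
proof -
  have "openin (quasinorm_topology V N) V"
    unfolding openin_quasinorm_topology using zero_less_one by blast
  then show ?thesis
    by (meson openin_quasinorm_topology openin_subset openin_topspace subset_antisym)
qed

definition compact_operator ::
  "'a set \<Rightarrow> ('a \<Rightarrow> ennreal) \<Rightarrow> 'b::minus set \<Rightarrow> ('b \<Rightarrow> ennreal) \<Rightarrow> ('a \<Rightarrow> 'b) \<Rightarrow> bool" where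
  "compact_operator V N W N' T \<longleftrightarrow> T \<in> V \<rightarrow> W \<and>
    compactin (quasinorm_topology W N')
      (quasinorm_topology W N' closure_of (T ` {f \<in> V. N f \<le> 1}))"

definition weighted_Ls_norm ::
  "real \<Rightarrow> real \<Rightarrow> complex measure \<Rightarrow> (complex \<Rightarrow> complex) \<Rightarrow> ennreal" where
  "weighted_Ls_norm \<alpha> s \<mu> f = enn_powr
     (\<integral>\<^sup>+z. ennreal (cmod (f z) powr s * exp (- (\<alpha> * s / 2) * (cmod z)\<^sup>2)) \<partial>\<mu>) (1 / s)"

definition weighted_Ls ::
  "real \<Rightarrow> real \<Rightarrow> complex measure \<Rightarrow> (complex \<Rightarrow> complex) set" where
  "weighted_Ls \<alpha> s \<mu> = {f \<in> borel_measurable \<mu>. weighted_Ls_norm \<alpha> s \<mu> f < \<infinity>}"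

definition vanishing_Carleson ::
  "real \<Rightarrow> ennreal \<Rightarrow> ennreal \<Rightarrow> real \<Rightarrow> complex measure \<Rightarrow> bool" where
  "vanishing_Carleson \<alpha> p q s \<mu> \<longleftrightarrow>
    compact_operator (fock_space \<alpha> p q) (fock_norm \<alpha> p q)
      (weighted_Ls \<alpha> s \<mu>) (weighted_Ls_norm \<alpha> s \<mu>) (\<lambda>f. f)"

section \<open>Ball masses and shell norms\<close>

definition ball_mass ::
  "real \<Rightarrow> ennreal \<Rightarrow> ennreal \<Rightarrow> real \<Rightarrow> complex measure \<Rightarrow> real \<Rightarrow> complex \<Rightarrow> ennreal" where
  "ball_mass \<alpha> p q s \<mu> R \<zeta> =
    inverse (enn_powr (fock_norm \<alpha> p q (kernel \<alpha> \<zeta>)) s) * emeasure \<mu> (ball \<zeta> R)"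

definition pocket_mass ::
  "real \<Rightarrow> ennreal \<Rightarrow> ennreal \<Rightarrow> real \<Rightarrow> complex measure \<Rightarrow> real \<Rightarrow> real \<Rightarrow> pocket_index \<Rightarrow> ennreal"
  where "pocket_mass \<alpha> p q s \<mu> R \<delta> Q = ball_mass \<alpha> p q s \<mu> R (pocket_center \<delta> Q)"

definition seq_shell_norm :: "real \<Rightarrow> ennreal \<Rightarrow> (pocket_index \<Rightarrow> ennreal) \<Rightarrow> nat \<Rightarrow> ennreal" where
  "seq_shell_norm \<delta> p c k = lp_enorm p (tiling_shell \<delta> k) c"

definition fun_shell_norm :: "ennreal \<Rightarrow> (complex \<Rightarrow> ennreal) \<Rightarrow> nat \<Rightarrow> ennreal" where
  "fun_shell_norm p F k = Lp_enorm p (restrict_space lborel (annulus k)) F"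

definition mixed_seq_space ::
  "real \<Rightarrow> ennreal \<Rightarrow> ennreal \<Rightarrow> (pocket_index \<Rightarrow> ennreal) set" where
  "mixed_seq_space \<delta> p q = {c. lp_enorm q UNIV (seq_shell_norm \<delta> p c) < \<infinity>}"

definition mixed_shell_space :: "ennreal \<Rightarrow> ennreal \<Rightarrow> (complex \<Rightarrow> ennreal) set" where
  "mixed_shell_space p q =
    {F \<in> borel_measurable lborel. lp_enorm q UNIV (fun_shell_norm p F) < \<infinity>}"

text \<open>Convergence to \<open>0\<close> of a sequence of norms, as a sequence of real numbers.  The finiteness
  clause matters when \<open>\<mu>\<close> is not locally finite: without it, infinite mass near the
  origin would go unnoticed by a limit along the shells.\<close>
definition null_norm_sequence :: "(nat \<Rightarrow> ennreal) \<Rightarrow> bool" where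
  "null_norm_sequence x \<longleftrightarrow> (\<forall>k. x k < \<infinity>) \<and> x \<longlonglongrightarrow> 0"

end

theory Submission imports Defs "HOL-Probability.Distributions"
begin

text \<open>Everything reduces to sequences indexed by the pockets. In modulus the normalised kernels are
  Gaussians, so synthesis, evaluation on pockets and passage from centers to arbitrary points are all
  dominated by Gaussian matrices \<open>exp (- \<beta> dist\<^sup>2)\<close>; these act boundedly on the mixed
  sequence norms for all exponents and even preserve null sequences. This gives the equivalence of the
  two mass conditions, and, with Hoelder's inequality, a bound for the \<open>L\<^sup>s\<close> norm of
  \<open>f\<close> outside a large disc by the tail of the masses. Montel's theorem inside the disc then yields
  compactness.

  Conversely, for coefficients \<open>c\<close> on finitely many pockets, averaging over all signs bounds
  \<open>\<Sum>\<bar>c\<^sub>Q\<bar>\<^sup>s \<mu> (B (\<zeta>\<^sub>Q, R))\<close> by the \<open>L\<^sup>s\<close> norm of some signed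
  synthesis. Choosing \<open>c\<close> extremal for Hoelder's inequality turns boundedness of the embedding into
  the mixed norm bound. If the shell masses did not tend to zero, extremal functions on distant shells
  would converge to zero pointwise while staying away from zero in \<open>L\<^sup>s\<close>; by Fatou's lemma
  every cluster point of them vanishes almost everywhere, contradicting compactness.\<close>

section \<open>Extended powers and mixed norms\<close>

text \<open>Each of p, q, s may lie below 1, and p, q may be infinite, so neither convexity nor
  duality of the spaces is available in general. Matrices therefore act through suprema, the
  topology of the target comes from the power \<open>min 1 s\<close> of its quasi-norm, and duality
  is replaced by explicit extremal sequences on finite index sets, with bounds uniform in the set.
  The two cases of the mass condition meet in one fact: the shell masses beyond the n-th shell tend
  to 0 in the star exponent of q. For s < q that exponent is finite and membership already forces
  this, which is why a bounded embedding is compact there; for q \<le> s it is infinite and the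
  decay must be demanded. In p no such distinction arises, because a shell holds finitely many
  pockets. The weight of the coefficient space is the size (1 + |w|)^(1/q - 1/p) of the Fock norm of
  a kernel; the ball masses carry its power -s, so the weights cancel whenever coefficients meet
  masses. Local finiteness of the measure is derived on the way, from the masses for sufficiency and
  from single kernels for necessity.\<close>

lemma enn_powr_ennreal: "0 \<le> x \<Longrightarrow> enn_powr (ennreal x) a = ennreal (x powr a)"
  by (simp add: enn_powr_def)

lemma enn_powr_0 [simp]: "enn_powr 0 a = 0"
  by (simp add: enn_powr_def)

lemma enn_powr_top [simp]: "enn_powr top a = top"
  by (simp add: enn_powr_def)

lemma enn_powr_eq_0_iff [simp]: "enn_powr x a = 0 \<longleftrightarrow> x = 0"
  by (cases x) (auto simp: enn_powr_ennreal)

lemma enn_powr_eq_top_iff [simp]: "enn_powr x a = top \<longleftrightarrow> x = top"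
  by (cases x) (auto simp: enn_powr_ennreal)

lemma enn_powr_less_top_iff [simp]: "enn_powr x a < top \<longleftrightarrow> x < top"
  by (simp add: less_top[symmetric])

lemma enn_powr_one_base [simp]: "enn_powr 1 a = 1"
  using enn_powr_ennreal[of 1 a] by simp

lemma enn_powr_1 [simp]: "enn_powr x 1 = x"
  by (cases x) (auto simp: enn_powr_ennreal)

lemma enn_powr_mono: "x \<le> y \<Longrightarrow> a \<ge> 0 \<Longrightarrow> enn_powr x a \<le> enn_powr y a"
  by (cases x; cases y) (auto simp: enn_powr_ennreal powr_mono2 ennreal_leI top_unique)

lemma enn_powr_mult: "enn_powr (x * y) a = enn_powr x a * enn_powr y a"
proof (cases "x = 0 \<or> y = 0")
  case False
  then show ?thesis
  proof (cases "x = top \<or> y = top")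
    case True
    then show ?thesis using False by (auto simp: ennreal_mult_eq_top_iff ennreal_top_mult ennreal_mult_top)
  next
    case False
    then obtain u v where "x = ennreal u" "0 \<le> u" "y = ennreal v" "0 \<le> v"
      by (cases x; cases y) auto
    then show ?thesis
      by (simp add: enn_powr_ennreal powr_mult flip: ennreal_mult)
  qed
qed auto

lemma enn_powr_inverse_base: "enn_powr (inverse x) a = inverse (enn_powr x a)"
proof (cases "x = 0 \<or> x = top")
  case False
  then obtain u where "x = ennreal u" "0 < u"
    by (cases x) (auto simp: less_le)
  then show ?thesis
    by (simp add: enn_powr_ennreal inverse_ennreal inverse_powr)
qed auto

lemma enn_powr_powr: "enn_powr (enn_powr x a) b = enn_powr x (a * b)"
  by (cases x) (auto simp: enn_powr_ennreal powr_powr)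

lemma enn_powr_inverse [simp]:
  "a > 0 \<Longrightarrow> enn_powr (enn_powr x a) (1 / a) = x"
  "a > 0 \<Longrightarrow> enn_powr (enn_powr x (1 / a)) a = x"
  by (auto simp: enn_powr_powr)

lemma enn_powr_add: "a > 0 \<Longrightarrow> b > 0 \<Longrightarrow> enn_powr x (a + b) = enn_powr x a * enn_powr x b"
  by (cases x) (auto simp: enn_powr_ennreal powr_add ennreal_mult)

lemma enn_powr_le_iff: "a > 0 \<Longrightarrow> enn_powr x a \<le> y \<longleftrightarrow> x \<le> enn_powr y (1 / a)"
  by (metis enn_powr_inverse enn_powr_mono less_imp_le zero_less_divide_1_iff)

lemma le_enn_powr_iff: "a > 0 \<Longrightarrow> x \<le> enn_powr y a \<longleftrightarrow> enn_powr x (1 / a) \<le> y"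
  by (metis enn_powr_inverse enn_powr_mono less_imp_le zero_less_divide_1_iff)

text \<open>A positive power is an order isomorphism of [0, \<infinity>] whose inverse is the power
  1/a, and such maps preserve suprema, also the empty one.\<close>

lemma enn_powr_SUP:
  assumes "a > 0" shows "enn_powr (SUP i\<in>I. f i) a = (SUP i\<in>I. enn_powr (f i) a)"
proof (rule antisym)
  show "(SUP i\<in>I. enn_powr (f i) a) \<le> enn_powr (SUP i\<in>I. f i) a"
    using assms by (intro SUP_least enn_powr_mono SUP_upper) auto
  have "f i \<le> enn_powr (SUP i\<in>I. enn_powr (f i) a) (1 / a)" if "i \<in> I" for i
    using SUP_upper[OF that, of "\<lambda>i. enn_powr (f i) a"] assms by (simp flip: enn_powr_le_iff)
  then show "enn_powr (SUP i\<in>I. f i) a \<le> (SUP i\<in>I. enn_powr (f i) a)"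
    using assms by (subst enn_powr_le_iff) (auto intro: SUP_least)
qed

lemma borel_measurable_enn_powr [measurable (raw)]:
  assumes [measurable]: "f \<in> borel_measurable M"
  shows "(\<lambda>x. enn_powr (f x) a) \<in> borel_measurable M"
  unfolding enn_powr_def infinity_ennreal_def by measurable

section \<open>Star exponents and norms of families\<close>

lemma star_exponent_pos: "0 < star_exponent s p"
  by (auto simp: star_exponent_def ennreal_zero_less_divide zero_less_iff_neq_zero top_unique)

lemma ennreal_pos_cases:
  assumes "(p :: ennreal) > 0"
  obtains "p = top" | r where "p = ennreal r" "r > 0"
  using assms by (cases p) auto

lemma star_exponent_le: "p \<le> ennreal s \<Longrightarrow> star_exponent s p = top"
  by (simp add: star_exponent_def)

lemma star_exponent_top [simp]: "star_exponent s top = 1"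
  by (simp add: star_exponent_def top_unique)

lemma star_exponent_real: "0 < s \<Longrightarrow> s < r \<Longrightarrow> star_exponent s (ennreal r) = ennreal (r / (r - s))"
  by (auto simp: star_exponent_def ennreal_minus divide_ennreal)

lemma lp_enorm_finite_exponent:
  "r > 0 \<Longrightarrow> Lp_enorm (ennreal r) M F = enn_powr (\<integral>\<^sup>+x. enn_powr (F x) r \<partial>M) (1 / r)"
  by (simp add: Lp_enorm_def)

lemma Lp_enorm_1: "Lp_enorm 1 M F = (\<integral>\<^sup>+x. F x \<partial>M)"
  using lp_enorm_finite_exponent[of 1 M F] by simp

lemma lp_enorm_top: "lp_enorm top I c = (SUP i\<in>I. c i)"
  using lp_enorm_infinity[of I c] by simp

lemma lp_enorm_mono:
  assumes "p > 0" "\<And>i. i \<in> I \<Longrightarrow> f i \<le> g i"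
  shows "lp_enorm p I f \<le> lp_enorm p I g"
  using assms(1)
proof (cases rule: ennreal_pos_cases)
  case 1
  then show ?thesis using assms(2) by (simp add: lp_enorm_top SUP_subset_mono)
next
  case (2 r)
  then show ?thesis using assms(2)
    by (simp add: lp_enorm_finite_exponent)
      (intro enn_powr_mono nn_integral_mono, auto intro: enn_powr_mono)
qed

lemma lp_enorm_cong:
  "(\<And>i. i \<in> I \<Longrightarrow> f i = g i) \<Longrightarrow> p > 0 \<Longrightarrow> lp_enorm p I f = lp_enorm p I g"
  by (intro antisym lp_enorm_mono) auto

lemma lp_enorm_cmult:
  assumes "p > 0"
  shows "lp_enorm p I (\<lambda>i. c * f i) = c * lp_enorm p I f"
  using assms
proof (cases rule: ennreal_pos_cases)
  case 1
  then show ?thesis by (simp add: lp_enorm_top SUP_mult_left_ennreal)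
next
  case (2 r)
  then show ?thesis
    by (simp add: lp_enorm_finite_exponent enn_powr_mult nn_integral_cmult)
qed

lemma lp_enorm_upper:
  assumes "p > 0" "i \<in> I"
  shows "f i \<le> lp_enorm p I f"
  using assms(1)
proof (cases rule: ennreal_pos_cases)
  case 1
  then show ?thesis using assms(2) by (simp add: lp_enorm_top SUP_upper)
next
  case (2 r)
  have "enn_powr (f i) r \<le> (\<integral>\<^sup>+j. enn_powr (f j) r \<partial>count_space I)"
    using nn_integral_ge_point[OF assms(2)] .
  then show ?thesis using 2 by (simp add: lp_enorm_finite_exponent enn_powr_le_iff)
qed

lemma lp_enorm_zero [simp]: "p > 0 \<Longrightarrow> lp_enorm p I (\<lambda>_. 0) = 0"
  using lp_enorm_cmult[of p I 0 "\<lambda>_. 0"] by simp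


section \<open>Hoelder inequalities in the extended nonnegative reals\<close>

lemma nn_integral_powr_le_lp_enorm:
  assumes "0 < r" "r \<le> s"
  shows "(\<integral>\<^sup>+i. enn_powr (b i) s \<partial>count_space I) \<le> enn_powr (lp_enorm (ennreal r) I b) s"
proof (cases "r = s")
  case True
  then show ?thesis using assms by (simp add: lp_enorm_finite_exponent enn_powr_powr)
next
  case False
  \<comment> \<open>Single entries are bounded by the norm B, so b^s = b^(s-r) b^r is at most
    B^(s-r) b^r, and the sum of b^r is B^r.\<close>
  let ?B = "lp_enorm (ennreal r) I b"
  have "(\<integral>\<^sup>+i. enn_powr (b i) s \<partial>count_space I) \<le>
      (\<integral>\<^sup>+i. enn_powr ?B (s - r) * enn_powr (b i) r \<partial>count_space I)"
  proof (rule nn_integral_mono)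
    fix i assume "i \<in> space (count_space I)"
    then have "b i \<le> ?B" using assms by (intro lp_enorm_upper) auto
    then have "enn_powr (b i) (s - r) * enn_powr (b i) r \<le> enn_powr ?B (s - r) * enn_powr (b i) r"
      using assms by (intro mult_right_mono enn_powr_mono) auto
    then show "enn_powr (b i) s \<le> enn_powr ?B (s - r) * enn_powr (b i) r"
      using assms False by (simp flip: enn_powr_add)
  qed
  also have "\<dots> = enn_powr ?B (s - r) * enn_powr ?B r"
    using assms by (simp add: nn_integral_cmult lp_enorm_finite_exponent enn_powr_powr)
  also have "\<dots> = enn_powr ?B s"
    using assms False by (simp flip: enn_powr_add)
  finally show ?thesis .
qed

text \<open>The functions and both integrals may be infinite, so normalising before Young's
  inequality is legitimate only for integrals in (0, \<infinity>). If one integral vanishes, the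
  product is zero almost everywhere, even where the other factor is infinite; if both are positive
  and one is infinite, so is the right side.\<close>

lemma nn_integral_Holder:
  fixes f g :: "'a \<Rightarrow> ennreal"
  assumes [measurable]: "f \<in> borel_measurable M" "g \<in> borel_measurable M"
    and "P > 1" "Q > 1" "1 / P + 1 / Q = 1"
  shows "(\<integral>\<^sup>+x. f x * g x \<partial>M) \<le>
    enn_powr (\<integral>\<^sup>+x. enn_powr (f x) P \<partial>M) (1 / P) * enn_powr (\<integral>\<^sup>+x. enn_powr (g x) Q \<partial>M) (1 / Q)"
proof -
  define A B where "A = (\<integral>\<^sup>+x. enn_powr (f x) P \<partial>M)" and "B = (\<integral>\<^sup>+x. enn_powr (g x) Q \<partial>M)"
  consider "A = 0 \<or> B = 0" | "A \<noteq> 0" "B \<noteq> 0" "A = top \<or> B = top" | "A \<noteq> 0" "B \<noteq> 0" "A \<noteq> top" "B \<noteq> top"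
    by blast
  then show ?thesis
  proof cases
    case 1
    have "AE x in M. f x * g x = 0"
      using 1
    proof
      assume "A = 0"
      then have "AE x in M. enn_powr (f x) P = 0"
        unfolding A_def by (subst (asm) nn_integral_0_iff_AE) auto
      then show ?thesis by eventually_elim simp
    next
      assume "B = 0"
      then have "AE x in M. enn_powr (g x) Q = 0"
        unfolding B_def by (subst (asm) nn_integral_0_iff_AE) auto
      then show ?thesis by eventually_elim simp
    qed
    then have "(\<integral>\<^sup>+x. f x * g x \<partial>M) = 0"
      by (subst nn_integral_0_iff_AE) auto
    then show ?thesis by simp
  next
    case 2
    then have "enn_powr A (1 / P) * enn_powr B (1 / Q) = top"
      by (auto simp: ennreal_mult_eq_top_iff)
    then show ?thesis unfolding A_def B_def by simp
  next
    case 3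
    define a b where "a = enn_powr A (1 / P)" and "b = enn_powr B (1 / Q)"
    have ab: "a \<noteq> 0" "b \<noteq> 0" "a \<noteq> top" "b \<noteq> top" using 3 by (auto simp: a_def b_def)
    have aP: "enn_powr a P = A" "enn_powr b Q = B" using assms by (auto simp: a_def b_def)
    have young: "x * y \<le> ennreal (1 / P) * enn_powr x P + ennreal (1 / Q) * enn_powr y Q" for x y :: ennreal
    proof (cases "x = top \<or> y = top")
      case True
      then show ?thesis using assms by (auto simp: ennreal_mult_top ennreal_mult_eq_top_iff)
    next
      case False
      then obtain u v where uv: "x = ennreal u" "0 \<le> u" "y = ennreal v" "0 \<le> v"
        by (cases x; cases y) auto
      then have "u * v \<le> u powr P / P + v powr Q / Q"
        using assms by (intro Youngs_inequality) auto
      then show ?thesis using uv assms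
        by (simp add: enn_powr_ennreal flip: ennreal_mult ennreal_plus)
    qed
    have "(\<integral>\<^sup>+x. f x * g x \<partial>M) = a * b * (\<integral>\<^sup>+x. (f x / a) * (g x / b) \<partial>M)"
    proof -
      have "f x * g x = a * b * ((f x / a) * (g x / b))" for x
      proof -
        have "a * (f x / a) = f x" "b * (g x / b) = g x"
          using ab by (simp_all add: ennreal_times_divide mult.commute[of a] mult.commute[of b] ennreal_mult_divide_eq)
        then show ?thesis by (metis mult.assoc mult.left_commute)
      qed
      then show ?thesis by (subst nn_integral_cmult[symmetric]) auto
    qed
    also have "\<dots> \<le> a * b * 1"
    proof (intro mult_left_mono)
      have "(\<integral>\<^sup>+x. (f x / a) * (g x / b) \<partial>M) \<le>
          (\<integral>\<^sup>+x. ennreal (1 / P) * enn_powr (f x / a) P + ennreal (1 / Q) * enn_powr (g x / b) Q \<partial>M)"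
        by (intro nn_integral_mono young)
      also have "\<dots> = ennreal (1 / P) * (inverse A * A) + ennreal (1 / Q) * (inverse B * B)"
      proof -
        have "enn_powr (f x / a) P = inverse A * enn_powr (f x) P" for x
          using aP by (simp add: divide_ennreal_def enn_powr_mult enn_powr_inverse_base mult.commute)
        moreover have "enn_powr (g x / b) Q = inverse B * enn_powr (g x) Q" for x
          using aP by (simp add: divide_ennreal_def enn_powr_mult enn_powr_inverse_base mult.commute)
        ultimately show ?thesis
          by (simp add: nn_integral_add nn_integral_cmult A_def B_def)
      qed
      also have "\<dots> = 1"
      proof -
        have "inverse A * A = 1" "inverse B * B = 1"
          using ennreal_divide_self[of A] ennreal_divide_self[of B] 3
          by (auto simp: divide_ennreal_def mult.commute less_top)
        then show ?thesis
          using assms by (simp flip: ennreal_plus)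
      qed
      finally show "(\<integral>\<^sup>+x. (f x / a) * (g x / b) \<partial>M) \<le> 1" .
    qed simp
    finally show ?thesis by (simp add: a_def b_def A_def B_def)
  qed
qed

text \<open>For s < p < \<infinity> the star exponent is conjugate to p/s, so this is Hoelder for
  b^s; for p \<le> s the inclusion of l^p in l^s leaves only the supremum of m, and for p =
  \<infinity> the supremum falls on b instead. Having all regimes in one inequality allows it to be
  iterated, inside the shells with p and across them with q.\<close>

lemma Holder_star_exponent:
  assumes "p > 0" "s > 0"
  shows "(\<integral>\<^sup>+i. enn_powr (b i) s * m i \<partial>count_space I) \<le>
    enn_powr (lp_enorm p I b) s * lp_enorm (star_exponent s p) I m"
  using assms(1)
proof (cases rule: ennreal_pos_cases)
  case 1
  have "(\<integral>\<^sup>+i. enn_powr (b i) s * m i \<partial>count_space I) \<le>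
      (\<integral>\<^sup>+i. enn_powr (lp_enorm p I b) s * m i \<partial>count_space I)"
    using assms by (intro nn_integral_mono mult_right_mono enn_powr_mono lp_enorm_upper) auto
  then show ?thesis using 1 by (simp add: nn_integral_cmult Lp_enorm_1)
next
  case (2 r)
  show ?thesis
  proof (cases "r \<le> s")
    case True
    have "(\<integral>\<^sup>+i. enn_powr (b i) s * m i \<partial>count_space I) \<le>
        (\<integral>\<^sup>+i. enn_powr (b i) s * lp_enorm top I m \<partial>count_space I)"
      by (intro nn_integral_mono mult_left_mono lp_enorm_upper) auto
    also have "\<dots> \<le> enn_powr (lp_enorm p I b) s * lp_enorm top I m"
      using nn_integral_powr_le_lp_enorm[OF 2(2) True, of I b] 2
      by (simp add: nn_integral_multc mult_right_mono)
    also have "top = star_exponent s p"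
      using star_exponent_le 2 True assms by (metis ennreal_leI)
    finally show ?thesis .
  next
    case False
    have rs: "r / s > 1" "r / (r - s) > 1" "1 / (r / s) + 1 / (r / (r - s)) = 1"
      using False assms 2 by (auto simp: field_simps)
    have "(\<integral>\<^sup>+i. enn_powr (b i) s * m i \<partial>count_space I) \<le>
      enn_powr (\<integral>\<^sup>+x. enn_powr (enn_powr (b x) s) (r / s) \<partial>count_space I) (1 / (r / s)) *
      enn_powr (\<integral>\<^sup>+x. enn_powr (m x) (r / (r - s)) \<partial>count_space I) (1 / (r / (r - s)))"
      by (rule nn_integral_Holder[OF _ _ rs]) auto
    also have "\<dots> = enn_powr (lp_enorm p I b) s * lp_enorm (star_exponent s p) I m"
      using 2 False assms rs
      by (simp add: star_exponent_real lp_enorm_finite_exponent enn_powr_powr)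
    finally show ?thesis .
  qed
qed


text \<open>A power of a supremum is at most the sum of the powers. After this step the estimate is
  Tonelli's theorem, and a bound on the column sums of K^r suffices for every r > 0, with no
  splitting at r = 1.\<close>

lemma lp_enorm_SUP_Schur:
  fixes K :: "'i \<Rightarrow> 'j \<Rightarrow> ennreal"
  assumes "countable I" "countable J" "p > 0"
    and fin: "\<And>r j. p = ennreal r \<Longrightarrow> r > 0 \<Longrightarrow> j \<in> J \<Longrightarrow> (\<integral>\<^sup>+i. enn_powr (K i j) r \<partial>count_space I) \<le> enn_powr A r"
    and top: "\<And>i j. p = top \<Longrightarrow> i \<in> I \<Longrightarrow> j \<in> J \<Longrightarrow> K i j \<le> A"
  shows "lp_enorm p I (\<lambda>i. SUP j\<in>J. K i j * g j) \<le> A * lp_enorm p J g"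
  using assms(3)
proof (cases rule: ennreal_pos_cases)
  case 1
  show ?thesis unfolding 1 lp_enorm_top
    by (intro SUP_least mult_mono top[OF 1] SUP_upper) auto
next
  case (2 r)
  have "enn_powr (SUP j\<in>J. K i j * g j) r \<le> (\<integral>\<^sup>+j. enn_powr (K i j) r * enn_powr (g j) r \<partial>count_space J)" for i
  proof -
    have "enn_powr (K i j * g j) r \<le> (\<integral>\<^sup>+j. enn_powr (K i j) r * enn_powr (g j) r \<partial>count_space J)"
      if "j \<in> J" for j
      using nn_integral_ge_point[OF that, of "\<lambda>j. enn_powr (K i j) r * enn_powr (g j) r"]
      by (simp add: enn_powr_mult)
    then show ?thesis
      using 2 by (subst enn_powr_SUP) (auto intro: SUP_least)
  qed
  then have "(\<integral>\<^sup>+i. enn_powr (SUP j\<in>J. K i j * g j) r \<partial>count_space I) \<le>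
      (\<integral>\<^sup>+i. \<integral>\<^sup>+j. enn_powr (K i j) r * enn_powr (g j) r \<partial>count_space J \<partial>count_space I)"
    by (intro nn_integral_mono)
  also have "\<dots> = (\<integral>\<^sup>+j. \<integral>\<^sup>+i. enn_powr (K i j) r * enn_powr (g j) r \<partial>count_space I \<partial>count_space J)"
  proof -
    interpret pair_sigma_finite "count_space I" "count_space J"
      using assms by (intro pair_sigma_finite.intro sigma_finite_measure_count_space_countable)
    show ?thesis
      by (subst Fubini') (auto simp: pair_measure_countable assms)
  qed
  also have "\<dots> \<le> (\<integral>\<^sup>+j. enn_powr A r * enn_powr (g j) r \<partial>count_space J)"
    using fin[OF 2] by (intro nn_integral_mono) (auto simp: nn_integral_multc intro!: mult_right_mono)
  also have "\<dots> = enn_powr (A * lp_enorm p J g) r"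
    using 2 by (simp add: nn_integral_cmult enn_powr_mult lp_enorm_finite_exponent)
  finally show ?thesis
    using 2 by (simp add: lp_enorm_finite_exponent enn_powr_le_iff)
qed

lemma ennreal_le_suminf: "f k \<le> (\<Sum>k. f k :: ennreal)"
  using sum_le_suminf[of f "{k}"] by simp

text \<open>The comparison of a supremum with a sum of r-th powers replaces the triangle inequality
  for countably many terms: the weights a only have to be r-summable. It adds up the contributions
  of all shells.\<close>

lemma lp_enorm_SUP_le:
  fixes a :: "nat \<Rightarrow> ennreal"
  assumes "p > 0"
    and fin: "\<And>r. p = ennreal r \<Longrightarrow> r > 0 \<Longrightarrow> (\<Sum>k. enn_powr (a k) r) \<le> enn_powr A r"
    and top: "\<And>k. p = top \<Longrightarrow> a k \<le> A"
  shows "lp_enorm p I (\<lambda>i. SUP k. a k * h k i) \<le> A * (SUP k. lp_enorm p I (h k))"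
  using assms(1)
proof (cases rule: ennreal_pos_cases)
  case 1
  have "a k * h k i \<le> A * (SUP k. SUP i\<in>I. h k i)" if "i \<in> I" for k i
  proof (intro mult_mono top[OF 1])
    have "h k i \<le> (SUP i\<in>I. h k i)" using that by (rule SUP_upper)
    also have "\<dots> \<le> (SUP k. SUP i\<in>I. h k i)" by (rule SUP_upper) simp
    finally show "h k i \<le> (SUP k. SUP i\<in>I. h k i)" .
  qed auto
  then show ?thesis unfolding 1 lp_enorm_top
    by (intro SUP_least)
next
  case (2 r)
  let ?S = "SUP k. lp_enorm p I (h k)"
  have "enn_powr (SUP k. a k * h k i) r \<le> (\<Sum>k. enn_powr (a k) r * enn_powr (h k i) r)" for i
    using 2 by (subst enn_powr_SUP)
      (auto intro!: SUP_least ennreal_le_suminf simp: enn_powr_mult)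
  then have "(\<integral>\<^sup>+i. enn_powr (SUP k. a k * h k i) r \<partial>count_space I) \<le>
      (\<integral>\<^sup>+i. (\<Sum>k. enn_powr (a k) r * enn_powr (h k i) r) \<partial>count_space I)"
    by (intro nn_integral_mono)
  also have "\<dots> = (\<Sum>k. enn_powr (a k) r * (\<integral>\<^sup>+i. enn_powr (h k i) r \<partial>count_space I))"
    by (simp add: nn_integral_suminf nn_integral_cmult)
  also have "\<dots> \<le> (\<Sum>k. enn_powr (a k) r * enn_powr ?S r)"
  proof (intro suminf_le mult_left_mono)
    fix k
    have "lp_enorm p I (h k) \<le> ?S" by (rule SUP_upper) simp
    then show "(\<integral>\<^sup>+i. enn_powr (h k i) r \<partial>count_space I) \<le> enn_powr ?S r"
      using 2 by (simp add: lp_enorm_finite_exponent enn_powr_le_iff)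
  qed auto
  also have "\<dots> \<le> enn_powr (A * ?S) r"
    using fin[OF 2] by (simp add: enn_powr_mult mult_right_mono)
  finally show ?thesis
    using 2 by (simp add: lp_enorm_finite_exponent enn_powr_le_iff)
qed




text \<open>Cases of equality in \<open>Holder_star_exponent\<close>: a constant for p =
  \<infinity>, a point mass at a largest entry of m for p \<le> s, and a normalised power of m
  otherwise. Finiteness of I and of the entries makes the largest entry exist and the normalisation
  possible.\<close>

lemma lp_dual_extremal:
  fixes m :: "'i \<Rightarrow> ennreal"
  assumes "finite I" "p > 0" "s > 0" "\<And>i. i \<in> I \<Longrightarrow> m i < top"
  obtains b :: "'i \<Rightarrow> real" where "\<And>i. 0 \<le> b i" "lp_enorm p I (\<lambda>i. ennreal (b i)) \<le> 1"
    "(\<Sum>i\<in>I. enn_powr (ennreal (b i)) s * m i) = lp_enorm (star_exponent s p) I m"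
proof -
  consider "p = top" | r where "p = ennreal r" "r > 0" "r \<le> s" | r where "p = ennreal r" "r > 0" "r > s"
    using assms(2) by (cases rule: ennreal_pos_cases) (auto simp: not_le[symmetric])
  then show ?thesis
  proof cases
    case 1
    show ?thesis
    proof (rule that[of "\<lambda>_. 1"])
      show "lp_enorm p I (\<lambda>i. ennreal 1) \<le> 1"
        unfolding 1 lp_enorm_top by (intro SUP_least) simp
      show "(\<Sum>i\<in>I. enn_powr (ennreal 1) s * m i) = lp_enorm (star_exponent s p) I m"
        using assms by (simp add: 1 Lp_enorm_1 nn_integral_count_space_finite)
    qed simp
  next
    case (2 r)
    have star: "star_exponent s p = top" using 2 by (intro star_exponent_le) (auto intro: ennreal_leI)
    show ?thesis
    proof (cases "I = {}")
      \<comment> \<open>Over the empty set the supremum is 0, which \<open>b = 0\<close>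
        attains.\<close>
      case True
      show ?thesis
        by (rule that[of "\<lambda>_. 0"]) (use True assms in \<open>auto simp: star lp_enorm_top bot_ennreal\<close>)
    next
      case False
      then obtain j where j: "j \<in> I" "(SUP i\<in>I. m i) = m j"
        using assms(1) Max_in[of "m ` I"] Max_Sup[of "m ` I"] by auto
      show ?thesis
      proof (rule that[of "\<lambda>i. if i = j then 1 else 0"])
        have "(\<integral>\<^sup>+i. enn_powr (ennreal (if i = j then 1 else 0)) r \<partial>count_space I) = (\<Sum>i\<in>I. if i = j then 1 else 0)"
          unfolding nn_integral_count_space_finite[OF assms(1)] by (intro sum.cong refl) simp
        also have "\<dots> = 1" using j assms by simp
        finally show "lp_enorm p I (\<lambda>i. ennreal (if i = j then 1 else 0)) \<le> 1"
          unfolding 2(1) lp_enorm_finite_exponent[OF 2(2)] by (simp only: enn_powr_one_base order_refl)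
        have "(\<Sum>i\<in>I. enn_powr (ennreal (if i = j then 1 else 0)) s * m i) = (\<Sum>i\<in>I. if i = j then m j else 0)"
          by (intro sum.cong) auto
        then show "(\<Sum>i\<in>I. enn_powr (ennreal (if i = j then 1 else 0)) s * m i) = lp_enorm (star_exponent s p) I m"
          using j assms by (simp add: star lp_enorm_top)
      qed simp
    qed
  next
    case (3 r)
    define v where "v i = enn2real (m i)" for i
    have v: "m i = ennreal (v i)" "0 \<le> v i" if "i \<in> I" for i
      using assms(4)[OF that] by (auto simp: v_def less_top)
    define S where "S = (\<Sum>i\<in>I. v i powr (r / (r - s)))"
    have S0: "S \<ge> 0" unfolding S_def by (intro sum_nonneg) auto
    have star: "lp_enorm (star_exponent s p) I m = ennreal (S powr ((r - s) / r))"
    proof -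
      have "(\<integral>\<^sup>+i. enn_powr (m i) (r / (r - s)) \<partial>count_space I) = ennreal S"
        using v assms(1) by (simp add: nn_integral_count_space_finite enn_powr_ennreal S_def)
      then show ?thesis
        using 3 assms S0 by (simp add: star_exponent_real lp_enorm_finite_exponent enn_powr_ennreal)
    qed
    show ?thesis
    proof (cases "S = 0")
      case True
      show ?thesis
        by (rule that[of "\<lambda>_. 0"]) (use True star assms in auto)
    next
      case False
      then have S: "S > 0" using S0 by simp
      \<comment> \<open>Equality in Hoelder's inequality needs b^r proportional to m^(r/(r-s));
        dividing by S^(1/r) gives b the l^r norm 1.\<close>
      define b where "b i = v i powr (1 / (r - s)) * S powr (- 1 / r)" for i
      show ?thesis
      proof (rule that[of b])
        show "0 \<le> b i" for i by (simp add: b_def)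
        have "b i powr r = v i powr (r / (r - s)) / S" for i
          using 3 S by (simp add: b_def powr_mult powr_divide powr_powr)
        then have "(\<integral>\<^sup>+i. enn_powr (ennreal (b i)) r \<partial>count_space I) = ennreal ((\<Sum>i\<in>I. v i powr (r / (r - s))) / S)"
          using assms(1) S by (simp add: nn_integral_count_space_finite enn_powr_ennreal b_def sum_divide_distrib)
        then show "lp_enorm p I (\<lambda>i. ennreal (b i)) \<le> 1"
          using 3 S by (simp add: lp_enorm_finite_exponent flip: S_def)
        have "b i powr s * v i = v i powr (r / (r - s)) * S powr (- s / r)" if "i \<in> I" for i
        proof (cases "v i = 0")
          case False
          then have "v i > 0" using v(2)[OF that] by simp
          moreover have "s / (r - s) + 1 = r / (r - s)" using 3 by (simp add: field_simps)
          ultimately have "v i powr (s / (r - s)) * v i = v i powr (r / (r - s))"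
            by (metis powr_add powr_one less_imp_le)
          then show ?thesis
            using S by (simp add: b_def powr_mult powr_powr)
        qed simp
        then have "(\<Sum>i\<in>I. enn_powr (ennreal (b i)) s * m i) = (\<Sum>i\<in>I. ennreal (v i powr (r / (r - s)) * S powr (- s / r)))"
          by (intro sum.cong) (auto simp: v enn_powr_ennreal b_def simp flip: ennreal_mult)
        also have "\<dots> = ennreal (S * S powr (- s / r))"
          by (subst sum_ennreal) (auto simp: S_def sum_distrib_right)
        also have "S * S powr (- s / r) = S powr ((r - s) / r)"
          using S 3 by (subst powr_mult_base) (auto simp: field_simps)
        finally show "(\<Sum>i\<in>I. enn_powr (ennreal (b i)) s * m i) = lp_enorm (star_exponent s p) I m"
          using star by simp
      qed
    qed
  qed
qed

section \<open>Fock norms of the kernels\<close>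

lemma nn_integral_gaussian:
  fixes A m :: real
  assumes "A > 0"
  shows "(\<integral>\<^sup>+x. ennreal (exp (- A * (x - m)\<^sup>2)) \<partial>lborel) = ennreal (sqrt (pi / A))"
proof -
  define \<sigma> where "\<sigma> = sqrt (1 / (2 * A))"
  have \<sigma>: "\<sigma> > 0" "\<sigma>\<^sup>2 = 1 / (2 * A)" using assms by (auto simp: \<sigma>_def)
  have "ennreal (exp (- A * (x - m)\<^sup>2)) = ennreal (sqrt (pi / A)) * ennreal (normal_density m \<sigma> x)" for x
    using assms by (simp add: normal_density_def \<sigma> real_sqrt_divide field_simps flip: ennreal_mult)
  moreover have "(\<integral>\<^sup>+x. ennreal (normal_density m \<sigma> x) \<partial>lborel) = 1"
    using \<sigma> by (subst nn_integral_eq_integral) auto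
  ultimately show ?thesis
    by (simp add: nn_integral_cmult)
qed

text \<open>With y = x/2: sin x = 2 sin y cos y >= 2 y (cos y)^2 >= y, because sin y >= y cos y, and
  (cos y)^2 >= 1/2 for y \<le> \<pi>/4. A linear lower bound turns the angular part of a squared
  distance into a genuine Gaussian.\<close>

lemma half_le_sin:
  fixes x :: real
  assumes "0 \<le> x" "x \<le> pi / 2"
  shows "x / 2 \<le> sin x"
proof -
  define y where "y = x / 2"
  have y: "0 \<le> y" "y \<le> pi / 4" using assms by (auto simp: y_def)
  have "y * cos y \<le> sin y"
  proof -
    have "sin 0 - 0 * cos 0 \<le> sin y - y * cos y"
    proof (rule DERIV_nonneg_imp_nondecreasing[OF y(1)])
      fix t assume t: "0 \<le> t" "t \<le> y"
      have "((\<lambda>t. sin t - t * cos t) has_real_derivative t * sin t) (at t)"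
        by (auto intro!: derivative_eq_intros)
      moreover have "0 \<le> t * sin t"
        using t y by (intro mult_nonneg_nonneg sin_ge_zero) auto
      ultimately show "\<exists>d. ((\<lambda>t. sin t - t * cos t) has_real_derivative d) (at t) \<and> 0 \<le> d" by blast
    qed
    then show ?thesis by simp
  qed
  moreover have "cos y \<ge> sqrt 2 / 2"
    using y cos_monotone_0_pi_le[of y "pi / 4"] by (simp add: cos_45)
  then have "(cos y)\<^sup>2 \<ge> 1 / 2"
    using power_mono[of "sqrt 2 / 2" "cos y" 2] by (simp add: power_divide)
  moreover have "cos y \<ge> 0"
    using y by (intro cos_ge_zero) auto
  ultimately have "x * (1 / 2) \<le> x * (cos y)\<^sup>2" "y * cos y * cos y \<le> sin y * cos y"
    using assms mult_left_mono[of "1 / 2" "(cos y)\<^sup>2" x] by (auto intro: mult_right_mono)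
  moreover have "sin x = 2 * sin y * cos y" by (simp add: y_def flip: sin_double)
  ultimately show ?thesis by (simp add: y_def power2_eq_square)
qed

text \<open>The law of cosines in half-angle form. It separates the radial distance from the angular
  one, so a Gaussian in the planar distance factors into a radial Gaussian and a function of the
  angle.\<close>

lemma norm_diff_polar_sq:
  "(cmod (of_real r * cis \<theta> - of_real \<rho> * cis \<phi>))\<^sup>2 = (r - \<rho>)\<^sup>2 + 4 * r * \<rho> * (sin ((\<theta> - \<phi>) / 2))\<^sup>2"
proof -
  have "(cmod (of_real r * cis \<theta> - of_real \<rho> * cis \<phi>))\<^sup>2 = (r * cos \<theta> - \<rho> * cos \<phi>)\<^sup>2 + (r * sin \<theta> - \<rho> * sin \<phi>)\<^sup>2"
    by (simp add: cmod_power2)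
  also have "\<dots> = r\<^sup>2 * ((cos \<theta>)\<^sup>2 + (sin \<theta>)\<^sup>2) + \<rho>\<^sup>2 * ((cos \<phi>)\<^sup>2 + (sin \<phi>)\<^sup>2) - 2 * r * \<rho> * (cos \<theta> * cos \<phi> + sin \<theta> * sin \<phi>)"
    by (simp only: power2_eq_square) algebra
  also have "\<dots> = r\<^sup>2 + \<rho>\<^sup>2 - 2 * r * \<rho> * cos (\<theta> - \<phi>)"
    by (simp add: cos_diff)
  also have "cos (\<theta> - \<phi>) = 1 - 2 * (sin ((\<theta> - \<phi>) / 2))\<^sup>2"
    using cos_double_sin[of "(\<theta> - \<phi>) / 2"] by (simp only: mult_2 field_sum_of_halves)
  finally show ?thesis by (simp add: power2_eq_square algebra_simps)
qed

lemma cmod_kernel: "cmod (kernel \<alpha> w z) = exp (\<alpha> / 2 * (cmod z)\<^sup>2) * exp (- (\<alpha> / 2) * (cmod (z - w))\<^sup>2)"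
proof -
  have "(cmod (z - w))\<^sup>2 = (cmod z)\<^sup>2 + (cmod w)\<^sup>2 - 2 * Re (cnj w * z)"
    unfolding cmod_power2 by (simp add: power2_eq_square algebra_simps)
  then have "\<alpha> * Re (cnj w * z) - \<alpha> / 2 * (cmod w)\<^sup>2 = \<alpha> / 2 * (cmod z)\<^sup>2 + - (\<alpha> / 2) * (cmod (z - w))\<^sup>2"
    by (simp only:) (simp add: field_simps)
  moreover have "Re (of_real \<alpha> * cnj w * z - of_real (\<alpha> / 2 * (cmod w)\<^sup>2)) = \<alpha> * Re (cnj w * z) - \<alpha> / 2 * (cmod w)\<^sup>2"
    by (simp add: algebra_simps)
  ultimately show ?thesis
    unfolding kernel_def norm_exp_eq_Re by (simp only: exp_add)
qed

lemma kernel_holomorphic: "kernel \<alpha> w holomorphic_on UNIV"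
  unfolding kernel_def by (intro holomorphic_intros)

lemma one_plus_norm_pos [simp]: "0 < 1 + norm w" "1 + norm w \<noteq> 0"
  using norm_ge_zero[of w] by linarith+

lemma exp_neg_le_inverse: "0 < x \<Longrightarrow> exp (- x) \<le> 1 / (x :: real)"
proof -
  assume "0 < x"
  then have "x \<le> exp x" using exp_ge_add_one_self[of x] by linarith
  with \<open>0 < x\<close> show ?thesis by (simp add: exp_minus field_simps)
qed

text \<open>The point \<phi> or one of its two translates by 2\<pi> lies within \<pi> of \<theta>,
  and for it \<open>half_le_sin\<close> bounds the squared sine below by 1/16 of the squared
  distance. Three Gaussians of parameter a/16 on the whole line therefore dominate, and 3 sqrt 16 is
  the factor 12.\<close>

lemma arc_gaussian_bound:
  fixes a \<phi> :: real
  assumes "a > 0" "0 \<le> \<phi>" "\<phi> \<le> 2 * pi"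
  shows "(\<integral>\<^sup>+\<theta>\<in>{0..2 * pi}. ennreal (exp (- a * (sin ((\<theta> - \<phi>) / 2))\<^sup>2)) \<partial>lborel) \<le> ennreal (12 * sqrt (pi / a))"
proof -
  define g where "g j \<theta> = exp (- (a / 16) * (\<theta> - (\<phi> + j * (2 * pi)))\<^sup>2)" for j \<theta> :: real
  have pw: "exp (- a * (sin ((\<theta> - \<phi>) / 2))\<^sup>2) \<le> g 0 \<theta> + g 1 \<theta> + g (- 1) \<theta>" if "\<theta> \<in> {0..2 * pi}" for \<theta>
  proof -
    have *: "exp (- a * (sin ((\<theta> - \<phi>) / 2))\<^sup>2) \<le> g j \<theta>"
      if "\<bar>\<theta> - (\<phi> + j * (2 * pi))\<bar> \<le> pi" "(sin ((\<theta> - \<phi>) / 2))\<^sup>2 = (sin ((\<theta> - (\<phi> + j * (2 * pi))) / 2))\<^sup>2" for j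
    proof -
      let ?x = "\<bar>\<theta> - (\<phi> + j * (2 * pi))\<bar> / 2"
      have "?x / 2 \<le> sin ?x" using that by (intro half_le_sin) auto
      then have "(?x / 2)\<^sup>2 \<le> (sin ?x)\<^sup>2" by (intro power_mono) auto
      also have "(sin ?x)\<^sup>2 = (sin ((\<theta> - (\<phi> + j * (2 * pi))) / 2))\<^sup>2"
      proof -
        have "(sin \<bar>u\<bar>)\<^sup>2 = (sin u)\<^sup>2" for u :: real by (simp add: abs_if)
        from this[of "(\<theta> - (\<phi> + j * (2 * pi))) / 2"] show ?thesis by (simp only: abs_divide abs_numeral)
      qed
      finally have "a * (?x / 2)\<^sup>2 \<le> a * (sin ((\<theta> - \<phi>) / 2))\<^sup>2"
        using that assms by simp
      then show ?thesis by (simp add: g_def power_divide)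
    qed
    have pos: "0 \<le> g j \<theta>" for j by (simp add: g_def)
    consider "\<bar>\<theta> - \<phi>\<bar> \<le> pi" | "\<theta> - \<phi> > pi" | "\<theta> - \<phi> < - pi" by linarith
    then show ?thesis
    proof cases
      case 1
      then show ?thesis using *[of 0] pos[of 1] pos[of "-1"] by simp
    next
      case 2
      have "(\<theta> - (\<phi> + 1 * (2 * pi))) / 2 = (\<theta> - \<phi>) / 2 - pi" by (simp add: field_simps)
      then have "(sin ((\<theta> - (\<phi> + 1 * (2 * pi))) / 2))\<^sup>2 = (sin ((\<theta> - \<phi>) / 2))\<^sup>2"
        by (simp only: sin_diff) simp
      moreover have "\<bar>\<theta> - (\<phi> + 1 * (2 * pi))\<bar> \<le> pi" using 2 that assms by simp
      ultimately show ?thesis using *[of 1] pos[of 0] pos[of "-1"] by fastforce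
    next
      case 3
      have "(\<theta> - (\<phi> + (-1) * (2 * pi))) / 2 = (\<theta> - \<phi>) / 2 + pi" by (simp add: field_simps)
      then have "(sin ((\<theta> - (\<phi> + (-1) * (2 * pi))) / 2))\<^sup>2 = (sin ((\<theta> - \<phi>) / 2))\<^sup>2"
        by (simp only: sin_add) simp
      moreover have "\<bar>\<theta> - (\<phi> + (-1) * (2 * pi))\<bar> \<le> pi" using 3 that assms by simp
      ultimately show ?thesis using *[of "-1"] pos[of 0] pos[of 1] by fastforce
    qed
  qed
  have "(\<integral>\<^sup>+\<theta>\<in>{0..2 * pi}. ennreal (exp (- a * (sin ((\<theta> - \<phi>) / 2))\<^sup>2)) \<partial>lborel) \<le>
      (\<integral>\<^sup>+\<theta>. ennreal (g 0 \<theta>) + ennreal (g 1 \<theta>) + ennreal (g (- 1) \<theta>) \<partial>lborel)"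
  proof (rule nn_integral_mono)
    fix \<theta> :: real
    have "0 \<le> g j \<theta>" for j by (simp add: g_def)
    then show "ennreal (exp (- a * (sin ((\<theta> - \<phi>) / 2))\<^sup>2)) * indicator {0..2 * pi} \<theta> \<le> ennreal (g 0 \<theta>) + ennreal (g 1 \<theta>) + ennreal (g (- 1) \<theta>)"
      using pw[of \<theta>] by (cases "\<theta> \<in> {0..2 * pi}") (auto simp flip: ennreal_plus intro!: ennreal_leI)
  qed
  also have "\<dots> = (\<integral>\<^sup>+\<theta>. ennreal (g 0 \<theta>) \<partial>lborel) + (\<integral>\<^sup>+\<theta>. ennreal (g 1 \<theta>) \<partial>lborel) + (\<integral>\<^sup>+\<theta>. ennreal (g (- 1) \<theta>) \<partial>lborel)"
    unfolding g_def by (simp add: nn_integral_add)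
  also have "\<dots> = ennreal (3 * sqrt (pi / (a / 16)))"
    using assms unfolding g_def by (subst (1 2 3) nn_integral_gaussian) (auto simp flip: ennreal_plus)
  also have "3 * sqrt (pi / (a / 16)) = 12 * sqrt (pi / a)"
    by (simp add: real_sqrt_divide real_sqrt_mult)
  finally show ?thesis .
qed

text \<open>A circle meets the unit neighbourhood of w in an arc of angle of order 1/(1 + |w|),
  which is where this factor comes from. Half of the exponent is given up so that the radial part
  can also pay for radii far from |w|, where the arc estimate is useless.\<close>

lemma circle_gaussian_bound:
  fixes a :: real
  assumes "a > 0"
  obtains C where "C > 0" "\<And>r w. 0 \<le> r \<Longrightarrow>
    (\<integral>\<^sup>+\<theta>\<in>{0..2 * pi}. ennreal (exp (- a * (cmod (of_real r * cis \<theta> - w))\<^sup>2)) \<partial>lborel)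
      \<le> ennreal (C / (1 + cmod w) * exp (- (a / 2) * (r - cmod w)\<^sup>2))"
proof -
  \<comment> \<open>One summand for each of the three regimes distinguished below.\<close>
  define C where "C = 4 * pi + 32 * pi / a + 24 * sqrt (pi / (2 * a))"
  have sq: "0 \<le> sqrt (pi / (2 * a))" using assms by simp
  have C: "C > 0" "C \<ge> 4 * pi" "C \<ge> 32 * pi / a" "C \<ge> 24 * sqrt (pi / (2 * a))" 
    using assms sq by (auto simp: C_def intro!: add_pos_nonneg)
  have "(\<integral>\<^sup>+\<theta>\<in>{0..2 * pi}. ennreal (exp (- a * (cmod (of_real r * cis \<theta> - w))\<^sup>2)) \<partial>lborel)
      \<le> ennreal (C / (1 + cmod w) * exp (- (a / 2) * (r - cmod w)\<^sup>2))" if r: "0 \<le> r" for r w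
  proof -
    define \<rho> \<phi> where "\<rho> = cmod w" and "\<phi> = Arg2pi w"
    have \<phi>: "0 \<le> \<phi>" "\<phi> \<le> 2 * pi" using Arg2pi[of w] by (auto simp: \<phi>_def)
    have w: "w = of_real \<rho> * cis \<phi>" using Arg2pi[of w] by (simp add: \<phi>_def \<rho>_def cis_conv_exp is_Arg_def)
    have \<rho>: "0 \<le> \<rho>" by (simp add: \<rho>_def)
    let ?E = "exp (- a * (r - \<rho>)\<^sup>2)"
    have split: "exp (- a * (cmod (of_real r * cis \<theta> - w))\<^sup>2) = ?E * exp (- (4 * a * r * \<rho>) * (sin ((\<theta> - \<phi>) / 2))\<^sup>2)" for \<theta>
      unfolding w norm_diff_polar_sq by (simp add: algebra_simps flip: exp_add)
    have E: "?E = exp (- (a / 2) * (r - \<rho>)\<^sup>2) * exp (- (a / 2) * (r - \<rho>)\<^sup>2)" by (simp flip: exp_add)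
    have E1: "exp (- (a / 2) * (r - \<rho>)\<^sup>2) \<le> 1" using assms by simp
    let ?L = "\<integral>\<^sup>+\<theta>\<in>{0..2 * pi}. ennreal (exp (- a * (cmod (of_real r * cis \<theta> - w))\<^sup>2)) \<partial>lborel"
    have trivial: "?L \<le> ennreal (?E * (2 * pi))"
    proof -
      have "?L \<le> (\<integral>\<^sup>+\<theta>. ennreal ?E * indicator {0..2 * pi} \<theta> \<partial>lborel)"
        unfolding split using assms r \<rho>
        by (intro nn_integral_mono mult_right_mono) (auto intro!: ennreal_leI)
      also have "\<dots> = ennreal (?E * (2 * pi))"
        by (simp add: nn_integral_cmult_indicator ennreal_mult)
      finally show ?thesis .
    qed
    \<comment> \<open>For |w| \<le> 1 the trivial bound by the length 2\<pi> is enough. For r <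
      |w|/2 half of the radial Gaussian is at most exp (- a |w|^2 / 8), which beats 1/(1 + |w|).
      Otherwise the angular parameter 4 a r |w| is at least 2 a |w|^2 and the arc bound
      applies.\<close>
    consider "\<rho> \<le> 1" | "\<rho> > 1" "r < \<rho> / 2" | "\<rho> > 1" "r \<ge> \<rho> / 2" by linarith
    then have "?L \<le> ennreal (C / (1 + \<rho>) * exp (- (a / 2) * (r - \<rho>)\<^sup>2))"
    proof cases
      case 1
      then have "2 * pi \<le> C / (1 + \<rho>)"
        using C(2) \<rho> mult_left_mono[of "1 + \<rho>" 2 "2 * pi"] pi_gt_zero 1 by (subst pos_le_divide_eq) linarith+
      then have "(2 * pi) * (exp (- (a / 2) * (r - \<rho>)\<^sup>2) * 1) \<le> C / (1 + \<rho>) * exp (- (a / 2) * (r - \<rho>)\<^sup>2)"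
        unfolding mult_1_right by (intro mult_right_mono) auto
      moreover have "?E * (2 * pi) \<le> (2 * pi) * (exp (- (a / 2) * (r - \<rho>)\<^sup>2) * 1)"
        using E1 by (subst E) simp
      ultimately show ?thesis using trivial by (meson ennreal_leI order_trans)
    next
      case 2
      have "exp (- (a / 2) * (r - \<rho>)\<^sup>2) \<le> exp (- (a * \<rho>\<^sup>2 / 8))"
      proof -
        have "(\<rho> / 2)\<^sup>2 \<le> (\<rho> - r)\<^sup>2" using 2 by (intro power_mono) auto
        then have "a / 2 * (\<rho> / 2)\<^sup>2 \<le> a / 2 * (r - \<rho>)\<^sup>2" 
          using assms by (intro mult_left_mono) (auto simp: power2_commute)
        then show ?thesis by (simp add: power_divide)
      qed
      also have "\<dots> \<le> 1 / (a * \<rho>\<^sup>2 / 8)"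
        using 2 assms by (intro exp_neg_le_inverse) auto
      also have "\<dots> = 8 / (a * \<rho> * \<rho>)" by (simp add: power2_eq_square)
      also have "\<dots> \<le> 8 / (a * ((1 + \<rho>) / 2))"
      proof (intro divide_left_mono)
        have "1 * \<rho> \<le> \<rho> * \<rho>" using 2 by (intro mult_right_mono) auto
        moreover have "(1 + \<rho>) / 2 \<le> 1 * \<rho>" using 2 by simp
        ultimately have "(1 + \<rho>) / 2 \<le> \<rho> * \<rho>" by (rule order_trans[rotated])
        then show "a * ((1 + \<rho>) / 2) \<le> a * \<rho> * \<rho>" using assms by (simp add: mult.assoc)
      qed (use assms 2 in auto)
      finally have "exp (- (a / 2) * (r - \<rho>)\<^sup>2) * (2 * pi) \<le> 8 / (a * ((1 + \<rho>) / 2)) * (2 * pi)"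
        by (intro mult_right_mono) auto
      also have "\<dots> = (32 * pi / a) / (1 + \<rho>)" by (simp add: field_simps)
      also have "\<dots> \<le> C / (1 + \<rho>)" using C(3) \<rho> by (intro divide_right_mono) auto
      finally have "exp (- (a / 2) * (r - \<rho>)\<^sup>2) * (2 * pi) \<le> C / (1 + \<rho>)" .
      then have "exp (- (a / 2) * (r - \<rho>)\<^sup>2) * (2 * pi) * exp (- (a / 2) * (r - \<rho>)\<^sup>2) \<le> C / (1 + \<rho>) * exp (- (a / 2) * (r - \<rho>)\<^sup>2)"
        by (rule mult_right_mono) simp
      then have "?E * (2 * pi) \<le> C / (1 + \<rho>) * exp (- (a / 2) * (r - \<rho>)\<^sup>2)"
        unfolding E by (simp only: mult_ac)
      then show ?thesis using trivial by (meson ennreal_leI order_trans)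
    next
      case 3
      then have rp: "r > 0" by linarith
      have "?L = (\<integral>\<^sup>+\<theta>. ennreal ?E * (ennreal (exp (- (4 * a * r * \<rho>) * (sin ((\<theta> - \<phi>) / 2))\<^sup>2)) * indicator {0..2 * pi} \<theta>) \<partial>lborel)"
        unfolding split by (simp add: ennreal_mult mult.assoc)
      also have "\<dots> = ennreal ?E * (\<integral>\<^sup>+\<theta>\<in>{0..2*pi}. ennreal (exp (- (4 * a * r * \<rho>) * (sin ((\<theta> - \<phi>) / 2))\<^sup>2)) \<partial>lborel)"
        by (rule nn_integral_cmult) auto
      also have "\<dots> \<le> ennreal ?E * ennreal (12 * sqrt (pi / (4 * a * r * \<rho>)))"
        using assms 3 rp \<phi> by (intro mult_left_mono arc_gaussian_bound) auto
      also have "\<dots> = ennreal (?E * (12 * sqrt (pi / (4 * a * r * \<rho>))))"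
        using assms 3 rp by (subst ennreal_mult) auto
      also have "\<dots> \<le> ennreal (C / (1 + \<rho>) * exp (- (a / 2) * (r - \<rho>)\<^sup>2))"
      proof (rule ennreal_leI)
        have "sqrt (pi / (4 * a * r * \<rho>)) \<le> sqrt (pi / (2 * a * \<rho>\<^sup>2))"
        proof (intro real_sqrt_le_mono divide_left_mono)
          have "a * (\<rho> * \<rho>) \<le> a * ((2 * r) * \<rho>)" using 3 assms by (intro mult_left_mono mult_right_mono) auto
          then show "2 * a * \<rho>\<^sup>2 \<le> 4 * a * r * \<rho>" by (simp only: power2_eq_square)
        qed (use assms 3 rp in auto)
        also have "\<dots> = sqrt (pi / (2 * a)) / \<rho>"
          using \<rho> by (simp add: real_sqrt_divide real_sqrt_mult)
        also have "\<dots> \<le> sqrt (pi / (2 * a)) / ((1 + \<rho>) / 2)"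
          using 3 assms by (intro divide_left_mono) auto
        finally have "12 * sqrt (pi / (4 * a * r * \<rho>)) \<le> 24 * sqrt (pi / (2 * a)) / (1 + \<rho>)" by simp
        also have "\<dots> \<le> C / (1 + \<rho>)" using C(4) \<rho> by (intro divide_right_mono) auto
        finally have "(exp (- (a / 2) * (r - \<rho>)\<^sup>2) * 1) * (12 * sqrt (pi / (4 * a * r * \<rho>))) \<le> (exp (- (a / 2) * (r - \<rho>)\<^sup>2) * 1) * (C / (1 + \<rho>))"
          by (intro mult_left_mono) auto
        moreover have "?E * (12 * sqrt (pi / (4 * a * r * \<rho>))) \<le> (exp (- (a / 2) * (r - \<rho>)\<^sup>2) * 1) * (12 * sqrt (pi / (4 * a * r * \<rho>)))"
          using E1 assms 3 rp by (subst E, intro mult_right_mono mult_left_mono) auto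
        ultimately have "?E * (12 * sqrt (pi / (4 * a * r * \<rho>))) \<le> (exp (- (a / 2) * (r - \<rho>)\<^sup>2) * 1) * (C / (1 + \<rho>))"
          by (rule order_trans[rotated])
        then show "?E * (12 * sqrt (pi / (4 * a * r * \<rho>))) \<le> C / (1 + \<rho>) * exp (- (a / 2) * (r - \<rho>)\<^sup>2)"
          by (simp only: mult_1_right mult.commute)
      qed
      finally show ?thesis .
    qed
    then show ?thesis by (simp add: \<rho>_def)
  qed
  then show ?thesis using C(1) that by blast
qed



section \<open>Circular means and Fock norms of the kernels\<close>

lemma cmod_kernel_circle:
  "cmod (kernel \<alpha> w (of_real r * cis \<theta>)) = exp (\<alpha> / 2 * r\<^sup>2) * exp (- (\<alpha> / 2) * (cmod (of_real r * cis \<theta> - w))\<^sup>2)"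
  unfolding cmod_kernel by (simp add: norm_mult)

text \<open>For finite p, \<open>circle_gaussian_bound\<close> is applied to the p-th power of the
  modulus; the p-th root turns 1/(1 + |w|) into the power -1/p. The exponent \<alpha>/4 is half of
  \<alpha>/2, the loss in that bound; for p = \<infinity> it is accepted too, so that one form
  covers all p.\<close>

lemma integral_mean_kernel_upper:
  assumes "\<alpha> > 0" "p > 0"
  obtains C where "C > 0" "\<And>w r. 0 \<le> r \<Longrightarrow> integral_mean p (kernel \<alpha> w) r \<le>
    ennreal (C * (1 + cmod w) powr (- enn2real (1 / p)) * exp (- (\<alpha> / 4) * (r - cmod w)\<^sup>2) * exp (\<alpha> / 2 * r\<^sup>2))"
  using assms(2)
proof (cases rule: ennreal_pos_cases)
  case 1
  have "integral_mean p (kernel \<alpha> w) r \<le> ennreal (exp (- (\<alpha> / 4) * (r - cmod w)\<^sup>2) * exp (\<alpha> / 2 * r\<^sup>2))"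
    if "0 \<le> r" for w r
  proof -
    have "cmod (kernel \<alpha> w (of_real r * cis \<theta>)) \<le> exp (- (\<alpha> / 4) * (r - cmod w)\<^sup>2) * exp (\<alpha> / 2 * r\<^sup>2)" for \<theta>
    proof -
      have "\<bar>r - cmod w\<bar> \<le> cmod (of_real r * cis \<theta> - w)"
        using norm_triangle_ineq3[of "of_real r * cis \<theta>" w] that by (simp add: norm_mult)
      then have "(r - cmod w)\<^sup>2 \<le> (cmod (of_real r * cis \<theta> - w))\<^sup>2"
        by (metis abs_ge_zero power2_abs power_mono)
      then have "\<alpha> / 4 * (r - cmod w)\<^sup>2 \<le> \<alpha> / 2 * (cmod (of_real r * cis \<theta> - w))\<^sup>2"
        using assms by (intro mult_mono) auto
      then show ?thesis unfolding cmod_kernel_circle by simp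
    qed
    then show ?thesis unfolding integral_mean_def 1 by (auto intro!: SUP_least ennreal_leI)
  qed
  then show ?thesis using 1 that[of 1] by simp
next
  case (2 t)
  have "\<alpha> * t / 2 > 0" using assms 2 by simp
  then obtain C where C: "C > 0" "\<And>r w. 0 \<le> r \<Longrightarrow>
    (\<integral>\<^sup>+\<theta>\<in>{0..2 * pi}. ennreal (exp (- (\<alpha> * t / 2) * (cmod (of_real r * cis \<theta> - w))\<^sup>2)) \<partial>lborel)
      \<le> ennreal (C / (1 + cmod w) * exp (- (\<alpha> * t / 2 / 2) * (r - cmod w)\<^sup>2))"
    using circle_gaussian_bound by blast
  have p: "enn2real p = t" "enn2real (1 / p) = 1 / t"
    using 2 by (auto simp: divide_ennreal simp flip: ennreal_1)
  show ?thesis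
  proof (rule that[of "(C / (2 * pi)) powr (1 / t)"])
    show "(C / (2 * pi)) powr (1 / t) > 0" using C by simp
    fix w :: complex and r :: real assume r: "0 \<le> r"
    let ?X = "C / (2 * pi) * (1 / (1 + cmod w)) * exp (- (\<alpha> * t / 4) * (r - cmod w)\<^sup>2) * exp (\<alpha> * t / 2 * r\<^sup>2)"
    have "cmod (kernel \<alpha> w (of_real r * cis \<theta>)) powr t = exp (\<alpha> * t / 2 * r\<^sup>2) * exp (- (\<alpha> * t / 2) * (cmod (of_real r * cis \<theta> - w))\<^sup>2)" for \<theta>
      unfolding cmod_kernel_circle by (simp add: powr_def ln_mult algebra_simps flip: exp_add)
    then have "(\<integral>\<^sup>+\<theta>\<in>{0..2 * pi}. ennreal (cmod (kernel \<alpha> w (of_real r * cis \<theta>)) powr enn2real p) \<partial>lborel)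
       = (\<integral>\<^sup>+\<theta>. ennreal (exp (\<alpha> * t / 2 * r\<^sup>2)) * (ennreal (exp (- (\<alpha> * t / 2) * (cmod (of_real r * cis \<theta> - w))\<^sup>2)) * indicator {0..2 * pi} \<theta>) \<partial>lborel)"
      by (simp add: p ennreal_mult mult.assoc)
    also have "\<dots> = ennreal (exp (\<alpha> * t / 2 * r\<^sup>2)) * (\<integral>\<^sup>+\<theta>\<in>{0..2 * pi}. ennreal (exp (- (\<alpha> * t / 2) * (cmod (of_real r * cis \<theta> - w))\<^sup>2)) \<partial>lborel)"
    proof (rule nn_integral_cmult)
      have [measurable]: "(\<lambda>\<theta>. exp (- (\<alpha> * t / 2) * (cmod (of_real r * cis \<theta> - w))\<^sup>2)) \<in> borel_measurable borel"
        by (intro borel_measurable_continuous_onI continuous_intros)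
      show "(\<lambda>\<theta>. ennreal (exp (- (\<alpha> * t / 2) * (cmod (of_real r * cis \<theta> - w))\<^sup>2)) * indicator {0..2 * pi} \<theta>) \<in> borel_measurable lborel"
        by measurable
    qed
    also have "\<dots> \<le> ennreal (exp (\<alpha> * t / 2 * r\<^sup>2)) * ennreal (C / (1 + cmod w) * exp (- (\<alpha> * t / 2 / 2) * (r - cmod w)\<^sup>2))"
      by (intro mult_left_mono C r) auto
    finally have "ennreal (1 / (2 * pi)) * (\<integral>\<^sup>+\<theta>\<in>{0..2 * pi}. ennreal (cmod (kernel \<alpha> w (of_real r * cis \<theta>)) powr enn2real p) \<partial>lborel)
       \<le> ennreal (1 / (2 * pi)) * (ennreal (exp (\<alpha> * t / 2 * r\<^sup>2)) * ennreal (C / (1 + cmod w) * exp (- (\<alpha> * t / 2 / 2) * (r - cmod w)\<^sup>2)))"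
      by (intro mult_left_mono) auto
    also have "\<dots> = ennreal ?X"
      using C by (simp flip: ennreal_mult)
    finally have "integral_mean p (kernel \<alpha> w) r \<le> enn_powr (ennreal ?X) (1 / t)"
      using 2 by (simp add: integral_mean_def enn_powr_mono)
    also have "\<dots> = ennreal (?X powr (1 / t))"
      using C by (intro enn_powr_ennreal) auto
    also have "?X powr (1 / t) = (C / (2 * pi)) powr (1 / t) * (1 + cmod w) powr (- (1 / t)) * exp (- (\<alpha> / 4) * (r - cmod w)\<^sup>2) * exp (\<alpha> / 2 * r\<^sup>2)"
    proof -
      have "exp (x * t) powr (1 / t) = exp x" for x
        using 2 by (simp add: powr_def)
      from this[of "- (\<alpha> / 4) * (r - cmod w)\<^sup>2"] this[of "\<alpha> / 2 * r\<^sup>2"]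
      have "exp (- (\<alpha> * t / 4) * (r - cmod w)\<^sup>2) powr (1 / t) = exp (- (\<alpha> / 4) * (r - cmod w)\<^sup>2)"
        "exp (\<alpha> * t / 2 * r\<^sup>2) powr (1 / t) = exp (\<alpha> / 2 * r\<^sup>2)"
        by (simp_all add: mult_ac)
      then show ?thesis
        unfolding powr_mult powr_minus_divide by (simp only: powr_divide powr_one_eq_one)
    qed
    finally show "integral_mean p (kernel \<alpha> w) r \<le> ennreal ((C / (2 * pi)) powr (1 / t) * (1 + cmod w) powr (- enn2real (1 / p)) * exp (- (\<alpha> / 4) * (r - cmod w)\<^sup>2) * exp (\<alpha> / 2 * r\<^sup>2))"
      by (simp only: p)
  qed
qed

text \<open>If r lies in [|w|, |w| + 1] and the angle within 1/(1 + |w|) of that of w, the point is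
  at squared distance at most 2 from w, so the Gaussian factor is at least exp (-\<alpha>). The
  length of this arc accounts for the power of 1 + |w|.\<close>

lemma integral_mean_kernel_lower:
  assumes "\<alpha> > 0" "p > 0"
  obtains c where "c > 0" "\<And>w r. cmod w \<le> r \<Longrightarrow> r \<le> cmod w + 1 \<Longrightarrow>
    ennreal (c * (1 + cmod w) powr (- enn2real (1 / p)) * exp (\<alpha> / 2 * r\<^sup>2)) \<le> integral_mean p (kernel \<alpha> w) r"
proof -
  have arc: "(cmod (of_real r * cis \<theta> - w))\<^sup>2 \<le> 2"
    if "cmod w \<le> r" "r \<le> cmod w + 1" "\<bar>\<theta> - Arg2pi w\<bar> \<le> 1 / (1 + cmod w)" for w r \<theta>
  proof -
    define \<rho> \<phi> where "\<rho> = cmod w" and "\<phi> = Arg2pi w"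
    have w: "w = of_real \<rho> * cis \<phi>" using Arg2pi[of w] by (simp add: \<phi>_def \<rho>_def cis_conv_exp is_Arg_def)
    have \<rho>: "0 \<le> \<rho>" "\<rho> \<le> r" "r \<le> \<rho> + 1" using that by (auto simp: \<rho>_def)
    have "\<bar>sin ((\<theta> - \<phi>) / 2)\<bar> \<le> \<bar>(\<theta> - \<phi>) / 2\<bar>" by (rule abs_sin_x_le_abs_x)
    also have "\<dots> \<le> 1 / (1 + \<rho>) / 2"
      using divide_right_mono[OF that(3), of 2] by (simp add: \<rho>_def \<phi>_def)
    finally have "(sin ((\<theta> - \<phi>) / 2))\<^sup>2 \<le> (1 / (1 + \<rho>) / 2)\<^sup>2"
      using \<rho> power_mono[of "\<bar>sin ((\<theta> - \<phi>) / 2)\<bar>" _ 2] by simp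
    then have "4 * r * \<rho> * (sin ((\<theta> - \<phi>) / 2))\<^sup>2 \<le> 4 * (1 + \<rho>) * (1 + \<rho>) * (1 / (1 + \<rho>) / 2)\<^sup>2"
      using \<rho> by (intro mult_mono) auto
    also have "\<dots> = 4 * ((1 + \<rho>) * (1 / (1 + \<rho>) / 2))\<^sup>2" by (simp add: power2_eq_square)
    also have "(1 + \<rho>) * (1 / (1 + \<rho>) / 2) = 1 / 2" using \<rho> by simp
    also have "4 * (1 / 2 :: real)\<^sup>2 = 1" by (simp add: power2_eq_square)
    finally have "4 * r * \<rho> * (sin ((\<theta> - \<phi>) / 2))\<^sup>2 \<le> 1" .
    moreover have "(r - \<rho>)\<^sup>2 \<le> 1" using \<rho> power_mono[of "r - \<rho>" 1 2] by simp
    ultimately show ?thesis unfolding w norm_diff_polar_sq by linarith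
  qed
  have low: "cmod (kernel \<alpha> w (of_real r * cis \<theta>)) \<ge> exp (\<alpha> / 2 * r\<^sup>2) * exp (- \<alpha>)"
    if "cmod w \<le> r" "r \<le> cmod w + 1" "\<bar>\<theta> - Arg2pi w\<bar> \<le> 1 / (1 + cmod w)" for w r \<theta>
    using arc[OF that] assms unfolding cmod_kernel_circle by simp
  from assms(2) show ?thesis
  proof (cases rule: ennreal_pos_cases)
    case 1
    show ?thesis
    proof (rule that[of "exp (- \<alpha>)"])
      fix w :: complex and r :: real assume r: "cmod w \<le> r" "r \<le> cmod w + 1"
      have "ennreal (exp (- \<alpha>) * exp (\<alpha> / 2 * r\<^sup>2)) \<le> ennreal (cmod (kernel \<alpha> w (of_real r * cis (Arg2pi w))))"
        using low[OF r, of "Arg2pi w"] by (intro ennreal_leI) (simp add: mult.commute)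
      also have "\<dots> \<le> (SUP \<theta>. ennreal (cmod (kernel \<alpha> w (of_real r * cis \<theta>))))"
        by (rule SUP_upper) simp
      finally show "ennreal (exp (- \<alpha>) * (1 + cmod w) powr (- enn2real (1 / p)) * exp (\<alpha> / 2 * r\<^sup>2)) \<le> integral_mean p (kernel \<alpha> w) r"
        by (simp add: 1 integral_mean_def)
    qed simp
  next
    case (2 t)
    have p: "enn2real p = t" "enn2real (1 / p) = 1 / t"
      using 2 by (auto simp: divide_ennreal simp flip: ennreal_1)
    show ?thesis
    proof (rule that[of "(1 / (2 * pi)) powr (1 / t) * exp (- \<alpha>)"])
      fix w :: complex and r :: real assume r: "cmod w \<le> r" "r \<le> cmod w + 1"
      define h where "h = 1 / (1 + cmod w)"
      have h: "0 < h" "h \<le> 1" by (auto simp: h_def)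
      \<comment> \<open>A one-sided arc, turned towards the middle of [0, 2\<pi>]: as h \<le> 1 <
        \<pi>, it stays inside the interval of integration.\<close>
      define I where "I = (if Arg2pi w \<le> pi then {Arg2pi w .. Arg2pi w + h} else {Arg2pi w - h .. Arg2pi w})"
      have I: "I \<subseteq> {0..2 * pi}" "emeasure lborel I = ennreal h" "I \<in> sets lborel"
        using Arg2pi[of w] h pi_gt3 by (auto simp: I_def)
      have I2: "\<bar>\<theta> - Arg2pi w\<bar> \<le> 1 / (1 + cmod w)" if "\<theta> \<in> I" for \<theta>
        using that by (auto simp: I_def h_def split: if_splits)
      let ?e = "exp (\<alpha> / 2 * r\<^sup>2) * exp (- \<alpha>)"
      have "ennreal (?e powr t * h) = (\<integral>\<^sup>+\<theta>. ennreal (?e powr t) * indicator I \<theta> \<partial>lborel)"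
        using I h by (simp add: nn_integral_cmult_indicator ennreal_mult)
      also have "\<dots> \<le> (\<integral>\<^sup>+\<theta>\<in>{0..2 * pi}. ennreal (cmod (kernel \<alpha> w (of_real r * cis \<theta>)) powr enn2real p) \<partial>lborel)"
      proof (rule nn_integral_mono)
        fix \<theta> :: real
        show "ennreal (?e powr t) * indicator I \<theta> \<le> ennreal (cmod (kernel \<alpha> w (of_real r * cis \<theta>)) powr enn2real p) * indicator {0..2 * pi} \<theta>"
        proof (cases "\<theta> \<in> I")
          case True
          then have "\<theta> \<in> {0..2 * pi}" using I(1) by blast
          then show ?thesis using True low[OF r I2[OF True]] 2(2)
            by (simp add: p ennreal_leI powr_mono2 del: atLeastAtMost_iff)
        qed simp
      qed
      finally have "ennreal (1 / (2 * pi)) * ennreal (?e powr t * h) \<le> ennreal (1 / (2 * pi)) * (\<integral>\<^sup>+\<theta>\<in>{0..2 * pi}. ennreal (cmod (kernel \<alpha> w (of_real r * cis \<theta>)) powr enn2real p) \<partial>lborel)"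
        by (intro mult_left_mono) auto
      then have "enn_powr (ennreal (1 / (2 * pi)) * ennreal (?e powr t * h)) (1 / t) \<le> integral_mean p (kernel \<alpha> w) r"
        using 2 by (simp add: integral_mean_def enn_powr_mono)
      moreover have "enn_powr (ennreal (1 / (2 * pi)) * ennreal (?e powr t * h)) (1 / t) =
        ennreal ((1 / (2 * pi)) powr (1 / t) * ((?e powr t) powr (1 / t) * h powr (1 / t)))"
        using h by (simp only: enn_powr_mult) (simp add: enn_powr_ennreal powr_mult flip: ennreal_mult)
      moreover have "(?e powr t) powr (1 / t) = ?e" using 2 by (simp add: powr_powr)
      moreover have "h powr (1 / t) = (1 + cmod w) powr - (1 / t)"
        unfolding h_def powr_minus_divide by (simp add: powr_divide)
      ultimately show "ennreal ((1 / (2 * pi)) powr (1 / t) * exp (- \<alpha>) * (1 + cmod w) powr (- enn2real (1 / p)) * exp (\<alpha> / 2 * r\<^sup>2)) \<le> integral_mean p (kernel \<alpha> w) r"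
        by (simp only: p mult_ac)
    qed simp
  qed
qed

text \<open>The area weight costs r \<le> (1 + \<rho>) (1 + |r - \<rho>|) \<le> (1 + \<rho>) exp |r
  - \<rho>|, and completing the square absorbs this exponential into half of the Gaussian.\<close>

lemma radial_gaussian_bound:
  fixes b \<rho> :: real
  assumes "b > 0"
  obtains K where "K > 0" "\<And>\<rho>. \<rho> \<ge> 0 \<Longrightarrow>
    (\<integral>\<^sup>+r\<in>{0..}. ennreal (exp (- b * (r - \<rho>)\<^sup>2) * r) \<partial>lborel) \<le> ennreal (K * (1 + \<rho>))"
proof (rule that[of "exp (1 / (2 * b)) * sqrt (pi / (b / 2))"])
  fix \<rho> :: real assume \<rho>: "\<rho> \<ge> 0"
  let ?c = "(1 + \<rho>) * exp (1 / (2 * b))"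
  have "exp (- b * (r - \<rho>)\<^sup>2) * r \<le> ?c * exp (- (b / 2) * (r - \<rho>)\<^sup>2)" if "0 \<le> r" for r
  proof -
    define x where "x = \<bar>r - \<rho>\<bar>"
    have "r \<le> \<rho> + x" by (simp add: x_def)
    also have "\<dots> \<le> (1 + \<rho>) * (1 + x)" using \<rho> by (simp add: algebra_simps x_def)
    also have "\<dots> \<le> (1 + \<rho>) * exp x" using \<rho> by (intro mult_left_mono) auto
    also have "\<dots> \<le> (1 + \<rho>) * exp (1 / (2 * b) + b / 2 * x\<^sup>2)"
    proof -
      have "0 \<le> (b * x - 1)\<^sup>2 / (2 * b)" using assms by simp
      also have "\<dots> = 1 / (2 * b) + b / 2 * x\<^sup>2 - x"
        using assms by (simp add: power2_eq_square field_simps)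
      finally show ?thesis using \<rho> by simp
    qed
    finally have "exp (- b * x\<^sup>2) * r \<le> exp (- b * x\<^sup>2) * ((1 + \<rho>) * exp (1 / (2 * b) + b / 2 * x\<^sup>2))"
      by (intro mult_left_mono) auto
    also have "\<dots> = ?c * (exp (- b * x\<^sup>2) * exp (b / 2 * x\<^sup>2))" by (simp add: exp_add)
    also have "exp (- b * x\<^sup>2) * exp (b / 2 * x\<^sup>2) = exp (- (b / 2) * x\<^sup>2)"
      by (simp flip: exp_add)
    finally show ?thesis by (simp add: x_def)
  qed
  then have "(\<integral>\<^sup>+r\<in>{0..}. ennreal (exp (- b * (r - \<rho>)\<^sup>2) * r) \<partial>lborel) \<le> (\<integral>\<^sup>+r. ennreal ?c * ennreal (exp (- (b / 2) * (r - \<rho>)\<^sup>2)) \<partial>lborel)"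
    using \<rho> by (intro nn_integral_mono) (auto simp: indicator_def simp flip: ennreal_mult intro!: ennreal_leI)
  also have "\<dots> = ennreal ?c * ennreal (sqrt (pi / (b / 2)))"
    using assms by (subst nn_integral_cmult) (simp_all only: nn_integral_gaussian[of "b / 2"], auto)
  also have "\<dots> = ennreal (exp (1 / (2 * b)) * sqrt (pi / (b / 2)) * (1 + \<rho>))"
    using \<rho> assms by (simp add: mult_ac flip: ennreal_mult)
  finally show "(\<integral>\<^sup>+r\<in>{0..}. ennreal (exp (- b * (r - \<rho>)\<^sup>2) * r) \<partial>lborel) \<le> ennreal (exp (1 / (2 * b)) * sqrt (pi / (b / 2)) * (1 + \<rho>))" .
qed (use assms in auto)


text \<open>The weight of the space cancels exp (\<alpha> r^2 / 2) exactly. What remains for finite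
  q is a Gaussian in r - |w| with area weight, whose integral is of order 1 + |w| and contributes
  the power 1/q. With the matching lower bound this identifies the weight of the coefficient space
  as the size of the kernel norms.\<close>

lemma fock_norm_kernel_upper:
  assumes "\<alpha> > 0" "p > 0" "q > 0"
  obtains C where "C > 0" "\<And>w. fock_norm \<alpha> p q (kernel \<alpha> w) \<le>
    ennreal (C * (1 + cmod w) powr (enn2real (1 / q) - enn2real (1 / p)))"
proof -
  let ?\<tau> = "enn2real (1 / p)"
  obtain C where C: "C > 0" "\<And>w r. 0 \<le> r \<Longrightarrow> integral_mean p (kernel \<alpha> w) r \<le>
    ennreal (C * (1 + cmod w) powr (- ?\<tau>) * exp (- (\<alpha> / 4) * (r - cmod w)\<^sup>2) * exp (\<alpha> / 2 * r\<^sup>2))"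
    using integral_mean_kernel_upper[OF assms(1,2)] by blast
  from assms(3) show ?thesis
  proof (cases rule: ennreal_pos_cases)
    case 1
    have "fock_norm \<alpha> p q (kernel \<alpha> w) \<le> ennreal (C * (1 + cmod w) powr (- ?\<tau>))" for w
    proof -
      have "integral_mean p (kernel \<alpha> w) r * ennreal (exp (- (\<alpha> / 2) * r\<^sup>2)) \<le> ennreal (C * (1 + cmod w) powr (- ?\<tau>))"
        if "0 \<le> r" for r
      proof -
        have "integral_mean p (kernel \<alpha> w) r * ennreal (exp (- (\<alpha> / 2) * r\<^sup>2)) \<le>
          ennreal (C * (1 + cmod w) powr (- ?\<tau>) * exp (- (\<alpha> / 4) * (r - cmod w)\<^sup>2) * exp (\<alpha> / 2 * r\<^sup>2)) * ennreal (exp (- (\<alpha> / 2) * r\<^sup>2))"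
          using C(2)[OF that] by (rule mult_right_mono) simp
        also have "\<dots> = ennreal (C * (1 + cmod w) powr (- ?\<tau>) * exp (- (\<alpha> / 4) * (r - cmod w)\<^sup>2) * (exp (\<alpha> / 2 * r\<^sup>2) * exp (- (\<alpha> / 2) * r\<^sup>2)))"
          using C by (simp add: mult.assoc flip: ennreal_mult)
        also have "exp (\<alpha> / 2 * r\<^sup>2) * exp (- (\<alpha> / 2) * r\<^sup>2) = 1" by (simp flip: exp_add)
        also have "ennreal (C * (1 + cmod w) powr (- ?\<tau>) * exp (- (\<alpha> / 4) * (r - cmod w)\<^sup>2) * 1) \<le> ennreal (C * (1 + cmod w) powr (- ?\<tau>))"
          using C(1) assms by (intro ennreal_leI) (simp add: mult_left_le)
        finally show ?thesis .
      qed
      then show ?thesis by (auto simp: fock_norm_def 1 intro!: SUP_least)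
    qed
    then show ?thesis using 1 C(1) that[of C] by simp
  next
    case (2 u)
    have q: "enn2real q = u" "enn2real (1 / q) = 1 / u"
      using 2 by (auto simp: divide_ennreal simp flip: ennreal_1)
    obtain K where K: "K > 0" "\<And>\<rho>. \<rho> \<ge> 0 \<Longrightarrow>
      (\<integral>\<^sup>+r\<in>{0..}. ennreal (exp (- (\<alpha> * u / 4) * (r - \<rho>)\<^sup>2) * r) \<partial>lborel) \<le> ennreal (K * (1 + \<rho>))"
      using radial_gaussian_bound[of "\<alpha> * u / 4"] assms 2 by auto
    show ?thesis
    proof (rule that[of "(\<alpha> * u * K) powr (1 / u) * C"])
      show "(\<alpha> * u * K) powr (1 / u) * C > 0" using C K 2 assms by simp
      fix w :: complex
      define X where "X = C * (1 + cmod w) powr (- ?\<tau>)"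
      have X: "X > 0" using C(1) by (simp add: X_def)
      have *: "enn_powr (integral_mean p (kernel \<alpha> w) r) u * ennreal (\<alpha> * u * exp (- (\<alpha> * u / 2) * r\<^sup>2) * r)
          \<le> ennreal (X powr u * (\<alpha> * u)) * ennreal (exp (- (\<alpha> * u / 4) * (r - cmod w)\<^sup>2) * r)" if "0 \<le> r" for r
      proof -
        have "enn_powr (integral_mean p (kernel \<alpha> w) r) u \<le> enn_powr (ennreal (X * exp (- (\<alpha> / 4) * (r - cmod w)\<^sup>2) * exp (\<alpha> / 2 * r\<^sup>2))) u"
          using C(2)[OF that, of w] 2 unfolding X_def by (intro enn_powr_mono) auto
        also have "\<dots> = ennreal (X powr u * exp (- (\<alpha> * u / 4) * (r - cmod w)\<^sup>2) * exp (\<alpha> * u / 2 * r\<^sup>2))"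
          using X by (simp add: enn_powr_ennreal powr_mult exp_powr_real) (simp add: mult_ac)
        finally have "enn_powr (integral_mean p (kernel \<alpha> w) r) u * ennreal (\<alpha> * u * exp (- (\<alpha> * u / 2) * r\<^sup>2) * r) \<le>
          ennreal (X powr u * exp (- (\<alpha> * u / 4) * (r - cmod w)\<^sup>2) * exp (\<alpha> * u / 2 * r\<^sup>2)) * ennreal (\<alpha> * u * exp (- (\<alpha> * u / 2) * r\<^sup>2) * r)"
          by (rule mult_right_mono) simp
        also have "\<dots> = ennreal (X powr u * (\<alpha> * u) * (exp (- (\<alpha> * u / 4) * (r - cmod w)\<^sup>2) * r) * (exp (\<alpha> * u / 2 * r\<^sup>2) * exp (- (\<alpha> * u / 2) * r\<^sup>2)))"
          using that 2 assms by (simp add: mult_ac flip: ennreal_mult)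
        also have "exp (\<alpha> * u / 2 * r\<^sup>2) * exp (- (\<alpha> * u / 2) * r\<^sup>2) = 1" by (simp flip: exp_add)
        finally show ?thesis using that 2 assms by (simp add: ennreal_mult)
      qed
      have "(\<integral>\<^sup>+r\<in>{0..}. enn_powr (integral_mean p (kernel \<alpha> w) r) u * ennreal (\<alpha> * u * exp (- (\<alpha> * u / 2) * r\<^sup>2) * r) \<partial>lborel)
          \<le> (\<integral>\<^sup>+r. ennreal (X powr u * (\<alpha> * u)) * (ennreal (exp (- (\<alpha> * u / 4) * (r - cmod w)\<^sup>2) * r) * indicator {0..} r) \<partial>lborel)"
        using * by (intro nn_integral_mono) (auto simp: indicator_def)
      also have "\<dots> = ennreal (X powr u * (\<alpha> * u)) * (\<integral>\<^sup>+r\<in>{0..}. ennreal (exp (- (\<alpha> * u / 4) * (r - cmod w)\<^sup>2) * r) \<partial>lborel)"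
        by (rule nn_integral_cmult) simp
      also have "\<dots> \<le> ennreal (X powr u * (\<alpha> * u)) * ennreal (K * (1 + cmod w))"
        using K(2)[of "cmod w"] by (intro mult_left_mono) auto
      also have "\<dots> = ennreal (X powr u * ((\<alpha> * u * K) * (1 + cmod w)))"
        using 2 assms K by (simp add: mult_ac flip: ennreal_mult)
      finally have "fock_norm \<alpha> p q (kernel \<alpha> w) \<le> enn_powr (ennreal (X powr u * ((\<alpha> * u * K) * (1 + cmod w)))) (1 / u)"
        using 2 by (simp add: fock_norm_def q enn_powr_mono)
      also have "\<dots> = ennreal (X * ((\<alpha> * u * K) powr (1 / u) * (1 + cmod w) powr (1 / u)))"
        using 2 assms K X by (simp add: enn_powr_ennreal powr_mult powr_powr)
      also have "X * ((\<alpha> * u * K) powr (1 / u) * (1 + cmod w) powr (1 / u)) = (\<alpha> * u * K) powr (1 / u) * C * (1 + cmod w) powr (1 / u - ?\<tau>)"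
        by (simp add: X_def powr_diff powr_minus_divide)
      finally show "fock_norm \<alpha> p q (kernel \<alpha> w) \<le> ennreal ((\<alpha> * u * K) powr (1 / u) * C * (1 + cmod w) powr (enn2real (1 / q) - ?\<tau>))"
        by (simp only: q)
    qed
  qed
qed

lemma fock_norm_kernel_lower:
  assumes "\<alpha> > 0" "p > 0" "q > 0"
  obtains c where "c > 0" "\<And>w. ennreal (c * (1 + cmod w) powr (enn2real (1 / q) - enn2real (1 / p)))
    \<le> fock_norm \<alpha> p q (kernel \<alpha> w)"
proof -
  let ?\<tau> = "enn2real (1 / p)"
  obtain c where c: "c > 0" "\<And>w r. cmod w \<le> r \<Longrightarrow> r \<le> cmod w + 1 \<Longrightarrow>
    ennreal (c * (1 + cmod w) powr (- ?\<tau>) * exp (\<alpha> / 2 * r\<^sup>2)) \<le> integral_mean p (kernel \<alpha> w) r"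
    using integral_mean_kernel_lower[OF assms(1,2)] by blast
  from assms(3) show ?thesis
  proof (cases rule: ennreal_pos_cases)
    case 1
    have "ennreal (c * (1 + cmod w) powr (- ?\<tau>)) \<le> fock_norm \<alpha> p q (kernel \<alpha> w)" for w
    proof -
      let ?r = "cmod w"
      have "ennreal (c * (1 + cmod w) powr (- ?\<tau>)) = ennreal (c * (1 + cmod w) powr (- ?\<tau>) * (exp (\<alpha> / 2 * ?r\<^sup>2) * exp (- (\<alpha> / 2) * ?r\<^sup>2)))"
        by (simp flip: exp_add)
      also have "\<dots> = ennreal (c * (1 + cmod w) powr (- ?\<tau>) * exp (\<alpha> / 2 * ?r\<^sup>2)) * ennreal (exp (- (\<alpha> / 2) * ?r\<^sup>2))"
        using c by (simp add: mult.assoc flip: ennreal_mult)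
      also have "\<dots> \<le> integral_mean p (kernel \<alpha> w) ?r * ennreal (exp (- (\<alpha> / 2) * ?r\<^sup>2))"
        by (intro mult_right_mono c) auto
      also have "\<dots> \<le> (SUP r\<in>{0..}. integral_mean p (kernel \<alpha> w) r * ennreal (exp (- (\<alpha> / 2) * r\<^sup>2)))"
        by (rule SUP_upper) simp
      finally show ?thesis by (simp add: fock_norm_def 1)
    qed
    then show ?thesis using 1 c(1) that[of c] by simp
  next
    case (2 u)
    have q: "enn2real q = u" "enn2real (1 / q) = 1 / u"
      using 2 by (auto simp: divide_ennreal simp flip: ennreal_1)
    show ?thesis
    proof (rule that[of "(\<alpha> * u / 4) powr (1 / u) * c"])
      show "(\<alpha> * u / 4) powr (1 / u) * c > 0" using c 2 assms by simp
      fix w :: complex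
      define X where "X = c * (1 + cmod w) powr (- ?\<tau>)"
      have X: "X > 0" using c(1) by (simp add: X_def)
      \<comment> \<open>Starting at |w| + 1/2 keeps the area weight r above (1 + |w|)/2, also for w
        near 0. The interval has length 1/2, which gives the constant \<alpha> u / 4.\<close>
      let ?I = "{cmod w + 1 / 2 .. cmod w + 1}"
      have *: "ennreal (X powr u * (\<alpha> * u * ((1 + cmod w) / 2)))
          \<le> enn_powr (integral_mean p (kernel \<alpha> w) r) u * ennreal (\<alpha> * u * exp (- (\<alpha> * u / 2) * r\<^sup>2) * r)" if "r \<in> ?I" for r
      proof -
        have r1: "cmod w + 1 / 2 \<le> r" using that by simp
        have "1 + cmod w \<le> 2 * r" using r1 norm_ge_zero[of w] by linarith
        then have r2: "(1 + cmod w) / 2 \<le> r" by simp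
        have r: "0 \<le> r" using r1 norm_ge_zero[of w] by linarith
        note r = r r2
        have "X powr u * (\<alpha> * u * ((1 + cmod w) / 2)) \<le> X powr u * (\<alpha> * u * r) * (exp (\<alpha> * u / 2 * r\<^sup>2) * exp (- (\<alpha> * u / 2) * r\<^sup>2))"
        proof -
          have "exp (\<alpha> * u / 2 * r\<^sup>2) * exp (- (\<alpha> * u / 2) * r\<^sup>2) = 1" by (simp flip: exp_add)
          moreover have "X powr u * (\<alpha> * u * ((1 + cmod w) / 2)) \<le> X powr u * (\<alpha> * u * r)"
            using assms 2 by (intro mult_left_mono r2) auto
          ultimately show ?thesis by (simp only: mult_1_right)
        qed
        then have "ennreal (X powr u * (\<alpha> * u * ((1 + cmod w) / 2))) \<le> ennreal ((X powr u * exp (\<alpha> * u / 2 * r\<^sup>2)) * (\<alpha> * u * exp (- (\<alpha> * u / 2) * r\<^sup>2) * r))"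
          by (intro ennreal_leI) (simp only: mult_ac)
        also have "\<dots> = ennreal (X powr u * exp (\<alpha> * u / 2 * r\<^sup>2)) * ennreal (\<alpha> * u * exp (- (\<alpha> * u / 2) * r\<^sup>2) * r)"
          using r assms 2 by (subst ennreal_mult) auto
        also have "ennreal (X powr u * exp (\<alpha> * u / 2 * r\<^sup>2)) = enn_powr (ennreal (X * exp (\<alpha> / 2 * r\<^sup>2))) u"
          using X by (simp add: enn_powr_ennreal powr_mult exp_powr_real)
        also have "\<dots> \<le> enn_powr (integral_mean p (kernel \<alpha> w) r) u"
          using c(2)[of w r] that 2 unfolding X_def by (intro enn_powr_mono) auto
        finally show ?thesis by (simp add: mult_right_mono)
      qed
      have "ennreal (X powr u * ((\<alpha> * u / 4) * (1 + cmod w))) = ennreal (X powr u * (\<alpha> * u * ((1 + cmod w) / 2))) * emeasure lborel ?I"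
      proof -
        have "emeasure lborel ?I = ennreal (1 / 2)" by (subst emeasure_lborel_Icc) auto
        moreover have "X powr u * (\<alpha> * u * ((1 + cmod w) / 2)) * (1 / 2) = X powr u * ((\<alpha> * u / 4) * (1 + cmod w))"
          by simp
        moreover have "ennreal (X powr u * (\<alpha> * u * ((1 + cmod w) / 2))) * ennreal (1 / 2) =
            ennreal (X powr u * (\<alpha> * u * ((1 + cmod w) / 2)) * (1 / 2))"
          using assms 2 by (intro ennreal_mult[symmetric]) auto
        ultimately show ?thesis by (simp only:)
      qed
      also have "\<dots> = (\<integral>\<^sup>+r. ennreal (X powr u * (\<alpha> * u * ((1 + cmod w) / 2))) * indicator ?I r \<partial>lborel)"
        by (simp only: nn_integral_cmult_indicator sets_lborel atLeastAtMost_borel)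
      also have "\<dots> \<le> (\<integral>\<^sup>+r\<in>{0..}. enn_powr (integral_mean p (kernel \<alpha> w) r) u * ennreal (\<alpha> * u * exp (- (\<alpha> * u / 2) * r\<^sup>2) * r) \<partial>lborel)"
      proof (rule nn_integral_mono)
        fix r :: real
        have "0 \<le> r" if "r \<in> ?I" using that by (intro order_trans[of 0 "cmod w + 1 / 2" r]) auto
        then show "ennreal (X powr u * (\<alpha> * u * ((1 + cmod w) / 2))) * indicator ?I r \<le>
          enn_powr (integral_mean p (kernel \<alpha> w) r) u * ennreal (\<alpha> * u * exp (- (\<alpha> * u / 2) * r\<^sup>2) * r) * indicator {0..} r"
          using *[of r] by (cases "r \<in> ?I") (simp_all del: atLeastAtMost_iff)
      qed
      finally have "enn_powr (ennreal (X powr u * ((\<alpha> * u / 4) * (1 + cmod w)))) (1 / u) \<le> fock_norm \<alpha> p q (kernel \<alpha> w)"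
        using 2 by (simp add: fock_norm_def q enn_powr_mono)
      moreover have "enn_powr (ennreal (X powr u * ((\<alpha> * u / 4) * (1 + cmod w)))) (1 / u) = ennreal (X * ((\<alpha> * u / 4) powr (1 / u) * (1 + cmod w) powr (1 / u)))"
        using 2 assms X by (subst enn_powr_ennreal) (auto simp: powr_mult powr_powr powr_divide)
      moreover have "X * ((\<alpha> * u / 4) powr (1 / u) * (1 + cmod w) powr (1 / u)) = (\<alpha> * u / 4) powr (1 / u) * c * (1 + cmod w) powr (1 / u - ?\<tau>)"
        by (simp add: X_def powr_diff powr_minus_divide)
      ultimately show "ennreal ((\<alpha> * u / 4) powr (1 / u) * c * (1 + cmod w) powr (enn2real (1 / q) - ?\<tau>)) \<le> fock_norm \<alpha> p q (kernel \<alpha> w)"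
        by (simp only: q)
    qed
  qed
qed

section \<open>Measurable dependence of the kernel norm on the center\<close>

lemma borel_measurable_SUP_continuous:
  fixes f :: "'i \<Rightarrow> 'a::topological_space \<Rightarrow> ennreal"
  assumes "\<And>i. i \<in> I \<Longrightarrow> continuous_on UNIV (f i)"
  shows "(\<lambda>x. SUP i\<in>I. f i x) \<in> borel_measurable borel"
proof (rule borel_measurableI_greater)
  fix y
  \<comment> \<open>Suprema over uncountable families stay measurable here because each superlevel
    set is a union of open sets.\<close>
  have "{x \<in> space borel. y < (SUP i\<in>I. f i x)} = (\<Union>i\<in>I. {x. y < f i x})"
    by (auto simp: less_SUP_iff)
  moreover have "open {x. y < f i x}" if "i \<in> I" for i
    using assms[OF that] open_Collect_less[of "\<lambda>_. y" "f i"] by simp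
  ultimately show "{x \<in> space borel. y < (SUP i\<in>I. f i x)} \<in> sets borel"
    by (simp only:) (intro borel_open open_UN ballI, simp)
qed

lemma continuous_on_enn_powr:
  assumes "a > 0" "continuous_on S g" "\<And>x. x \<in> S \<Longrightarrow> 0 \<le> g x"
  shows "continuous_on S (\<lambda>x. enn_powr (ennreal (g x)) a)"
proof -
  have "continuous_on S (\<lambda>x. ennreal (g x powr a))"
    using assms by (intro continuous_on_ennreal continuous_on_powr' continuous_on_const) auto
  then show ?thesis by (rule continuous_on_eq) (simp add: enn_powr_ennreal assms)
qed

text \<open>Needed because the function form of the mass condition speaks of a Borel function.
  Finite p makes the circular mean jointly continuous in center and radius, p = \<infinity> makes it
  a supremum of continuous functions; then a finite q is integrated out, and q = \<infinity> is
  again a supremum.\<close>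

lemma fock_norm_kernel_measurable:
  assumes "p > 0" "q > 0"
  shows "(\<lambda>w. fock_norm \<alpha> p q (kernel \<alpha> w)) \<in> borel_measurable borel"
proof -
  define k where "k w r \<theta> = cmod (kernel \<alpha> w (of_real r * cis \<theta>))" for w r \<theta>
  have k_cont: "continuous_on S (\<lambda>x. k (u x) (v x) (h x))"
    if "continuous_on S u" "continuous_on S v" "continuous_on S h" for S :: "'b::topological_space set" and u v h
    unfolding k_def kernel_def using that by (intro continuous_intros)
  have k0: "0 \<le> k w r \<theta>" for w r \<theta> by (simp add: k_def)
  have mean_top: "integral_mean top (kernel \<alpha> w) r = (SUP \<theta>. ennreal (k w r \<theta>))" for w r
    by (simp add: integral_mean_def k_def)
  have mean_fin: "integral_mean (ennreal t) (kernel \<alpha> w) r =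
      enn_powr (ennreal (1 / (2 * pi) * integral (cbox 0 (2 * pi)) (\<lambda>\<theta>. k w r \<theta> powr t))) (1 / t)" if "t > 0" for t w r
  proof -
    have "(\<integral>\<^sup>+\<theta>\<in>{0..2 * pi}. ennreal (k w r \<theta> powr t) \<partial>lborel) = ennreal (integral (cbox 0 (2 * pi)) (\<lambda>\<theta>. k w r \<theta> powr t))"
    proof -
      have "continuous_on (cbox 0 (2 * pi)) (\<lambda>\<theta>. k w r \<theta> powr t)"
        using that by (intro continuous_on_powr' k_cont continuous_intros) (auto simp: k0)
      then have "((\<lambda>\<theta>. k w r \<theta> powr t) has_integral integral (cbox 0 (2 * pi)) (\<lambda>\<theta>. k w r \<theta> powr t)) (cbox 0 (2 * pi))"
        using integrable_continuous integrable_integral by blast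
      then show ?thesis
        using nn_integral_has_integral_lebesgue'[of "cbox 0 (2 * pi)" "\<lambda>\<theta>. k w r \<theta> powr t"] by simp
    qed
    then show ?thesis using that
      by (simp add: integral_mean_def flip: k_def ennreal_mult')
  qed
  have cont_fin: "continuous_on UNIV (\<lambda>x. integral_mean (ennreal t) (kernel \<alpha> (fst x)) (snd x))" if "t > 0" for t
  proof -
    have "continuous_on (UNIV \<times> cbox 0 (2 * pi)) (\<lambda>y. k (fst (fst y)) (snd (fst y)) (snd y) powr t)"
      using that by (intro continuous_on_powr' k_cont continuous_intros) (auto simp: k0)
    then have "continuous_on UNIV (\<lambda>x. integral (cbox 0 (2 * pi)) (\<lambda>\<theta>. k (fst x) (snd x) \<theta> powr t))"
      by (intro integral_continuous_on_param) (simp add: case_prod_unfold)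
    then show ?thesis unfolding mean_fin[OF that]
    proof (intro continuous_on_enn_powr continuous_on_mult continuous_on_const)
      fix x
      have "continuous_on (cbox 0 (2 * pi)) (\<lambda>\<theta>. k (fst x) (snd x) \<theta> powr t)"
        using that by (intro continuous_on_powr' k_cont continuous_intros) (auto simp: k0)
      then have "0 \<le> integral (cbox 0 (2 * pi)) (\<lambda>\<theta>. k (fst x) (snd x) \<theta> powr t)"
        by (intro integral_nonneg integrable_continuous) auto
      then show "0 \<le> 1 / (2 * pi) * integral (cbox 0 (2 * pi)) (\<lambda>\<theta>. k (fst x) (snd x) \<theta> powr t)" by simp
    qed (use that in auto)
  qed
  have mean_meas: "(\<lambda>x. integral_mean p (kernel \<alpha> (fst x)) (snd x)) \<in> borel_measurable borel"
    using assms(1)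
  proof (cases rule: ennreal_pos_cases)
    case 1
    show ?thesis unfolding 1 mean_top
      by (intro borel_measurable_SUP_continuous continuous_on_ennreal k_cont continuous_intros)
  next
    case (2 t)
    then show ?thesis using cont_fin by (auto intro: borel_measurable_continuous_onI)
  qed
  from assms(2) show ?thesis
  proof (cases rule: ennreal_pos_cases)
    case 1
    from assms(1) show ?thesis
    proof (cases rule: ennreal_pos_cases)
      case p: 1
      \<comment> \<open>Two nested suprema are merged into one, so that the family consists of
        continuous functions of the center.\<close>
      have "fock_norm \<alpha> p q (kernel \<alpha> w) = (SUP y\<in>{0..} \<times> UNIV. ennreal (k w (fst y) (snd y) * exp (- (\<alpha> / 2) * (fst y)\<^sup>2)))" for w
      proof -
        have "fock_norm \<alpha> p q (kernel \<alpha> w) = (SUP r\<in>{0..}. SUP \<theta>. ennreal (k w r \<theta> * exp (- (\<alpha> / 2) * r\<^sup>2)))"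
          by (simp add: fock_norm_def 1 p mean_top SUP_mult_right_ennreal ennreal_mult k0)
        also have "\<dots> = (SUP y\<in>{0..} \<times> UNIV. ennreal (k w (fst y) (snd y) * exp (- (\<alpha> / 2) * (fst y)\<^sup>2)))"
          by (intro antisym SUP_least) (auto intro!: SUP_upper2 SUP_least)
        finally show ?thesis .
      qed
      then show ?thesis
        by (simp only:) (intro borel_measurable_SUP_continuous continuous_on_ennreal continuous_on_mult k_cont continuous_intros)
    next
      case p: (2 t)
      have "continuous_on UNIV (\<lambda>w. integral_mean p (kernel \<alpha> w) r * ennreal (exp (- (\<alpha> / 2) * r\<^sup>2)))" for r
      proof -
        have "continuous_on UNIV (\<lambda>w. integral_mean (ennreal t) (kernel \<alpha> (fst (w, r))) (snd (w, r)))"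
          by (rule continuous_on_compose2[OF cont_fin[OF p(2)]]) (auto intro!: continuous_intros)
        then have "continuous_on UNIV (\<lambda>w. ennreal (exp (- (\<alpha> / 2) * r\<^sup>2)) * integral_mean (ennreal t) (kernel \<alpha> w) r)"
          by (intro ennreal_continuous_on_cmult) auto
        then show ?thesis
          unfolding p(1) by (simp only: mult.commute)
      qed
      then show ?thesis
        unfolding fock_norm_def 1 by (simp add: borel_measurable_SUP_continuous)
    qed
  next
    case (2 u)
    have [measurable]: "(\<lambda>x. integral_mean p (kernel \<alpha> (fst x)) (snd x)) \<in> borel_measurable (borel \<Otimes>\<^sub>M lborel)"
      using mean_meas
      by (subst measurable_cong_sets[OF sets_pair_measure_cong[OF refl sets_lborel] refl]) (simp only: borel_prod)
    show ?thesis
      using 2 unfolding fock_norm_def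
      by simp
  qed
qed



section \<open>Geometry of the pocket tiling\<close>

lemma interval_cover:
  fixes f :: "nat \<Rightarrow> real"
  assumes "f 0 \<le> x" "x < f n"
  shows "\<exists>i<n. f i \<le> x \<and> x < f (Suc i)"
  using assms(2)
proof (induction n)
  case (Suc n)
  show ?case
  proof (cases "x < f n")
    case True
    then show ?thesis using Suc.IH less_Suc_eq by blast
  next
    case False
    then show ?thesis using Suc.prems by (intro exI[of _ n]) auto
  qed
qed (use assms(1) in simp)

lemma interval_index_unique:
  fixes f :: "nat \<Rightarrow> real"
  assumes "mono f" "f i \<le> x" "x < f (Suc i)" "f j \<le> x" "x < f (Suc j)"
  shows "i = j"
proof (rule ccontr)
  assume "i \<noteq> j"
  then have "Suc i \<le> j \<or> Suc j \<le> i" by linarith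
  then have "f (Suc i) \<le> f j \<or> f (Suc j) \<le> f i" using monoD[OF assms(1)] by blast
  then show False using assms by linarith
qed

locale pocket_tiling =
  fixes \<delta> c_in C_out :: real
  assumes \<delta>_pos: "0 < \<delta>" and \<delta>_le: "\<delta> \<le> 1 / 2"
    and ball_constants: "pocket_ball_constants c_in C_out"
begin

abbreviation N where "N \<equiv> num_radial \<delta>"
abbreviation \<zeta> where "\<zeta> \<equiv> pocket_center \<delta>"

lemma N_pos: "0 < N"
  using \<delta>_pos by (simp add: num_radial_def)

lemma num_angular_pos: "0 < num_angular \<delta> k \<nu>"
  using N_pos by (simp add: num_angular_def)

lemma c_in_pos: "0 < c_in" and c_in_less: "c_in < C_out"
  using ball_constants by (auto simp: pocket_ball_constants_def)

lemma ball_subset_pocket: "Q \<in> tiling \<delta> \<Longrightarrow> ball (\<zeta> Q) (c_in * \<delta>) \<subseteq> pocket \<delta> Q"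
  and pocket_subset_ball: "Q \<in> tiling \<delta> \<Longrightarrow> pocket \<delta> Q \<subseteq> ball (\<zeta> Q) (C_out * \<delta>)"
  using ball_constants \<delta>_pos \<delta>_le by (auto simp: pocket_ball_constants_def)

lemma mono_pocket_radius: "mono (pocket_radius \<delta> k)"
  using N_pos by (intro monoI) (auto simp: pocket_radius_def divide_right_mono mult_right_mono)

lemma mono_pocket_angle: "mono (pocket_angle \<delta> k \<nu>)"
  by (intro monoI) (auto simp: pocket_angle_def divide_right_mono)

lemma pocket_radius_0 [simp]: "pocket_radius \<delta> k 0 = real k"
  by (simp add: pocket_radius_def)

lemma pocket_radius_N [simp]: "pocket_radius \<delta> k N = real k + 1"
proof -
  have "(real k)\<^sup>2 + (2 * real k + 1) = (real k + 1)\<^sup>2" by (simp add: power2_eq_square algebra_simps)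
  then show ?thesis using N_pos by (simp add: pocket_radius_def)
qed

lemma pocket_radius_nonneg: "0 \<le> pocket_radius \<delta> k \<nu>"
  using monoD[OF mono_pocket_radius, of 0 \<nu> k] by simp

lemma pocket_subset_annulus:
  assumes "Q \<in> tiling \<delta>" shows "pocket \<delta> Q \<subseteq> annulus (fst Q)"
proof
  fix z assume z: "z \<in> pocket \<delta> Q"
  obtain k \<nu> m where Q: "Q = (k, \<nu>, m)" by (cases Q) auto
  obtain r \<theta> where r: "z = of_real r * cis \<theta>" "pocket_radius \<delta> k \<nu> \<le> r" "r < pocket_radius \<delta> k (Suc \<nu>)"
    using z unfolding Q pocket_def by auto
  have "Suc \<nu> \<le> N" using assms by (auto simp: Q tiling_def)
  then have "pocket_radius \<delta> k (Suc \<nu>) \<le> real k + 1"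
    using monoD[OF mono_pocket_radius, of "Suc \<nu>" N k] by simp
  moreover have "real k \<le> pocket_radius \<delta> k \<nu>"
    using monoD[OF mono_pocket_radius, of 0 \<nu> k] by simp
  ultimately show "z \<in> annulus (fst Q)"
    using r by (auto simp: annulus_def Q norm_mult)
qed

lemma annulus_unique: "z \<in> annulus k \<Longrightarrow> z \<in> annulus j \<Longrightarrow> k = j"
  by (auto simp: annulus_def)

lemma center_in_pocket: "Q \<in> tiling \<delta> \<Longrightarrow> \<zeta> Q \<in> pocket \<delta> Q"
  using ball_subset_pocket c_in_pos \<delta>_pos by (meson centre_in_ball mult_pos_pos subsetD)

lemma center_in_annulus: "Q \<in> tiling \<delta> \<Longrightarrow> \<zeta> Q \<in> annulus (fst Q)"
  using center_in_pocket pocket_subset_annulus by blast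

text \<open>A pocket contains its center and the annuli are disjoint, so inclusion in an annulus is
  decided by the first index.\<close>

lemma tiling_shell_eq: "tiling_shell \<delta> k = {Q \<in> tiling \<delta>. fst Q = k}"
proof -
  have "fst Q = k" if "Q \<in> tiling \<delta>" "pocket \<delta> Q \<subseteq> annulus k" for Q
    using that center_in_pocket center_in_annulus annulus_unique by blast
  then show ?thesis unfolding tiling_shell_def
    by (intro Collect_cong) (metis pocket_subset_annulus)
qed

lemma shell_subset: "tiling_shell \<delta> k \<subseteq> tiling \<delta>"
  by (auto simp: tiling_shell_eq)

lemma finite_shell [simp]: "finite (tiling_shell \<delta> k)"
proof -
  have "tiling_shell \<delta> k \<subseteq> (\<lambda>(\<nu>, m). (k, \<nu>, m)) ` (SIGMA \<nu>:{..<N}. {..<num_angular \<delta> k \<nu>})"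
    by (force simp: tiling_shell_eq tiling_def)
  then show ?thesis by (rule finite_subset) auto
qed

lemma pocket_cover:
  assumes "z \<in> annulus k"
  obtains Q where "Q \<in> tiling_shell \<delta> k" "z \<in> pocket \<delta> Q"
proof -
  obtain \<nu> where \<nu>: "\<nu> < N" "pocket_radius \<delta> k \<nu> \<le> cmod z" "cmod z < pocket_radius \<delta> k (Suc \<nu>)"
    using interval_cover[of "pocket_radius \<delta> k" "cmod z" N] assms by (auto simp: annulus_def)
  let ?M = "num_angular \<delta> k \<nu>"
  have "pocket_angle \<delta> k \<nu> 0 = 0" "pocket_angle \<delta> k \<nu> ?M = 2 * pi"
    using num_angular_pos[of k \<nu>] by (auto simp: pocket_angle_def)
  then obtain m where m: "m < ?M" "pocket_angle \<delta> k \<nu> m \<le> Arg2pi z" "Arg2pi z < pocket_angle \<delta> k \<nu> (Suc m)"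
    using interval_cover[of "pocket_angle \<delta> k \<nu>" "Arg2pi z" ?M] Arg2pi[of z] by auto
  have "z = of_real (cmod z) * cis (Arg2pi z)"
    using Arg2pi[of z] by (simp add: cis_conv_exp is_Arg_def)
  then have "z \<in> pocket \<delta> (k, \<nu>, m)"
    using \<nu> m unfolding pocket_def by auto
  moreover have "(k, \<nu>, m) \<in> tiling_shell \<delta> k"
    using \<nu> m by (simp add: tiling_shell_eq tiling_def)
  ultimately show ?thesis using that by blast
qed

lemma annulus_floor: "z \<in> annulus (nat \<lfloor>cmod z\<rfloor>)"
  unfolding annulus_def by (auto simp: floor_correct)

lemma pocket_disjoint:
  assumes "Q \<in> tiling \<delta>" "Q' \<in> tiling \<delta>" "z \<in> pocket \<delta> Q" "z \<in> pocket \<delta> Q'"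
  shows "Q = Q'"
proof -
  obtain k \<nu> m k' \<nu>' m' where Q: "Q = (k, \<nu>, m)" "Q' = (k', \<nu>', m')" by (cases Q, cases Q') auto
  have k: "k' = k"
    using annulus_unique[of z k' k] subsetD[OF pocket_subset_annulus[OF assms(1)] assms(3)]
      subsetD[OF pocket_subset_annulus[OF assms(2)] assms(4)] by (simp add: Q)
  obtain r \<theta> where r: "z = of_real r * cis \<theta>" "pocket_radius \<delta> k \<nu> \<le> r" "r < pocket_radius \<delta> k (Suc \<nu>)"
      "pocket_angle \<delta> k \<nu> m \<le> \<theta>" "\<theta> < pocket_angle \<delta> k \<nu> (Suc m)"
    using assms(3) unfolding Q pocket_def by auto
  obtain r' \<theta>' where r': "z = of_real r' * cis \<theta>'" "pocket_radius \<delta> k \<nu>' \<le> r'" "r' < pocket_radius \<delta> k (Suc \<nu>')"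
      "pocket_angle \<delta> k \<nu>' m' \<le> \<theta>'" "\<theta>' < pocket_angle \<delta> k \<nu>' (Suc m')"
    using assms(4) unfolding Q k pocket_def by auto
  have rr: "r \<ge> 0" "r' \<ge> 0"
    using r(2) r'(2) pocket_radius_nonneg[of k \<nu>] pocket_radius_nonneg[of k \<nu>'] by linarith+
  have "cmod z = r" using rr unfolding r(1) by (simp add: norm_mult)
  moreover have "cmod z = r'" using rr unfolding r'(1) by (simp add: norm_mult)
  ultimately have r_eq: "r' = r" by simp
  have \<nu>: "\<nu>' = \<nu>"
    using interval_index_unique[OF mono_pocket_radius r(2,3), of \<nu>'] r'(2,3) unfolding r_eq by simp
  have angle: "0 \<le> t \<and> t < 2 * pi"
    if "j < num_angular \<delta> k \<nu>" "pocket_angle \<delta> k \<nu> j \<le> t" "t < pocket_angle \<delta> k \<nu> (Suc j)" for j t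
  proof -
    have "pocket_angle \<delta> k \<nu> 0 \<le> pocket_angle \<delta> k \<nu> j" "pocket_angle \<delta> k \<nu> (Suc j) \<le> pocket_angle \<delta> k \<nu> (num_angular \<delta> k \<nu>)"
      using that by (auto intro!: monoD[OF mono_pocket_angle])
    moreover have "pocket_angle \<delta> k \<nu> 0 = 0" "pocket_angle \<delta> k \<nu> (num_angular \<delta> k \<nu>) = 2 * pi"
      using num_angular_pos[of k \<nu>] by (auto simp: pocket_angle_def)
    ultimately show ?thesis using that by linarith
  qed
  have mm: "m < num_angular \<delta> k \<nu>" "m' < num_angular \<delta> k \<nu>"
    using assms by (auto simp: Q k \<nu> tiling_def)
  show ?thesis
  proof (cases "r = 0")
    \<comment> \<open>At the origin the angle carries no information. There k = \<nu> = 0, and the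
      innermost ring is a single pocket, since 2 * 0 + 1 = 1.\<close>
    case True
    then have "pocket_radius \<delta> k \<nu> = 0" using r(2) pocket_radius_nonneg[of k \<nu>] by simp
    moreover have "real k \<le> pocket_radius \<delta> k \<nu>"
      using monoD[OF mono_pocket_radius, of 0 \<nu> k] by simp
    ultimately have "k = 0" "\<nu> = 0" using N_pos by (auto simp: pocket_radius_def)
    then show ?thesis using mm by (simp add: Q k \<nu> num_angular_def)
  next
    case False
    then have "r > 0" using rr by simp
    have "\<theta>' = \<theta>"
    proof -
      have "Arg2pi z = \<theta>"
        using angle[OF mm(1) r(4,5)]
        by (intro Arg2pi_unique[OF _ \<open>r > 0\<close>]) (simp_all only: r(1) cis_conv_exp)
      moreover have "Arg2pi z = \<theta>'"
        using angle[OF mm(2), of \<theta>'] r'(4,5) unfolding \<nu>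
        by (intro Arg2pi_unique[OF _ \<open>r > 0\<close>]) (simp_all only: r'(1) r_eq cis_conv_exp)
      ultimately show ?thesis by simp
    qed
    then have "m' = m"
      using interval_index_unique[OF mono_pocket_angle r(4,5), of m'] r'(4,5) unfolding \<nu> by simp
    then show ?thesis by (simp add: Q k \<nu>)
  qed
qed

text \<open>The pockets contain disjoint discs of radius \<open>c_in * \<delta>\<close> about their
  centers, and the discs with center within D of z lie in one of radius D +
  \<open>c_in * \<delta>\<close> about z; compare areas.\<close>

lemma packing:
  assumes "D \<ge> 0"
  shows "finite {Q \<in> tiling \<delta>. dist z (\<zeta> Q) < D}"
    and "real (card {Q \<in> tiling \<delta>. dist z (\<zeta> Q) < D}) \<le> (D / (c_in * \<delta>) + 1)\<^sup>2"
proof -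
  let ?c = "c_in * \<delta>"
  have c: "?c > 0" using c_in_pos \<delta>_pos by simp
  have bound: "real (card F) \<le> (D / ?c + 1)\<^sup>2" if F: "finite F" "F \<subseteq> {Q \<in> tiling \<delta>. dist z (\<zeta> Q) < D}" for F
  proof -
    have fin_ball: "emeasure lborel (ball x r) \<noteq> top" for x :: complex and r
      using emeasure_lborel_ball_finite[of x r] by (simp add: less_top)
    have "disjoint_family_on (\<lambda>Q. ball (\<zeta> Q) ?c) F"
      unfolding disjoint_family_on_def using F ball_subset_pocket pocket_disjoint by blast
    then have "(\<Sum>Q\<in>F. measure lborel (ball (\<zeta> Q) ?c)) = measure lborel (\<Union>Q\<in>F. ball (\<zeta> Q) ?c)"
      using F fin_ball by (intro measure_finite_Union[symmetric]) auto
    also have "\<dots> \<le> measure lborel (ball z (D + ?c))"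
    proof (intro measure_mono_fmeasurable)
      show "(\<Union>Q\<in>F. ball (\<zeta> Q) ?c) \<subseteq> ball z (D + ?c)"
      proof
        fix x assume "x \<in> (\<Union>Q\<in>F. ball (\<zeta> Q) ?c)"
        then obtain Q where "Q \<in> F" "dist (\<zeta> Q) x < ?c" by auto
        moreover have "dist z x \<le> dist z (\<zeta> Q) + dist (\<zeta> Q) x" by (rule dist_triangle)
        ultimately show "x \<in> ball z (D + ?c)" using F by fastforce
      qed
    qed (use fin_ball in \<open>auto intro!: fmeasurableI simp: less_top[symmetric]\<close>)
    finally have "real (card F) * (pi * ?c\<^sup>2) \<le> pi * (D + ?c)\<^sup>2"
      using c assms by (simp add: content_ball unit_ball_vol_2)
    then have "pi * (real (card F) * ?c\<^sup>2) \<le> pi * (D + ?c)\<^sup>2" by (simp only: mult_ac)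
    then have "real (card F) * ?c\<^sup>2 \<le> (D + ?c)\<^sup>2" by (simp only: mult_le_cancel_left_pos pi_gt_zero)
    moreover have "0 < ?c\<^sup>2" using c by (rule zero_less_power)
    ultimately have "real (card F) \<le> (D + ?c)\<^sup>2 / ?c\<^sup>2"
      by (subst pos_le_divide_eq)
    also have "\<dots> = ((D + ?c) / ?c)\<^sup>2" by (simp only: power_divide)
    also have "(D + ?c) / ?c = D / ?c + 1"     proof -
      show ?thesis using c_in_pos \<delta>_pos by (simp add: add_divide_distrib)
    qed
    finally show ?thesis .
  qed
  \<comment> \<open>A common bound for all finite subsets yields finiteness of the whole set, after
    which the bound applies to it as well.\<close>
  have "card F \<le> nat \<lfloor>(D / ?c + 1)\<^sup>2\<rfloor>" if "F \<subseteq> {Q \<in> tiling \<delta>. dist z (\<zeta> Q) < D}" "finite F" for F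
    using bound[OF that(2,1)] by (simp add: le_nat_floor)
  then show fin: "finite {Q \<in> tiling \<delta>. dist z (\<zeta> Q) < D}"
    by (rule finite_if_finite_subsets_card_bdd[THEN conjunct1])
  show "real (card {Q \<in> tiling \<delta>. dist z (\<zeta> Q) < D}) \<le> (D / ?c + 1)\<^sup>2"
    using bound[OF fin] by simp
qed

text \<open>Group the pockets by the integer part n of the distance to z. A group has O((n + 1)^2)
  members by \<open>packing\<close>, and each contributes at most exp (- \<beta> n^2); the bound is
  uniform in z because the packing bound is.\<close>

lemma gaussian_sum:
  assumes "\<beta> > 0"
  obtains C where "C > 0" "\<And>F z. finite F \<Longrightarrow> F \<subseteq> tiling \<delta> \<Longrightarrow> (\<Sum>Q\<in>F. exp (- \<beta> * (dist z (\<zeta> Q))\<^sup>2)) \<le> C"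
proof -
  let ?c = "c_in * \<delta>"
  have c: "?c > 0" using c_in_pos \<delta>_pos by simp
  define g where "g n = ((real n + 1) / ?c + 1)\<^sup>2 * exp (- \<beta> * (real n)\<^sup>2)" for n
  have g0: "g n \<ge> 0" for n by (simp add: g_def)
  have sg: "summable g"
  proof (rule summable_comparison_test')
    \<comment> \<open>From exp x >= x^2 / 2 at x = \<beta> n^2 the Gaussian is O(n^-4), which
      against the quadratic count leaves a multiple of n^-2.\<close>
    show "summable (\<lambda>n. (2 / ?c + 1)\<^sup>2 * (2 / \<beta>\<^sup>2) * inverse (real n ^ 2))"
      using inverse_power_summable[of 2, where 'a=real] by (intro summable_mult) auto
    fix n :: nat assume n: "1 \<le> n"
    have "(\<beta> * (real n)\<^sup>2)\<^sup>2 / 2 \<le> exp (\<beta> * (real n)\<^sup>2)"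
    proof -
      have "0 \<le> \<beta> * (real n)\<^sup>2" using assms by simp
      then show ?thesis using exp_lower_Taylor_quadratic[of "\<beta> * (real n)\<^sup>2"] by linarith
    qed
    then have inv_le: "inverse (exp (\<beta> * (real n)\<^sup>2)) \<le> inverse ((\<beta> * (real n)\<^sup>2)\<^sup>2 / 2)"
      using n assms by (intro le_imp_inverse_le) auto
    have "exp (- \<beta> * (real n)\<^sup>2) \<le> 2 / (\<beta>\<^sup>2 * (real n)\<^sup>2 * (real n)\<^sup>2)"
    proof -
      have "inverse ((b * x)\<^sup>2 / 2) = 2 / (b\<^sup>2 * x * x)" for b x :: real
        by (simp add: power2_eq_square)
      from this[of \<beta> "(real n)\<^sup>2"] inv_le show ?thesis by (simp only: mult_minus_left exp_minus)
    qed
    moreover have "((real n + 1) / ?c + 1)\<^sup>2 \<le> (real n * (2 / ?c + 1))\<^sup>2"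
    proof (intro power_mono)
      have "(real n + 1) / ?c \<le> (2 * real n) / ?c" using n c by (intro divide_right_mono) auto
      then have "(real n + 1) / ?c + 1 \<le> (2 * real n) / ?c + real n" using n by linarith
      then show "(real n + 1) / ?c + 1 \<le> real n * (2 / ?c + 1)" by (simp add: algebra_simps)
    qed (use c in auto)
    ultimately have "g n \<le> (real n * (2 / ?c + 1))\<^sup>2 * (2 / (\<beta>\<^sup>2 * (real n)\<^sup>2 * (real n)\<^sup>2))"
      unfolding g_def by (intro mult_mono) auto
    also have "\<dots> = (2 / ?c + 1)\<^sup>2 * (2 / \<beta>\<^sup>2) * inverse (real n ^ 2)"
    proof -
      have "x\<^sup>2 * y\<^sup>2 * (2 / (b * x\<^sup>2 * x\<^sup>2)) = y\<^sup>2 * (2 / b) * inverse (x\<^sup>2)" if "x \<noteq> 0" for x y b :: real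
        using that by (cases "b = 0") (auto simp: field_simps)
      moreover have "real n \<noteq> 0" using n by simp
      ultimately show ?thesis by (simp only: power_mult_distrib) blast
    qed
    finally show "norm (g n) \<le> (2 / ?c + 1)\<^sup>2 * (2 / \<beta>\<^sup>2) * inverse (real n ^ 2)" using g0[of n] by simp
  qed
  show ?thesis
  proof (rule that[of "suminf g + 1"])
    show "suminf g + 1 > 0" using suminf_nonneg[OF sg g0] by simp
    fix F z assume F: "finite F" "F \<subseteq> tiling \<delta>"
    define h where "h Q = nat \<lfloor>dist z (\<zeta> Q)\<rfloor>" for Q
    have h: "real (h Q) \<le> dist z (\<zeta> Q)" "dist z (\<zeta> Q) < real (h Q) + 1" for Q
      unfolding h_def by (auto simp: floor_correct)
    have "(\<Sum>Q\<in>F. exp (- \<beta> * (dist z (\<zeta> Q))\<^sup>2)) = (\<Sum>n\<in>h ` F. \<Sum>Q | Q \<in> F \<and> h Q = n. exp (- \<beta> * (dist z (\<zeta> Q))\<^sup>2))"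
      using F by (intro sum.group[symmetric]) auto
    also have "\<dots> \<le> (\<Sum>n\<in>h ` F. g n)"
    proof (rule sum_mono)
      fix n
      have "(\<Sum>Q | Q \<in> F \<and> h Q = n. exp (- \<beta> * (dist z (\<zeta> Q))\<^sup>2)) \<le> (\<Sum>Q | Q \<in> F \<and> h Q = n. exp (- \<beta> * (real n)\<^sup>2))"
        using h(1) assms by (intro sum_mono) (auto intro!: power_mono)
      also have "\<dots> = real (card {Q \<in> F. h Q = n}) * exp (- \<beta> * (real n)\<^sup>2)" by simp
      also have "\<dots> \<le> g n"
        unfolding g_def
      proof (intro mult_right_mono)
        have "card {Q \<in> F. h Q = n} \<le> card {Q \<in> tiling \<delta>. dist z (\<zeta> Q) < real n + 1}"
          using F h(2) by (intro card_mono packing) auto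
        then show "real (card {Q \<in> F. h Q = n}) \<le> ((real n + 1) / ?c + 1)\<^sup>2"
          using packing(2)[of "real n + 1" z] by linarith
      qed simp
      finally show "(\<Sum>Q | Q \<in> F \<and> h Q = n. exp (- \<beta> * (dist z (\<zeta> Q))\<^sup>2)) \<le> g n" .
    qed
    also have "\<dots> \<le> suminf g" using F g0 by (intro sum_le_suminf[OF sg]) auto
    finally show "(\<Sum>Q\<in>F. exp (- \<beta> * (dist z (\<zeta> Q))\<^sup>2)) \<le> suminf g + 1" by simp
  qed
qed

text \<open>Shell indices differ by at most the distance plus 1. Through this inequality a planar
  Gaussian yields a Gaussian in the shell index.\<close>

lemma shell_distance:
  assumes "z \<in> annulus k" "w \<in> annulus j"
  shows "(real k - real j)\<^sup>2 \<le> 2 * (dist z w)\<^sup>2 + 2"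
proof -
  have "\<bar>cmod z - cmod w\<bar> \<le> dist z w" by (simp add: dist_norm norm_triangle_ineq3)
  then have "\<bar>real k - real j\<bar> \<le> dist z w + 1"
    using assms by (auto simp: annulus_def)
  then have "(real k - real j)\<^sup>2 \<le> (dist z w + 1)\<^sup>2"
    by (metis abs_ge_zero power2_abs power_mono)
  also have "\<dots> \<le> 2 * (dist z w)\<^sup>2 + 2"
    using zero_le_power2[of "dist z w - 1"] unfolding power2_eq_square by (simp add: algebra_simps)
  finally show ?thesis .
qed

end

section \<open>Almost diagonal Gaussian matrices\<close>

text \<open>A sum against a Gaussian is at most a constant times a supremum against a wider Gaussian. With
  suprema the exponents below \<open>1\<close> need no separate treatment.\<close>

definition gauss_sup :: "real \<Rightarrow> (nat \<Rightarrow> ennreal) \<Rightarrow> nat \<Rightarrow> ennreal" where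
  "gauss_sup \<gamma> y k = (SUP j. ennreal (exp (- \<gamma> * (real k - real j)\<^sup>2)) * y j)"

text \<open>Each half, j < k and j \<ge> k, is reindexed by |k - j| and compared with a geometric
  series through n^2 \<ge> n; hence the uniformity in k.\<close>

lemma nat_gaussian_sum:
  assumes "\<gamma> > 0"
  obtains C where "C > 0" "\<And>k. (\<Sum>j. ennreal (exp (- \<gamma> * (real k - real j)\<^sup>2))) \<le> ennreal C"
proof -
  define a where "a n = exp (- \<gamma> * (real n)\<^sup>2)" for n
  have sa: "summable a"
  proof (rule summable_comparison_test')
    show "summable (\<lambda>n. exp (- \<gamma>) ^ n)" using assms by (intro summable_geometric) auto
    fix n :: nat assume "0 \<le> n"
    have "real n * 1 \<le> real n * real n" by (cases n) auto
    then have "\<gamma> * real n \<le> \<gamma> * (real n)\<^sup>2" using assms by (simp add: power2_eq_square)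
    then show "norm (a n) \<le> exp (- \<gamma>) ^ n"
      by (simp add: a_def mult.commute flip: exp_of_nat_mult)
  qed
  have a0: "a n \<ge> 0" for n by (simp add: a_def)
  have le: "(\<Sum>n\<in>F. a n) \<le> suminf a" if "finite F" for F
    using that a0 by (intro sum_le_suminf[OF sa]) auto
  have part: "(\<Sum>j<n. exp (- \<gamma> * (real k - real j)\<^sup>2)) \<le> 2 * suminf a" for n k
  proof -
    let ?f = "\<lambda>j. exp (- \<gamma> * (real k - real j)\<^sup>2)"
    have "(\<Sum>j<n. ?f j) = (\<Sum>j\<in>{..<n} \<inter> {j. j < k}. ?f j) + (\<Sum>j\<in>{..<n} \<inter> - {j. j < k}. ?f j)"
      by (subst sum.Int_Diff[of _ _ "{j. j < k}"]) (auto simp: Diff_eq)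
    moreover have "(\<Sum>j\<in>{..<n} \<inter> {j. j < k}. ?f j) \<le> suminf a"
    proof -
      have "(\<Sum>j\<in>{..<n} \<inter> {j. j < k}. ?f j) = (\<Sum>j\<in>{..<n} \<inter> {j. j < k}. a (k - j))"
        by (intro sum.cong) (auto simp: a_def of_nat_diff)
      also have "\<dots> = (\<Sum>i\<in>(\<lambda>j. k - j) ` ({..<n} \<inter> {j. j < k}). a i)"
        by (subst sum.reindex) (auto simp: inj_on_def)
      also have "\<dots> \<le> suminf a" by (intro le) auto
      finally show ?thesis .
    qed
    moreover have "(\<Sum>j\<in>{..<n} \<inter> - {j. j < k}. ?f j) \<le> suminf a"
    proof -
      have "(\<Sum>j\<in>{..<n} \<inter> - {j. j < k}. ?f j) = (\<Sum>j\<in>{..<n} \<inter> - {j. j < k}. a (j - k))"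
        by (intro sum.cong) (auto simp: a_def of_nat_diff power2_commute)
      also have "\<dots> = (\<Sum>i\<in>(\<lambda>j. j - k) ` ({..<n} \<inter> - {j. j < k}). a i)"
        by (subst sum.reindex) (auto simp: inj_on_def)
      also have "\<dots> \<le> suminf a" by (intro le) auto
      finally show ?thesis .
    qed
    ultimately show ?thesis by linarith
  qed
  show ?thesis
  proof (rule that[of "2 * suminf a + 1"])
    show "2 * suminf a + 1 > 0" using suminf_nonneg[OF sa a0] by linarith
    fix k
    have "(\<Sum>j<n. ennreal (exp (- \<gamma> * (real k - real j)\<^sup>2))) \<le> ennreal (2 * suminf a + 1)" for n
      using part[of k n] by (subst sum_ennreal) (auto intro!: ennreal_leI)
    then show "(\<Sum>j. ennreal (exp (- \<gamma> * (real k - real j)\<^sup>2))) \<le> ennreal (2 * suminf a + 1)"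
      by (simp add: suminf_eq_SUP SUP_le_iff)
  qed
qed

lemma enn_powr_exp: "enn_powr (ennreal (exp x)) r = ennreal (exp (x * r))"
  by (simp add: enn_powr_ennreal exp_powr_real)

text \<open>Powers of a Gaussian are Gaussians with another parameter. Packaged as one constant for
  finite and infinite p, in the shape in which \<open>lp_enorm_SUP_Schur\<close> and
  \<open>lp_enorm_SUP_le\<close> take their hypotheses.\<close>

lemma nat_gaussian_power_sum:
  assumes "\<gamma> > 0" "p > 0"
  obtains A where "A > 0"
    "\<And>r k. p = ennreal r \<Longrightarrow> r > 0 \<Longrightarrow> (\<Sum>j. enn_powr (ennreal (exp (- \<gamma> * (real k - real j)\<^sup>2))) r) \<le> enn_powr (ennreal A) r"
    "\<And>k j. p = top \<Longrightarrow> ennreal (exp (- \<gamma> * (real k - real j)\<^sup>2)) \<le> ennreal A"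
  using assms(2)
proof (cases rule: ennreal_pos_cases)
  case 1
  then show ?thesis using that[of 1] assms by (auto simp: ennreal_leI simp flip: ennreal_1)
next
  case (2 r)
  obtain C where C: "C > 0" "\<And>k. (\<Sum>j. ennreal (exp (- (\<gamma> * r) * (real k - real j)\<^sup>2))) \<le> ennreal C"
    using nat_gaussian_sum[OF mult_pos_pos[OF assms(1) 2(2)]] by blast
  show ?thesis
  proof (rule that[of "C powr (1 / r)"])
    fix r' k assume "p = ennreal r'" "r' > 0"
    then have "r' = r" using 2 by simp
    moreover have "(\<Sum>j. enn_powr (ennreal (exp (- \<gamma> * (real k - real j)\<^sup>2))) r) \<le> enn_powr (ennreal (C powr (1 / r))) r"
      using C(2)[of k] C(1) 2(2) by (simp add: enn_powr_exp enn_powr_ennreal powr_powr) (simp add: mult_ac)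
    ultimately show "(\<Sum>j. enn_powr (ennreal (exp (- \<gamma> * (real k - real j)\<^sup>2))) r') \<le> enn_powr (ennreal (C powr (1 / r))) r'"
      by simp
  qed (use C 2 in auto)
qed

lemma lp_enorm_gauss_sup:
  assumes "\<gamma> > 0" "q > 0"
  obtains C where "C > 0" "\<And>y. lp_enorm q UNIV (gauss_sup \<gamma> y) \<le> ennreal C * lp_enorm q UNIV y"
proof -
  obtain A where A: "A > 0"
    "\<And>r k. q = ennreal r \<Longrightarrow> r > 0 \<Longrightarrow> (\<Sum>j. enn_powr (ennreal (exp (- \<gamma> * (real k - real j)\<^sup>2))) r) \<le> enn_powr (ennreal A) r"
    "\<And>k j. q = top \<Longrightarrow> ennreal (exp (- \<gamma> * (real k - real j)\<^sup>2)) \<le> ennreal A"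
    using nat_gaussian_power_sum[OF assms] by blast
  have "lp_enorm q UNIV (gauss_sup \<gamma> y) \<le> ennreal A * lp_enorm q UNIV y" for y
    unfolding gauss_sup_def
  proof (rule lp_enorm_SUP_Schur)
    fix r j assume "q = ennreal r" "r > 0"
    then show "(\<integral>\<^sup>+i. enn_powr (ennreal (exp (- \<gamma> * (real i - real j)\<^sup>2))) r \<partial>count_space UNIV) \<le> enn_powr (ennreal A) r"
      using A(2)[of r j] by (simp add: nn_integral_count_space_nat power2_commute[of _ "real j"])
  qed (use A assms in auto)
  then show ?thesis using that A(1) by blast
qed

lemma gauss_sup_mono: "(\<And>j. x j \<le> y j) \<Longrightarrow> gauss_sup \<gamma> x k \<le> gauss_sup \<gamma> y k"
  unfolding gauss_sup_def by (intro SUP_mono' mult_left_mono) auto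

lemma gauss_sup_cmult: "gauss_sup \<gamma> (\<lambda>j. c * y j) k = c * gauss_sup \<gamma> y k"
  unfolding gauss_sup_def by (simp add: SUP_mult_left_ennreal mult.left_commute)

text \<open>A null sequence of finite values is bounded, say by B. Far from the first J indices the
  Gaussian factor makes B negligible, and beyond J the entries are small themselves. Finiteness of
  every term, including the first ones, is part of the condition and is preserved as well.\<close>

lemma null_norm_sequence_gauss_sup:
  assumes "\<gamma> > 0" "null_norm_sequence y"
  shows "null_norm_sequence (\<lambda>k. ennreal C * gauss_sup \<gamma> y k)"
proof -
  have fin: "y k < top" for k
    using assms(2) by (simp add: null_norm_sequence_def)
  have lim: "y \<longlonglongrightarrow> 0"
    using assms(2) by (simp add: null_norm_sequence_def)
  obtain B where B: "B > 0" "\<And>j. y j \<le> ennreal B"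
  proof -
    obtain J where J: "\<And>j. j \<ge> J \<Longrightarrow> y j < 1"
      using order_tendstoD(2)[OF lim, of 1] by (auto simp: eventually_sequentially)
    have "y j \<le> ennreal ((\<Sum>i<J. enn2real (y i)) + 1)" for j
    proof (cases "j < J")
      case True
      have "enn2real (y j) \<le> (\<Sum>i<J. enn2real (y i))"
        using True by (intro member_le_sum) auto
      then have "ennreal (enn2real (y j)) \<le> ennreal ((\<Sum>i<J. enn2real (y i)) + 1)" by (intro ennreal_leI) linarith
      then show ?thesis using fin[of j] by simp
    next
      case False
      then have "y j \<le> ennreal 1" using J[of j] by simp
      also have "\<dots> \<le> ennreal ((\<Sum>i<J. enn2real (y i)) + 1)" by (intro ennreal_leI) (simp add: sum_nonneg)
      finally show ?thesis .
    qed
    then show ?thesis using that[of "(\<Sum>i<J. enn2real (y i)) + 1"] by (simp add: sum_nonneg add_nonneg_pos)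
  qed
  have g_fin: "gauss_sup \<gamma> y k \<le> ennreal B" for k
    unfolding gauss_sup_def
  proof (rule SUP_least)
    fix j
    have "ennreal (exp (- \<gamma> * (real k - real j)\<^sup>2)) * y j \<le> 1 * ennreal B"
      using assms B by (intro mult_mono) (auto simp flip: ennreal_1 intro!: ennreal_leI)
    then show "ennreal (exp (- \<gamma> * (real k - real j)\<^sup>2)) * y j \<le> ennreal B" by simp
  qed
  have "gauss_sup \<gamma> y \<longlonglongrightarrow> 0"
  proof (rule order_tendstoI)
    fix e :: ennreal assume "0 < e"
    then obtain \<epsilon> where \<epsilon>: "\<epsilon> > 0" "ennreal \<epsilon> < e"
    proof -
      obtain d where d: "0 < d" "d < e" using dense[OF \<open>0 < e\<close>] by blast
      then have "d < top" using le_less_trans[of d e top] by (meson less_le_trans top_greatest)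
      then show ?thesis using d that[of "enn2real d"] by (cases d) auto
    qed
    obtain J where J: "\<And>j. j \<ge> J \<Longrightarrow> y j < ennreal \<epsilon>"
      using order_tendstoD(2)[OF lim, of "ennreal \<epsilon>"] \<epsilon> by (auto simp: eventually_sequentially)
    have "(\<lambda>k. exp (- \<gamma> * real k) * B) \<longlonglongrightarrow> 0 * B"
    proof (intro tendsto_mult tendsto_const)
      have "(\<lambda>k. exp (- \<gamma>) ^ k) \<longlonglongrightarrow> 0" using assms by (intro LIMSEQ_power_zero) auto
      then show "(\<lambda>k. exp (- \<gamma> * real k)) \<longlonglongrightarrow> 0" by (simp add: mult.commute flip: exp_of_nat_mult)
    qed
    then have "eventually (\<lambda>k. exp (- \<gamma> * real k) * B < \<epsilon>) sequentially"
      using \<epsilon> by (intro order_tendstoD(2)) auto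
    then obtain K where K: "\<And>k. k \<ge> K \<Longrightarrow> exp (- \<gamma> * real k) * B < \<epsilon>"
      by (auto simp: eventually_sequentially)
    have "gauss_sup \<gamma> y k < e" if k: "k \<ge> J + K + 1" for k
    proof -
      have "ennreal (exp (- \<gamma> * (real k - real j)\<^sup>2)) * y j \<le> ennreal \<epsilon>" for j
      proof (cases "j \<ge> J")
        case True
        have "ennreal (exp (- \<gamma> * (real k - real j)\<^sup>2)) * y j \<le> 1 * ennreal \<epsilon>"
          using assms J[OF True] by (intro mult_mono) (auto simp flip: ennreal_1 intro!: ennreal_leI)
        then show ?thesis by simp
      next
        case False
        \<comment> \<open>Here j < J and k \<ge> J + K + 1, so k - j is at least both K and 1, and
          its square is at least K.\<close>
        then have kj: "real K \<le> real k - real j" "1 \<le> real k - real j" using k by auto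
        have "real K * 1 \<le> (real k - real j) * (real k - real j)"
          using kj by (intro mult_mono) auto
        then have "\<gamma> * real K \<le> \<gamma> * (real k - real j)\<^sup>2"
          using assms by (simp add: power2_eq_square)
        then have "exp (- \<gamma> * (real k - real j)\<^sup>2) * B \<le> exp (- \<gamma> * real K) * B"
          using B by (intro mult_right_mono) auto
        also have "\<dots> < \<epsilon>" using K[of K] by simp
        finally have "ennreal (exp (- \<gamma> * (real k - real j)\<^sup>2) * B) \<le> ennreal \<epsilon>" by (intro ennreal_leI) simp
        moreover have "ennreal (exp (- \<gamma> * (real k - real j)\<^sup>2)) * y j \<le> ennreal (exp (- \<gamma> * (real k - real j)\<^sup>2)) * ennreal B"
          by (intro mult_left_mono B) auto
        ultimately show ?thesis using B by (simp add: ennreal_mult)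
      qed
      then have "gauss_sup \<gamma> y k \<le> ennreal \<epsilon>" unfolding gauss_sup_def by (intro SUP_least)
      then show ?thesis using \<epsilon> by simp
    qed
    then show "eventually (\<lambda>k. gauss_sup \<gamma> y k < e) sequentially"
      unfolding eventually_sequentially by blast
  qed simp
  then have "(\<lambda>k. ennreal C * gauss_sup \<gamma> y k) \<longlonglongrightarrow> ennreal C * 0"
    by (intro ennreal_tendsto_cmult) auto
  moreover have "ennreal C * gauss_sup \<gamma> y k < top" for k
    using le_less_trans[OF g_fin[of k] ennreal_less_top] by (simp add: ennreal_mult_less_top)
  ultimately show ?thesis by (simp add: null_norm_sequence_def)
qed

text \<open>Polynomial weights vary slowly: 1 + k \<le> (1 + |k - j|) (1 + j) bounds the ratio by
  exp (|\<tau>| |k - j|) for either sign of \<tau>, and completing the square turns this into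
  Gaussian growth of arbitrarily small rate \<gamma>.\<close>

lemma weight_ratio:
  assumes "\<gamma> > 0"
  shows "(1 + real k) powr \<tau> \<le> exp (\<tau>\<^sup>2 / (4 * \<gamma>)) * exp (\<gamma> * (real k - real j)\<^sup>2) * (1 + real j) powr \<tau>"
proof -
  have gen: "(1 + real a) powr t \<le> exp (t * \<bar>real a - real b\<bar>) * (1 + real b) powr t" if "t \<ge> 0" for a b t
  proof -
    have "1 + x \<le> (1 + u) * (1 + y)" if "x \<le> y + u" "0 \<le> u" "0 \<le> y" for x y u :: real
    proof -
      have "0 \<le> u * y" using that by simp
      then show ?thesis using that by (simp only: distrib_left distrib_right mult_1 mult_1_right)
    qed
    then have "1 + real a \<le> (1 + \<bar>real a - real b\<bar>) * (1 + real b)" by simp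
    also have "\<dots> \<le> exp \<bar>real a - real b\<bar> * (1 + real b)" by (intro mult_right_mono) auto
    finally have "(1 + real a) powr t \<le> (exp \<bar>real a - real b\<bar> * (1 + real b)) powr t"
      using that by (intro powr_mono2) auto
    then show ?thesis by (simp add: powr_mult exp_powr_real mult.commute)
  qed
  have "(1 + real k) powr \<tau> \<le> exp (\<bar>\<tau>\<bar> * \<bar>real k - real j\<bar>) * (1 + real j) powr \<tau>"
  proof (cases "\<tau> \<ge> 0")
    case True
    then show ?thesis using gen[of \<tau> k j] by simp
  next
    case False
    then have "(1 + real j) powr (- \<tau>) \<le> exp (- \<tau> * \<bar>real j - real k\<bar>) * (1 + real k) powr (- \<tau>)"
      by (intro gen) simp
    moreover have "1 / y \<le> e * (1 / x)" if "x \<le> e * y" "0 < x" "0 < y" for x y e :: real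
      using that by (simp add: field_simps)
    ultimately have "1 / (1 + real k) powr (- \<tau>) \<le> exp (- \<tau> * \<bar>real j - real k\<bar>) * (1 / (1 + real j) powr (- \<tau>))"
      by simp
    then have "(1 + real k) powr \<tau> \<le> exp (- \<tau> * \<bar>real j - real k\<bar>) * (1 + real j) powr \<tau>"
      unfolding powr_minus_divide[of _ "- \<tau>", symmetric] by simp
    moreover have "- \<tau> * \<bar>real j - real k\<bar> = \<bar>\<tau>\<bar> * \<bar>real k - real j\<bar>"
      using False by (simp add: abs_minus_commute)
    ultimately show ?thesis by (simp only:)
  qed
  also have "\<dots> \<le> exp (\<tau>\<^sup>2 / (4 * \<gamma>) + \<gamma> * (real k - real j)\<^sup>2) * (1 + real j) powr \<tau>"
  proof -
    have "0 \<le> (2 * \<gamma> * \<bar>real k - real j\<bar> - \<bar>\<tau>\<bar>)\<^sup>2 / (4 * \<gamma>)" using assms by simp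
    also have "\<dots> = \<tau>\<^sup>2 / (4 * \<gamma>) + \<gamma> * (real k - real j)\<^sup>2 - \<bar>\<tau>\<bar> * \<bar>real k - real j\<bar>"
    proof -
      have "(2 * g * x - t)\<^sup>2 / (4 * g) = t\<^sup>2 / (4 * g) + g * x\<^sup>2 - t * x" if "g > 0" for g x t :: real
        using that by (simp add: power2_eq_square field_simps)
      from this[OF assms, of "\<bar>real k - real j\<bar>" "\<bar>\<tau>\<bar>"] show ?thesis by simp
    qed
    finally show ?thesis by (intro mult_right_mono) auto
  qed
  finally show ?thesis by (simp add: exp_add)
qed

text \<open>Half of the Gaussian pays for moving the weight from k to j; \<open>weight_ratio\<close>
  at rate \<gamma>/2 produces the constant.\<close>

lemma gauss_sup_weight:
  assumes "\<gamma> > 0"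
  shows "ennreal ((1 + real k) powr \<tau>) * gauss_sup \<gamma> y k \<le>
    ennreal (exp (\<tau>\<^sup>2 / (2 * \<gamma>))) * gauss_sup (\<gamma> / 2) (\<lambda>j. ennreal ((1 + real j) powr \<tau>) * y j) k"
proof -
  have "ennreal ((1 + real k) powr \<tau>) * (ennreal (exp (- \<gamma> * (real k - real j)\<^sup>2)) * y j) \<le>
      ennreal (exp (\<tau>\<^sup>2 / (2 * \<gamma>))) * (ennreal (exp (- (\<gamma> / 2) * (real k - real j)\<^sup>2)) * (ennreal ((1 + real j) powr \<tau>) * y j))" for j
  proof -
    have "(1 + real k) powr \<tau> * exp (- \<gamma> * (real k - real j)\<^sup>2) \<le>
        (exp (\<tau>\<^sup>2 / (4 * (\<gamma> / 2))) * exp (\<gamma> / 2 * (real k - real j)\<^sup>2) * (1 + real j) powr \<tau>) * exp (- \<gamma> * (real k - real j)\<^sup>2)"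
      using assms by (intro mult_right_mono weight_ratio) auto
    also have "\<dots> = exp (\<tau>\<^sup>2 / (2 * \<gamma>)) * ((exp (\<gamma> / 2 * (real k - real j)\<^sup>2) * exp (- \<gamma> * (real k - real j)\<^sup>2)) * (1 + real j) powr \<tau>)"
      by simp
    also have "exp (\<gamma> / 2 * (real k - real j)\<^sup>2) * exp (- \<gamma> * (real k - real j)\<^sup>2) = exp (- (\<gamma> / 2) * (real k - real j)\<^sup>2)"
      by (simp flip: exp_add)
    finally have "ennreal ((1 + real k) powr \<tau> * exp (- \<gamma> * (real k - real j)\<^sup>2)) * y j \<le>
        ennreal (exp (\<tau>\<^sup>2 / (2 * \<gamma>)) * (exp (- (\<gamma> / 2) * (real k - real j)\<^sup>2) * (1 + real j) powr \<tau>)) * y j"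
      by (intro mult_right_mono ennreal_leI) auto
    then show ?thesis by (simp add: ennreal_mult mult.assoc)
  qed
  then show ?thesis
    unfolding gauss_sup_def by (simp add: SUP_mult_left_ennreal SUP_mono')
qed

text \<open>Common form of both mass conditions, in which only the sequence of shell norms appears.
  A bound by \<open>gauss_sup\<close> then transfers it from one sequence to another, whatever the
  relation of q and s.\<close>

definition shell_condition :: "real \<Rightarrow> ennreal \<Rightarrow> (nat \<Rightarrow> ennreal) \<Rightarrow> bool" where
  "shell_condition s q x \<longleftrightarrow> (q \<le> ennreal s \<longrightarrow> null_norm_sequence x) \<and>
    (ennreal s < q \<longrightarrow> lp_enorm (star_exponent s q) UNIV x < top)"

text \<open>Gaussian matrices are bounded for every exponent and preserve null sequences, so either
  branch of the condition passes to a dominated sequence. Both directions of the comparison between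
  the two mass conditions end here.\<close>

lemma shell_condition_dominated:
  assumes "shell_condition s q y" "\<gamma> > 0" "\<And>k. x k \<le> ennreal C * gauss_sup \<gamma> y k"
  shows "shell_condition s q x"
  unfolding shell_condition_def
proof (intro conjI impI)
  assume "q \<le> ennreal s"
  then have n: "null_norm_sequence (\<lambda>k. ennreal C * gauss_sup \<gamma> y k)"
    using assms by (intro null_norm_sequence_gauss_sup) (auto simp: shell_condition_def)
  have "x \<longlonglongrightarrow> 0"
  proof (rule tendsto_sandwich[OF _ _ tendsto_const])
    show "(\<lambda>k. ennreal C * gauss_sup \<gamma> y k) \<longlonglongrightarrow> 0" using n by (simp add: null_norm_sequence_def)
  qed (simp_all add: assms(3))
  moreover have "x k < \<infinity>" for k
    using n le_less_trans[OF assms(3)[of k]] by (simp add: null_norm_sequence_def)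
  ultimately show "null_norm_sequence x" by (simp add: null_norm_sequence_def)
next
  assume "ennreal s < q"
  then have fin: "lp_enorm (star_exponent s q) UNIV y < top" using assms by (auto simp: shell_condition_def)
  obtain A where A: "\<And>y. lp_enorm (star_exponent s q) UNIV (gauss_sup \<gamma> y) \<le> ennreal A * lp_enorm (star_exponent s q) UNIV y"
    using lp_enorm_gauss_sup[OF assms(2) star_exponent_pos] by blast
  have "lp_enorm (star_exponent s q) UNIV x \<le> lp_enorm (star_exponent s q) UNIV (\<lambda>k. ennreal C * gauss_sup \<gamma> y k)"
    by (intro lp_enorm_mono star_exponent_pos assms)
  also have "\<dots> \<le> ennreal C * (ennreal A * lp_enorm (star_exponent s q) UNIV y)"
    by (subst lp_enorm_cmult[OF star_exponent_pos]) (intro mult_left_mono A, simp)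
  also have "\<dots> < top" using fin by (simp add: ennreal_mult_less_top)
  finally show "lp_enorm (star_exponent s q) UNIV x < top" .
qed

section \<open>Gaussian matrices indexed by pockets\<close>

context pocket_tiling
begin

lemma gaussian_power_sum:
  assumes "\<beta> > 0" "p > 0"
  obtains A where "A > 0"
    "\<And>r k z. p = ennreal r \<Longrightarrow> r > 0 \<Longrightarrow>
      (\<Sum>Q\<in>tiling_shell \<delta> k. enn_powr (ennreal (exp (- \<beta> * (dist z (\<zeta> Q))\<^sup>2))) r) \<le> enn_powr (ennreal A) r"
    "\<And>z w. p = top \<Longrightarrow> ennreal (exp (- \<beta> * (dist z w)\<^sup>2)) \<le> ennreal A"
  using assms(2)
proof (cases rule: ennreal_pos_cases)
  case 1
  then show ?thesis using that[of 1] assms by (auto simp: ennreal_leI simp flip: ennreal_1)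
next
  case (2 r)
  obtain C where C: "C > 0" "\<And>F z. finite F \<Longrightarrow> F \<subseteq> tiling \<delta> \<Longrightarrow> (\<Sum>Q\<in>F. exp (- (\<beta> * r) * (dist z (\<zeta> Q))\<^sup>2)) \<le> C"
    using gaussian_sum[OF mult_pos_pos[OF assms(1) 2(2)]] by blast
  show ?thesis
  proof (rule that[of "C powr (1 / r)"])
    fix r' k z assume "p = ennreal r'" "r' > 0"
    then have "r' = r" using 2 by simp
    moreover have "(\<Sum>Q\<in>tiling_shell \<delta> k. enn_powr (ennreal (exp (- \<beta> * (dist z (\<zeta> Q))\<^sup>2))) r)
        = ennreal (\<Sum>Q\<in>tiling_shell \<delta> k. exp (- (\<beta> * r) * (dist z (\<zeta> Q))\<^sup>2))"
      by (subst sum_ennreal[symmetric]) (auto simp: enn_powr_exp mult_ac)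
    moreover have "ennreal (\<Sum>Q\<in>tiling_shell \<delta> k. exp (- (\<beta> * r) * (dist z (\<zeta> Q))\<^sup>2)) \<le> enn_powr (ennreal (C powr (1 / r))) r"
      using C(2)[OF finite_shell shell_subset, of z k] C(1) 2(2) by (simp add: enn_powr_ennreal powr_powr ennreal_leI)
    ultimately show "(\<Sum>Q\<in>tiling_shell \<delta> k. enn_powr (ennreal (exp (- \<beta> * (dist z (\<zeta> Q))\<^sup>2))) r') \<le> enn_powr (ennreal (C powr (1 / r))) r'"
      by simp
  qed (use C 2 in auto)
qed

text \<open>Kept as a function on the plane, not only on centers: ball masses and synthesized
  functions are first bounded at arbitrary points, and the base point is moved to a center
  afterwards.\<close>

definition gauss_sup_tiling :: "real \<Rightarrow> (pocket_index \<Rightarrow> ennreal) \<Rightarrow> complex \<Rightarrow> ennreal" where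
  "gauss_sup_tiling \<beta> g z = (SUP Q\<in>tiling \<delta>. ennreal (exp (- \<beta> * (dist z (\<zeta> Q))\<^sup>2)) * g Q)"

text \<open>One planar Gaussian is split in three by \<open>shell_distance\<close>: two factors in
  the shell index and one planar factor. The planar factor is summed inside a pair of shells by the
  Schur test, one index factor adds up the shells within the l^p norm, and the other survives as
  \<open>gauss_sup\<close>.\<close>

lemma lp_enorm_shell_gaussian:
  assumes "\<beta> > 0" "p > 0"
  obtains C \<gamma> where "C > 0" "\<gamma> > 0"
    "\<And>g k. lp_enorm p (tiling_shell \<delta> k) (\<lambda>Q. gauss_sup_tiling \<beta> g (\<zeta> Q)) \<le>
      ennreal C * gauss_sup \<gamma> (\<lambda>j. lp_enorm p (tiling_shell \<delta> j) g) k"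
proof -
  \<comment> \<open>From (k - j)^2 \<le> 2 d^2 + 2, half of the exponent \<beta> d^2 is worth
    (\<beta>/4) (k - j)^2 - \<beta>/2, that is two factors of rate \<beta>/8 and the constant exp
    (\<beta>/2).\<close>
  define \<gamma> where "\<gamma> = \<beta> / 8"
  have \<gamma>: "\<gamma> > 0" using assms by (simp add: \<gamma>_def)
  obtain A where A: "A > 0"
    "\<And>r k. p = ennreal r \<Longrightarrow> r > 0 \<Longrightarrow> (\<Sum>j. enn_powr (ennreal (exp (- \<gamma> * (real k - real j)\<^sup>2))) r) \<le> enn_powr (ennreal A) r"
    "\<And>k j. p = top \<Longrightarrow> ennreal (exp (- \<gamma> * (real k - real j)\<^sup>2)) \<le> ennreal A"
    using nat_gaussian_power_sum[OF \<gamma> assms(2)] by blast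
  obtain B where B: "B > 0"
    "\<And>r k z. p = ennreal r \<Longrightarrow> r > 0 \<Longrightarrow>
      (\<Sum>Q\<in>tiling_shell \<delta> k. enn_powr (ennreal (exp (- (\<beta> / 2) * (dist z (\<zeta> Q))\<^sup>2))) r) \<le> enn_powr (ennreal B) r"
    "\<And>z w :: complex. p = top \<Longrightarrow> ennreal (exp (- (\<beta> / 2) * (dist z w)\<^sup>2)) \<le> ennreal B"
    using gaussian_power_sum[OF half_gt_zero[OF assms(1)] assms(2)] by blast
  define E where "E Q Q' = ennreal (exp (- (\<beta> / 2) * (dist (\<zeta> Q) (\<zeta> Q'))\<^sup>2))" for Q Q'
  have block: "lp_enorm p (tiling_shell \<delta> k) (\<lambda>Q. SUP Q'\<in>tiling_shell \<delta> j. E Q Q' * g Q') \<le> ennreal B * lp_enorm p (tiling_shell \<delta> j) g" for j k g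
  proof (rule lp_enorm_SUP_Schur)
    fix r Q' assume "p = ennreal r" "r > 0"
    then show "(\<integral>\<^sup>+Q. enn_powr (E Q Q') r \<partial>count_space (tiling_shell \<delta> k)) \<le> enn_powr (ennreal B) r"
      using B(2)[where r = r and k = k and z = "\<zeta> Q'"] by (simp add: nn_integral_count_space_finite E_def dist_commute)
  qed (use B assms in \<open>auto simp: E_def countable_finite\<close>)
  show ?thesis
  proof (rule that[of "exp (\<beta> / 2) * (A * B)" \<gamma>])
    fix g k
    let ?a = "\<lambda>j. ennreal (exp (- \<gamma> * (real k - real j)\<^sup>2))"
    define h where "h j Q = ?a j * (SUP Q'\<in>tiling_shell \<delta> j. E Q Q' * g Q')" for j Q
    have "gauss_sup_tiling \<beta> g (\<zeta> Q) \<le> ennreal (exp (\<beta> / 2)) * (SUP j. ?a j * h j Q)" if Q: "Q \<in> tiling_shell \<delta> k" for Q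
      unfolding gauss_sup_tiling_def
    proof (rule SUP_least)
      fix Q' assume Q': "Q' \<in> tiling \<delta>"
      define j where "j = fst Q'"
      have Q'j: "Q' \<in> tiling_shell \<delta> j" using Q' by (simp add: tiling_shell_eq j_def)
      have kQ: "\<zeta> Q \<in> annulus k" "\<zeta> Q' \<in> annulus j"
        using Q Q' center_in_annulus[of Q] center_in_annulus[of Q'] by (simp_all add: tiling_shell_eq j_def)
      let ?d = "(dist (\<zeta> Q) (\<zeta> Q'))\<^sup>2" and ?x = "(real k - real j)\<^sup>2"
      have "\<beta> * ?x \<le> \<beta> * (2 * ?d + 2)"
        using shell_distance[OF kQ] assms by (intro mult_left_mono) auto
      then have "- \<beta> * ?d \<le> \<beta> / 2 + (- \<gamma> * ?x + (- \<gamma> * ?x + - (\<beta> / 2) * ?d))"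
        unfolding \<gamma>_def by (simp add: algebra_simps)
      then have "exp (- \<beta> * ?d) \<le> exp (\<beta> / 2) * (exp (- \<gamma> * ?x) * (exp (- \<gamma> * ?x) * exp (- (\<beta> / 2) * ?d)))"
        unfolding exp_add[symmetric] by simp
      then have "ennreal (exp (- \<beta> * ?d)) * g Q' \<le> ennreal (exp (\<beta> / 2) * (exp (- \<gamma> * ?x) * (exp (- \<gamma> * ?x) * exp (- (\<beta> / 2) * ?d)))) * g Q'"
        by (intro mult_right_mono ennreal_leI) auto
      also have "\<dots> = ennreal (exp (\<beta> / 2)) * (?a j * (?a j * (E Q Q' * g Q')))"
        by (simp add: ennreal_mult E_def mult_ac)
      also have "\<dots> \<le> ennreal (exp (\<beta> / 2)) * (?a j * h j Q)"
        unfolding h_def using Q'j by (intro mult_left_mono SUP_upper) auto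
      also have "\<dots> \<le> ennreal (exp (\<beta> / 2)) * (SUP j. ?a j * h j Q)"
        by (intro mult_left_mono SUP_upper) auto
      finally show "ennreal (exp (- \<beta> * ?d)) * g Q' \<le> ennreal (exp (\<beta> / 2)) * (SUP j. ?a j * h j Q)" .
    qed
    then have "lp_enorm p (tiling_shell \<delta> k) (\<lambda>Q. gauss_sup_tiling \<beta> g (\<zeta> Q)) \<le>
        lp_enorm p (tiling_shell \<delta> k) (\<lambda>Q. ennreal (exp (\<beta> / 2)) * (SUP j. ?a j * h j Q))"
      by (intro lp_enorm_mono assms) auto
    also have "\<dots> = ennreal (exp (\<beta> / 2)) * lp_enorm p (tiling_shell \<delta> k) (\<lambda>Q. SUP j. ?a j * h j Q)"
      by (rule lp_enorm_cmult[OF assms(2)])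
    also have "\<dots> \<le> ennreal (exp (\<beta> / 2)) * (ennreal A * (SUP j. lp_enorm p (tiling_shell \<delta> k) (h j)))"
      by (intro mult_left_mono lp_enorm_SUP_le assms A(2,3)) auto
    also have "\<dots> \<le> ennreal (exp (\<beta> / 2)) * (ennreal A * (ennreal B * gauss_sup \<gamma> (\<lambda>j. lp_enorm p (tiling_shell \<delta> j) g) k))"
    proof (intro mult_left_mono)
      have "lp_enorm p (tiling_shell \<delta> k) (h j) \<le> ennreal B * (?a j * lp_enorm p (tiling_shell \<delta> j) g)" for j
      proof -
        have "lp_enorm p (tiling_shell \<delta> k) (h j) = ?a j * lp_enorm p (tiling_shell \<delta> k) (\<lambda>Q. SUP Q'\<in>tiling_shell \<delta> j. E Q Q' * g Q')"
          unfolding h_def by (rule lp_enorm_cmult[OF assms(2)])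
        also have "\<dots> \<le> ?a j * (ennreal B * lp_enorm p (tiling_shell \<delta> j) g)"
          by (intro mult_left_mono block) auto
        finally show ?thesis by (simp add: mult_ac)
      qed
      then show "(SUP j. lp_enorm p (tiling_shell \<delta> k) (h j)) \<le> ennreal B * gauss_sup \<gamma> (\<lambda>j. lp_enorm p (tiling_shell \<delta> j) g) k"
        unfolding gauss_sup_def by (simp add: SUP_mult_left_ennreal SUP_mono')
    qed auto
    also have "\<dots> = ennreal (exp (\<beta> / 2) * (A * B)) * gauss_sup \<gamma> (\<lambda>j. lp_enorm p (tiling_shell \<delta> j) g) k"
      using A(1) B(1) by (simp add: ennreal_mult mult_ac)
    finally show "lp_enorm p (tiling_shell \<delta> k) (\<lambda>Q. gauss_sup_tiling \<beta> g (\<zeta> Q)) \<le>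
      ennreal (exp (\<beta> / 2) * (A * B)) * gauss_sup \<gamma> (\<lambda>j. lp_enorm p (tiling_shell \<delta> j) g) k" .
  qed (use A B \<gamma> in auto)
qed

end

section \<open>Ball masses at centers and at arbitrary points\<close>

lemma ennreal_inverse_antimono:
  assumes "x \<le> y" shows "inverse y \<le> inverse (x :: ennreal)"
proof (cases "x = 0 \<or> y = top")
  case False
  then obtain u v where "x = ennreal u" "0 < u" "y = ennreal v" "u \<le> v"
    using assms by (cases x; cases y) (auto simp: less_le top_unique)
  then show ?thesis by (simp add: inverse_ennreal le_imp_inverse_le ennreal_leI)
qed auto

lemma nn_integral_sum_cmult_ball:
  "(\<integral>\<^sup>+z. (\<Sum>i\<in>I. c i * indicator (ball (x i) r) z) \<partial>lborel) = (\<Sum>i\<in>I. c i * emeasure lborel (ball (x i) r))"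
proof (subst nn_integral_sum)
  show "(\<lambda>z. c i * indicator (ball (x i) r) z) \<in> borel_measurable lborel" for i
    by (intro borel_measurable_times_ennreal borel_measurable_const borel_measurable_indicator) simp
qed (simp add: nn_integral_cmult_indicator)

lemma powr_double_bounds:
  fixes x y \<tau> :: real
  assumes "0 < x" "x \<le> y" "y \<le> 2 * x"
  shows "2 powr (- \<bar>\<tau>\<bar>) * x powr \<tau> \<le> y powr \<tau>" "y powr \<tau> \<le> 2 powr \<bar>\<tau>\<bar> * x powr \<tau>"
proof -
  define t where "t = y / x"
  have t: "1 \<le> t" "t \<le> 2" "y = t * x" using assms by (auto simp: t_def field_simps)
  have y: "y powr \<tau> = t powr \<tau> * x powr \<tau>" using t(3) by (simp add: powr_mult)
  have "t powr \<tau> \<le> t powr \<bar>\<tau>\<bar>" using t by (intro powr_mono) auto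
  also have "\<dots> \<le> 2 powr \<bar>\<tau>\<bar>" using t by (intro powr_mono2) auto
  finally show "y powr \<tau> \<le> 2 powr \<bar>\<tau>\<bar> * x powr \<tau>" unfolding y by (intro mult_right_mono) auto
  have "2 powr (- \<bar>\<tau>\<bar>) \<le> t powr (- \<bar>\<tau>\<bar>)" using t by (intro powr_mono2') auto
  also have "\<dots> \<le> t powr \<tau>" using t by (intro powr_mono) auto
  finally show "2 powr (- \<bar>\<tau>\<bar>) * x powr \<tau> \<le> y powr \<tau>" unfolding y by (intro mult_right_mono) auto
qed

text \<open>Lower semicontinuity, valid for an arbitrary Borel measure: the mass of a ball is the
  supremum over slightly smaller concentric balls, and such a smaller ball stays inside the ball of
  radius R about any nearby point.\<close>

lemma ball_emeasure_measurable:
  fixes \<mu> :: "'a::metric_space measure"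
  assumes "sets \<mu> = sets borel"
  shows "(\<lambda>z. emeasure \<mu> (ball z R)) \<in> borel_measurable borel"
proof (rule borel_measurableI_greater)
  fix y
  have "open {z. y < emeasure \<mu> (ball z R)}"
    unfolding open_contains_ball
  proof (intro ballI)
    fix z assume "z \<in> {z. y < emeasure \<mu> (ball z R)}"
    then have y: "y < emeasure \<mu> (ball z R)" by simp
    define A where "A n = ball z (R - 1 / (real n + 1))" for n
    have "(SUP n. emeasure \<mu> (A n)) = emeasure \<mu> (\<Union>n. A n)"
    proof (rule SUP_emeasure_incseq)
      show "incseq A"
      proof (rule monoI)
        fix m n :: nat assume "m \<le> n"
        then have "1 / (real n + 1) \<le> 1 / (real m + 1)" by (intro divide_left_mono) auto
        then show "A m \<subseteq> A n" unfolding A_def by (intro subset_ball) linarith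
      qed
      show "range A \<subseteq> sets \<mu>"
        unfolding assms by (intro image_subsetI) (simp only: A_def borel_open open_ball)
    qed
    moreover have "(\<Union>n. A n) = ball z R"
    proof (intro equalityI subsetI)
      fix x assume "x \<in> ball z R"
      then have "0 < R - dist z x" by simp
      then obtain n where "inverse (real (Suc n)) < R - dist z x"
        using reals_Archimedean by blast
      then show "x \<in> (\<Union>n. A n)" by (auto simp: A_def inverse_eq_divide add.commute intro!: exI[of _ n])
    next
      fix x assume "x \<in> (\<Union>n. A n)"
      then obtain n where "dist z x < R - 1 / (real n + 1)" by (auto simp: A_def)
      moreover have "1 / (real n + 1) > 0" by simp
      ultimately show "x \<in> ball z R" unfolding mem_ball by linarith
    qed
    ultimately have "y < (SUP n. emeasure \<mu> (A n))" using y by (simp only:)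
    then obtain n where n: "y < emeasure \<mu> (A n)" unfolding less_SUP_iff by blast
    have "ball z (1 / (real n + 1)) \<subseteq> {z. y < emeasure \<mu> (ball z R)}"
    proof
      fix x assume x: "x \<in> ball z (1 / (real n + 1))"
      have "A n \<subseteq> ball x R"
      proof
        fix w assume "w \<in> A n"
        then have "dist z w < R - 1 / (real n + 1)" by (simp add: A_def)
        moreover have "dist x w \<le> dist z x + dist z w" by (metis dist_commute dist_triangle)
        ultimately show "w \<in> ball x R" using x unfolding mem_ball by linarith
      qed
      then have "emeasure \<mu> (A n) \<le> emeasure \<mu> (ball x R)" using assms by (intro emeasure_mono) auto
      then show "x \<in> {z. y < emeasure \<mu> (ball z R)}" using n by simp
    qed
    then show "\<exists>e>0. ball z e \<subseteq> {z. y < emeasure \<mu> (ball z R)}"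
      by (intro exI[of _ "1 / (real n + 1)"] conjI) auto
  qed
  then show "{z \<in> space borel. y < emeasure \<mu> (ball z R)} \<in> sets borel" by simp
qed

lemma Lp_enorm_cmult_le:
  assumes "p > 0" "K > 0" and [measurable]: "F \<in> borel_measurable M"
  shows "Lp_enorm p M (\<lambda>x. ennreal K * F x) \<le> ennreal K * Lp_enorm p M F"
  using assms(1)
proof (cases rule: ennreal_pos_cases)
  case 1
  have "esssup M (\<lambda>x. ennreal K * F x) \<le> ennreal K * esssup M F"
  proof (rule esssup_I)
    show "AE x in M. ennreal K * F x \<le> ennreal K * esssup M F"
      using esssup_AE[of F M] by eventually_elim (rule mult_left_mono, auto)
  qed simp
  then show ?thesis using 1 by (simp add: Lp_enorm_def)
next
  case (2 r)
  then show ?thesis by (simp add: lp_enorm_finite_exponent enn_powr_mult nn_integral_cmult)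
qed

section \<open>Norms over annuli versus norms over pockets\<close>

context pocket_tiling
begin

lemma annulus_measurable [measurable]: "annulus k \<in> sets borel"
  unfolding annulus_def by measurable

lemma cover_ball:
  assumes "z \<in> annulus k"
  obtains Q where "Q \<in> tiling_shell \<delta> k" "dist z (\<zeta> Q) < C_out * \<delta>"
proof -
  obtain Q where "Q \<in> tiling_shell \<delta> k" "z \<in> pocket \<delta> Q" using pocket_cover[OF assms] .
  moreover have "dist z (\<zeta> Q) < C_out * \<delta>"
    using subsetD[OF pocket_subset_ball \<open>z \<in> pocket \<delta> Q\<close>] subsetD[OF shell_subset \<open>Q \<in> tiling_shell \<delta> k\<close>]
    by (simp add: dist_commute)
  ultimately show ?thesis using that by blast
qed

text \<open>The annulus is covered by discs of radius \<rho> about the centers, and on some disc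
  containing z the function is below V; summing r-th powers over all discs covers every choice. Only
  the area \<pi> \<rho>^2 enters, so the constant is the same for all shells.\<close>

lemma fun_shell_norm_le:
  assumes "p > 0" "\<rho> > 0"
  obtains A where "A > 0" "\<And>F V k. F \<in> borel_measurable borel \<Longrightarrow>
    (\<And>z. z \<in> annulus k \<Longrightarrow> \<exists>Q\<in>tiling_shell \<delta> k. dist z (\<zeta> Q) < \<rho> \<and> F z \<le> V Q) \<Longrightarrow>
    fun_shell_norm p F k \<le> ennreal A * lp_enorm p (tiling_shell \<delta> k) V"
  using assms(1)
proof (cases rule: ennreal_pos_cases)
  case 1
  have "fun_shell_norm p F k \<le> lp_enorm p (tiling_shell \<delta> k) V"
    if [measurable]: "F \<in> borel_measurable borel"
      and F: "\<And>z. z \<in> annulus k \<Longrightarrow> \<exists>Q\<in>tiling_shell \<delta> k. dist z (\<zeta> Q) < \<rho> \<and> F z \<le> V Q" for F V k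
  proof -
    have "esssup (restrict_space lborel (annulus k)) F \<le> (SUP Q\<in>tiling_shell \<delta> k. V Q)"
    proof (rule esssup_I)
      show "F \<in> borel_measurable (restrict_space lborel (annulus k))"
        by (intro measurable_restrict_space1) simp
      show "AE z in restrict_space lborel (annulus k). F z \<le> (SUP Q\<in>tiling_shell \<delta> k. V Q)"
      proof (rule AE_I2)
        fix z assume "z \<in> space (restrict_space lborel (annulus k))"
        then have "z \<in> annulus k" by (simp add: space_restrict_space)
        then show "F z \<le> (SUP Q\<in>tiling_shell \<delta> k. V Q)" using F by (meson SUP_upper2)
      qed
    qed
    then show ?thesis by (simp add: fun_shell_norm_def 1 Lp_enorm_def[of top "restrict_space _ _"] lp_enorm_top)
  qed
  then show ?thesis using that[of 1] by simp
next
  case (2 r)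
  show ?thesis
  proof (rule that[of "(pi * \<rho>\<^sup>2) powr (1 / r)"])
    show "(pi * \<rho>\<^sup>2) powr (1 / r) > 0" using assms by simp
    fix F :: "complex \<Rightarrow> ennreal" and V k
    assume [measurable]: "F \<in> borel_measurable borel"
      and F: "\<And>z. z \<in> annulus k \<Longrightarrow> \<exists>Q\<in>tiling_shell \<delta> k. dist z (\<zeta> Q) < \<rho> \<and> F z \<le> V Q"
    have "(\<integral>\<^sup>+z. enn_powr (F z) r \<partial>restrict_space lborel (annulus k)) = (\<integral>\<^sup>+z. enn_powr (F z) r * indicator (annulus k) z \<partial>lborel)"
      by (subst nn_integral_restrict_space) auto
    also have "\<dots> \<le> (\<integral>\<^sup>+z. (\<Sum>Q\<in>tiling_shell \<delta> k. enn_powr (V Q) r * indicator (ball (\<zeta> Q) \<rho>) z) \<partial>lborel)"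
    proof (rule nn_integral_mono)
      fix z
      show "enn_powr (F z) r * indicator (annulus k) z \<le> (\<Sum>Q\<in>tiling_shell \<delta> k. enn_powr (V Q) r * indicator (ball (\<zeta> Q) \<rho>) z)"
      proof (cases "z \<in> annulus k")
        case True
        then obtain Q where Q: "Q \<in> tiling_shell \<delta> k" "dist z (\<zeta> Q) < \<rho>" "F z \<le> V Q" using F by blast
        have "enn_powr (F z) r \<le> enn_powr (V Q) r * indicator (ball (\<zeta> Q) \<rho>) z"
          using Q 2 by (simp add: dist_commute enn_powr_mono)
        also have "\<dots> \<le> (\<Sum>Q\<in>tiling_shell \<delta> k. enn_powr (V Q) r * indicator (ball (\<zeta> Q) \<rho>) z)"
          by (rule member_le_sum[OF Q(1)]) auto
        finally show ?thesis using True by simp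
      qed simp
    qed
    also have "\<dots> = (\<Sum>Q\<in>tiling_shell \<delta> k. enn_powr (V Q) r * emeasure lborel (ball (\<zeta> Q) \<rho>))"
      by (rule nn_integral_sum_cmult_ball)
    also have "\<dots> = ennreal (pi * \<rho>\<^sup>2) * (\<Sum>Q\<in>tiling_shell \<delta> k. enn_powr (V Q) r)"
      using assms(2) by (simp add: emeasure_ball unit_ball_vol_2 sum_distrib_left mult.commute)
    finally have "fun_shell_norm p F k \<le> enn_powr (ennreal (pi * \<rho>\<^sup>2) * (\<Sum>Q\<in>tiling_shell \<delta> k. enn_powr (V Q) r)) (1 / r)"
      using 2 by (simp add: fun_shell_norm_def lp_enorm_finite_exponent enn_powr_mono)
    also have "\<dots> = ennreal ((pi * \<rho>\<^sup>2) powr (1 / r)) * lp_enorm p (tiling_shell \<delta> k) V"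
      using 2 by (simp add: enn_powr_mult lp_enorm_finite_exponent enn_powr_ennreal nn_integral_count_space_finite)
    finally show "fun_shell_norm p F k \<le> ennreal ((pi * \<rho>\<^sup>2) powr (1 / r)) * lp_enorm p (tiling_shell \<delta> k) V" .
  qed
qed

text \<open>Counterpart of \<open>fun_shell_norm_le\<close>: the discs of radius \<eta> lie in
  disjoint pockets of the shell, so the integral sees each value V Q on a set of fixed area.\<close>

lemma fun_shell_norm_ge:
  assumes "p > 0" "0 < \<eta>" "\<eta> \<le> c_in * \<delta>"
  obtains A where "A > 0" "\<And>F V k. F \<in> borel_measurable borel \<Longrightarrow>
    (\<And>Q z. Q \<in> tiling_shell \<delta> k \<Longrightarrow> dist z (\<zeta> Q) < \<eta> \<Longrightarrow> V Q \<le> F z) \<Longrightarrow>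
    lp_enorm p (tiling_shell \<delta> k) V \<le> ennreal A * fun_shell_norm p F k"
proof -
  have ball_sub: "ball (\<zeta> Q) \<eta> \<subseteq> pocket \<delta> Q" "ball (\<zeta> Q) \<eta> \<subseteq> annulus k" if "Q \<in> tiling_shell \<delta> k" for Q k
    using that assms(3) ball_subset_pocket[of Q] subset_ball[of \<eta> "c_in * \<delta>" "\<zeta> Q"] pocket_subset_annulus[of Q]
    by (auto simp: tiling_shell_eq)
  from assms(1) show ?thesis
  proof (cases rule: ennreal_pos_cases)
    case 1
    have "lp_enorm p (tiling_shell \<delta> k) V \<le> fun_shell_norm p F k"
      if V: "\<And>Q z. Q \<in> tiling_shell \<delta> k \<Longrightarrow> dist z (\<zeta> Q) < \<eta> \<Longrightarrow> V Q \<le> F z" for F V k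
      unfolding 1 lp_enorm_top
    proof (rule SUP_least)
      fix Q assume Q: "Q \<in> tiling_shell \<delta> k"
      let ?e = "esssup (restrict_space lborel (annulus k)) F"
      have "AE z in restrict_space lborel (annulus k). F z \<le> ?e" by (rule esssup_AE)
      then have ae: "AE z in lborel. z \<in> annulus k \<longrightarrow> F z \<le> ?e"
        by (subst (asm) AE_restrict_space_iff) auto
      \<comment> \<open>The essential supremum is tested on a whole disc, a set of positive area; a
        value at the center alone would say nothing.\<close>
      have "V Q \<le> ?e"
      proof (rule ccontr)
        assume n: "\<not> V Q \<le> ?e"
        from ae have "AE z in lborel. z \<notin> ball (\<zeta> Q) \<eta>"
        proof eventually_elim
          case (elim z)
          show ?case
          proof
            assume z: "z \<in> ball (\<zeta> Q) \<eta>"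
            then have "V Q \<le> F z" using V[OF Q, of z] by (simp add: dist_commute)
            moreover have "F z \<le> ?e" using elim z ball_sub(2)[OF Q] by blast
            ultimately show False using n order_trans by blast
          qed
        qed
        from emeasure_eq_0_AE[OF this] have "emeasure lborel (ball (\<zeta> Q) \<eta>) = 0"
          by (simp del: mem_ball)
        then show False using assms(2) by (simp add: emeasure_ball unit_ball_vol_2)
      qed
      then show "V Q \<le> fun_shell_norm top F k"
        by (simp add: fun_shell_norm_def Lp_enorm_def[of top "restrict_space _ _"])
    qed
    then show ?thesis using that[of 1] by simp
  next
    case (2 r)
    define a where "a = pi * \<eta>\<^sup>2"
    have a: "a > 0" using assms by (simp add: a_def)
    show ?thesis
    proof (rule that[of "(1 / a) powr (1 / r)"])
      show "(1 / a) powr (1 / r) > 0" using a by simp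
      fix F :: "complex \<Rightarrow> ennreal" and V k
      assume [measurable]: "F \<in> borel_measurable borel"
        and V: "\<And>Q z. Q \<in> tiling_shell \<delta> k \<Longrightarrow> dist z (\<zeta> Q) < \<eta> \<Longrightarrow> V Q \<le> F z"
      have "ennreal a * (\<Sum>Q\<in>tiling_shell \<delta> k. enn_powr (V Q) r) = (\<Sum>Q\<in>tiling_shell \<delta> k. enn_powr (V Q) r * emeasure lborel (ball (\<zeta> Q) \<eta>))"
        using assms(2) by (simp add: a_def emeasure_ball unit_ball_vol_2 sum_distrib_left mult.commute)
      also have "\<dots> = (\<integral>\<^sup>+z. (\<Sum>Q\<in>tiling_shell \<delta> k. enn_powr (V Q) r * indicator (ball (\<zeta> Q) \<eta>) z) \<partial>lborel)"
        by (rule nn_integral_sum_cmult_ball[symmetric])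
      also have "\<dots> \<le> (\<integral>\<^sup>+z. enn_powr (F z) r * indicator (annulus k) z \<partial>lborel)"
      proof (rule nn_integral_mono)
        fix z
        show "(\<Sum>Q\<in>tiling_shell \<delta> k. enn_powr (V Q) r * indicator (ball (\<zeta> Q) \<eta>) z) \<le> enn_powr (F z) r * indicator (annulus k) z"
        proof (cases "\<exists>Q\<in>tiling_shell \<delta> k. z \<in> ball (\<zeta> Q) \<eta>")
          case True
          then obtain Q where Q: "Q \<in> tiling_shell \<delta> k" "z \<in> ball (\<zeta> Q) \<eta>" by blast
          have "z \<notin> ball (\<zeta> Q') \<eta>" if "Q' \<in> tiling_shell \<delta> k" "Q' \<noteq> Q" for Q'
            using ball_sub(1)[OF that(1)] ball_sub(1)[OF Q(1)] Q that pocket_disjoint shell_subset by blast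
          then have "(\<Sum>Q'\<in>tiling_shell \<delta> k. enn_powr (V Q') r * indicator (ball (\<zeta> Q') \<eta>) z) = (\<Sum>Q'\<in>tiling_shell \<delta> k. if Q' = Q then enn_powr (V Q) r else 0)"
            using Q by (intro sum.cong) auto
          also have "\<dots> = enn_powr (V Q) r" using Q(1) by simp
          also have "\<dots> \<le> enn_powr (F z) r" using V[OF Q(1), of z] Q(2) 2 by (intro enn_powr_mono) (auto simp: dist_commute)
          also have "\<dots> = enn_powr (F z) r * indicator (annulus k) z" using ball_sub(2)[OF Q(1)] Q(2) by auto
          finally show ?thesis .
        next
          case False
          then have "(\<Sum>Q\<in>tiling_shell \<delta> k. enn_powr (V Q) r * indicator (ball (\<zeta> Q) \<eta>) z) = 0"
            by (intro sum.neutral) auto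
          then show ?thesis by (simp only: zero_le)
        qed
      qed
      also have "\<dots> = (\<integral>\<^sup>+z. enn_powr (F z) r \<partial>restrict_space lborel (annulus k))"
        by (subst nn_integral_restrict_space) auto
      finally have "ennreal (1 / a) * (ennreal a * (\<Sum>Q\<in>tiling_shell \<delta> k. enn_powr (V Q) r)) \<le> ennreal (1 / a) * (\<integral>\<^sup>+z. enn_powr (F z) r \<partial>restrict_space lborel (annulus k))"
        by (intro mult_left_mono) auto
      moreover have "ennreal (1 / a) * (ennreal a * X) = X" for X
        using a by (simp add: mult.assoc[symmetric] flip: ennreal_mult)
      ultimately have "enn_powr (\<Sum>Q\<in>tiling_shell \<delta> k. enn_powr (V Q) r) (1 / r) \<le> enn_powr (ennreal (1 / a) * (\<integral>\<^sup>+z. enn_powr (F z) r \<partial>restrict_space lborel (annulus k))) (1 / r)"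
        using 2 by (intro enn_powr_mono) auto
      moreover have "enn_powr (ennreal (1 / a)) (1 / r) = ennreal ((1 / a) powr (1 / r))"
        using a by (intro enn_powr_ennreal) auto
      ultimately show "lp_enorm p (tiling_shell \<delta> k) V \<le> ennreal ((1 / a) powr (1 / r)) * fun_shell_norm p F k"
        using 2 by (simp add: fun_shell_norm_def lp_enorm_finite_exponent nn_integral_count_space_finite enn_powr_mult)
    qed
  qed
qed

end

section \<open>Equivalence of the two mass conditions\<close>

locale fock_tiling = pocket_tiling +
  fixes \<alpha> s :: real and p q :: ennreal and \<mu> :: "complex measure"
  assumes \<alpha>_pos: "\<alpha> > 0" and s_pos: "s > 0" and p_pos: "p > 0" and q_pos: "q > 0"
    and sets_\<mu> [measurable_cong]: "sets \<mu> = sets borel"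
begin

abbreviation \<tau> where "\<tau> \<equiv> enn2real (1 / q) - enn2real (1 / p)"
abbreviation \<omega> where "\<omega> k \<equiv> (1 + real k) powr \<tau>"
abbreviation norm_weight where "norm_weight w \<equiv> inverse (enn_powr (fock_norm \<alpha> p q (kernel \<alpha> w)) s)"
abbreviation U where "U \<equiv> ball_mass \<alpha> p q s \<mu>"
abbreviation u where "u r \<equiv> pocket_mass \<alpha> p q s \<mu> r \<delta>"

lemma kernel_norm_shell:
  obtains c C where "c > 0" "C > 0"
    "\<And>k w. w \<in> annulus k \<Longrightarrow> ennreal (c * \<omega> k) \<le> fock_norm \<alpha> p q (kernel \<alpha> w)"
    "\<And>k w. w \<in> annulus k \<Longrightarrow> fock_norm \<alpha> p q (kernel \<alpha> w) \<le> ennreal (C * \<omega> k)"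
proof -
  obtain c where c: "c > 0" "\<And>w. ennreal (c * (1 + cmod w) powr \<tau>) \<le> fock_norm \<alpha> p q (kernel \<alpha> w)"
    using fock_norm_kernel_lower[OF \<alpha>_pos p_pos q_pos] by blast
  obtain C where C: "C > 0" "\<And>w. fock_norm \<alpha> p q (kernel \<alpha> w) \<le> ennreal (C * (1 + cmod w) powr \<tau>)"
    using fock_norm_kernel_upper[OF \<alpha>_pos p_pos q_pos] by blast
  show ?thesis
  proof (rule that[of "c * 2 powr (- \<bar>\<tau>\<bar>)" "C * 2 powr \<bar>\<tau>\<bar>"])
    fix k w assume "w \<in> annulus k"
    then have *: "0 < 1 + real k" "1 + real k \<le> 1 + cmod w" "1 + cmod w \<le> 2 * (1 + real k)"
      by (auto simp: annulus_def)
    have "ennreal (c * 2 powr (- \<bar>\<tau>\<bar>) * \<omega> k) \<le> ennreal (c * (1 + cmod w) powr \<tau>)"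
      using powr_double_bounds(1)[OF *, of \<tau>] c(1) by (intro ennreal_leI) (simp add: mult.assoc)
    then show "ennreal (c * 2 powr (- \<bar>\<tau>\<bar>) * \<omega> k) \<le> fock_norm \<alpha> p q (kernel \<alpha> w)"
      using c(2) order_trans by blast
    have "ennreal (C * (1 + cmod w) powr \<tau>) \<le> ennreal (C * 2 powr \<bar>\<tau>\<bar> * \<omega> k)"
      using powr_double_bounds(2)[OF *, of \<tau>] C(1) by (intro ennreal_leI) (simp add: mult.assoc)
    then show "fock_norm \<alpha> p q (kernel \<alpha> w) \<le> ennreal (C * 2 powr \<bar>\<tau>\<bar> * \<omega> k)"
      using C(2) order_trans by blast
  qed (use c C in auto)
qed

lemma norm_weight_shell:
  obtains a b where "a > 0" "b > 0"
    "\<And>k w. w \<in> annulus k \<Longrightarrow> ennreal (a * (1 + real k) powr (- \<tau> * s)) \<le> norm_weight w"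
    "\<And>k w. w \<in> annulus k \<Longrightarrow> norm_weight w \<le> ennreal (b * (1 + real k) powr (- \<tau> * s))"
proof -
  obtain c C where c: "c > 0" "C > 0"
    "\<And>k w. w \<in> annulus k \<Longrightarrow> ennreal (c * \<omega> k) \<le> fock_norm \<alpha> p q (kernel \<alpha> w)"
    "\<And>k w. w \<in> annulus k \<Longrightarrow> fock_norm \<alpha> p q (kernel \<alpha> w) \<le> ennreal (C * \<omega> k)"
    using kernel_norm_shell by blast
  have inv: "inverse (enn_powr (ennreal (x * \<omega> k)) s) = ennreal (x powr (- s) * (1 + real k) powr (- \<tau> * s))" if "x > 0" for x k
  proof -
    have "enn_powr (ennreal (x * \<omega> k)) s = ennreal (x powr s * (1 + real k) powr (\<tau> * s))"
      using that by (simp add: enn_powr_ennreal powr_mult powr_powr)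
    then have "inverse (enn_powr (ennreal (x * \<omega> k)) s) = ennreal (inverse (x powr s * (1 + real k) powr (\<tau> * s)))"
      using that by (simp add: inverse_ennreal)
    then show ?thesis by (simp only: mult_minus_left powr_minus inverse_mult_distrib)
  qed
  show ?thesis
  proof (rule that[of "C powr (- s)" "c powr (- s)"])
    fix k w assume w: "w \<in> annulus k"
    show "ennreal (C powr (- s) * (1 + real k) powr (- \<tau> * s)) \<le> norm_weight w"
      using c(4)[OF w] s_pos unfolding inv[OF c(2), symmetric] by (intro ennreal_inverse_antimono enn_powr_mono) auto
    show "norm_weight w \<le> ennreal (c powr (- s) * (1 + real k) powr (- \<tau> * s))"
      using c(3)[OF w] s_pos unfolding inv[OF c(1), symmetric] by (intro ennreal_inverse_antimono enn_powr_mono) auto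
  qed (use c in auto)
qed

text \<open>Points at bounded distance lie in shells whose indices differ by a bounded amount, where
  \<open>weight_ratio\<close> at rate 1 bounds the ratio of the weights.\<close>

lemma norm_weight_local:
  obtains K where "K > 0" "\<And>z w. dist z w < D \<Longrightarrow> norm_weight z \<le> ennreal K * norm_weight w"
proof -
  obtain a b where ab: "a > 0" "b > 0"
    "\<And>k w. w \<in> annulus k \<Longrightarrow> ennreal (a * (1 + real k) powr (- \<tau> * s)) \<le> norm_weight w"
    "\<And>k w. w \<in> annulus k \<Longrightarrow> norm_weight w \<le> ennreal (b * (1 + real k) powr (- \<tau> * s))"
    using norm_weight_shell by blast
  define K where "K = exp ((- \<tau> * s)\<^sup>2 / (4 * 1)) * exp (1 * (2 * D\<^sup>2 + 2))"
  show ?thesis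
  proof (rule that[of "b * K / a"])
    show "b * K / a > 0" using ab by (simp add: K_def)
    fix z w :: complex assume d: "dist z w < D"
    let ?k = "nat \<lfloor>cmod z\<rfloor>" and ?j = "nat \<lfloor>cmod w\<rfloor>"
    have "(dist z w)\<^sup>2 \<le> D\<^sup>2" using d by (intro power_mono) auto
    then have "(real ?k - real ?j)\<^sup>2 \<le> 2 * D\<^sup>2 + 2"
      using shell_distance[OF annulus_floor annulus_floor, of z w] by linarith
    then have e: "exp (1 * (real ?k - real ?j)\<^sup>2) \<le> exp (1 * (2 * D\<^sup>2 + 2))" by simp
    have "(1 + real ?k) powr (- \<tau> * s) \<le> exp ((- \<tau> * s)\<^sup>2 / (4 * 1)) * exp (1 * (real ?k - real ?j)\<^sup>2) * (1 + real ?j) powr (- \<tau> * s)"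
      by (rule weight_ratio) simp
    also have "\<dots> \<le> K * (1 + real ?j) powr (- \<tau> * s)"
      unfolding K_def by (intro mult_right_mono mult_left_mono e) auto
    finally have "norm_weight z \<le> ennreal (b * (K * (1 + real ?j) powr (- \<tau> * s)))"
      using ab by (intro order_trans[OF ab(4)[OF annulus_floor]] ennreal_leI mult_left_mono) auto
    also have "b * (K * (1 + real ?j) powr (- \<tau> * s)) = (b * K / a) * (a * (1 + real ?j) powr (- \<tau> * s))"
      using ab by simp
    also have "ennreal \<dots> = ennreal (b * K / a) * ennreal (a * (1 + real ?j) powr (- \<tau> * s))"
      using ab by (intro ennreal_mult) (auto simp: K_def)
    also have "\<dots> \<le> ennreal (b * K / a) * norm_weight w"
      by (intro mult_left_mono ab annulus_floor) auto
    finally show "norm_weight z \<le> ennreal (b * K / a) * norm_weight w" .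
  qed
qed

lemma ball_mass_measurable: "U R \<in> borel_measurable borel"
proof -
  have [measurable]: "(\<lambda>z. fock_norm \<alpha> p q (kernel \<alpha> z)) \<in> borel_measurable borel"
    by (rule fock_norm_kernel_measurable[OF p_pos q_pos])
  have [measurable]: "(\<lambda>z. emeasure \<mu> (ball z R)) \<in> borel_measurable borel"
    by (rule ball_emeasure_measurable[OF sets_\<mu>])
  have "(\<lambda>x :: ennreal. inverse x) \<in> borel_measurable borel"
    by (intro borel_measurable_continuous_onI continuous_on_inverse_ennreal continuous_on_id)
  then have [measurable]: "(\<lambda>z. norm_weight z) \<in> borel_measurable borel"
    by (rule measurable_compose[rotated]) measurable
  show ?thesis unfolding ball_mass_def[abs_def] by measurable
qed

text \<open>The ball of radius r about z is covered by the balls of radius R about the boundedly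
  many centers within r + \<open>C_out * \<delta>\<close> of z, and the weights there are
  comparable. A matrix of bounded range is dominated by a Gaussian one at the cost of exp (D^2). As
  r is independent of R, this also serves to change the radius.\<close>

lemma ball_mass_le_gauss_sup:
  assumes "r > 0" "C_out * \<delta> \<le> R"
  obtains C where "C > 0" "\<And>z. U r z \<le> ennreal C * gauss_sup_tiling 1 (u R) z"
proof -
  define D where "D = r + C_out * \<delta>"
  have D: "D > 0" using assms c_in_pos c_in_less \<delta>_pos by (simp add: D_def add_pos_pos)
  obtain K where K: "K > 0" "\<And>z w. dist z w < D \<Longrightarrow> norm_weight z \<le> ennreal K * norm_weight w"
    using norm_weight_local by blast
  define M where "M = (D / (c_in * \<delta>) + 1)\<^sup>2"
  have "0 < D / (c_in * \<delta>) + 1"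
    using D c_in_pos \<delta>_pos by (intro add_pos_pos divide_pos_pos mult_pos_pos) auto
  then have M: "M > 0" unfolding M_def by (rule zero_less_power)
  show ?thesis
  proof (rule that[of "M * (K * exp (D\<^sup>2))"])
    show "M * (K * exp (D\<^sup>2)) > 0" using M K by simp
    fix z
    define F where "F = {Q \<in> tiling \<delta>. dist z (\<zeta> Q) < D}"
    have F: "finite F" "real (card F) \<le> M"
      using packing[of D z] D by (auto simp: F_def M_def)
    have cover: "ball z r \<subseteq> (\<Union>Q\<in>F. ball (\<zeta> Q) R)"
    proof
      fix x assume x: "x \<in> ball z r"
      obtain Q where Q: "Q \<in> tiling_shell \<delta> (nat \<lfloor>cmod x\<rfloor>)" "dist x (\<zeta> Q) < C_out * \<delta>"
        using cover_ball[OF annulus_floor] by blast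
      have "dist z (\<zeta> Q) \<le> dist z x + dist x (\<zeta> Q)" by (rule dist_triangle)
      then have "Q \<in> F" using x Q shell_subset by (auto simp: F_def D_def)
      moreover have "x \<in> ball (\<zeta> Q) R" using Q(2) assms(2) by (simp add: dist_commute)
      ultimately show "x \<in> (\<Union>Q\<in>F. ball (\<zeta> Q) R)" by blast
    qed
    have "emeasure \<mu> (ball z r) \<le> emeasure \<mu> (\<Union>Q\<in>F. ball (\<zeta> Q) R)"
      using F cover sets_\<mu> by (intro emeasure_mono) auto
    also have "\<dots> \<le> (\<Sum>Q\<in>F. emeasure \<mu> (ball (\<zeta> Q) R))"
    proof (rule emeasure_subadditive_finite[OF F(1)])
      show "(\<lambda>Q. ball (\<zeta> Q) R) ` F \<subseteq> sets \<mu>"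
        unfolding sets_\<mu> by (intro image_subsetI borel_open open_ball)
    qed
    finally have "U r z \<le> (\<Sum>Q\<in>F. norm_weight z * emeasure \<mu> (ball (\<zeta> Q) R))"
      unfolding ball_mass_def sum_distrib_left[symmetric] by (rule mult_left_mono) simp
    also have "\<dots> \<le> (\<Sum>Q\<in>F. ennreal (K * exp (D\<^sup>2)) * gauss_sup_tiling 1 (u R) z)"
    proof (rule sum_mono)
      fix Q assume Q: "Q \<in> F"
      have "norm_weight z * emeasure \<mu> (ball (\<zeta> Q) R) \<le> ennreal K * norm_weight (\<zeta> Q) * emeasure \<mu> (ball (\<zeta> Q) R)"
        using Q K(2)[of z "\<zeta> Q"] by (intro mult_right_mono) (auto simp: F_def)
      also have "\<dots> = ennreal K * u R Q" by (simp add: pocket_mass_def ball_mass_def mult.assoc)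
      also have "\<dots> \<le> ennreal K * (ennreal (exp (D\<^sup>2)) * gauss_sup_tiling 1 (u R) z)"
      proof (rule mult_left_mono)
        have "1 \<le> exp (D\<^sup>2) * exp (- 1 * (dist z (\<zeta> Q))\<^sup>2)"
        proof -
          have "(dist z (\<zeta> Q))\<^sup>2 \<le> D\<^sup>2" using Q by (intro power_mono) (auto simp: F_def)
          then show ?thesis by (simp flip: exp_add)
        qed
        then have "ennreal 1 * u R Q \<le> ennreal (exp (D\<^sup>2) * exp (- 1 * (dist z (\<zeta> Q))\<^sup>2)) * u R Q"
          by (intro mult_right_mono ennreal_leI) auto
        also have "\<dots> = ennreal (exp (D\<^sup>2)) * (ennreal (exp (- 1 * (dist z (\<zeta> Q))\<^sup>2)) * u R Q)"
          by (simp add: ennreal_mult mult.assoc)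
        also have "\<dots> \<le> ennreal (exp (D\<^sup>2)) * gauss_sup_tiling 1 (u R) z"
          unfolding gauss_sup_tiling_def using Q by (intro mult_left_mono SUP_upper) (auto simp: F_def)
        finally show "u R Q \<le> ennreal (exp (D\<^sup>2)) * gauss_sup_tiling 1 (u R) z" by simp
      qed simp
      also have "\<dots> = ennreal (K * exp (D\<^sup>2)) * gauss_sup_tiling 1 (u R) z"
        using K(1) by (simp add: ennreal_mult mult.assoc)
      finally show "norm_weight z * emeasure \<mu> (ball (\<zeta> Q) R) \<le> ennreal (K * exp (D\<^sup>2)) * gauss_sup_tiling 1 (u R) z" .
    qed
    also have "\<dots> = ennreal (real (card F)) * (ennreal (K * exp (D\<^sup>2)) * gauss_sup_tiling 1 (u R) z)"
      by (simp add: ennreal_of_nat_eq_real_of_nat)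
    also have "\<dots> \<le> ennreal M * (ennreal (K * exp (D\<^sup>2)) * gauss_sup_tiling 1 (u R) z)"
      using F by (intro mult_right_mono ennreal_leI) auto
    also have "\<dots> = ennreal (M * (K * exp (D\<^sup>2))) * gauss_sup_tiling 1 (u R) z"
      using M K(1) by (simp add: ennreal_mult mult.assoc)
    finally show "U r z \<le> ennreal (M * (K * exp (D\<^sup>2))) * gauss_sup_tiling 1 (u R) z" .
  qed
qed

text \<open>From |w - \<zeta>|^2 \<le> 2 \<rho>^2 + 2 |z - \<zeta>|^2: moving the base point halves
  the exponent and costs a constant factor.\<close>

lemma gauss_sup_tiling_shift:
  assumes "dist z w < \<rho>" and that: "\<beta> \<ge> 0"
  shows "gauss_sup_tiling \<beta> g z \<le> ennreal (exp (\<beta> * \<rho>\<^sup>2)) * gauss_sup_tiling (\<beta> / 2) g w"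
  unfolding gauss_sup_tiling_def
proof (rule SUP_least)
  fix Q assume Q: "Q \<in> tiling \<delta>"
  have "dist w (\<zeta> Q) \<le> dist z w + dist z (\<zeta> Q)" by (metis dist_commute dist_triangle)
  then have "(dist w (\<zeta> Q))\<^sup>2 \<le> (\<rho> + dist z (\<zeta> Q))\<^sup>2" using assms by (intro power_mono) auto
  also have "\<dots> \<le> 2 * \<rho>\<^sup>2 + 2 * (dist z (\<zeta> Q))\<^sup>2"
    using zero_le_power2[of "\<rho> - dist z (\<zeta> Q)"] unfolding power2_eq_square by (simp add: algebra_simps)
  finally have "\<beta> * (dist w (\<zeta> Q))\<^sup>2 \<le> \<beta> * (2 * \<rho>\<^sup>2 + 2 * (dist z (\<zeta> Q))\<^sup>2)" using that by (intro mult_left_mono)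
  then have "- \<beta> * (dist z (\<zeta> Q))\<^sup>2 \<le> \<beta> * \<rho>\<^sup>2 + - (\<beta> / 2) * (dist w (\<zeta> Q))\<^sup>2" by (simp add: algebra_simps)
  then have "exp (- \<beta> * (dist z (\<zeta> Q))\<^sup>2) \<le> exp (\<beta> * \<rho>\<^sup>2) * exp (- (\<beta> / 2) * (dist w (\<zeta> Q))\<^sup>2)"
    unfolding exp_add[symmetric] by simp
  then have "ennreal (exp (- \<beta> * (dist z (\<zeta> Q))\<^sup>2)) * g Q \<le> ennreal (exp (\<beta> * \<rho>\<^sup>2) * exp (- (\<beta> / 2) * (dist w (\<zeta> Q))\<^sup>2)) * g Q"
    by (intro mult_right_mono ennreal_leI) auto
  also have "\<dots> = ennreal (exp (\<beta> * \<rho>\<^sup>2)) * (ennreal (exp (- (\<beta> / 2) * (dist w (\<zeta> Q))\<^sup>2)) * g Q)"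
    by (simp add: ennreal_mult mult.assoc)
  also have "\<dots> \<le> ennreal (exp (\<beta> * \<rho>\<^sup>2)) * (SUP Q\<in>tiling \<delta>. ennreal (exp (- (\<beta> / 2) * (dist w (\<zeta> Q))\<^sup>2)) * g Q)"
    using Q by (intro mult_left_mono SUP_upper) auto
  finally show "ennreal (exp (- \<beta> * (dist z (\<zeta> Q))\<^sup>2)) * g Q \<le> ennreal (exp (\<beta> * \<rho>\<^sup>2)) * (SUP Q\<in>tiling \<delta>. ennreal (exp (- (\<beta> / 2) * (dist w (\<zeta> Q))\<^sup>2)) * g Q)" .
qed

text \<open>Towards the function form, values on a pocket are shifted to its center. Conversely, an
  integral norm of U sees only sets of positive area, so the radius at the centers is first reduced
  to \<open>C_out * \<delta>\<close>: the smaller ball lies in the ball of radius R about every z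
  close to the center, and \<open>ball_mass_le_gauss_sup\<close> restores the radius R
  afterwards.\<close>

lemma shell_condition_ball_mass_iff:
  assumes R: "C_out * \<delta> < R"
  shows "shell_condition s q (fun_shell_norm (star_exponent s p) (U R)) \<longleftrightarrow>
    shell_condition s q (seq_shell_norm \<delta> (star_exponent s p) (u R))"
proof
  let ?p = "star_exponent s p"
  have \<rho>: "C_out * \<delta> > 0" using c_in_pos c_in_less \<delta>_pos by simp
  have "R > 0" using \<rho> R by linarith
  {
    assume "shell_condition s q (seq_shell_norm \<delta> ?p (u R))"
    obtain C where C: "C > 0" "\<And>z. U R z \<le> ennreal C * gauss_sup_tiling 1 (u R) z"
      using ball_mass_le_gauss_sup[OF \<open>R > 0\<close> less_imp_le[OF R]] by blast
    obtain A where A: "A > 0" "\<And>F V k. F \<in> borel_measurable borel \<Longrightarrow>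
      (\<And>z. z \<in> annulus k \<Longrightarrow> \<exists>Q\<in>tiling_shell \<delta> k. dist z (\<zeta> Q) < C_out * \<delta> \<and> F z \<le> V Q) \<Longrightarrow>
      fun_shell_norm ?p F k \<le> ennreal A * lp_enorm ?p (tiling_shell \<delta> k) V"
      using fun_shell_norm_le[OF star_exponent_pos \<rho>] by blast
    obtain B \<gamma> where B: "B > 0" "\<gamma> > 0"
      "\<And>g k. lp_enorm ?p (tiling_shell \<delta> k) (\<lambda>Q. gauss_sup_tiling (1 / 2) g (\<zeta> Q)) \<le>
        ennreal B * gauss_sup \<gamma> (\<lambda>j. lp_enorm ?p (tiling_shell \<delta> j) g) k"
      using lp_enorm_shell_gaussian[OF half_gt_zero[OF zero_less_one] star_exponent_pos] by blast
    define E where "E = C * exp (1 * (C_out * \<delta>)\<^sup>2)"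
    have E: "E > 0" using C by (simp add: E_def)
    have "fun_shell_norm ?p (U R) k \<le> ennreal (A * (E * B)) * gauss_sup \<gamma> (seq_shell_norm \<delta> ?p (u R)) k" for k
    proof -
      have "fun_shell_norm ?p (U R) k \<le> ennreal A * lp_enorm ?p (tiling_shell \<delta> k) (\<lambda>Q. ennreal E * gauss_sup_tiling (1 / 2) (u R) (\<zeta> Q))"
      proof (rule A(2)[OF ball_mass_measurable])
        fix z assume "z \<in> annulus k"
        then obtain Q where Q: "Q \<in> tiling_shell \<delta> k" "dist z (\<zeta> Q) < C_out * \<delta>" using cover_ball by blast
        have "U R z \<le> ennreal C * (ennreal (exp (1 * (C_out * \<delta>)\<^sup>2)) * gauss_sup_tiling (1 / 2) (u R) (\<zeta> Q))"
          using Q(2) by (intro order_trans[OF C(2)] mult_left_mono gauss_sup_tiling_shift) auto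
        also have "\<dots> = ennreal E * gauss_sup_tiling (1 / 2) (u R) (\<zeta> Q)"
          using C(1) by (simp add: E_def ennreal_mult mult.assoc)
        finally show "\<exists>Q\<in>tiling_shell \<delta> k. dist z (\<zeta> Q) < C_out * \<delta> \<and> U R z \<le> ennreal E * gauss_sup_tiling (1 / 2) (u R) (\<zeta> Q)"
          using Q by blast
      qed
      also have "\<dots> = ennreal A * (ennreal E * lp_enorm ?p (tiling_shell \<delta> k) (\<lambda>Q. gauss_sup_tiling (1 / 2) (u R) (\<zeta> Q)))"
        by (subst lp_enorm_cmult[OF star_exponent_pos]) simp
      also have "\<dots> \<le> ennreal A * (ennreal E * (ennreal B * gauss_sup \<gamma> (\<lambda>j. lp_enorm ?p (tiling_shell \<delta> j) (u R)) k))"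
        by (intro mult_left_mono B) auto
      also have "\<dots> = ennreal (A * (E * B)) * gauss_sup \<gamma> (seq_shell_norm \<delta> ?p (u R)) k"
        using A(1) E B(1) by (simp add: ennreal_mult mult.assoc seq_shell_norm_def[abs_def])
      finally show ?thesis .
    qed
    then show "shell_condition s q (fun_shell_norm ?p (U R))"
      using shell_condition_dominated[OF \<open>shell_condition s q (seq_shell_norm \<delta> ?p (u R))\<close> B(2)] by blast
  next
    assume cond: "shell_condition s q (fun_shell_norm ?p (U R))"
    let ?r = "C_out * \<delta>"
    \<comment> \<open>The strict inequality between \<open>C_out * \<delta>\<close> and R provides
      this room; the second bound keeps the discs inside their pockets.\<close>
    define \<eta> where "\<eta> = min (R - ?r) (c_in * \<delta>)"
    have \<eta>: "0 < \<eta>" "\<eta> \<le> c_in * \<delta>" "\<eta> \<le> R - ?r" using R c_in_pos \<delta>_pos by (auto simp: \<eta>_def)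
    obtain A where A: "A > 0" "\<And>F V k. F \<in> borel_measurable borel \<Longrightarrow>
      (\<And>Q z. Q \<in> tiling_shell \<delta> k \<Longrightarrow> dist z (\<zeta> Q) < \<eta> \<Longrightarrow> V Q \<le> F z) \<Longrightarrow>
      lp_enorm ?p (tiling_shell \<delta> k) V \<le> ennreal A * fun_shell_norm ?p F k"
      using fun_shell_norm_ge[OF star_exponent_pos \<eta>(1,2)] by blast
    obtain K where K: "K > 0" "\<And>z w. dist z w < \<eta> \<Longrightarrow> norm_weight z \<le> ennreal K * norm_weight w"
      using norm_weight_local by blast
    obtain C where C: "C > 0" "\<And>z. U R z \<le> ennreal C * gauss_sup_tiling 1 (u ?r) z"
      using ball_mass_le_gauss_sup[OF \<open>R > 0\<close> order_refl] by blast
    obtain B \<gamma> where B: "B > 0" "\<gamma> > 0"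
      "\<And>g k. lp_enorm ?p (tiling_shell \<delta> k) (\<lambda>Q. gauss_sup_tiling 1 g (\<zeta> Q)) \<le>
        ennreal B * gauss_sup \<gamma> (\<lambda>j. lp_enorm ?p (tiling_shell \<delta> j) g) k"
      using lp_enorm_shell_gaussian[OF zero_less_one star_exponent_pos] by blast
    have inner: "lp_enorm ?p (tiling_shell \<delta> k) (u ?r) \<le> ennreal A * (ennreal K * fun_shell_norm ?p (U R) k)" for k
    proof -
      have "lp_enorm ?p (tiling_shell \<delta> k) (u ?r) \<le> ennreal A * fun_shell_norm ?p (\<lambda>z. ennreal K * U R z) k"
      proof (rule A(2))
        show "(\<lambda>z. ennreal K * U R z) \<in> borel_measurable borel"
          using ball_mass_measurable by (intro borel_measurable_times_ennreal) auto
        fix Q z assume d: "dist z (\<zeta> Q) < \<eta>"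
        have "ball (\<zeta> Q) ?r \<subseteq> ball z R"
        proof
          fix x assume "x \<in> ball (\<zeta> Q) ?r"
          then have "dist (\<zeta> Q) x < ?r" by simp
          moreover have "dist z x \<le> dist z (\<zeta> Q) + dist (\<zeta> Q) x" by (rule dist_triangle)
          ultimately show "x \<in> ball z R" using d \<eta>(3) unfolding mem_ball by linarith
        qed
        then have "emeasure \<mu> (ball (\<zeta> Q) ?r) \<le> emeasure \<mu> (ball z R)"
          using sets_\<mu> by (intro emeasure_mono) auto
        moreover have "norm_weight (\<zeta> Q) \<le> ennreal K * norm_weight z"
          using d by (intro K(2)) (simp add: dist_commute)
        ultimately have "u ?r Q \<le> (ennreal K * norm_weight z) * emeasure \<mu> (ball z R)"
          unfolding pocket_mass_def ball_mass_def by (intro mult_mono) auto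
        then show "u ?r Q \<le> ennreal K * U R z" by (simp add: ball_mass_def mult.assoc)
      qed
      also have "fun_shell_norm ?p (\<lambda>z. ennreal K * U R z) k \<le> ennreal K * fun_shell_norm ?p (U R) k"
        unfolding fun_shell_norm_def
        using ball_mass_measurable K(1) by (intro Lp_enorm_cmult_le star_exponent_pos measurable_restrict_space1) auto
      finally show ?thesis by (simp add: mult_left_mono)
    qed
    have "seq_shell_norm \<delta> ?p (u R) k \<le> ennreal (C * (B * (A * K))) * gauss_sup \<gamma> (fun_shell_norm ?p (U R)) k" for k
    proof -
      have "seq_shell_norm \<delta> ?p (u R) k \<le> lp_enorm ?p (tiling_shell \<delta> k) (\<lambda>Q. ennreal C * gauss_sup_tiling 1 (u ?r) (\<zeta> Q))"
        unfolding seq_shell_norm_def pocket_mass_def[of _ _ _ _ _ R]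
        by (intro lp_enorm_mono star_exponent_pos C)
      also have "\<dots> \<le> ennreal C * (ennreal B * gauss_sup \<gamma> (\<lambda>j. lp_enorm ?p (tiling_shell \<delta> j) (u ?r)) k)"
        by (subst lp_enorm_cmult[OF star_exponent_pos]) (intro mult_left_mono B, simp)
      also have "\<dots> \<le> ennreal C * (ennreal B * gauss_sup \<gamma> (\<lambda>j. ennreal (A * K) * fun_shell_norm ?p (U R) j) k)"
        using inner A(1) K(1) by (intro mult_left_mono gauss_sup_mono) (auto simp: ennreal_mult mult.assoc)
      also have "\<dots> = ennreal (C * (B * (A * K))) * gauss_sup \<gamma> (fun_shell_norm ?p (U R)) k"
        using A(1) B(1) C(1) K(1) by (simp add: gauss_sup_cmult ennreal_mult mult.assoc)
      finally show ?thesis .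
    qed
    then show "shell_condition s q (seq_shell_norm \<delta> ?p (u R))"
      using shell_condition_dominated[OF cond B(2)] by blast
  }
qed

end

section \<open>The metric of a weighted \<open>L\<^sup>s\<close> space\<close>

text \<open>After division by a + b both terms lie in [0, 1], where x \<le> x^s.\<close>

lemma powr_add_le_add_powr:
  fixes a b s :: real
  assumes "0 \<le> a" "0 \<le> b" "0 < s" "s \<le> 1"
  shows "(a + b) powr s \<le> a powr s + b powr s"
proof (cases "a + b = 0")
  case False
  then have ab: "a + b > 0" using assms by simp
  have *: "x / (a + b) \<le> (x / (a + b)) powr s" if "0 \<le> x" "x \<le> a + b" for x
    using that ab assms powr_mono'[of s 1 "x / (a + b)"] by simp
  have "1 = a / (a + b) + b / (a + b)" using ab by (simp flip: add_divide_distrib)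
  also have "\<dots> \<le> (a / (a + b)) powr s + (b / (a + b)) powr s"
    using assms by (intro add_mono *) auto
  also have "\<dots> = (a powr s + b powr s) / (a + b) powr s"
    by (simp add: powr_divide add_divide_distrib)
  finally show ?thesis using ab by (simp add: pos_le_divide_eq)
qed (use assms in auto)

text \<open>Convexity of t^s at the points a/l and b/(1 - l) with weights l and 1 - l. The free
  parameter is chosen after integration, when it produces Minkowski's inequality.\<close>

lemma convex_powr_bound:
  fixes a b s l :: real
  assumes "0 \<le> a" "0 \<le> b" "1 \<le> s" "0 < l" "l < 1"
  shows "(a + b) powr s \<le> l powr (1 - s) * a powr s + (1 - l) powr (1 - s) * b powr s"
proof (cases "a = 0 \<or> b = 0")
  case True
  have "1 \<le> t powr (1 - s)" if "0 < t" "t < 1" for t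
    using powr_mono'[of "1 - s" 0 t] that assms by simp
  then have "1 * x powr s \<le> t powr (1 - s) * x powr s" if "0 < t" "t < 1" for t x
    using that by (intro mult_right_mono) auto
  from this[of l a] this[of "1 - l" b] show ?thesis using True assms by auto
next
  case False
  then have "(l * (a / l) + (1 - l) * (b / (1 - l))) powr s \<le> l * (a / l) powr s + (1 - l) * (b / (1 - l)) powr s"
    using assms convex_onD[OF powr_convex[OF assms(3)], of "1 - l" "a / l" "b / (1 - l)"] by simp
  moreover have "t * (x / t) powr s = t powr (1 - s) * x powr s" if "t > 0" for t x :: real
    using that by (simp add: powr_divide powr_diff)
  ultimately show ?thesis using assms by simp
qed

text \<open>Integrate \<open>convex_powr_bound\<close> and optimise the parameter. With a and b the
  two norms, l = a/(a + b) makes the right side (a + b)^s; this choice needs both norms positive and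
  finite, hence the separate cases.\<close>

lemma nn_integral_Minkowski_powr:
  fixes f g h :: "'a \<Rightarrow> real"
  assumes [measurable]: "f \<in> borel_measurable M" "g \<in> borel_measurable M" and "1 \<le> s"
    and nn: "\<And>x. 0 \<le> f x" "\<And>x. 0 \<le> g x" and h: "\<And>x. h x \<le> f x + g x" "\<And>x. 0 \<le> h x"
  shows "enn_powr (\<integral>\<^sup>+x. ennreal (h x powr s) \<partial>M) (1 / s) \<le>
    enn_powr (\<integral>\<^sup>+x. ennreal (f x powr s) \<partial>M) (1 / s) + enn_powr (\<integral>\<^sup>+x. ennreal (g x powr s) \<partial>M) (1 / s)"
proof -
  define A B where "A = (\<integral>\<^sup>+x. ennreal (f x powr s) \<partial>M)" and "B = (\<integral>\<^sup>+x. ennreal (g x powr s) \<partial>M)"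
  have s: "s > 0" using assms by simp
  have bound: "(\<integral>\<^sup>+x. ennreal (h x powr s) \<partial>M) \<le> ennreal (l powr (1 - s)) * A + ennreal ((1 - l) powr (1 - s)) * B"
    if l: "0 < l" "l < 1" for l
  proof -
    have "(\<integral>\<^sup>+x. ennreal (h x powr s) \<partial>M) \<le> (\<integral>\<^sup>+x. ennreal (l powr (1 - s)) * ennreal (f x powr s) + ennreal ((1 - l) powr (1 - s)) * ennreal (g x powr s) \<partial>M)"
    proof (rule nn_integral_mono)
      fix x
      have "h x powr s \<le> (f x + g x) powr s" using h s by (intro powr_mono2) auto
      also have "\<dots> \<le> l powr (1 - s) * f x powr s + (1 - l) powr (1 - s) * g x powr s"
        using nn assms(3) l by (intro convex_powr_bound) auto
      finally show "ennreal (h x powr s) \<le> ennreal (l powr (1 - s)) * ennreal (f x powr s) + ennreal ((1 - l) powr (1 - s)) * ennreal (g x powr s)"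
        by (simp add: ennreal_leI flip: ennreal_mult ennreal_plus)
    qed
    also have "\<dots> = ennreal (l powr (1 - s)) * A + ennreal ((1 - l) powr (1 - s)) * B"
      by (simp add: nn_integral_add nn_integral_cmult A_def B_def)
    finally show ?thesis .
  qed
  consider "A = top \<or> B = top" | "A = 0" "B \<noteq> top" | "B = 0" "A \<noteq> top" | "A \<noteq> 0" "B \<noteq> 0" "A \<noteq> top" "B \<noteq> top" by blast
  then have "enn_powr (\<integral>\<^sup>+x. ennreal (h x powr s) \<partial>M) (1 / s) \<le> enn_powr A (1 / s) + enn_powr B (1 / s)"
  proof cases
    case 1
    then show ?thesis by auto
  next
    case 2
    then have "AE x in M. ennreal (f x powr s) = 0"
      unfolding A_def by (subst (asm) nn_integral_0_iff_AE) auto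
    then have ae: "AE x in M. ennreal (h x powr s) \<le> ennreal (g x powr s)"
    proof eventually_elim
      case (elim x)
      then have "f x = 0" by simp
      then have "h x \<le> g x" using h(1)[of x] by simp
      then show ?case using h s by (intro ennreal_leI powr_mono2) auto
    qed
    have "(\<integral>\<^sup>+x. ennreal (h x powr s) \<partial>M) \<le> B" unfolding B_def by (rule nn_integral_mono_AE[OF ae])
    then show ?thesis using 2 s by (simp add: enn_powr_mono)
  next
    case 3
    then have "AE x in M. ennreal (g x powr s) = 0"
      unfolding B_def by (subst (asm) nn_integral_0_iff_AE) auto
    then have ae: "AE x in M. ennreal (h x powr s) \<le> ennreal (f x powr s)"
    proof eventually_elim
      case (elim x)
      then have "g x = 0" by simp
      then have "h x \<le> f x" using h(1)[of x] by simp
      then show ?case using h s by (intro ennreal_leI powr_mono2) auto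
    qed
    have "(\<integral>\<^sup>+x. ennreal (h x powr s) \<partial>M) \<le> A" unfolding A_def by (rule nn_integral_mono_AE[OF ae])
    then show ?thesis using 3 s by (simp add: enn_powr_mono)
  next
    case 4
    define a b where "a = enn2real A powr (1 / s)" and "b = enn2real B powr (1 / s)"
    have AB: "A = ennreal (a powr s)" "B = ennreal (b powr s)" "a > 0" "b > 0"
      using 4 s by (auto simp: a_def b_def powr_powr less_top enn2real_eq_0_iff)
    define l where "l = a / (a + b)"
    have l: "0 < l" "l < 1" "1 - l = b / (a + b)" using AB by (auto simp: l_def field_simps)
    have pw: "(x / (a + b)) powr (1 - s) * x powr s = x * (a + b) powr (s - 1)" if "x > 0" for x
    proof -
      have "(x / (a + b)) powr (1 - s) = x powr (1 - s) * (a + b) powr (s - 1)"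
        using powr_minus_divide[of "a + b" "1 - s"] by (simp add: powr_divide)
      moreover have "x powr (1 - s) * x powr s = x" using that by (simp flip: powr_add)
      ultimately show ?thesis by (simp add: mult_ac)
    qed
    have "(\<integral>\<^sup>+x. ennreal (h x powr s) \<partial>M) \<le> ennreal (l powr (1 - s) * a powr s + (1 - l) powr (1 - s) * b powr s)"
      using bound[OF l(1,2)] by (simp add: AB ennreal_mult)
    also have "l powr (1 - s) * a powr s + (1 - l) powr (1 - s) * b powr s = (a + b) powr s"
    proof -
      have "l powr (1 - s) * a powr s + (1 - l) powr (1 - s) * b powr s = (a + b) * (a + b) powr (s - 1)"
        unfolding l(3) unfolding l_def pw[OF AB(3)] pw[OF AB(4)] by (simp add: distrib_right)
      also have "\<dots> = (a + b) powr s" using AB by (simp add: powr_mult_base)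
      finally show ?thesis .
    qed
    finally have "enn_powr (\<integral>\<^sup>+x. ennreal (h x powr s) \<partial>M) (1 / s) \<le> enn_powr (ennreal ((a + b) powr s)) (1 / s)"
      using s by (intro enn_powr_mono) auto
    also have "\<dots> = ennreal a + ennreal b" using AB s by (simp add: enn_powr_ennreal powr_powr)
    also have "\<dots> = enn_powr A (1 / s) + enn_powr B (1 / s)" using AB s by (simp add: enn_powr_ennreal powr_powr)
    finally show ?thesis .
  qed
  then show ?thesis by (simp add: A_def B_def)
qed

definition Ls_integrand :: "real \<Rightarrow> real \<Rightarrow> (complex \<Rightarrow> complex) \<Rightarrow> complex \<Rightarrow> real" where
  "Ls_integrand \<alpha> s f z = cmod (f z) powr s * exp (- (\<alpha> * s / 2) * (cmod z)\<^sup>2)"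

lemma Ls_integrand_alt: "Ls_integrand \<alpha> s f z = (cmod (f z) * exp (- (\<alpha> / 2) * (cmod z)\<^sup>2)) powr s"
  by (simp add: Ls_integrand_def powr_mult exp_powr_real mult_ac)

lemma Ls_integrand_nonneg [simp]: "0 \<le> Ls_integrand \<alpha> s f z"
  by (simp add: Ls_integrand_def)

lemma weighted_Ls_norm_alt: "weighted_Ls_norm \<alpha> s \<mu> f = enn_powr (\<integral>\<^sup>+z. ennreal (Ls_integrand \<alpha> s f z) \<partial>\<mu>) (1 / s)"
  by (simp add: weighted_Ls_norm_def Ls_integrand_def)

lemma Ls_integrand_measurable:
  assumes "sets \<mu> = sets borel" "f \<in> borel_measurable \<mu>"
  shows "Ls_integrand \<alpha> s f \<in> borel_measurable \<mu>"
proof -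
  note [measurable] = assms(2)
  have "(\<lambda>z. exp (- (\<alpha> * s / 2) * (cmod z)\<^sup>2)) \<in> borel_measurable borel"
    by (intro borel_measurable_continuous_onI continuous_intros)
  then have [measurable]: "(\<lambda>z. exp (- (\<alpha> * s / 2) * (cmod z)\<^sup>2)) \<in> borel_measurable \<mu>"
    using assms(1) by (simp cong: measurable_cong_sets)
  show ?thesis unfolding Ls_integrand_def by measurable
qed

text \<open>For s < 1 the quasi-norm itself fails the triangle inequality in general, but its s-th
  power satisfies it; the power \<open>min 1 s\<close> covers both ranges. On the space the value is
  finite, so passing to reals loses nothing.\<close>

definition Ls_dist :: "real \<Rightarrow> real \<Rightarrow> complex measure \<Rightarrow> (complex \<Rightarrow> complex) \<Rightarrow> (complex \<Rightarrow> complex) \<Rightarrow> real" where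
  "Ls_dist \<alpha> s \<mu> f g = enn2real (enn_powr (weighted_Ls_norm \<alpha> s \<mu> (f - g)) (min 1 s))"

text \<open>Pointwise subadditivity of the s-th power for s \<le> 1, Minkowski for s > 1; the
  Gaussian weight is put into the functions beforehand. Stated for any k dominated by |f| + |g|,
  which covers differences and sums alike.\<close>

lemma weighted_Ls_norm_triangle:
  assumes "s > 0" "sets \<mu> = sets borel" "f \<in> borel_measurable \<mu>" "g \<in> borel_measurable \<mu>"
    and k: "\<And>z. cmod (k z) \<le> cmod (f z) + cmod (g z)"
  shows "enn_powr (weighted_Ls_norm \<alpha> s \<mu> k) (min 1 s) \<le>
    enn_powr (weighted_Ls_norm \<alpha> s \<mu> f) (min 1 s) + enn_powr (weighted_Ls_norm \<alpha> s \<mu> g) (min 1 s)"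
proof -
  define w where "w z = exp (- (\<alpha> / 2) * (cmod z)\<^sup>2)" for z :: complex
  have w: "w z > 0" for z by (simp add: w_def)
  have kw: "cmod (k z) * w z \<le> cmod (f z) * w z + cmod (g z) * w z" for z
    using mult_right_mono[OF k[of z] less_imp_le[OF w[of z]]] by (simp add: distrib_right)
  have "w \<in> borel_measurable borel"
    unfolding w_def by (intro borel_measurable_continuous_onI continuous_intros)
  then have [measurable]: "w \<in> borel_measurable \<mu>"
    using assms(2) by (simp cong: measurable_cong_sets)
  note [measurable] = assms(3,4)
  note integrand = Ls_integrand_alt[of \<alpha> s, folded w_def]
  show ?thesis
  proof (cases "s \<le> 1")
    case True
    have "(\<integral>\<^sup>+z. ennreal (Ls_integrand \<alpha> s k z) \<partial>\<mu>) \<le> (\<integral>\<^sup>+z. ennreal (Ls_integrand \<alpha> s f z) + ennreal (Ls_integrand \<alpha> s g z) \<partial>\<mu>)"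
    proof (rule nn_integral_mono)
      fix z
      have "(cmod (k z) * w z) powr s \<le> (cmod (f z) * w z + cmod (g z) * w z) powr s"
        using kw[of z] w[of z] assms(1) by (intro powr_mono2) auto
      also have "\<dots> \<le> (cmod (f z) * w z) powr s + (cmod (g z) * w z) powr s"
        using w[of z] assms(1) True by (intro powr_add_le_add_powr) auto
      finally show "ennreal (Ls_integrand \<alpha> s k z) \<le> ennreal (Ls_integrand \<alpha> s f z) + ennreal (Ls_integrand \<alpha> s g z)"
        unfolding integrand by (simp add: ennreal_leI flip: ennreal_plus)
    qed
    also have "\<dots> = (\<integral>\<^sup>+z. ennreal (Ls_integrand \<alpha> s f z) \<partial>\<mu>) + (\<integral>\<^sup>+z. ennreal (Ls_integrand \<alpha> s g z) \<partial>\<mu>)"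
      using Ls_integrand_measurable[OF assms(2,3)] Ls_integrand_measurable[OF assms(2,4)]
      by (intro nn_integral_add measurable_compose[OF _ measurable_ennreal])
    finally show ?thesis
      using True assms(1) by (simp add: weighted_Ls_norm_alt min_absorb2)
  next
    case False
    have "enn_powr (\<integral>\<^sup>+z. ennreal ((cmod (k z) * w z) powr s) \<partial>\<mu>) (1 / s) \<le>
      enn_powr (\<integral>\<^sup>+z. ennreal ((cmod (f z) * w z) powr s) \<partial>\<mu>) (1 / s) + enn_powr (\<integral>\<^sup>+z. ennreal ((cmod (g z) * w z) powr s) \<partial>\<mu>) (1 / s)"
      using False w kw less_imp_le[OF w] by (intro nn_integral_Minkowski_powr) auto
    then show ?thesis using False by (simp add: weighted_Ls_norm_alt integrand min_absorb1)
  qed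
qed

text \<open>Functions in \<open>L\<^sup>s\<close> are not identified modulo null sets, so \<open>d\<close> may vanish off the diagonal.\<close>
locale pseudometric =
  fixes pm_topology :: "'a topology" and W :: "'a set" and d :: "'a \<Rightarrow> 'a \<Rightarrow> real"
  assumes openin_pm_topology:
      "openin pm_topology S \<longleftrightarrow> S \<subseteq> W \<and> (\<forall>x\<in>S. \<exists>e>0. \<forall>y\<in>W. d y x < e \<longrightarrow> y \<in> S)"
    and d_nonneg: "x \<in> W \<Longrightarrow> y \<in> W \<Longrightarrow> 0 \<le> d x y"
    and d_self: "x \<in> W \<Longrightarrow> d x x = 0"
    and d_commute: "x \<in> W \<Longrightarrow> y \<in> W \<Longrightarrow> d x y = d y x"
    and d_triangle: "x \<in> W \<Longrightarrow> y \<in> W \<Longrightarrow> z \<in> W \<Longrightarrow> d x z \<le> d x y + d y z"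
begin

section \<open>Compactness and sequences in pseudometric spaces\<close>

lemma topspace_pm_topology: "topspace pm_topology = W"
proof -
  have "openin pm_topology W" unfolding openin_pm_topology using zero_less_one by blast
  then show ?thesis by (meson openin_pm_topology openin_subset openin_topspace subset_antisym)
qed

lemma openin_pm_ball: "x \<in> W \<Longrightarrow> openin pm_topology {y \<in> W. d y x < e}"
  unfolding openin_pm_topology
proof (intro conjI ballI)
  fix y assume x: "x \<in> W" and y: "y \<in> {y \<in> W. d y x < e}"
  show "\<exists>e'>0. \<forall>z\<in>W. d z y < e' \<longrightarrow> z \<in> {y \<in> W. d y x < e}"
  proof (intro exI[of _ "e - d y x"] conjI ballI impI)
    fix z assume "z \<in> W" "d z y < e - d y x"
    then show "z \<in> {y \<in> W. d y x < e}" using d_triangle[of z y x] x y by auto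
  qed (use y in simp)
qed auto

text \<open>Otherwise every g has a ball containing the terms of only finitely many indices;
  finitely many such balls cover the closure, and then only finitely many indices exist. Counting
  indices instead of points also covers sequences with repeated terms.\<close>

lemma compactin_closure_cluster:
  assumes comp: "compactin pm_topology (pm_topology closure_of S)" and S: "S \<subseteq> W"
    and \<sigma>: "\<And>n :: nat. \<sigma> n \<in> S"
  obtains g where "g \<in> W" "\<And>e. e > 0 \<Longrightarrow> infinite {n. d (\<sigma> n) g < e}"
proof (rule ccontr)
  assume "\<not> thesis"
  then have "\<forall>g\<in>W. \<exists>e>0. finite {n. d (\<sigma> n) g < e}" using that by blast
  then obtain e where e: "\<And>g. g \<in> W \<Longrightarrow> e g > 0 \<and> finite {n. d (\<sigma> n) g < e g}" by metis
  let ?K = "pm_topology closure_of S"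
  have K: "?K \<subseteq> W" "S \<subseteq> ?K"
    using closure_of_subset_topspace[of pm_topology S] closure_of_subset[of S pm_topology] S
    by (auto simp: topspace_pm_topology)
  let ?B = "\<lambda>g. {y \<in> W. d y g < e g}"
  have "\<exists>\<F>. finite \<F> \<and> \<F> \<subseteq> ?B ` ?K \<and> ?K \<subseteq> \<Union>\<F>"
  proof (rule compactinD[OF comp])
    fix U assume "U \<in> ?B ` ?K"
    then show "openin pm_topology U" using K openin_pm_ball by blast
  next
    show "?K \<subseteq> \<Union> (?B ` ?K)"
    proof
      fix g assume "g \<in> ?K"
      then have "g \<in> ?B g" using K e[of g] d_self[of g] by auto
      then show "g \<in> \<Union> (?B ` ?K)" using \<open>g \<in> ?K\<close> by blast
    qed
  qed
  then obtain G where G: "finite G" "G \<subseteq> ?K" "?K \<subseteq> (\<Union>g\<in>G. ?B g)"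
    by (metis (no_types, lifting) finite_subset_image)
  have "UNIV \<subseteq> (\<Union>g\<in>G. {n. d (\<sigma> n) g < e g})"
  proof
    fix n :: nat
    have "\<sigma> n \<in> (\<Union>g\<in>G. ?B g)" using \<sigma>[of n] K G by blast
    then show "n \<in> (\<Union>g\<in>G. {n. d (\<sigma> n) g < e g})" by blast
  qed
  moreover have "finite (\<Union>g\<in>G. {n. d (\<sigma> n) g < e g})" using G K e by blast
  ultimately show False using finite_subset infinite_UNIV_nat by blast
qed

text \<open>The argument passes to a genuine metric space, where sequential compactness and
  compactness agree, by choosing one representative from each class of points at distance 0. Open
  sets are unions of such classes, and therefore open covers pass to the representatives and
  back.\<close>

lemma compactin_closureI:
  assumes S: "S \<subseteq> W"
    and seq: "\<And>\<sigma> :: nat \<Rightarrow> 'a. (\<And>n. \<sigma> n \<in> S) \<Longrightarrow> \<exists>l\<in>W. \<exists>r. strict_mono r \<and> (\<lambda>n. d (\<sigma> (r n)) l) \<longlonglongrightarrow> 0"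
  shows "compactin pm_topology (pm_topology closure_of S)"
proof -
  \<comment> \<open>Points at distance 0 satisfy the same predicate, so the choice is literally the
    same for both: \<open>rep\<close> is constant on classes.\<close>
  define rep where "rep x = (SOME y. y \<in> W \<and> d x y = 0)" for x
  have rep: "rep x \<in> W" "d x (rep x) = 0" if "x \<in> W" for x
    unfolding rep_def using someI[of "\<lambda>y. y \<in> W \<and> d x y = 0" x] that d_self by auto
  have zero_cong: "d x z = d y z" if "x \<in> W" "y \<in> W" "z \<in> W" "d x y = 0" for x y z
    using that d_triangle[of x y z] d_triangle[of y x z] d_commute[of x y] by simp
  have rep_eq: "rep x = rep y" if "x \<in> W" "y \<in> W" "d x y = 0" for x y
  proof -
    have "(\<lambda>z. z \<in> W \<and> d x z = 0) = (\<lambda>z. z \<in> W \<and> d y z = 0)"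
      using zero_cong[OF that(1,2) _ that(3)] by auto
    then show ?thesis by (simp add: rep_def)
  qed
  have rep_d: "d (rep x) (rep y) = d x y" if "x \<in> W" "y \<in> W" for x y
    using that rep zero_cong[of x "rep x" "rep y"] zero_cong[of y "rep y" x] d_commute[of x y] d_commute[of x "rep y"] by simp
  define M where "M = rep ` W"
  have MW: "M \<subseteq> W" using rep by (auto simp: M_def)
  \<comment> \<open>Nonnegativity and symmetry are required on the whole type, the other axioms only
    on M; the value 0 off the space arranges this.\<close>
  interpret Metric_space M "\<lambda>x y. if x \<in> W \<and> y \<in> W then d x y else 0"
  proof
    fix x y
    show "0 \<le> (if x \<in> W \<and> y \<in> W then d x y else 0)" using d_nonneg by simp
    show "(if x \<in> W \<and> y \<in> W then d x y else 0) = (if y \<in> W \<and> x \<in> W then d y x else 0)" using d_commute by simp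
    assume "x \<in> M" "y \<in> M"
    then obtain a b where ab: "a \<in> W" "x = rep a" "b \<in> W" "y = rep b" by (auto simp: M_def)
    have W: "x \<in> W" "y \<in> W" using ab rep by simp_all
    have "d x y = 0 \<longleftrightarrow> x = y"
    proof
      assume "d x y = 0"
      then have "d a b = 0" using rep_d[OF ab(1,3)] ab by simp
      then show "x = y" using rep_eq[OF ab(1,3)] ab by simp
    qed (use W d_self in simp)
    then show "(if x \<in> W \<and> y \<in> W then d x y else 0) = 0 \<longleftrightarrow> x = y" using W by simp
    fix z assume "z \<in> M"
    then show "(if x \<in> W \<and> z \<in> W then d x z else 0) \<le> (if x \<in> W \<and> y \<in> W then d x y else 0) + (if y \<in> W \<and> z \<in> W then d y z else 0)"
      using d_triangle[OF W, of z] W subsetD[OF MW \<open>z \<in> M\<close>] by simp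
  qed
  have saturated: "y \<in> U" if "openin pm_topology U" "x \<in> U" "y \<in> W" "d y x = 0" for U x y
    using that unfolding openin_pm_topology by force
  have rep_open: "openin mtopology (rep ` U)" if U: "openin pm_topology U" for U
    unfolding openin_mtopology
  proof (intro conjI allI impI)
    have UW: "U \<subseteq> W" using U by (simp add: openin_pm_topology)
    then show "rep ` U \<subseteq> M" by (auto simp: M_def)
    fix x assume "x \<in> rep ` U"
    then obtain a where a: "a \<in> U" "x = rep a" by blast
    obtain e where e: "e > 0" "\<And>y. y \<in> W \<Longrightarrow> d y a < e \<Longrightarrow> y \<in> U"
      using U a unfolding openin_pm_topology by blast
    have "mball x e \<subseteq> rep ` U"
    proof
      fix y assume "y \<in> mball x e"
      moreover have "x \<in> W" using a UW rep by blast
      ultimately have y: "y \<in> M" "d x y < e" using MW by (auto simp: in_mball split: if_splits)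
      then obtain b where b: "b \<in> W" "y = rep b" by (auto simp: M_def)
      have "a \<in> W" using a UW by blast
      then have "d b a < e" using y(2) rep_d[of a b] d_commute[of a b] b a(2) by simp
      then show "y \<in> rep ` U" using b e by blast
    qed
    then show "\<exists>r>0. mball x r \<subseteq> rep ` U" using e(1) by blast
  qed
  define K where "K = pm_topology closure_of S"
  have K: "K \<subseteq> W" "S \<subseteq> K"
    using closure_of_subset_topspace[of pm_topology S] closure_of_subset[of S pm_topology] S
    by (auto simp: topspace_pm_topology K_def)
  have K_approx: "\<exists>y\<in>S. d y x < e" if "x \<in> K" "e > 0" for x e
  proof -
    have "x \<in> {y \<in> W. d y x < e}" using that K d_self by auto
    moreover have "openin pm_topology {y \<in> W. d y x < e}" using that K by (intro openin_pm_ball) auto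
    moreover have "\<forall>T. x \<in> T \<and> openin pm_topology T \<longrightarrow> (\<exists>y. y \<in> S \<and> y \<in> T)"
      using that(1) unfolding K_def in_closure_of by (rule conjunct2)
    ultimately have "\<exists>y. y \<in> S \<and> y \<in> {y \<in> W. d y x < e}" by meson
    then show ?thesis by auto
  qed
  have K_lim: "l \<in> K" if lW: "l \<in> W" and approx: "\<And>e. e > 0 \<Longrightarrow> \<exists>y\<in>S. d y l < e" for l
    unfolding K_def in_closure_of topspace_pm_topology
  proof (intro conjI allI impI)
    fix T assume T: "l \<in> T \<and> openin pm_topology T"
    then have "\<forall>x\<in>T. \<exists>e>0. \<forall>y\<in>W. d y x < e \<longrightarrow> y \<in> T"
      unfolding openin_pm_topology by (elim conjE)
    then obtain e where e: "e > 0" "\<forall>y\<in>W. d y l < e \<longrightarrow> y \<in> T"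
      using T by meson
    obtain y where "y \<in> S" "d y l < e" using approx[OF e(1)] by auto
    then show "\<exists>y. y \<in> S \<and> y \<in> T" using e(2) S by auto
  qed (rule lW)
  \<comment> \<open>Points of the closure are replaced by points of S at distance less than 1/(n +
    1), whose convergent subsequence has the same limit.\<close>
  have seqK: "\<exists>l\<in>K. \<exists>r. strict_mono r \<and> (\<lambda>n. d (\<sigma> (r n)) l) \<longlonglongrightarrow> 0" if \<sigma>: "\<And>n. \<sigma> n \<in> K" for \<sigma> :: "nat \<Rightarrow> 'a"
  proof -
    have "\<forall>n. \<exists>y\<in>S. d y (\<sigma> n) < 1 / (real n + 1)"
      using K_approx[OF \<sigma>] by simp
    then obtain \<rho> where \<rho>: "\<And>n. \<rho> n \<in> S" "\<And>n. d (\<rho> n) (\<sigma> n) < 1 / (real n + 1)" by metis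
    obtain l r where l: "l \<in> W" "strict_mono r" "(\<lambda>n. d (\<rho> (r n)) l) \<longlonglongrightarrow> 0"
      using seq[of \<rho>, OF \<rho>(1)] by auto
    have W: "\<rho> n \<in> W" "\<sigma> n \<in> W" for n using \<rho>(1) \<sigma> S K by blast+
    have "l \<in> K"
    proof (rule K_lim[OF l(1)])
      fix e :: real assume "e > 0"
      then have "eventually (\<lambda>n. d (\<rho> (r n)) l < e) sequentially" using order_tendstoD(2)[OF l(3)] by blast
      then obtain N where "\<forall>n\<ge>N. d (\<rho> (r n)) l < e" unfolding eventually_sequentially by (elim exE)
      then show "\<exists>y\<in>S. d y l < e" using \<rho>(1) by (intro bexI[of _ "\<rho> (r N)"]) auto
    qed
    moreover have "(\<lambda>n. d (\<sigma> (r n)) l) \<longlonglongrightarrow> 0"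
    proof (rule tendsto_sandwich[OF _ _ tendsto_const])
      have "(\<lambda>n. 1 / (real n + 1)) \<longlonglongrightarrow> 0"
        using LIMSEQ_inverse_real_of_nat by (simp add: inverse_eq_divide add.commute)
      then have "(\<lambda>n. 1 / (real (r n) + 1)) \<longlonglongrightarrow> 0"
        using LIMSEQ_subseq_LIMSEQ[OF _ l(2)] by (auto simp: o_def)
      from tendsto_add[OF this l(3)] show "(\<lambda>n. 1 / (real (r n) + 1) + d (\<rho> (r n)) l) \<longlonglongrightarrow> 0" by simp
      show "\<forall>\<^sub>F n in sequentially. d (\<sigma> (r n)) l \<le> 1 / (real (r n) + 1) + d (\<rho> (r n)) l"
      proof (rule always_eventually, rule allI)
        fix n
        have "d (\<sigma> (r n)) l \<le> d (\<sigma> (r n)) (\<rho> (r n)) + d (\<rho> (r n)) l" by (intro d_triangle W l)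
        then show "d (\<sigma> (r n)) l \<le> 1 / (real (r n) + 1) + d (\<rho> (r n)) l"
          using \<rho>(2)[of "r n"] d_commute[OF W(1,2), of "r n" "r n"] by linarith
      qed
      show "\<forall>\<^sub>F n in sequentially. 0 \<le> d (\<sigma> (r n)) l" using d_nonneg[OF W(2) l(1)] by simp
    qed
    ultimately show ?thesis using l(2) by blast
  qed
  have comp: "compactin mtopology (rep ` K)"
    unfolding compactin_sequentially
  proof (intro conjI allI impI)
    show "rep ` K \<subseteq> M" using K by (auto simp: M_def)
    fix \<sigma> :: "nat \<Rightarrow> 'a" assume "range \<sigma> \<subseteq> rep ` K"
    then have "\<forall>n. \<exists>x\<in>K. \<sigma> n = rep x" by blast
    then obtain \<rho> where \<rho>: "\<And>n. \<rho> n \<in> K" "\<And>n. \<sigma> n = rep (\<rho> n)" by metis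
    obtain l r where l: "l \<in> K" "strict_mono r" "(\<lambda>n. d (\<rho> (r n)) l) \<longlonglongrightarrow> 0" using seqK[of \<rho>] \<rho>(1) by blast
    have W: "\<rho> n \<in> W" "l \<in> W" for n using \<rho>(1) l K by blast+
    have "limitin mtopology (\<sigma> \<circ> r) (rep l) sequentially"
      unfolding limitin_metric
    proof (intro conjI allI impI)
      show "rep l \<in> M" using W by (auto simp: M_def)
      fix \<epsilon> :: real assume "\<epsilon> > 0"
      then have "eventually (\<lambda>n. d (\<rho> (r n)) l < \<epsilon>) sequentially" using order_tendstoD(2)[OF l(3)] by blast
      then show "\<forall>\<^sub>F n in sequentially. (\<sigma> \<circ> r) n \<in> M \<and> (if (\<sigma> \<circ> r) n \<in> W \<and> rep l \<in> W then d ((\<sigma> \<circ> r) n) (rep l) else 0) < \<epsilon>"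
        by eventually_elim (use W rep rep_d in \<open>auto simp: \<rho>(2) M_def\<close>)
    qed
    then show "\<exists>l r. l \<in> rep ` K \<and> strict_mono r \<and> limitin mtopology (\<sigma> \<circ> r) l sequentially"
      using l by blast
  qed
  show ?thesis
    unfolding compactin_def topspace_pm_topology
  proof (intro conjI allI impI)
    show "pm_topology closure_of S \<subseteq> W" using K by (simp add: K_def)
    fix \<U> assume \<U>: "(\<forall>U\<in>\<U>. openin pm_topology U) \<and> pm_topology closure_of S \<subseteq> \<Union>\<U>"
    have "\<exists>\<F>. finite \<F> \<and> \<F> \<subseteq> (`) rep ` \<U> \<and> rep ` K \<subseteq> \<Union>\<F>"
    proof (rule compactinD[OF comp])
      fix V assume "V \<in> (`) rep ` \<U>"
      then show "openin mtopology V" using rep_open \<U> by blast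
    next
      show "rep ` K \<subseteq> \<Union> ((`) rep ` \<U>)"
      proof (rule image_subsetI)
        fix x assume "x \<in> K"
        then obtain U where "U \<in> \<U>" "x \<in> U" using \<U> unfolding K_def by (meson UnionE subsetD)
        then show "rep x \<in> \<Union> ((`) rep ` \<U>)" by (intro UnionI[of "rep ` U"] imageI)
      qed
    qed
    then obtain \<F> where \<F>: "finite \<F>" "\<F> \<subseteq> \<U>" "rep ` K \<subseteq> \<Union> ((`) rep ` \<F>)"
      by (metis (no_types, lifting) finite_subset_image)
    have "K \<subseteq> \<Union>\<F>"
    proof
      fix x assume x: "x \<in> K"
      then obtain U where U: "U \<in> \<F>" "rep x \<in> rep ` U" using \<F>(3) by blast
      then obtain y where y: "y \<in> U" "rep x = rep y" by blast
      have "openin pm_topology U" using U \<F> \<U> by blast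
      moreover have "y \<in> W" using calculation y by (auto simp: openin_pm_topology)
      moreover have "x \<in> W" using x K by blast
      moreover have "d x y = 0" using rep_d[OF \<open>x \<in> W\<close> \<open>y \<in> W\<close>] y(2) rep[OF \<open>y \<in> W\<close>] d_self by simp
      ultimately have "x \<in> U" using saturated y(1) by blast
      then show "x \<in> \<Union>\<F>" using U by blast
    qed
    then show "\<exists>\<F>. finite \<F> \<and> \<F> \<subseteq> \<U> \<and> pm_topology closure_of S \<subseteq> \<Union>\<F>"
      using \<F> by (auto simp: K_def)
  qed
qed

end

section \<open>Tail estimates for synthesized functions\<close>

lemma enn_powr_less_iff: "a > 0 \<Longrightarrow> enn_powr x a < y \<longleftrightarrow> x < enn_powr y (1 / a)"
  by (simp add: le_enn_powr_iff flip: not_le)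

lemma lp_enorm_restrict:
  assumes "p > 0"
  shows "lp_enorm p UNIV (\<lambda>i. if i \<in> I then x i else 0) = lp_enorm p I x"
  using assms
proof (cases rule: ennreal_pos_cases)
  case 1
  show ?thesis unfolding 1 lp_enorm_top
  proof (rule antisym)
    show "(SUP i\<in>I. x i) \<le> (SUP i. if i \<in> I then x i else 0)"
    proof (rule SUP_least)
      fix i assume "i \<in> I"
      then show "x i \<le> (SUP i. if i \<in> I then x i else 0)" by (intro SUP_upper2[of i]) auto
    qed
    show "(SUP i. if i \<in> I then x i else 0) \<le> (SUP i\<in>I. x i)"
      by (rule SUP_least) (simp add: SUP_upper)
  qed
next
  case (2 r)
  have "(\<integral>\<^sup>+i. enn_powr (if i \<in> I then x i else 0) r \<partial>count_space UNIV) = (\<integral>\<^sup>+i. enn_powr (x i) r * indicator I i \<partial>count_space UNIV)"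
    by (intro nn_integral_cong) (auto simp: indicator_def)
  also have "\<dots> = (\<integral>\<^sup>+i. enn_powr (x i) r \<partial>count_space I)"
    by (rule nn_integral_count_space_indicator[symmetric]) simp
  finally show ?thesis using 2 by (simp add: lp_enorm_finite_exponent)
qed

lemma star_exponent_finite:
  assumes "s > 0" "ennreal s < q"
  obtains r where "r > 0" "star_exponent s q = ennreal r"
proof (cases q)
  case (real t)
  then have "s < t" using assms by (simp add: ennreal_less_iff)
  then show ?thesis using that[of "t / (t - s)"] assms real by (simp add: star_exponent_real)
next
  case top
  then show ?thesis using that[of 1] by simp
qed

definition shell_tail :: "(nat \<Rightarrow> ennreal) \<Rightarrow> nat \<Rightarrow> nat \<Rightarrow> ennreal" where
  "shell_tail x n k = (if n \<le> k then x k else 0)"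

text \<open>For q \<le> s the star exponent is \<infinity>, and the supremum of the tail is small
  because the sequence is null. For s < q the exponent is finite, and dominated convergence with the
  sequence itself as majorant gives the same conclusion from a finite norm alone.\<close>

lemma shell_condition_tail:
  assumes "shell_condition s q x" "s > 0"
  shows "(\<lambda>n. lp_enorm (star_exponent s q) UNIV (shell_tail x n)) \<longlonglongrightarrow> 0"
    and "lp_enorm (star_exponent s q) UNIV x < top" and "x k < top"
proof -
  have "(\<lambda>n. lp_enorm (star_exponent s q) UNIV (shell_tail x n)) \<longlonglongrightarrow> 0 \<and> lp_enorm (star_exponent s q) UNIV x < top"
  proof (cases "q \<le> ennreal s")
    case True
    then have null: "null_norm_sequence x" and star: "star_exponent s q = top"
      using assms by (simp_all add: shell_condition_def star_exponent_le)
    have lim: "x \<longlonglongrightarrow> 0" and fin: "\<And>k. x k < top" using null by (simp_all add: null_norm_sequence_def)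
    have small: "\<exists>N. \<forall>n\<ge>N. (SUP k. shell_tail x n k) < e" if e: "e > 0" for e
    proof -
      obtain e' where e': "0 < e'" "e' < e" using dense[OF e] by blast
      obtain N where N: "\<And>n. n \<ge> N \<Longrightarrow> x n < e'"
        using order_tendstoD(2)[OF lim e'(1)] by (auto simp: eventually_sequentially)
      have "(SUP k. shell_tail x n k) \<le> e'" if "n \<ge> N" for n
        by (intro SUP_least) (use N that in \<open>auto simp: shell_tail_def intro: less_imp_le\<close>)
      then show ?thesis using e'(2) le_less_trans by blast
    qed
    have "(\<lambda>n. SUP k. shell_tail x n k) \<longlonglongrightarrow> 0"
    proof (rule order_tendstoI)
      fix e :: ennreal assume "0 < e"
      then show "\<forall>\<^sub>F n in sequentially. (SUP k. shell_tail x n k) < e"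
        using small unfolding eventually_sequentially by blast
    qed simp
    moreover have "(SUP k. x k) < top"
    proof -
      obtain N where N: "\<And>n. n \<ge> N \<Longrightarrow> x n < 1"
        using order_tendstoD(2)[OF lim, of 1] by (auto simp: eventually_sequentially)
      have "x k \<le> (\<Sum>i<N. x i) + 1" for k
      proof (cases "k < N")
        case True
        then have "x k \<le> (\<Sum>i<N. x i)" by (intro member_le_sum) auto
        then show ?thesis using add_increasing2[of 1 "x k" "\<Sum>i<N. x i"] by simp
      next
        case False
        then have "x k \<le> 1" using N[of k] by simp
        then show ?thesis using add_increasing[of "\<Sum>i<N. x i" "x k" 1] by simp
      qed
      then have "(SUP k. x k) \<le> (\<Sum>i<N. x i) + 1" by (intro SUP_least)
      also have "\<dots> < top" using fin by (simp add: less_top[symmetric])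
      finally show ?thesis .
    qed
    ultimately show ?thesis unfolding star lp_enorm_top by blast
  next
    case False
    then have q: "ennreal s < q" by simp
    obtain r where r: "r > 0" "star_exponent s q = ennreal r" using star_exponent_finite[OF assms(2) q] by blast
    have fin: "lp_enorm (ennreal r) UNIV x < top" using assms(1) q r by (simp add: shell_condition_def)
    then have fin': "(\<integral>\<^sup>+k. enn_powr (x k) r \<partial>count_space UNIV) < top"
      using r by (simp add: lp_enorm_finite_exponent)
    have "(\<lambda>n. \<integral>\<^sup>+k. enn_powr (shell_tail x n k) r \<partial>count_space UNIV) \<longlonglongrightarrow> (\<integral>\<^sup>+k. 0 \<partial>count_space (UNIV :: nat set))"
    proof (rule nn_integral_dominated_convergence[where w = "\<lambda>k. enn_powr (x k) r"])
      show "AE k in count_space UNIV. (\<lambda>n. enn_powr (shell_tail x n k) r) \<longlonglongrightarrow> 0"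
      proof (rule AE_I2)
        fix k :: nat
        have "\<forall>\<^sub>F n in sequentially. 0 = enn_powr (shell_tail x n k) r"
          unfolding eventually_sequentially shell_tail_def by (intro exI[of _ "Suc k"]) auto
        then show "(\<lambda>n. enn_powr (shell_tail x n k) r) \<longlonglongrightarrow> 0"
          using tendsto_cong[of "\<lambda>_. 0" "\<lambda>n. enn_powr (shell_tail x n k) r" sequentially 0] by simp
      qed
    qed (use fin' r in \<open>auto simp: shell_tail_def intro!: enn_powr_mono\<close>)
    then have lim: "(\<lambda>n. \<integral>\<^sup>+k. enn_powr (shell_tail x n k) r \<partial>count_space UNIV) \<longlonglongrightarrow> 0" by simp
    have "(\<lambda>n. lp_enorm (ennreal r) UNIV (shell_tail x n)) \<longlonglongrightarrow> 0"
    proof (rule order_tendstoI)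
      fix e :: ennreal assume "0 < e"
      then have "0 < enn_powr e r" by (simp add: zero_less_iff_neq_zero)
      from order_tendstoD(2)[OF lim this]
      show "\<forall>\<^sub>F n in sequentially. lp_enorm (ennreal r) UNIV (shell_tail x n) < e"
        using r by (simp add: lp_enorm_finite_exponent enn_powr_less_iff)
    qed simp
    then show ?thesis using fin r by simp
  qed
  then show "(\<lambda>n. lp_enorm (star_exponent s q) UNIV (shell_tail x n)) \<longlonglongrightarrow> 0"
    and fin: "lp_enorm (star_exponent s q) UNIV x < top" by simp_all
  show "x k < top" using le_less_trans[OF lp_enorm_upper[OF star_exponent_pos UNIV_I] fin] .
qed

context fock_tiling
begin

text \<open>The Gaussian of exponent \<alpha>/2 is split into two equal factors: one is kept with
  the coefficients under the supremum, the other is summed over the tiling. The bound on finite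
  partial sums survives the limit.\<close>

lemma synthesis_pointwise_bound:
  obtains C where "C > 0" "\<And>c f z. synthesizes \<alpha> \<delta> c f \<Longrightarrow>
    ennreal (cmod (f z) * exp (- (\<alpha> / 2) * (cmod z)\<^sup>2)) \<le> ennreal C * gauss_sup_tiling (\<alpha> / 4) (\<lambda>Q. ennreal (cmod (c Q))) z"
proof -
  have "\<alpha> / 4 > 0" using \<alpha>_pos by simp
  then obtain C where C: "C > 0" "\<And>F z. finite F \<Longrightarrow> F \<subseteq> tiling \<delta> \<Longrightarrow> (\<Sum>Q\<in>F. exp (- (\<alpha> / 4) * (dist z (\<zeta> Q))\<^sup>2)) \<le> C"
    using gaussian_sum by blast
  show ?thesis
  proof (rule that[OF C(1)])
    fix c f z assume syn: "synthesizes \<alpha> \<delta> c f"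
    let ?X = "gauss_sup_tiling (\<alpha> / 4) (\<lambda>Q. ennreal (cmod (c Q))) z"
    let ?e = "exp (- (\<alpha> / 2) * (cmod z)\<^sup>2)"
    let ?E = "\<lambda>Q. exp (- (\<alpha> / 4) * (dist z (\<zeta> Q))\<^sup>2)"
    show "ennreal (cmod (f z) * ?e) \<le> ennreal C * ?X"
    proof (cases "?X = top")
      case True
      then show ?thesis using C by (simp add: ennreal_mult_top)
    next
      case False
      then obtain X where X: "?X = ennreal X" "X \<ge> 0" by (cases ?X) auto
      have term_le: "cmod (c Q * kernel \<alpha> (\<zeta> Q) z) * ?e \<le> ?E Q * X" if Q: "Q \<in> tiling \<delta>" for Q
      proof -
        have "ennreal (?E Q) * ennreal (cmod (c Q)) \<le> ?X"
          unfolding gauss_sup_tiling_def using Q by (rule SUP_upper)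
        then have "?E Q * cmod (c Q) \<le> X"
          using X by (simp flip: ennreal_mult)
        then have "?E Q * (?E Q * cmod (c Q)) \<le> ?E Q * X" by (intro mult_left_mono) auto
        moreover have "exp (\<alpha> / 2 * (cmod z)\<^sup>2) * ?e = 1" by (simp flip: exp_add)
        moreover have "exp (- (\<alpha> / 2) * (cmod (z - \<zeta> Q))\<^sup>2) = ?E Q * ?E Q"
          by (simp add: dist_norm flip: exp_add)
        moreover have "cmod (c Q) * (exp (\<alpha> / 2 * (cmod z)\<^sup>2) * (?E Q * ?E Q)) * ?e = (exp (\<alpha> / 2 * (cmod z)\<^sup>2) * ?e) * (?E Q * (?E Q * cmod (c Q)))"
          by (simp only: mult_ac)
        ultimately show ?thesis
          unfolding norm_mult cmod_kernel by (simp only: mult_1)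
      qed
      have hs: "((\<lambda>Q. c Q * kernel \<alpha> (\<zeta> Q) z) has_sum f z) (tiling \<delta>)"
        using syn by (simp add: synthesizes_def)
      have lim: "((\<lambda>F. cmod (\<Sum>Q\<in>F. c Q * kernel \<alpha> (\<zeta> Q) z) * ?e) \<longlongrightarrow> cmod (f z) * ?e) (finite_subsets_at_top (tiling \<delta>))"
        using hs unfolding has_sum_def by (intro tendsto_mult tendsto_norm tendsto_const)
      have "cmod (f z) * ?e \<le> C * X"
      proof (rule tendsto_upperbound[OF lim])
        show "\<forall>\<^sub>F F in finite_subsets_at_top (tiling \<delta>). cmod (\<Sum>Q\<in>F. c Q * kernel \<alpha> (\<zeta> Q) z) * ?e \<le> C * X"
        proof (rule eventually_finite_subsets_at_top_weakI)
          fix F assume F: "finite F" "F \<subseteq> tiling \<delta>"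
          have "cmod (\<Sum>Q\<in>F. c Q * kernel \<alpha> (\<zeta> Q) z) * ?e \<le> (\<Sum>Q\<in>F. cmod (c Q * kernel \<alpha> (\<zeta> Q) z)) * ?e"
            by (intro mult_right_mono norm_sum) auto
          also have "\<dots> = (\<Sum>Q\<in>F. cmod (c Q * kernel \<alpha> (\<zeta> Q) z) * ?e)" by (rule sum_distrib_right)
          also have "\<dots> \<le> (\<Sum>Q\<in>F. ?E Q * X)" using F by (intro sum_mono term_le) auto
          also have "\<dots> = (\<Sum>Q\<in>F. ?E Q) * X" by (rule sum_distrib_right[symmetric])
          also have "\<dots> \<le> C * X" using X C(2)[OF F, of z] by (intro mult_right_mono)
          finally show "cmod (\<Sum>Q\<in>F. c Q * kernel \<alpha> (\<zeta> Q) z) * ?e \<le> C * X" .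
        qed
      qed simp
      then show ?thesis using X C(1) by (simp add: ennreal_leI flip: ennreal_mult)
    qed
  qed
qed

text \<open>The majorant a dominates the weighted function uniformly on the ball of radius R about
  each center, while its mixed norm is still controlled by the coefficients. Values are shifted to
  the center; then a Gaussian matrix acts inside shells, the weight is moved across it, and a
  Gaussian matrix between shells remains, bounded for the exponent q.\<close>

lemma synthesis_shell_bound:
  obtains C where "C > 0" "\<And>c f. synthesizes \<alpha> \<delta> c f \<Longrightarrow>
    \<exists>a. lp_enorm q UNIV (\<lambda>k. lp_enorm p (tiling_shell \<delta> k) a) \<le> ennreal C * weighted_norm \<delta> p q c \<and>
      (\<forall>k Q z. Q \<in> tiling_shell \<delta> k \<longrightarrow> dist z (\<zeta> Q) < R \<longrightarrow>
        ennreal (\<omega> k) * ennreal (cmod (f z) * exp (- (\<alpha> / 2) * (cmod z)\<^sup>2)) \<le> a Q)"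
proof -
  obtain C1 where C1: "C1 > 0" "\<And>c f z. synthesizes \<alpha> \<delta> c f \<Longrightarrow>
    ennreal (cmod (f z) * exp (- (\<alpha> / 2) * (cmod z)\<^sup>2)) \<le> ennreal C1 * gauss_sup_tiling (\<alpha> / 4) (\<lambda>Q. ennreal (cmod (c Q))) z"
    using synthesis_pointwise_bound by blast
  have pos: "\<alpha> / 4 / 2 > 0" "0 \<le> \<alpha> / 4" using \<alpha>_pos by auto
  obtain C2 \<gamma> where C2: "C2 > 0" "\<gamma> > 0"
    "\<And>g k. lp_enorm p (tiling_shell \<delta> k) (\<lambda>Q. gauss_sup_tiling (\<alpha> / 4 / 2) g (\<zeta> Q)) \<le>
      ennreal C2 * gauss_sup \<gamma> (\<lambda>j. lp_enorm p (tiling_shell \<delta> j) g) k"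
    using lp_enorm_shell_gaussian[OF pos(1) p_pos] by blast
  have "\<gamma> / 2 > 0" using C2 by simp
  then obtain C3 where C3: "C3 > 0" "\<And>y. lp_enorm q UNIV (gauss_sup (\<gamma> / 2) y) \<le> ennreal C3 * lp_enorm q UNIV y"
    using lp_enorm_gauss_sup[OF _ q_pos] by blast
  define D where "D = C1 * exp (\<alpha> / 4 * R\<^sup>2)"
  have D: "D > 0" using C1 by (simp add: D_def)
  define E where "E = exp (\<tau>\<^sup>2 / (2 * \<gamma>))"
  show ?thesis
  proof (rule that[of "D * (C2 * (E * C3))"])
    show "D * (C2 * (E * C3)) > 0" using D C2 C3 by (simp add: E_def)
    fix c f assume syn: "synthesizes \<alpha> \<delta> c f"
    let ?c = "\<lambda>Q. ennreal (cmod (c Q))"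
    define a where "a Q = ennreal (\<omega> (fst Q)) * (ennreal D * gauss_sup_tiling (\<alpha> / 4 / 2) ?c (\<zeta> Q))" for Q
    have "lp_enorm p (tiling_shell \<delta> k) a \<le> ennreal (D * (C2 * E)) * gauss_sup (\<gamma> / 2) (\<lambda>j. ennreal (\<omega> j) * lp_enorm p (tiling_shell \<delta> j) ?c) k" for k
    proof -
      have "lp_enorm p (tiling_shell \<delta> k) a = lp_enorm p (tiling_shell \<delta> k) (\<lambda>Q. (ennreal (\<omega> k) * ennreal D) * gauss_sup_tiling (\<alpha> / 4 / 2) ?c (\<zeta> Q))"
        using p_pos by (intro lp_enorm_cong) (auto simp: a_def tiling_shell_eq mult.assoc)
      also have "\<dots> = (ennreal (\<omega> k) * ennreal D) * lp_enorm p (tiling_shell \<delta> k) (\<lambda>Q. gauss_sup_tiling (\<alpha> / 4 / 2) ?c (\<zeta> Q))"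
        by (rule lp_enorm_cmult[OF p_pos])
      also have "\<dots> \<le> (ennreal (\<omega> k) * ennreal D) * (ennreal C2 * gauss_sup \<gamma> (\<lambda>j. lp_enorm p (tiling_shell \<delta> j) ?c) k)"
        by (intro mult_left_mono C2) auto
      also have "\<dots> = (ennreal D * ennreal C2) * (ennreal (\<omega> k) * gauss_sup \<gamma> (\<lambda>j. lp_enorm p (tiling_shell \<delta> j) ?c) k)"
        by (simp only: mult_ac)
      also have "\<dots> \<le> (ennreal D * ennreal C2) * (ennreal E * gauss_sup (\<gamma> / 2) (\<lambda>j. ennreal (\<omega> j) * lp_enorm p (tiling_shell \<delta> j) ?c) k)"
        unfolding E_def by (intro mult_left_mono gauss_sup_weight C2) auto
      also have "\<dots> = ennreal (D * (C2 * E)) * gauss_sup (\<gamma> / 2) (\<lambda>j. ennreal (\<omega> j) * lp_enorm p (tiling_shell \<delta> j) ?c) k"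
        using D C2 by (simp add: ennreal_mult E_def mult.assoc)
      finally show ?thesis .
    qed
    then have "lp_enorm q UNIV (\<lambda>k. lp_enorm p (tiling_shell \<delta> k) a) \<le>
        lp_enorm q UNIV (\<lambda>k. ennreal (D * (C2 * E)) * gauss_sup (\<gamma> / 2) (\<lambda>j. ennreal (\<omega> j) * lp_enorm p (tiling_shell \<delta> j) ?c) k)"
      by (intro lp_enorm_mono q_pos)
    also have "\<dots> = ennreal (D * (C2 * E)) * lp_enorm q UNIV (gauss_sup (\<gamma> / 2) (\<lambda>j. ennreal (\<omega> j) * lp_enorm p (tiling_shell \<delta> j) ?c))"
      by (rule lp_enorm_cmult[OF q_pos])
    also have "\<dots> \<le> ennreal (D * (C2 * E)) * (ennreal C3 * weighted_norm \<delta> p q c)"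
      unfolding weighted_norm_def by (intro mult_left_mono C3) auto
    also have "\<dots> = ennreal (D * (C2 * (E * C3))) * weighted_norm \<delta> p q c"
      using D C2 C3 by (simp add: ennreal_mult E_def mult.assoc)
    finally have 1: "lp_enorm q UNIV (\<lambda>k. lp_enorm p (tiling_shell \<delta> k) a) \<le> ennreal (D * (C2 * (E * C3))) * weighted_norm \<delta> p q c" .
    have "ennreal (\<omega> k) * ennreal (cmod (f z) * exp (- (\<alpha> / 2) * (cmod z)\<^sup>2)) \<le> a Q"
      if "Q \<in> tiling_shell \<delta> k" "dist z (\<zeta> Q) < R" for k Q z
    proof -
      have "ennreal (cmod (f z) * exp (- (\<alpha> / 2) * (cmod z)\<^sup>2)) \<le> ennreal C1 * (ennreal (exp (\<alpha> / 4 * R\<^sup>2)) * gauss_sup_tiling (\<alpha> / 4 / 2) ?c (\<zeta> Q))"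
        by (intro order_trans[OF C1(2)[OF syn]] mult_left_mono gauss_sup_tiling_shift that pos) auto
      also have "\<dots> = ennreal D * gauss_sup_tiling (\<alpha> / 4 / 2) ?c (\<zeta> Q)"
        using C1(1) by (simp add: D_def ennreal_mult mult.assoc)
      finally show ?thesis
        using that(1) unfolding a_def by (simp add: tiling_shell_eq mult_left_mono)
    qed
    then show "\<exists>a. lp_enorm q UNIV (\<lambda>k. lp_enorm p (tiling_shell \<delta> k) a) \<le> ennreal (D * (C2 * (E * C3))) * weighted_norm \<delta> p q c \<and>
      (\<forall>k Q z. Q \<in> tiling_shell \<delta> k \<longrightarrow> dist z (\<zeta> Q) < R \<longrightarrow>
        ennreal (\<omega> k) * ennreal (cmod (f z) * exp (- (\<alpha> / 2) * (cmod z)\<^sup>2)) \<le> a Q)"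
      using 1 by blast
  qed
qed

text \<open>Inverts the normalisation in the ball mass, which on the k-th shell is comparable to (1
  + k)^(- \<tau> s).\<close>

lemma emeasure_ball_le_pocket_mass:
  obtains C where "C > 0" "\<And>k Q R. Q \<in> tiling_shell \<delta> k \<Longrightarrow> emeasure \<mu> (ball (\<zeta> Q) R) \<le> ennreal (C * (1 + real k) powr (\<tau> * s)) * u R Q"
proof -
  obtain a b where ab: "a > 0" "b > 0"
    "\<And>k w. w \<in> annulus k \<Longrightarrow> ennreal (a * (1 + real k) powr (- \<tau> * s)) \<le> norm_weight w"
    "\<And>k w. w \<in> annulus k \<Longrightarrow> norm_weight w \<le> ennreal (b * (1 + real k) powr (- \<tau> * s))"
    using norm_weight_shell by blast
  show ?thesis
  proof (rule that[of "1 / a"])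
    fix k Q R assume Q: "Q \<in> tiling_shell \<delta> k"
    then have "\<zeta> Q \<in> annulus k" using center_in_annulus[of Q] by (simp add: tiling_shell_eq)
    have "(1 / a * (1 + real k) powr (\<tau> * s)) * (a * (1 + real k) powr (- \<tau> * s)) = 1"
    proof -
      have "(1 + real k) powr (\<tau> * s) * (1 + real k) powr (- \<tau> * s) = 1"
        by (simp only: mult_minus_left flip: powr_add) simp
      then show ?thesis using ab(1) by (simp add: field_simps)
    qed
    then have "emeasure \<mu> (ball (\<zeta> Q) R) = ennreal ((1 / a * (1 + real k) powr (\<tau> * s)) * (a * (1 + real k) powr (- \<tau> * s))) * emeasure \<mu> (ball (\<zeta> Q) R)"
      by (simp only: ennreal_1 mult_1)
    also have "\<dots> = ennreal (1 / a * (1 + real k) powr (\<tau> * s)) * (ennreal (a * (1 + real k) powr (- \<tau> * s)) * emeasure \<mu> (ball (\<zeta> Q) R))"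
      using ab(1) by (subst ennreal_mult) (auto simp: mult.assoc)
    also have "\<dots> \<le> ennreal (1 / a * (1 + real k) powr (\<tau> * s)) * (norm_weight (\<zeta> Q) * emeasure \<mu> (ball (\<zeta> Q) R))"
      by (intro mult_left_mono mult_right_mono ab(3) \<open>\<zeta> Q \<in> annulus k\<close>) auto
    finally show "emeasure \<mu> (ball (\<zeta> Q) R) \<le> ennreal (1 / a * (1 + real k) powr (\<tau> * s)) * u R Q"
      by (simp add: pocket_mass_def ball_mass_def)
  qed (use ab in simp)
qed

abbreviation shell_mass where "shell_mass R \<equiv> seq_shell_norm \<delta> (star_exponent s p) (u R)"

text \<open>On a ball about the center of Q the integrand is at most (a Q / \<omega> k)^s, and the
  mass of the ball is at most a constant times (\<omega> k)^s u Q; the weights cancel and the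
  integral is bounded by the sum of a^s u. Hoelder with star exponents, within shells and then
  across them, separates the two factors. The case n = 0 gives the boundedness of the
  embedding.\<close>

lemma tail_bound:
  assumes R: "C_out * \<delta> \<le> R"
  obtains C where "C > 0" "\<And>c f n. synthesizes \<alpha> \<delta> c f \<Longrightarrow> f \<in> borel_measurable \<mu> \<Longrightarrow>
    (\<integral>\<^sup>+z. ennreal (Ls_integrand \<alpha> s f z) * indicator {z. real n \<le> cmod z} z \<partial>\<mu>) \<le>
      ennreal C * enn_powr (weighted_norm \<delta> p q c) s * lp_enorm (star_exponent s q) UNIV (shell_tail (shell_mass R) n)"
proof -
  obtain C1 where C1: "C1 > 0" "\<And>c f. synthesizes \<alpha> \<delta> c f \<Longrightarrow>
    \<exists>a. lp_enorm q UNIV (\<lambda>k. lp_enorm p (tiling_shell \<delta> k) a) \<le> ennreal C1 * weighted_norm \<delta> p q c \<and>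
      (\<forall>k Q z. Q \<in> tiling_shell \<delta> k \<longrightarrow> dist z (\<zeta> Q) < R \<longrightarrow>
        ennreal (\<omega> k) * ennreal (cmod (f z) * exp (- (\<alpha> / 2) * (cmod z)\<^sup>2)) \<le> a Q)"
    using synthesis_shell_bound by blast
  obtain C2 where C2: "C2 > 0" "\<And>k Q R. Q \<in> tiling_shell \<delta> k \<Longrightarrow> emeasure \<mu> (ball (\<zeta> Q) R) \<le> ennreal (C2 * (1 + real k) powr (\<tau> * s)) * u R Q"
    using emeasure_ball_le_pocket_mass by blast
  show ?thesis
  proof (rule that[of "C2 * C1 powr s"])
    show "C2 * C1 powr s > 0" using C1 C2 by simp
    fix c f and n :: nat assume syn: "synthesizes \<alpha> \<delta> c f" and f: "f \<in> borel_measurable \<mu>"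
    let ?g = "\<lambda>z. ennreal (Ls_integrand \<alpha> s f z)"
    have [measurable]: "?g \<in> borel_measurable \<mu>"
      using Ls_integrand_measurable[OF sets_\<mu> f] by (rule measurable_compose[OF _ measurable_ennreal])
    obtain a where a: "lp_enorm q UNIV (\<lambda>k. lp_enorm p (tiling_shell \<delta> k) a) \<le> ennreal C1 * weighted_norm \<delta> p q c"
      "\<And>k Q z. Q \<in> tiling_shell \<delta> k \<Longrightarrow> dist z (\<zeta> Q) < R \<Longrightarrow>
        ennreal (\<omega> k) * ennreal (cmod (f z) * exp (- (\<alpha> / 2) * (cmod z)\<^sup>2)) \<le> a Q"
      using C1(2)[OF syn] by meson
    have ball_set: "ball x r \<in> sets \<mu>" for x r
      unfolding sets_\<mu> by (rule borel_open[OF open_ball])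
    have piece: "(\<integral>\<^sup>+z. ?g z * indicator (ball (\<zeta> Q) R) z \<partial>\<mu>) \<le> ennreal C2 * (enn_powr (a Q) s * u R Q)"
      if Q: "Q \<in> tiling_shell \<delta> k" for k Q
    proof -
      let ?w = "(1 + real k) powr (\<tau> * s)"
      have w: "?w > 0" by simp
      have pt: "?g z \<le> ennreal (1 / ?w) * enn_powr (a Q) s" if "z \<in> ball (\<zeta> Q) R" for z
      proof -
        have "enn_powr (ennreal (\<omega> k) * ennreal (cmod (f z) * exp (- (\<alpha> / 2) * (cmod z)\<^sup>2))) s \<le> enn_powr (a Q) s"
          using a(2)[OF Q] that s_pos by (intro enn_powr_mono) (auto simp: dist_commute)
        moreover have "enn_powr (ennreal (\<omega> k) * ennreal (cmod (f z) * exp (- (\<alpha> / 2) * (cmod z)\<^sup>2))) s = ennreal ?w * ?g z"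
          unfolding enn_powr_mult by (simp add: enn_powr_ennreal powr_powr Ls_integrand_alt)
        ultimately have "ennreal (1 / ?w) * (ennreal ?w * ?g z) \<le> ennreal (1 / ?w) * enn_powr (a Q) s"
          by (intro mult_left_mono) auto
        moreover have "ennreal (1 / ?w) * (ennreal ?w * ?g z) = ?g z"
          using w by (simp add: mult.assoc[symmetric] flip: ennreal_mult)
        ultimately show ?thesis by (simp only:)
      qed
      have "(\<integral>\<^sup>+z. ?g z * indicator (ball (\<zeta> Q) R) z \<partial>\<mu>) \<le> (\<integral>\<^sup>+z. ennreal (1 / ?w) * enn_powr (a Q) s * indicator (ball (\<zeta> Q) R) z \<partial>\<mu>)"
        using pt by (intro nn_integral_mono) (simp add: indicator_def del: mem_ball)
      also have "\<dots> = ennreal (1 / ?w) * enn_powr (a Q) s * emeasure \<mu> (ball (\<zeta> Q) R)"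
        by (rule nn_integral_cmult_indicator[OF ball_set])
      also have "\<dots> \<le> ennreal (1 / ?w) * enn_powr (a Q) s * (ennreal (C2 * ?w) * u R Q)"
        by (intro mult_left_mono C2(2)[OF Q]) auto
      also have "\<dots> = (ennreal (1 / ?w) * ennreal (C2 * ?w)) * (enn_powr (a Q) s * u R Q)"
        by (simp only: mult_ac)
      also have "ennreal (1 / ?w) * ennreal (C2 * ?w) = ennreal C2"
        using w C2(1) by (simp flip: ennreal_mult)
      finally show ?thesis .
    qed
    have "(\<integral>\<^sup>+z. ?g z * indicator {z. real n \<le> cmod z} z \<partial>\<mu>) \<le>
        (\<integral>\<^sup>+z. (\<Sum>k. shell_tail (\<lambda>k. \<Sum>Q\<in>tiling_shell \<delta> k. ?g z * indicator (ball (\<zeta> Q) R) z) n k) \<partial>\<mu>)"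
    proof (rule nn_integral_mono)
      fix z
      show "?g z * indicator {z. real n \<le> cmod z} z \<le> (\<Sum>k. shell_tail (\<lambda>k. \<Sum>Q\<in>tiling_shell \<delta> k. ?g z * indicator (ball (\<zeta> Q) R) z) n k)"
      proof (cases "real n \<le> cmod z")
        case True
        define k where "k = nat \<lfloor>cmod z\<rfloor>"
        \<comment> \<open>A point with |z| \<ge> n lies in a shell of index at least n, so only the
          tail of the masses is used.\<close>
        have nk: "n \<le> k" using True by (simp add: k_def le_nat_floor)
        obtain Q where Q: "Q \<in> tiling_shell \<delta> k" "dist z (\<zeta> Q) < C_out * \<delta>"
          using cover_ball[OF annulus_floor, of z] unfolding k_def by blast
        have "z \<in> ball (\<zeta> Q) R" using Q(2) R by (simp add: dist_commute)
        then have "?g z = ?g z * indicator (ball (\<zeta> Q) R) z" by (simp del: mem_ball)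
        also have "\<dots> \<le> (\<Sum>Q\<in>tiling_shell \<delta> k. ?g z * indicator (ball (\<zeta> Q) R) z)"
          by (rule member_le_sum[OF Q(1)]) auto
        also have "\<dots> = shell_tail (\<lambda>k. \<Sum>Q\<in>tiling_shell \<delta> k. ?g z * indicator (ball (\<zeta> Q) R) z) n k"
          using nk by (simp add: shell_tail_def)
        also have "\<dots> \<le> (\<Sum>k. shell_tail (\<lambda>k. \<Sum>Q\<in>tiling_shell \<delta> k. ?g z * indicator (ball (\<zeta> Q) R) z) n k)"
          by (rule ennreal_le_suminf)
        finally show ?thesis using True by simp
      qed simp
    qed
    also have "\<dots> = (\<Sum>k. \<integral>\<^sup>+z. shell_tail (\<lambda>k. \<Sum>Q\<in>tiling_shell \<delta> k. ?g z * indicator (ball (\<zeta> Q) R) z) n k \<partial>\<mu>)"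
    proof (rule nn_integral_suminf)
      fix k
      have "(\<lambda>z. ?g z * indicator (ball (\<zeta> Q) R) z) \<in> borel_measurable \<mu>" for Q
        by (intro borel_measurable_times_ennreal borel_measurable_indicator ball_set) measurable
      then have "(\<lambda>z. \<Sum>Q\<in>tiling_shell \<delta> k. ?g z * indicator (ball (\<zeta> Q) R) z) \<in> borel_measurable \<mu>"
        by (intro borel_measurable_sum)
      then show "(\<lambda>z. shell_tail (\<lambda>k. \<Sum>Q\<in>tiling_shell \<delta> k. ?g z * indicator (ball (\<zeta> Q) R) z) n k) \<in> borel_measurable \<mu>"
        by (cases "n \<le> k") (simp_all add: shell_tail_def)
    qed
    also have "\<dots> \<le> (\<Sum>k. ennreal C2 * (enn_powr (lp_enorm p (tiling_shell \<delta> k) a) s * shell_tail (shell_mass R) n k))"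
    proof (rule suminf_le)
      fix k
      show "(\<integral>\<^sup>+z. shell_tail (\<lambda>k. \<Sum>Q\<in>tiling_shell \<delta> k. ?g z * indicator (ball (\<zeta> Q) R) z) n k \<partial>\<mu>) \<le>
        ennreal C2 * (enn_powr (lp_enorm p (tiling_shell \<delta> k) a) s * shell_tail (shell_mass R) n k)"
      proof (cases "n \<le> k")
        case True
        have "(\<integral>\<^sup>+z. (\<Sum>Q\<in>tiling_shell \<delta> k. ?g z * indicator (ball (\<zeta> Q) R) z) \<partial>\<mu>) = (\<Sum>Q\<in>tiling_shell \<delta> k. \<integral>\<^sup>+z. ?g z * indicator (ball (\<zeta> Q) R) z \<partial>\<mu>)"
        proof (rule nn_integral_sum)
          show "(\<lambda>z. ?g z * indicator (ball (\<zeta> Q) R) z) \<in> borel_measurable \<mu>" for Q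
            by (intro borel_measurable_times_ennreal borel_measurable_indicator ball_set) measurable
        qed
        also have "\<dots> \<le> (\<Sum>Q\<in>tiling_shell \<delta> k. ennreal C2 * (enn_powr (a Q) s * u R Q))"
          by (intro sum_mono piece)
        also have "\<dots> = ennreal C2 * (\<integral>\<^sup>+Q. enn_powr (a Q) s * u R Q \<partial>count_space (tiling_shell \<delta> k))"
          by (simp add: nn_integral_count_space_finite sum_distrib_left)
        also have "\<dots> \<le> ennreal C2 * (enn_powr (lp_enorm p (tiling_shell \<delta> k) a) s * shell_mass R k)"
          unfolding seq_shell_norm_def by (intro mult_left_mono Holder_star_exponent p_pos s_pos) simp
        finally show ?thesis using True by (simp add: shell_tail_def)
      qed (simp add: shell_tail_def)
    qed auto
    also have "\<dots> = ennreal C2 * (\<integral>\<^sup>+k. enn_powr (lp_enorm p (tiling_shell \<delta> k) a) s * shell_tail (shell_mass R) n k \<partial>count_space UNIV)"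
      by (simp add: nn_integral_count_space_nat)
    also have "\<dots> \<le> ennreal C2 * (enn_powr (lp_enorm q UNIV (\<lambda>k. lp_enorm p (tiling_shell \<delta> k) a)) s * lp_enorm (star_exponent s q) UNIV (shell_tail (shell_mass R) n))"
      by (intro mult_left_mono Holder_star_exponent q_pos s_pos) simp
    also have "\<dots> \<le> ennreal C2 * (enn_powr (ennreal C1 * weighted_norm \<delta> p q c) s * lp_enorm (star_exponent s q) UNIV (shell_tail (shell_mass R) n))"
      using s_pos by (intro mult_left_mono mult_right_mono enn_powr_mono a) auto
    also have "\<dots> = ennreal (C2 * C1 powr s) * enn_powr (weighted_norm \<delta> p q c) s * lp_enorm (star_exponent s q) UNIV (shell_tail (shell_mass R) n)"
      using C1(1) C2(1) by (simp add: enn_powr_mult enn_powr_ennreal ennreal_mult mult.assoc)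
    finally show "(\<integral>\<^sup>+z. ?g z * indicator {z. real n \<le> cmod z} z \<partial>\<mu>) \<le>
      ennreal (C2 * C1 powr s) * enn_powr (weighted_norm \<delta> p q c) s * lp_enorm (star_exponent s q) UNIV (shell_tail (shell_mass R) n)" .
  qed
qed

text \<open>Local finiteness of the measure has to be derived: a disc is covered by finitely many of
  the balls about centers, and the shell condition makes every single mass finite.\<close>

lemma emeasure_ball_finite:
  assumes "shell_condition s q (shell_mass R)" "C_out * \<delta> \<le> R"
  shows "emeasure \<mu> {z. cmod z < real n} < top"
proof -
  obtain C where C: "C > 0" "\<And>k Q R. Q \<in> tiling_shell \<delta> k \<Longrightarrow> emeasure \<mu> (ball (\<zeta> Q) R) \<le> ennreal (C * (1 + real k) powr (\<tau> * s)) * u R Q"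
    using emeasure_ball_le_pocket_mass by blast
  have fin: "emeasure \<mu> (ball (\<zeta> Q) R) < top" if Q: "Q \<in> tiling_shell \<delta> k" for Q k
  proof -
    have "u R Q \<le> shell_mass R k"
      unfolding seq_shell_norm_def using Q by (intro lp_enorm_upper star_exponent_pos)
    also have "\<dots> < top" by (rule shell_condition_tail(3)[OF assms(1) s_pos])
    finally have "ennreal (C * (1 + real k) powr (\<tau> * s)) * u R Q < top" by (simp add: ennreal_mult_less_top)
    then show ?thesis using C(2)[OF Q, of R] le_less_trans by blast
  qed
  let ?I = "SIGMA k:{..<n}. tiling_shell \<delta> k"
  have finI: "finite ?I" by auto
  have sub: "(\<lambda>i. ball (\<zeta> (snd i)) R) ` ?I \<subseteq> sets \<mu>"
    unfolding sets_\<mu> by (intro image_subsetI borel_open open_ball)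
  have "{z. cmod z < real n} \<subseteq> (\<Union>i\<in>?I. ball (\<zeta> (snd i)) R)"
  proof
    fix z assume "z \<in> {z. cmod z < real n}"
    then have k: "nat \<lfloor>cmod z\<rfloor> < n" by (simp add: nat_less_iff floor_less_iff)
    obtain Q where Q: "Q \<in> tiling_shell \<delta> (nat \<lfloor>cmod z\<rfloor>)" "dist z (\<zeta> Q) < C_out * \<delta>"
      using cover_ball[OF annulus_floor, of z] by blast
    have "z \<in> ball (\<zeta> (snd (nat \<lfloor>cmod z\<rfloor>, Q))) R" using Q assms(2) by (simp add: dist_commute)
    moreover have "(nat \<lfloor>cmod z\<rfloor>, Q) \<in> ?I" using k Q by simp
    ultimately show "z \<in> (\<Union>i\<in>?I. ball (\<zeta> (snd i)) R)" by (rule UN_I[rotated])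
  qed
  moreover have "(\<Union>i\<in>?I. ball (\<zeta> (snd i)) R) \<in> sets \<mu>"
    using sub by (intro sets.finite_UN finI) blast
  ultimately have "emeasure \<mu> {z. cmod z < real n} \<le> emeasure \<mu> (\<Union>i\<in>?I. ball (\<zeta> (snd i)) R)"
    by (rule emeasure_mono)
  also have "\<dots> \<le> (\<Sum>i\<in>?I. emeasure \<mu> (ball (\<zeta> (snd i)) R))"
    by (rule emeasure_subadditive_finite[OF finI sub])
  also have "\<dots> < top"
    using fin finI by (subst ennreal_sum_less_top) auto
  finally show ?thesis .
qed

end

section \<open>Compactness of the embedding\<close>

lemma nn_integral_limit_le:
  fixes u :: "nat \<Rightarrow> 'a \<Rightarrow> ennreal"
  assumes "\<And>n. u n \<in> borel_measurable M" "\<And>x. (\<lambda>n. u n x) \<longlonglongrightarrow> v x" "\<And>n. (\<integral>\<^sup>+x. u n x \<partial>M) \<le> X"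
  shows "(\<integral>\<^sup>+x. v x \<partial>M) \<le> X"
proof -
  have "v x = liminf (\<lambda>n. u n x)" for x
    using lim_imp_Liminf[OF _ assms(2)[of x]] by simp
  then have "(\<integral>\<^sup>+x. v x \<partial>M) = (\<integral>\<^sup>+x. liminf (\<lambda>n. u n x) \<partial>M)" by simp
  also have "\<dots> \<le> liminf (\<lambda>n. \<integral>\<^sup>+x. u n x \<partial>M)"
    by (rule nn_integral_liminf[OF assms(1)])
  also have "\<dots> \<le> X"
    using assms(3) by (intro order_trans[OF Liminf_le_Limsup Limsup_bounded]) auto
  finally show ?thesis .
qed

lemma Ls_integrand_tendsto:
  assumes "(\<lambda>n. h n z) \<longlonglongrightarrow> g z" "s > 0"
  shows "(\<lambda>n. ennreal (Ls_integrand \<alpha> s (h n) z)) \<longlonglongrightarrow> ennreal (Ls_integrand \<alpha> s g z)"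
  unfolding Ls_integrand_def using assms
  by (intro tendsto_ennrealI tendsto_mult tendsto_const tendsto_powr' tendsto_norm) auto

text \<open>The sum is replaced by twice the maximum, which is crude but works for all s > 0 without
  separating s < 1.\<close>

lemma Ls_integrand_diff_le:
  assumes "s > 0"
  shows "Ls_integrand \<alpha> s (f - g) z \<le> 2 powr s * (Ls_integrand \<alpha> s f z + Ls_integrand \<alpha> s g z)"
proof -
  let ?e = "exp (- (\<alpha> / 2) * (cmod z)\<^sup>2)"
  let ?a = "cmod (f z) * ?e" and ?b = "cmod (g z) * ?e"
  have "cmod ((f - g) z) * ?e \<le> (cmod (f z) + cmod (g z)) * ?e"
    by (intro mult_right_mono) (auto intro: norm_triangle_ineq4)
  also have "\<dots> \<le> 2 * max ?a ?b" by (simp add: distrib_right)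
  finally have "(cmod ((f - g) z) * ?e) powr s \<le> (2 * max ?a ?b) powr s"
    using assms by (intro powr_mono2) auto
  also have "\<dots> = 2 powr s * (max ?a ?b) powr s" by (simp add: powr_mult)
  also have "\<dots> \<le> 2 powr s * (?a powr s + ?b powr s)"
    by (intro mult_left_mono) (auto simp: max_def)
  finally show ?thesis unfolding Ls_integrand_alt .
qed

section \<open>The quasi-norm topology as a pseudometric topology\<close>

context fock_tiling
begin

abbreviation Ls where "Ls \<equiv> weighted_Ls \<alpha> s \<mu>"
abbreviation ls_norm where "ls_norm \<equiv> weighted_Ls_norm \<alpha> s \<mu>"
abbreviation ls_int where "ls_int f \<equiv> \<integral>\<^sup>+z. ennreal (Ls_integrand \<alpha> s f z) \<partial>\<mu>"
abbreviation ls_dist where "ls_dist \<equiv> Ls_dist \<alpha> s \<mu>"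
abbreviation fock where "fock \<equiv> fock_space \<alpha> p q"
abbreviation fock_ball where "fock_ball \<equiv> {f \<in> fock. fock_norm \<alpha> p q f \<le> 1}"

lemma ls_norm_less_iff: "ls_norm f < ennreal x \<longleftrightarrow> ls_int f < ennreal (x powr s)" if "x \<ge> 0"
  using s_pos that by (simp add: weighted_Ls_norm_alt enn_powr_less_iff enn_powr_ennreal)

lemma ls_norm_finite_iff: "ls_norm f < top \<longleftrightarrow> ls_int f < top"
  using s_pos by (simp add: weighted_Ls_norm_alt)

lemma ls_diff: "f \<in> Ls \<Longrightarrow> g \<in> Ls \<Longrightarrow> f - g \<in> Ls"
proof -
  assume fg: "f \<in> Ls" "g \<in> Ls"
  then have m: "f \<in> borel_measurable \<mu>" "g \<in> borel_measurable \<mu>" by (auto simp: weighted_Ls_def)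
  have "enn_powr (ls_norm (f - g)) (min 1 s) \<le> enn_powr (ls_norm f) (min 1 s) + enn_powr (ls_norm g) (min 1 s)"
    by (rule weighted_Ls_norm_triangle[OF s_pos sets_\<mu> m]) (auto intro: norm_triangle_ineq4)
  also have "\<dots> < top" using fg by (simp add: weighted_Ls_def)
  finally have "ls_norm (f - g) < top" by simp
  moreover have "f - g \<in> borel_measurable \<mu>"
    unfolding fun_diff_def using m by (rule borel_measurable_diff)
  ultimately show ?thesis by (simp add: weighted_Ls_def)
qed

lemma ls_dist_less_norm:
  assumes "f \<in> Ls" "g \<in> Ls" "r > 0"
  shows "ls_dist f g < r \<longleftrightarrow> ls_norm (f - g) < ennreal (r powr (1 / min 1 s))"
proof -
  let ?t = "min 1 s"
  have t: "?t > 0" using s_pos by simp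
  have "ls_norm (f - g) < top" using ls_diff[OF assms(1,2)] by (simp add: weighted_Ls_def)
  then have "enn_powr (ls_norm (f - g)) ?t < top" by simp
  then have "ls_dist f g < r \<longleftrightarrow> enn_powr (ls_norm (f - g)) ?t < ennreal r"
    using assms(3) unfolding Ls_dist_def by (cases "enn_powr (ls_norm (f - g)) ?t") (auto simp: ennreal_less_iff)
  also have "\<dots> \<longleftrightarrow> ls_norm (f - g) < ennreal (r powr (1 / ?t))"
    using t assms(3) by (simp add: enn_powr_less_iff enn_powr_ennreal)
  finally show ?thesis .
qed

lemma ls_dist_less_int:
  assumes "f \<in> Ls" "g \<in> Ls" "r > 0"
  shows "ls_dist f g < r \<longleftrightarrow> ls_int (f - g) < ennreal (r powr (s / min 1 s))"
  unfolding ls_dist_less_norm[OF assms] by (subst ls_norm_less_iff) (auto simp: powr_powr)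

text \<open>On the space the distance is a fixed positive power of the quasi-norm, so the two kinds
  of balls are the same sets with changed radii and generate the same open sets.\<close>

lemma ls_pseudometric: "pseudometric (quasinorm_topology Ls ls_norm) Ls ls_dist"
proof
  let ?t = "min 1 s"
  have t: "?t > 0" using s_pos by simp
  have fin: "enn_powr (ls_norm (f - g)) ?t < top" if "f \<in> Ls" "g \<in> Ls" for f g
    using ls_diff[OF that] by (simp add: weighted_Ls_def)
  show "openin (quasinorm_topology Ls ls_norm) S \<longleftrightarrow> S \<subseteq> Ls \<and> (\<forall>x\<in>S. \<exists>e>0. \<forall>y\<in>Ls. ls_dist y x < e \<longrightarrow> y \<in> S)" for S
  proof -
    have "(\<exists>e>0. \<forall>g\<in>Ls. ls_norm (g - f) < e \<longrightarrow> g \<in> S) \<longleftrightarrow> (\<exists>e>0. \<forall>g\<in>Ls. ls_dist g f < e \<longrightarrow> g \<in> S)" if f: "f \<in> Ls" for f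
    proof
      assume "\<exists>e>0. \<forall>g\<in>Ls. ls_norm (g - f) < e \<longrightarrow> g \<in> S"
      then obtain e where e: "e > 0" "\<And>g. g \<in> Ls \<Longrightarrow> ls_norm (g - f) < e \<Longrightarrow> g \<in> S" by blast
      \<comment> \<open>The radius in the topology may be infinite, whereas the distance is
        real-valued.\<close>
      obtain x where x: "x > 0" "ennreal x \<le> e"
      proof (cases e)
        case (real x)
        then show ?thesis using e(1) that[of x] by simp
      next
        case top
        then show ?thesis using that[of 1] by simp
      qed
      have "g \<in> S" if g: "g \<in> Ls" "ls_dist g f < x powr ?t" for g
      proof -
        have "ls_norm (g - f) < ennreal ((x powr ?t) powr (1 / ?t))"
          using ls_dist_less_norm[OF g(1) f, of "x powr ?t"] g(2) x by simp
        also have "(x powr ?t) powr (1 / ?t) = x" using t x by (simp add: powr_powr)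
        also note x(2)
        finally show ?thesis using e(2) g by blast
      qed
      then show "\<exists>e>0. \<forall>g\<in>Ls. ls_dist g f < e \<longrightarrow> g \<in> S"
        using x by (intro exI[of _ "x powr ?t"]) auto
    next
      assume "\<exists>e>0. \<forall>g\<in>Ls. ls_dist g f < e \<longrightarrow> g \<in> S"
      then obtain e where e: "e > 0" "\<And>g. g \<in> Ls \<Longrightarrow> ls_dist g f < e \<Longrightarrow> g \<in> S" by blast
      have "g \<in> S" if "g \<in> Ls" "ls_norm (g - f) < ennreal (e powr (1 / ?t))" for g
        using e(2)[OF that(1)] ls_dist_less_norm[OF that(1) f e(1)] that(2) by simp
      then show "\<exists>e>0. \<forall>g\<in>Ls. ls_norm (g - f) < e \<longrightarrow> g \<in> S"
        using e(1) by (intro exI[of _ "ennreal (e powr (1 / ?t))"]) auto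
    qed
    then show ?thesis unfolding openin_quasinorm_topology
      by (intro conj_cong ball_cong refl) (blast dest: subsetD)
  qed
  fix f g h assume f: "f \<in> Ls"
  show "ls_dist f f = 0"
    using s_pos by (simp add: Ls_dist_def weighted_Ls_norm_alt Ls_integrand_def)
  assume g: "g \<in> Ls"
  show "0 \<le> ls_dist f g" by (simp add: Ls_dist_def)
  show "ls_dist f g = ls_dist g f"
    by (simp add: Ls_dist_def weighted_Ls_norm_alt Ls_integrand_def norm_minus_commute)
  assume h: "h \<in> Ls"
  have "enn_powr (ls_norm (f - h)) ?t \<le> enn_powr (ls_norm (f - g)) ?t + enn_powr (ls_norm (g - h)) ?t"
  proof (rule weighted_Ls_norm_triangle[OF s_pos sets_\<mu>])
    show "f - g \<in> borel_measurable \<mu>" "g - h \<in> borel_measurable \<mu>"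
      using ls_diff[OF f g] ls_diff[OF g h] by (auto simp: weighted_Ls_def)
    show "cmod ((f - h) z) \<le> cmod ((f - g) z) + cmod ((g - h) z)" for z
      using norm_triangle_ineq[of "f z - g z" "g z - h z"] by simp
  qed
  then have "ls_dist f h \<le> enn2real (enn_powr (ls_norm (f - g)) ?t + enn_powr (ls_norm (g - h)) ?t)"
    unfolding Ls_dist_def using fin[OF f g] fin[OF g h] by (intro enn2real_mono) auto
  also have "\<dots> = ls_dist f g + ls_dist g h"
    unfolding Ls_dist_def using fin[OF f g] fin[OF g h] by (intro enn2real_plus) auto
  finally show "ls_dist f h \<le> ls_dist f g + ls_dist g h" .
qed

lemma holomorphic_measurable: "f holomorphic_on UNIV \<Longrightarrow> f \<in> borel_measurable \<mu>"
  using borel_measurable_continuous_onI[OF holomorphic_on_imp_continuous_on, of f] sets_\<mu>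
  by (simp cong: measurable_cong_sets)

lemma fock_measurable: "f \<in> fock \<Longrightarrow> f \<in> borel_measurable \<mu>"
  by (rule holomorphic_measurable) (simp add: fock_space_def)

end

section \<open>Consequences of the atomic decomposition\<close>

locale fock_atomic = fock_tiling +
  fixes \<delta>\<^sub>0 :: real
  assumes AD: "atomic_decomposition \<alpha> p q \<delta>\<^sub>0" and \<delta>_less: "\<delta> < \<delta>\<^sub>0"
begin

text \<open>Boundedness of synthesis only provides some function with the given coefficients. Sums
  are unique, and for finitely supported coefficients this identifies it with the finite sum of
  kernels.\<close>

lemma finite_synthesis_in_ball:
  obtains C where "C > 0" "\<And>F c. finite F \<Longrightarrow> F \<subseteq> tiling \<delta> \<Longrightarrow>
    weighted_norm \<delta> p q (\<lambda>Q. if Q \<in> F then c Q else 0) \<le> ennreal (1 / C) \<Longrightarrow>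
    (\<lambda>z. \<Sum>Q\<in>F. c Q * kernel \<alpha> (\<zeta> Q) z) \<in> fock_ball"
proof -
  have "\<exists>C>0. \<forall>c\<in>weighted_space \<delta> p q. \<exists>f\<in>fock.
      synthesizes \<alpha> \<delta> c f \<and> fock_norm \<alpha> p q f \<le> ennreal C * weighted_norm \<delta> p q c"
    using AD \<delta>_pos \<delta>_less unfolding atomic_decomposition_def by blast
  then obtain C where C: "C > 0" "\<And>c. c \<in> weighted_space \<delta> p q \<Longrightarrow> \<exists>f\<in>fock.
      synthesizes \<alpha> \<delta> c f \<and> fock_norm \<alpha> p q f \<le> ennreal C * weighted_norm \<delta> p q c" by blast
  show ?thesis
  proof (rule that[OF C(1)])
    fix F and c :: "pocket_index \<Rightarrow> complex" assume F: "finite F" "F \<subseteq> tiling \<delta>"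
    let ?c = "\<lambda>Q. if Q \<in> F then c Q else 0"
    assume le: "weighted_norm \<delta> p q ?c \<le> ennreal (1 / C)"
    then have "?c \<in> weighted_space \<delta> p q"
      unfolding weighted_space_def using le_less_trans[OF le ennreal_less_top] by simp
    then obtain f where f: "f \<in> fock" "synthesizes \<alpha> \<delta> ?c f" "fock_norm \<alpha> p q f \<le> ennreal C * weighted_norm \<delta> p q ?c"
      using C(2) by blast
    have "f z = (\<Sum>Q\<in>F. c Q * kernel \<alpha> (\<zeta> Q) z)" for z
    proof -
      have "((\<lambda>Q. ?c Q * kernel \<alpha> (\<zeta> Q) z) has_sum f z) (tiling \<delta>)"
        using f(2) by (simp only: synthesizes_def)
      moreover have "((\<lambda>Q. ?c Q * kernel \<alpha> (\<zeta> Q) z) has_sum (\<Sum>Q\<in>F. ?c Q * kernel \<alpha> (\<zeta> Q) z)) (tiling \<delta>)"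
        using F by (intro has_sum_finite_neutralI) auto
      ultimately have "f z = (\<Sum>Q\<in>F. ?c Q * kernel \<alpha> (\<zeta> Q) z)"
        by (rule has_sum_unique)
      then show ?thesis by simp
    qed
    then have eq: "f = (\<lambda>z. \<Sum>Q\<in>F. c Q * kernel \<alpha> (\<zeta> Q) z)" by (rule ext)
    have "fock_norm \<alpha> p q f \<le> ennreal C * ennreal (1 / C)"
      by (rule order_trans[OF f(3) mult_left_mono[OF le]]) simp
    also have "\<dots> = 1" using C(1) by (simp flip: ennreal_mult)
    finally show "(\<lambda>z. \<Sum>Q\<in>F. c Q * kernel \<alpha> (\<zeta> Q) z) \<in> fock_ball"
      using f(1) eq by simp
  qed
qed

lemma fock_coefficients:
  assumes "f \<in> fock"
  obtains c where "weighted_norm \<delta> p q c < top" "synthesizes \<alpha> \<delta> c f"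
proof -
  have "\<forall>f\<in>fock. \<exists>c\<in>weighted_space \<delta> p q. synthesizes \<alpha> \<delta> c f"
    using AD \<delta>_pos \<delta>_less unfolding atomic_decomposition_def by blast
  then show ?thesis using assms that by (auto simp: weighted_space_def)
qed

text \<open>The lower half of the norm equivalence bounds the infimum over all representations by C;
  a particular one is then chosen within C + 1, as the infimum may not be attained.\<close>

lemma fock_ball_coefficients:
  obtains C where "C > 0" "\<And>f. f \<in> fock_ball \<Longrightarrow> \<exists>c. weighted_norm \<delta> p q c \<le> ennreal C \<and> synthesizes \<alpha> \<delta> c f"
proof -
  let ?Q = "\<lambda>f. INF c\<in>{c \<in> weighted_space \<delta> p q. synthesizes \<alpha> \<delta> c f}. weighted_norm \<delta> p q c"
  have "\<exists>C>0. \<forall>f\<in>fock. ennreal (inverse C) * ?Q f \<le> fock_norm \<alpha> p q f \<and> fock_norm \<alpha> p q f \<le> ennreal C * ?Q f"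
    using AD \<delta>_pos \<delta>_less unfolding atomic_decomposition_def Let_def by blast
  then obtain C where C: "C > 0" "\<And>f. f \<in> fock \<Longrightarrow> ennreal (inverse C) * ?Q f \<le> fock_norm \<alpha> p q f" by blast
  show ?thesis
  proof (rule that[of "C + 1"])
    fix f assume f: "f \<in> fock_ball"
    have "ennreal (inverse C) * ?Q f \<le> 1" using C(2)[of f] f by (auto intro: order_trans)
    then have "ennreal C * (ennreal (inverse C) * ?Q f) \<le> ennreal C * 1" by (intro mult_left_mono) auto
    moreover have "ennreal C * (ennreal (inverse C) * ?Q f) = ?Q f"
      using C(1) by (simp add: mult.assoc[symmetric] flip: ennreal_mult)
    ultimately have "?Q f \<le> ennreal C" by simp
    also have "ennreal C < ennreal (C + 1)" using C(1) by (simp add: ennreal_less_iff)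
    finally obtain c where "c \<in> weighted_space \<delta> p q" "synthesizes \<alpha> \<delta> c f" "weighted_norm \<delta> p q c < ennreal (C + 1)"
      unfolding INF_less_iff by blast
    then show "\<exists>c. weighted_norm \<delta> p q c \<le> ennreal (C + 1) \<and> synthesizes \<alpha> \<delta> c f"
      using less_imp_le by blast
  qed (use C in simp)
qed

text \<open>The hypothesis of Montel's theorem. A single weighted value of f is at most the mixed
  norm of the majorant from \<open>synthesis_shell_bound\<close>, and on |z| < n both the shell
  weight and the Gaussian are bounded below.\<close>

lemma fock_ball_locally_bounded:
  obtains B where "\<And>f z. f \<in> fock_ball \<Longrightarrow> cmod z < real n \<Longrightarrow> cmod (f z) \<le> B"
proof -
  obtain C1 where C1: "C1 > 0" "\<And>f. f \<in> fock_ball \<Longrightarrow> \<exists>c. weighted_norm \<delta> p q c \<le> ennreal C1 \<and> synthesizes \<alpha> \<delta> c f"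
    using fock_ball_coefficients by blast
  obtain C2 where C2: "C2 > 0" "\<And>c f. synthesizes \<alpha> \<delta> c f \<Longrightarrow>
    \<exists>a. lp_enorm q UNIV (\<lambda>k. lp_enorm p (tiling_shell \<delta> k) a) \<le> ennreal C2 * weighted_norm \<delta> p q c \<and>
      (\<forall>k Q z. Q \<in> tiling_shell \<delta> k \<longrightarrow> dist z (\<zeta> Q) < C_out * \<delta> \<longrightarrow>
        ennreal (\<omega> k) * ennreal (cmod (f z) * exp (- (\<alpha> / 2) * (cmod z)\<^sup>2)) \<le> a Q)"
    using synthesis_shell_bound by blast
  define B where "B = C2 * C1 * (exp (\<bar>\<tau>\<bar> * real n)) * exp (\<alpha> / 2 * (real n)\<^sup>2)"
  show ?thesis
  proof (rule that[of B])
    fix f z assume f: "f \<in> fock_ball" and z: "cmod z < real n"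
    obtain c where c: "weighted_norm \<delta> p q c \<le> ennreal C1" "synthesizes \<alpha> \<delta> c f" using C1(2)[OF f] by blast
    obtain a where a: "lp_enorm q UNIV (\<lambda>k. lp_enorm p (tiling_shell \<delta> k) a) \<le> ennreal C2 * weighted_norm \<delta> p q c"
      "\<And>k Q z. Q \<in> tiling_shell \<delta> k \<Longrightarrow> dist z (\<zeta> Q) < C_out * \<delta> \<Longrightarrow>
        ennreal (\<omega> k) * ennreal (cmod (f z) * exp (- (\<alpha> / 2) * (cmod z)\<^sup>2)) \<le> a Q"
      using C2(2)[OF c(2)] by meson
    define k where "k = nat \<lfloor>cmod z\<rfloor>"
    have k: "k < n" using z by (simp add: k_def nat_less_iff floor_less_iff)
    obtain Q where Q: "Q \<in> tiling_shell \<delta> k" "dist z (\<zeta> Q) < C_out * \<delta>"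
      using cover_ball[OF annulus_floor, of z] unfolding k_def by blast
    have "ennreal (\<omega> k) * ennreal (cmod (f z) * exp (- (\<alpha> / 2) * (cmod z)\<^sup>2)) \<le> a Q" by (rule a(2)[OF Q])
    also have "a Q \<le> lp_enorm p (tiling_shell \<delta> k) a" by (rule lp_enorm_upper[OF p_pos Q(1)])
    also have "\<dots> \<le> lp_enorm q UNIV (\<lambda>k. lp_enorm p (tiling_shell \<delta> k) a)"
      by (rule lp_enorm_upper[OF q_pos UNIV_I, of "\<lambda>k. lp_enorm p (tiling_shell \<delta> k) a"])
    also have "\<dots> \<le> ennreal C2 * ennreal C1" by (rule order_trans[OF a(1) mult_left_mono[OF c(1)]]) simp
    finally have "ennreal (\<omega> k * (cmod (f z) * exp (- (\<alpha> / 2) * (cmod z)\<^sup>2))) \<le> ennreal (C2 * C1)"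
      using C1(1) C2(1) by (simp add: ennreal_mult)
    then have le: "\<omega> k * (cmod (f z) * exp (- (\<alpha> / 2) * (cmod z)\<^sup>2)) \<le> C2 * C1"
      using C1(1) C2(1) by (subst (asm) ennreal_le_iff) auto
    \<comment> \<open>From ln (1 + k) \<le> k < n, for either sign of \<tau>.\<close>
    have wk: "1 \<le> exp (\<bar>\<tau>\<bar> * real n) * \<omega> k"
    proof -
      have "ln (1 + real k) \<le> real n" using ln_add_one_self_le_self[of "real k"] k by simp
      then have "\<bar>\<tau>\<bar> * ln (1 + real k) \<le> \<bar>\<tau>\<bar> * real n" by (intro mult_left_mono) auto
      moreover have "- \<bar>\<tau>\<bar> * ln (1 + real k) \<le> \<tau> * ln (1 + real k)" by (intro mult_right_mono) auto
      ultimately have "0 \<le> \<bar>\<tau>\<bar> * real n + \<tau> * ln (1 + real k)" by linarith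
      then have "exp 0 \<le> exp (\<bar>\<tau>\<bar> * real n + \<tau> * ln (1 + real k))" by (simp only: exp_le_cancel_iff)
      then show ?thesis by (simp add: exp_add powr_def)
    qed
    have ez: "1 \<le> exp (\<alpha> / 2 * (real n)\<^sup>2) * exp (- (\<alpha> / 2) * (cmod z)\<^sup>2)"
    proof -
      have "(cmod z)\<^sup>2 \<le> (real n)\<^sup>2" using z by (intro power_mono) auto
      then have "\<alpha> / 2 * (cmod z)\<^sup>2 \<le> \<alpha> / 2 * (real n)\<^sup>2" using \<alpha>_pos by (intro mult_left_mono) auto
      then show ?thesis by (simp flip: exp_add)
    qed
    have "cmod (f z) * (1 * 1) \<le> cmod (f z) * ((exp (\<bar>\<tau>\<bar> * real n) * \<omega> k) * (exp (\<alpha> / 2 * (real n)\<^sup>2) * exp (- (\<alpha> / 2) * (cmod z)\<^sup>2)))"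
      by (intro mult_left_mono mult_mono wk ez) auto
    also have "\<dots> = (exp (\<bar>\<tau>\<bar> * real n) * exp (\<alpha> / 2 * (real n)\<^sup>2)) * (\<omega> k * (cmod (f z) * exp (- (\<alpha> / 2) * (cmod z)\<^sup>2)))"
      by (simp only: mult_ac)
    also have "\<dots> \<le> (exp (\<bar>\<tau>\<bar> * real n) * exp (\<alpha> / 2 * (real n)\<^sup>2)) * (C2 * C1)"
      by (intro mult_left_mono le) auto
    also have "\<dots> = B" by (simp only: B_def mult_ac)
    finally show "cmod (f z) \<le> B" by simp
  qed
qed

lemma compact_embedding:
  assumes R: "C_out * \<delta> \<le> R" and cond: "shell_condition s q (shell_mass R)"
  shows "vanishing_Carleson \<alpha> p q s \<mu>"
proof -
  define t where "t n = lp_enorm (star_exponent s q) UNIV (shell_tail (shell_mass R) n)" for n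
  have t_lim: "t \<longlonglongrightarrow> 0" using shell_condition_tail(1)[OF cond s_pos] by (simp add: t_def[abs_def])
  have t_fin: "t n < top" for n
  proof -
    have "t n \<le> lp_enorm (star_exponent s q) UNIV (shell_mass R)"
      unfolding t_def by (intro lp_enorm_mono star_exponent_pos) (simp add: shell_tail_def)
    then show ?thesis using shell_condition_tail(2)[OF cond s_pos] le_less_trans by blast
  qed
  obtain C where C: "C > 0" "\<And>c f n. synthesizes \<alpha> \<delta> c f \<Longrightarrow> f \<in> borel_measurable \<mu> \<Longrightarrow>
    (\<integral>\<^sup>+z. ennreal (Ls_integrand \<alpha> s f z) * indicator {z. real n \<le> cmod z} z \<partial>\<mu>) \<le>
      ennreal C * enn_powr (weighted_norm \<delta> p q c) s * t n"
    using tail_bound[OF R] unfolding t_def by blast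
  obtain C1 where C1: "C1 > 0" "\<And>f. f \<in> fock_ball \<Longrightarrow> \<exists>c. weighted_norm \<delta> p q c \<le> ennreal C1 \<and> synthesizes \<alpha> \<delta> c f"
    using fock_ball_coefficients by blast
  have sub: "fock \<subseteq> Ls"
  proof
    fix f assume f: "f \<in> fock"
    obtain c where c: "weighted_norm \<delta> p q c < top" "synthesizes \<alpha> \<delta> c f" using fock_coefficients[OF f] .
    have "ls_int f \<le> ennreal C * enn_powr (weighted_norm \<delta> p q c) s * t 0"
      using C(2)[OF c(2) fock_measurable[OF f], of 0] by simp
    also have "\<dots> < top" using c t_fin[of 0] by (simp add: ennreal_mult_less_top)
    finally show "f \<in> Ls" using fock_measurable[OF f] ls_norm_finite_iff by (simp add: weighted_Ls_def)
  qed
  define K where "K = C * C1 powr s"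
  have K: "K > 0" using C(1) C1(1) by (simp add: K_def)
  \<comment> \<open>Uniform over the unit ball, since the coefficients can be taken with norm at
    most C1.\<close>
  have tail: "(\<integral>\<^sup>+z. ennreal (Ls_integrand \<alpha> s f z) * indicator {z. real n \<le> cmod z} z \<partial>\<mu>) \<le> ennreal K * t n"
    if f: "f \<in> fock_ball" for f n
  proof -
    obtain c where c: "weighted_norm \<delta> p q c \<le> ennreal C1" "synthesizes \<alpha> \<delta> c f" using C1(2)[OF f] by blast
    have "(\<integral>\<^sup>+z. ennreal (Ls_integrand \<alpha> s f z) * indicator {z. real n \<le> cmod z} z \<partial>\<mu>) \<le> ennreal C * enn_powr (weighted_norm \<delta> p q c) s * t n"
      using f by (intro C(2)[OF c(2)] fock_measurable) simp
    also have "\<dots> \<le> ennreal C * enn_powr (ennreal C1) s * t n"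
      using c(1) s_pos by (intro mult_right_mono mult_left_mono enn_powr_mono) auto
    also have "\<dots> = ennreal K * t n"
      using C(1) C1(1) by (simp add: K_def enn_powr_ennreal ennreal_mult)
    finally show ?thesis .
  qed
  have out_set: "{z. real n \<le> cmod z} \<in> sets \<mu>" "{z. cmod z < real n} \<in> sets \<mu>" for n
    unfolding sets_\<mu> by measurable
  interpret PM: pseudometric "quasinorm_topology Ls ls_norm" Ls ls_dist by (rule ls_pseudometric)
  have "compactin (quasinorm_topology Ls ls_norm) (quasinorm_topology Ls ls_norm closure_of fock_ball)"
  proof (rule PM.compactin_closureI)
    show "fock_ball \<subseteq> Ls" using sub by blast
    fix \<sigma> :: "nat \<Rightarrow> complex \<Rightarrow> complex" assume \<sigma>: "\<And>n. \<sigma> n \<in> fock_ball"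
    have hol: "h holomorphic_on UNIV" if "h \<in> fock_ball" for h using that by (simp add: fock_space_def)
    have bd: "\<exists>B. \<forall>h\<in>fock_ball. \<forall>z\<in>X. cmod (h z) \<le> B" if "compact X" for X
    proof -
      obtain b where "\<And>z. z \<in> X \<Longrightarrow> cmod z \<le> b" using compact_imp_bounded[OF \<open>compact X\<close>] unfolding bounded_iff by blast
      moreover obtain n :: nat where "b < real n" using reals_Archimedean2 by blast
      moreover obtain B where "\<And>f z. f \<in> fock_ball \<Longrightarrow> cmod z < real n \<Longrightarrow> cmod (f z) \<le> B"
        using fock_ball_locally_bounded by blast
      ultimately show ?thesis by (meson le_less_trans)
    qed
    have rng: "range \<sigma> \<subseteq> fock_ball" using \<sigma> by (intro image_subsetI)
    obtain g r where g: "g holomorphic_on UNIV" and r: "strict_mono (r :: nat \<Rightarrow> nat)"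
      and pt: "\<And>x. x \<in> UNIV \<Longrightarrow> (\<lambda>n. \<sigma> (r n) x) \<longlonglongrightarrow> g x"
      and unif: "\<And>X. compact X \<Longrightarrow> X \<subseteq> UNIV \<Longrightarrow> uniform_limit X (\<sigma> \<circ> r) g sequentially"
      using Montel[OF open_UNIV hol bd rng] by metis
    define h where "h n = \<sigma> (r n)" for n
    have h: "h n \<in> fock_ball" "h n \<in> Ls" "h n \<in> borel_measurable \<mu>" for n
      using \<sigma>[of "r n"] sub fock_measurable by (auto simp: h_def)
    have gm: "g \<in> borel_measurable \<mu>" by (rule holomorphic_measurable[OF g])
    have meas: "(\<lambda>z. ennreal (Ls_integrand \<alpha> s f z)) \<in> borel_measurable \<mu>" if "f \<in> borel_measurable \<mu>" for f
      using Ls_integrand_measurable[OF sets_\<mu> that] by (rule measurable_compose[OF _ measurable_ennreal])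
    have tail_meas: "(\<lambda>z. ennreal (Ls_integrand \<alpha> s f z) * indicator {z. real n \<le> cmod z} z) \<in> borel_measurable \<mu>"
      if "f \<in> borel_measurable \<mu>" for f n
      by (intro borel_measurable_times_ennreal meas that borel_measurable_indicator out_set)
    \<comment> \<open>The limit inherits the tail bound through Fatou's lemma, which needs no more
      than pointwise convergence.\<close>
    have tail_g: "(\<integral>\<^sup>+z. ennreal (Ls_integrand \<alpha> s g z) * indicator {z. real n \<le> cmod z} z \<partial>\<mu>) \<le> ennreal K * t n" for n
    proof (rule nn_integral_limit_le)
      show "(\<lambda>z. ennreal (Ls_integrand \<alpha> s (h i) z) * indicator {z. real n \<le> cmod z} z) \<in> borel_measurable \<mu>" for i
        by (rule tail_meas[OF h(3)])
      show "(\<integral>\<^sup>+z. ennreal (Ls_integrand \<alpha> s (h i) z) * indicator {z. real n \<le> cmod z} z \<partial>\<mu>) \<le> ennreal K * t n" for i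
        by (rule tail[OF h(1)])
      fix z
      have "(\<lambda>i. ennreal (Ls_integrand \<alpha> s (h i) z)) \<longlonglongrightarrow> ennreal (Ls_integrand \<alpha> s g z)"
        using pt[of z] s_pos by (intro Ls_integrand_tendsto) (simp_all add: h_def)
      then show "(\<lambda>i. ennreal (Ls_integrand \<alpha> s (h i) z) * indicator {z. real n \<le> cmod z} z) \<longlonglongrightarrow> ennreal (Ls_integrand \<alpha> s g z) * indicator {z. real n \<le> cmod z} z"
        by (cases "real n \<le> cmod z") simp_all
    qed
    have "ls_int g \<le> ennreal K * t 0" using tail_g[of 0] by simp
    also have "\<dots> < top" using t_fin[of 0] by (simp add: ennreal_mult_less_top)
    finally have gL: "g \<in> Ls" using gm ls_norm_finite_iff by (simp add: weighted_Ls_def)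
    have small: "\<forall>\<^sub>F n in sequentially. ls_int (h n - g) \<le> ennreal \<epsilon>" if \<epsilon>: "\<epsilon> > 0" for \<epsilon>
    proof -
      \<comment> \<open>Outside the disc the sequence and its limit each contribute a tail, and 2^s
        comes from \<open>Ls_integrand_diff_le\<close>.\<close>
      have "(\<lambda>n. ennreal (2 powr s * 2 * K) * t n) \<longlonglongrightarrow> ennreal (2 powr s * 2 * K) * 0"
        by (intro ennreal_tendsto_cmult t_lim) simp
      then have "\<forall>\<^sub>F n in sequentially. ennreal (2 powr s * 2 * K) * t n < ennreal (\<epsilon> / 2)"
        using \<epsilon> by (intro order_tendstoD(2)) auto
      then obtain N where N: "ennreal (2 powr s * 2 * K) * t N < ennreal (\<epsilon> / 2)"
        unfolding eventually_sequentially by blast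
      define m where "m = enn2real (emeasure \<mu> {z. cmod z < real N})"
      have m: "emeasure \<mu> {z. cmod z < real N} = ennreal m" "m \<ge> 0"
        using emeasure_ball_finite[OF cond R, of N] by (simp_all add: m_def)
      \<comment> \<open>Uniform closeness \<eta> on the disc of mass m contributes at most \<eta>^s
        m \<le> \<epsilon>/2; m + 1 in the denominator covers m = 0.\<close>
      define \<eta> where "\<eta> = (\<epsilon> / (2 * (m + 1))) powr (1 / s)"
      have \<eta>: "\<eta> > 0" "\<eta> powr s = \<epsilon> / (2 * (m + 1))" using \<epsilon> m s_pos by (auto simp: \<eta>_def powr_powr)
      have \<eta>m: "\<eta> powr s * m \<le> \<epsilon> / 2"
        unfolding \<eta>(2) using \<epsilon> m by (simp add: field_simps)
      have "uniform_limit (cball 0 (real N)) (\<sigma> \<circ> r) g sequentially" by (rule unif) auto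
      then have "\<forall>\<^sub>F n in sequentially. \<forall>z\<in>cball 0 (real N). dist ((\<sigma> \<circ> r) n z) (g z) < \<eta>"
        using \<eta>(1) unfolding uniform_limit_iff by blast
      then show ?thesis
      proof eventually_elim
        case (elim n)
        have pw: "ennreal (Ls_integrand \<alpha> s (h n - g) z) \<le> ennreal (\<eta> powr s) * indicator {z. cmod z < real N} z +
            ennreal (2 powr s) * (ennreal (Ls_integrand \<alpha> s (h n) z) * indicator {z. real N \<le> cmod z} z + ennreal (Ls_integrand \<alpha> s g z) * indicator {z. real N \<le> cmod z} z)" for z
        proof (cases "cmod z < real N")
          case True
          have "cmod ((h n - g) z) powr s \<le> \<eta> powr s"
            using elim[rule_format, of z] True s_pos by (intro powr_mono2) (auto simp: h_def dist_norm)
          moreover have "exp (- (\<alpha> * s / 2) * (cmod z)\<^sup>2) \<le> 1" using \<alpha>_pos s_pos by simp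
          ultimately have "Ls_integrand \<alpha> s (h n - g) z \<le> \<eta> powr s * 1"
            unfolding Ls_integrand_def by (intro mult_mono) auto
          then show ?thesis using True by (simp add: ennreal_leI)
        next
          case False
          have "ennreal (Ls_integrand \<alpha> s (h n - g) z) \<le> ennreal (2 powr s * (Ls_integrand \<alpha> s (h n) z + Ls_integrand \<alpha> s g z))"
            by (intro ennreal_leI Ls_integrand_diff_le s_pos)
          also have "\<dots> = ennreal (2 powr s) * (ennreal (Ls_integrand \<alpha> s (h n) z) + ennreal (Ls_integrand \<alpha> s g z))"
            by (simp add: ennreal_mult)
          finally show ?thesis using False by simp
        qed
        have "ls_int (h n - g) \<le> (\<integral>\<^sup>+z. ennreal (\<eta> powr s) * indicator {z. cmod z < real N} z +
            ennreal (2 powr s) * (ennreal (Ls_integrand \<alpha> s (h n) z) * indicator {z. real N \<le> cmod z} z + ennreal (Ls_integrand \<alpha> s g z) * indicator {z. real N \<le> cmod z} z) \<partial>\<mu>)"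
          by (intro nn_integral_mono pw)
        also have "\<dots> = (\<integral>\<^sup>+z. ennreal (\<eta> powr s) * indicator {z. cmod z < real N} z \<partial>\<mu>) +
            ennreal (2 powr s) * ((\<integral>\<^sup>+z. ennreal (Ls_integrand \<alpha> s (h n) z) * indicator {z. real N \<le> cmod z} z \<partial>\<mu>) +
              (\<integral>\<^sup>+z. ennreal (Ls_integrand \<alpha> s g z) * indicator {z. real N \<le> cmod z} z \<partial>\<mu>))"
          using tail_meas[OF h(3)] tail_meas[OF gm] out_set(2)
          by (subst nn_integral_add) (auto simp: nn_integral_cmult nn_integral_add intro!: borel_measurable_times_ennreal)
        also have "\<dots> \<le> ennreal (\<eta> powr s) * ennreal m + ennreal (2 powr s) * (ennreal K * t N + ennreal K * t N)"
          unfolding nn_integral_cmult_indicator[OF out_set(2)] m(1)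
          by (intro add_mono mult_left_mono tail[OF h(1)] tail_g order_refl) auto
        also have "\<dots> = ennreal (\<eta> powr s * m) + ennreal (2 powr s * 2 * K) * t N"
        proof -
          have "ennreal (2 powr s * 2 * K) = ennreal (2 powr s) * ennreal (K + K)"
            using K by (subst ennreal_mult[symmetric]) auto
          then have "ennreal (2 powr s * 2 * K) * t N = ennreal (2 powr s) * (ennreal (K + K) * t N)"
            by (simp only: mult.assoc)
          also have "ennreal (K + K) * t N = ennreal K * t N + ennreal K * t N"
          proof -
            have "ennreal (K + K) = ennreal K + ennreal K" using K by (intro ennreal_plus) auto
            then show ?thesis by (simp only: distrib_right)
          qed
          finally show ?thesis using m(2) by (simp add: ennreal_mult)
        qed
        also have "\<dots> \<le> ennreal (\<epsilon> / 2) + ennreal (\<epsilon> / 2)"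
          by (rule add_mono[OF ennreal_leI[OF \<eta>m] less_imp_le[OF N]])
        also have "\<dots> = ennreal \<epsilon>" using \<epsilon> by (simp flip: ennreal_plus)
        finally show "ls_int (h n - g) \<le> ennreal \<epsilon>" .
      qed
    qed
    have "(\<lambda>n. ls_dist (h n) g) \<longlonglongrightarrow> 0"
    proof (rule order_tendstoI)
      fix e :: real assume "e < 0"
      then show "\<forall>\<^sub>F n in sequentially. e < ls_dist (h n) g"
        using PM.d_nonneg[OF h(2) gL] by (intro always_eventually allI) (rule less_le_trans)
    next
      fix e :: real assume e: "0 < e"
      let ?x = "e powr (s / min 1 s)"
      \<comment> \<open>\<open>small\<close> gives a non-strict bound; aiming at half the threshold
        makes it strict.\<close>
      have x: "?x / 2 > 0" using e by simp
      from small[OF x] show "\<forall>\<^sub>F n in sequentially. ls_dist (h n) g < e"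
      proof eventually_elim
        case (elim n)
        also have "ennreal (?x / 2) < ennreal ?x" using e by (simp add: ennreal_less_iff)
        finally show ?case using ls_dist_less_int[OF h(2) gL e] by simp
      qed
    qed
    then show "\<exists>l\<in>Ls. \<exists>r. strict_mono r \<and> (\<lambda>n. ls_dist (\<sigma> (r n)) l) \<longlonglongrightarrow> 0"
      using gL r unfolding h_def by blast
  qed
  then show ?thesis
    using sub unfolding vanishing_Carleson_def compact_operator_def by auto
qed

end

section \<open>Averaging over signs\<close>

text \<open>Pair the sign patterns that differ only at \<open>j\<close> and use
  \<open>\<bar>a\<bar>\<^sup>s \<le> \<bar>x + a\<bar>\<^sup>s + \<bar>x - a\<bar>\<^sup>s\<close>; bounded overlap of the balls makes this
  substitute for Khinchine's inequality sufficient.\<close>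

lemma sum_signs_lower_bound:
  fixes a :: "'i \<Rightarrow> complex"
  assumes "finite F" "j \<in> F" "s > 0"
  shows "2 ^ card F * cmod (a j) powr s \<le> 2 * (\<Sum>A\<in>Pow F. cmod (\<Sum>i\<in>F. if i \<in> A then a i else - a i) powr s)"
proof -
  define G where "G = F - {j}"
  have G: "finite G" "j \<notin> G" "F = insert j G" using assms by (auto simp: G_def)
  define S where "S A = (\<Sum>i\<in>G. if i \<in> A then a i else - a i)" for A
  let ?X = "\<lambda>A. cmod (\<Sum>i\<in>F. if i \<in> A then a i else - a i) powr s"
  have pair: "cmod (a j) powr s \<le> ?X A + ?X (insert j A)" if A: "A \<in> Pow G" for A
  proof -
    have jA: "j \<notin> A" using A G by auto
    have SA: "S (insert j A) = S A" unfolding S_def using G by (intro sum.cong) auto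
    have 1: "(\<Sum>i\<in>F. if i \<in> A then a i else - a i) = S A - a j"
      using jA G by (simp add: S_def)
    have 2: "(\<Sum>i\<in>F. if i \<in> insert j A then a i else - a i) = S A + a j"
      using G SA by (simp add: S_def)
    have "2 * cmod (a j) = cmod ((S A + a j) - (S A - a j))" by (simp add: norm_mult)
    also have "\<dots> \<le> cmod (S A + a j) + cmod (S A - a j)" by (rule norm_triangle_ineq4)
    finally have "cmod (a j) \<le> cmod (S A + a j) \<or> cmod (a j) \<le> cmod (S A - a j)" by linarith
    then have "cmod (a j) powr s \<le> cmod (S A + a j) powr s \<or> cmod (a j) powr s \<le> cmod (S A - a j) powr s"
      using assms(3) by (auto intro: powr_mono2)
    then have "cmod (a j) powr s \<le> cmod (S A - a j) powr s + cmod (S A + a j) powr s"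
    proof
      assume "cmod (a j) powr s \<le> cmod (S A + a j) powr s"
      then show ?thesis by (simp add: add_increasing)
    next
      assume "cmod (a j) powr s \<le> cmod (S A - a j) powr s"
      then show ?thesis by (simp add: add_increasing2)
    qed
    then show ?thesis by (simp only: 1 2)
  qed
  have "2 ^ card F * cmod (a j) powr s = 2 * (\<Sum>A\<in>Pow G. cmod (a j) powr s)"
    using G by (simp add: card_Pow)
  also have "\<dots> \<le> 2 * (\<Sum>A\<in>Pow G. ?X A + ?X (insert j A))"
    by (intro mult_left_mono sum_mono pair) auto
  also have "(\<Sum>A\<in>Pow G. ?X A + ?X (insert j A)) = (\<Sum>A\<in>Pow F. ?X A)"
  proof -
    have "(\<Sum>A\<in>Pow F. ?X A) = (\<Sum>A\<in>Pow G. ?X A) + (\<Sum>A\<in>insert j ` Pow G. ?X A)"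
      unfolding G(3) Pow_insert using G by (intro sum.union_disjoint) auto
    also have "(\<Sum>A\<in>insert j ` Pow G. ?X A) = (\<Sum>A\<in>Pow G. ?X (insert j A))"
    proof (rule sum.reindex_cong[OF _ refl refl])
      show "inj_on (insert j) (Pow G)"
        using G(2) by (intro inj_onI) (metis PowD insert_ident subsetD)
    qed
    finally show ?thesis by (simp only: sum.distrib)
  qed
  finally show ?thesis .
qed

context fock_tiling
begin

text \<open>With the Gaussian weight of the target, the kernel of Q is bounded below on the ball
  about its center, so the sign inequality applies pointwise to every Q whose ball contains z. There
  are at most M of these, hence the sum over Q is bounded by M times the sum over all sign patterns,
  up to constants; after integration some pattern does at least as well as the average.\<close>

lemma sign_choice:
  assumes R: "R > 0"
  obtains K where "K > 0" "\<And>F c. finite F \<Longrightarrow> F \<subseteq> tiling \<delta> \<Longrightarrow> \<exists>A\<in>Pow F.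
    (\<Sum>Q\<in>F. ennreal (cmod (c Q) powr s) * emeasure \<mu> (ball (\<zeta> Q) R)) \<le>
      ennreal K * ls_int (\<lambda>z. \<Sum>Q\<in>F. (if Q \<in> A then c Q else - c Q) * kernel \<alpha> (\<zeta> Q) z)"
proof -
  define e0 where "e0 = exp (- (\<alpha> * s / 2) * R\<^sup>2)"
  define M where "M = (R / (c_in * \<delta>) + 1)\<^sup>2"
  have e0: "e0 > 0" by (simp add: e0_def)
  have "0 < R / (c_in * \<delta>) + 1"
    using R c_in_pos \<delta>_pos by (intro add_pos_pos divide_pos_pos mult_pos_pos) auto
  then have M: "M > 0" unfolding M_def by (rule zero_less_power)
  show ?thesis
  proof (rule that[of "2 * M / e0"])
    show "2 * M / e0 > 0" using M e0 by simp
    fix F and c :: "pocket_index \<Rightarrow> complex" assume F: "finite F" "F \<subseteq> tiling \<delta>"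
    define f where "f A = (\<lambda>z. \<Sum>Q\<in>F. (if Q \<in> A then c Q else - c Q) * kernel \<alpha> (\<zeta> Q) z)" for A
    have fm: "f A \<in> borel_measurable \<mu>" for A
      unfolding f_def by (intro holomorphic_measurable holomorphic_on_sum holomorphic_on_mult holomorphic_on_const kernel_holomorphic)
    have meas: "(\<lambda>z. ennreal (Ls_integrand \<alpha> s (f A) z)) \<in> borel_measurable \<mu>" for A
      using Ls_integrand_measurable[OF sets_\<mu> fm] by (rule measurable_compose[OF _ measurable_ennreal])
    have ball_set: "ball x r \<in> sets \<mu>" for x r
      unfolding sets_\<mu> by (rule borel_open[OF open_ball])
    have pointwise: "2 ^ card F * e0 * (\<Sum>Q\<in>F. cmod (c Q) powr s * indicator (ball (\<zeta> Q) R) z) \<le>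
        2 * M * (\<Sum>A\<in>Pow F. Ls_integrand \<alpha> s (f A) z)" for z
    proof -
      let ?g = "exp (- (\<alpha> * s / 2) * (cmod z)\<^sup>2)"
      let ?S = "\<Sum>A\<in>Pow F. Ls_integrand \<alpha> s (f A) z"
      have S0: "0 \<le> ?S" by (intro sum_nonneg) auto
      have one: "2 ^ card F * e0 * (cmod (c Q) powr s * indicator (ball (\<zeta> Q) R) z) \<le> (if dist z (\<zeta> Q) < R then 2 * ?S else 0)"
        if Q: "Q \<in> F" for Q
      proof (cases "dist z (\<zeta> Q) < R")
        case True
        have "2 ^ card F * cmod (c Q * kernel \<alpha> (\<zeta> Q) z) powr s \<le> 2 * (\<Sum>A\<in>Pow F. cmod (f A z) powr s)"
        proof -
          have "(if i \<in> A then c i else - c i) * kernel \<alpha> (\<zeta> i) z = (if i \<in> A then c i * kernel \<alpha> (\<zeta> i) z else - (c i * kernel \<alpha> (\<zeta> i) z))" for i A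
            by simp
          then show ?thesis
            using sum_signs_lower_bound[OF F(1) Q s_pos, of "\<lambda>Q. c Q * kernel \<alpha> (\<zeta> Q) z"] by (simp only: f_def)
        qed
        then have "2 ^ card F * cmod (c Q * kernel \<alpha> (\<zeta> Q) z) powr s * ?g \<le> 2 * (\<Sum>A\<in>Pow F. cmod (f A z) powr s) * ?g"
          by (rule mult_right_mono) simp
        also have "\<dots> = 2 * ?S" by (simp add: Ls_integrand_def sum_distrib_right)
        finally have 1: "2 ^ card F * (cmod (c Q * kernel \<alpha> (\<zeta> Q) z) powr s * ?g) \<le> 2 * ?S" by (simp only: mult.assoc)
        have "e0 * cmod (c Q) powr s \<le> cmod (c Q * kernel \<alpha> (\<zeta> Q) z) powr s * ?g"
        proof -
          have d: "cmod (z - \<zeta> Q) \<le> R" using True by (simp add: dist_norm)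
          have "(cmod (z - \<zeta> Q))\<^sup>2 \<le> R\<^sup>2" using d by (intro power_mono) auto
          then have "\<alpha> * s / 2 * (cmod (z - \<zeta> Q))\<^sup>2 \<le> \<alpha> * s / 2 * R\<^sup>2"
            using \<alpha>_pos s_pos by (intro mult_left_mono) auto
          then have le: "e0 \<le> exp (- (\<alpha> * s / 2) * (cmod (z - \<zeta> Q))\<^sup>2)" by (simp add: e0_def)
          have eq: "cmod (c Q * kernel \<alpha> (\<zeta> Q) z) powr s * ?g = cmod (c Q) powr s * exp (- (\<alpha> * s / 2) * (cmod (z - \<zeta> Q))\<^sup>2)"
          proof -
            have "cmod (kernel \<alpha> (\<zeta> Q) z) powr s = exp (\<alpha> * s / 2 * (cmod z)\<^sup>2) * exp (- (\<alpha> * s / 2) * (cmod (z - \<zeta> Q))\<^sup>2)"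
              unfolding cmod_kernel powr_mult exp_powr_real by (simp add: mult_ac)
            moreover have "exp (\<alpha> * s / 2 * (cmod z)\<^sup>2) * ?g = 1" by (simp flip: exp_add)
            ultimately show ?thesis by (simp add: norm_mult powr_mult mult_ac)
          qed
          show ?thesis unfolding eq mult.commute[of e0] by (intro mult_left_mono le) simp
        qed
        then have "2 ^ card F * (e0 * cmod (c Q) powr s) \<le> 2 ^ card F * (cmod (c Q * kernel \<alpha> (\<zeta> Q) z) powr s * ?g)"
          by (rule mult_left_mono) simp
        then have "2 ^ card F * (e0 * cmod (c Q) powr s) \<le> 2 * ?S" using 1 by (rule order_trans)
        then show ?thesis using True by (simp add: dist_commute mult.assoc)
      qed (simp add: dist_commute)
      have "2 ^ card F * e0 * (\<Sum>Q\<in>F. cmod (c Q) powr s * indicator (ball (\<zeta> Q) R) z) = (\<Sum>Q\<in>F. 2 ^ card F * e0 * (cmod (c Q) powr s * indicator (ball (\<zeta> Q) R) z))"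
        by (rule sum_distrib_left)
      also have "\<dots> \<le> (\<Sum>Q\<in>F. if dist z (\<zeta> Q) < R then 2 * ?S else 0)" by (intro sum_mono one)
      also have "\<dots> = real (card {Q \<in> F. dist z (\<zeta> Q) < R}) * (2 * ?S)"
        using F(1) by (simp add: sum.If_cases Int_def)
      also have "\<dots> \<le> M * (2 * ?S)"
      proof (intro mult_right_mono)
        have "card {Q \<in> F. dist z (\<zeta> Q) < R} \<le> card {Q \<in> tiling \<delta>. dist z (\<zeta> Q) < R}"
          using F R by (intro card_mono packing) auto
        then show "real (card {Q \<in> F. dist z (\<zeta> Q) < R}) \<le> M"
          using packing(2)[of R z] R unfolding M_def by linarith
      qed (use S0 in simp)
      finally show ?thesis by (simp only: mult_ac)
    qed
    \<comment> \<open>The pattern with the largest integral. Replacing every pattern by it gives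
      2^|F| equal terms, which cancel the factor in the sign inequality.\<close>
    obtain A where A: "A \<in> Pow F" "\<And>A'. A' \<in> Pow F \<Longrightarrow> ls_int (f A') \<le> ls_int (f A)"
    proof -
      have fin: "finite ((\<lambda>A. ls_int (f A)) ` Pow F)" "(\<lambda>A. ls_int (f A)) ` Pow F \<noteq> {}" using F(1) by auto
      from Max_in[OF fin] obtain A where "A \<in> Pow F" "Max ((\<lambda>A. ls_int (f A)) ` Pow F) = ls_int (f A)" by blast
      then show ?thesis using that Max_ge[OF fin(1)] by (metis imageI)
    qed
    let ?L = "\<Sum>Q\<in>F. ennreal (cmod (c Q) powr s) * emeasure \<mu> (ball (\<zeta> Q) R)"
    have "ennreal (2 ^ card F * e0) * ?L = (\<Sum>Q\<in>F. ennreal (2 ^ card F * e0 * cmod (c Q) powr s) * emeasure \<mu> (ball (\<zeta> Q) R))"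
      using e0 by (simp add: sum_distrib_left mult.assoc ennreal_mult)
    also have "\<dots> = (\<integral>\<^sup>+z. (\<Sum>Q\<in>F. ennreal (2 ^ card F * e0 * cmod (c Q) powr s) * indicator (ball (\<zeta> Q) R) z) \<partial>\<mu>)"
    proof (subst nn_integral_sum)
      show "(\<lambda>z. ennreal (2 ^ card F * e0 * cmod (c Q) powr s) * indicator (ball (\<zeta> Q) R) z) \<in> borel_measurable \<mu>" for Q
        by (intro borel_measurable_times_ennreal borel_measurable_const borel_measurable_indicator ball_set)
    qed (simp add: nn_integral_cmult_indicator ball_set)
    also have "\<dots> \<le> (\<integral>\<^sup>+z. ennreal (2 * M) * (\<Sum>A\<in>Pow F. ennreal (Ls_integrand \<alpha> s (f A) z)) \<partial>\<mu>)"
    proof (rule nn_integral_mono)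
      fix z
      have "(\<Sum>Q\<in>F. ennreal (2 ^ card F * e0 * cmod (c Q) powr s) * indicator (ball (\<zeta> Q) R) z) =
          (\<Sum>Q\<in>F. ennreal (2 ^ card F * e0 * (cmod (c Q) powr s * indicator (ball (\<zeta> Q) R) z)))"
        by (intro sum.cong refl) (simp add: indicator_def)
      also have "\<dots> = ennreal (2 ^ card F * e0 * (\<Sum>Q\<in>F. cmod (c Q) powr s * indicator (ball (\<zeta> Q) R) z))"
        using e0 by (subst sum_ennreal) (auto simp: sum_distrib_left)
      also have "\<dots> \<le> ennreal (2 * M * (\<Sum>A\<in>Pow F. Ls_integrand \<alpha> s (f A) z))"
        by (rule ennreal_leI[OF pointwise])
      also have "\<dots> = ennreal (2 * M) * (\<Sum>A\<in>Pow F. ennreal (Ls_integrand \<alpha> s (f A) z))"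
        using M by (simp add: ennreal_mult sum_nonneg)
      finally show "(\<Sum>Q\<in>F. ennreal (2 ^ card F * e0 * cmod (c Q) powr s) * indicator (ball (\<zeta> Q) R) z) \<le>
          ennreal (2 * M) * (\<Sum>A\<in>Pow F. ennreal (Ls_integrand \<alpha> s (f A) z))" .
    qed
    also have "\<dots> = ennreal (2 * M) * (\<Sum>A\<in>Pow F. ls_int (f A))"
    proof -
      have "(\<integral>\<^sup>+z. ennreal (2 * M) * (\<Sum>A\<in>Pow F. ennreal (Ls_integrand \<alpha> s (f A) z)) \<partial>\<mu>) =
          ennreal (2 * M) * (\<integral>\<^sup>+z. (\<Sum>A\<in>Pow F. ennreal (Ls_integrand \<alpha> s (f A) z)) \<partial>\<mu>)"
        by (intro nn_integral_cmult borel_measurable_sum meas)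
      also have "(\<integral>\<^sup>+z. (\<Sum>A\<in>Pow F. ennreal (Ls_integrand \<alpha> s (f A) z)) \<partial>\<mu>) = (\<Sum>A\<in>Pow F. ls_int (f A))"
        by (intro nn_integral_sum meas)
      finally show ?thesis .
    qed
    also have "\<dots> \<le> ennreal (2 * M) * (\<Sum>A'\<in>Pow F. ls_int (f A))"
      by (intro mult_left_mono sum_mono A(2)) auto
    also have "\<dots> = ennreal (2 ^ card F) * (ennreal (2 * M) * ls_int (f A))"
    proof -
      have "of_nat (card (Pow F)) = ennreal (2 ^ card F)"
        using F(1) by (simp add: card_Pow flip: ennreal_power)
      then show ?thesis by (simp only: sum_constant mult_ac)
    qed
    finally have "ennreal (1 / (2 ^ card F * e0)) * (ennreal (2 ^ card F * e0) * ?L) \<le> ennreal (1 / (2 ^ card F * e0)) * (ennreal (2 ^ card F) * (ennreal (2 * M) * ls_int (f A)))"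
      by (rule mult_left_mono) simp
    moreover have "ennreal (1 / (2 ^ card F * e0)) * (ennreal (2 ^ card F * e0) * ?L) = ?L"
    proof -
      have "ennreal (1 / (2 ^ card F * e0)) * ennreal (2 ^ card F * e0) = ennreal (1 / (2 ^ card F * e0) * (2 ^ card F * e0))"
        using e0 by (intro ennreal_mult[symmetric]) auto
      also have "1 / (2 ^ card F * e0) * (2 ^ card F * e0) = 1" using e0 by simp
      finally show ?thesis by (simp only: mult.assoc[symmetric] ennreal_1 mult_1)
    qed
    moreover have "ennreal (1 / (2 ^ card F * e0)) * (ennreal (2 ^ card F) * (ennreal (2 * M) * ls_int (f A))) = ennreal (2 * M / e0) * ls_int (f A)"
    proof -
      have "ennreal (1 / (2 ^ card F * e0)) * (ennreal (2 ^ card F) * ennreal (2 * M)) = ennreal (1 / (2 ^ card F * e0) * (2 ^ card F * (2 * M)))"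
      proof -
        have "0 \<le> 1 / (2 ^ card F * e0)" "0 \<le> (2 :: real) ^ card F" "0 \<le> 2 * M" "0 \<le> 2 ^ card F * (2 * M)"
          using e0 M by simp_all
        then show ?thesis by (simp only: ennreal_mult)
      qed
      also have "1 / (2 ^ card F * e0) * (2 ^ card F * (2 * M)) = 2 * M / e0" by simp
      finally show ?thesis by (simp only: mult.assoc[symmetric])
    qed
    ultimately have "?L \<le> ennreal (2 * M / e0) * ls_int (f A)" by (simp only:)
    then show "\<exists>A\<in>Pow F. ?L \<le> ennreal (2 * M / e0) * ls_int (\<lambda>z. \<Sum>Q\<in>F. (if Q \<in> A then c Q else - c Q) * kernel \<alpha> (\<zeta> Q) z)"
      using A(1) unfolding f_def by blast
  qed
qed

end

section \<open>Test functions with prescribed moduli of coefficients\<close>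

context fock_atomic
begin

text \<open>Finitely supported points of the positive unit ball of the unweighted mixed sequence
  space, against which the ball masses are tested. The weight of the coefficient space is inserted
  only in \<open>test_function\<close>.\<close>

definition seq_unit :: "pocket_index set \<Rightarrow> (pocket_index \<Rightarrow> real) \<Rightarrow> bool" where
  "seq_unit F b \<longleftrightarrow> finite F \<and> F \<subseteq> tiling \<delta> \<and> (\<forall>Q. 0 \<le> b Q) \<and>
    lp_enorm q UNIV (\<lambda>k. lp_enorm p (tiling_shell \<delta> k) (\<lambda>Q. if Q \<in> F then ennreal (b Q) else 0)) \<le> 1"

text \<open>Dividing b by C \<omega> k undoes the weight of the coefficient space and places the
  synthesis in the unit ball; the s-th power of this factor matches the weight inside u, so the
  pairing of b^s with u is what \<open>sign_choice\<close> bounds. The moduli of c belong to the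
  conclusion because pointwise decay is later read off from them.\<close>

lemma test_function:
  assumes R: "R > 0"
  obtains K C where "K > 0" "C > 0" "\<And>F b. seq_unit F b \<Longrightarrow> \<exists>c.
    (\<forall>Q\<in>F. cmod (c Q) = b Q / (C * \<omega> (fst Q))) \<and>
    (\<lambda>z. \<Sum>Q\<in>F. c Q * kernel \<alpha> (\<zeta> Q) z) \<in> fock_ball \<and>
    (\<Sum>Q\<in>F. enn_powr (ennreal (b Q)) s * u R Q) \<le> ennreal K * ls_int (\<lambda>z. \<Sum>Q\<in>F. c Q * kernel \<alpha> (\<zeta> Q) z)"
proof -
  obtain C where C: "C > 0" "\<And>F c. finite F \<Longrightarrow> F \<subseteq> tiling \<delta> \<Longrightarrow>
    weighted_norm \<delta> p q (\<lambda>Q. if Q \<in> F then c Q else 0) \<le> ennreal (1 / C) \<Longrightarrow>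
    (\<lambda>z. \<Sum>Q\<in>F. c Q * kernel \<alpha> (\<zeta> Q) z) \<in> fock_ball"
    using finite_synthesis_in_ball by blast
  obtain K where K: "K > 0" "\<And>F c. finite F \<Longrightarrow> F \<subseteq> tiling \<delta> \<Longrightarrow> \<exists>A\<in>Pow F.
    (\<Sum>Q\<in>F. ennreal (cmod (c Q) powr s) * emeasure \<mu> (ball (\<zeta> Q) R)) \<le>
      ennreal K * ls_int (\<lambda>z. \<Sum>Q\<in>F. (if Q \<in> A then c Q else - c Q) * kernel \<alpha> (\<zeta> Q) z)"
    using sign_choice[OF R] by blast
  obtain a b' where ab: "a > 0" "b' > 0"
    "\<And>k w. w \<in> annulus k \<Longrightarrow> ennreal (a * (1 + real k) powr (- \<tau> * s)) \<le> norm_weight w"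
    "\<And>k w. w \<in> annulus k \<Longrightarrow> norm_weight w \<le> ennreal (b' * (1 + real k) powr (- \<tau> * s))"
    using norm_weight_shell by blast
  note b' = ab(2,4)
  show ?thesis
  proof (rule that[of "b' * C powr s * K" C])
    show "b' * C powr s * K > 0" using b' C K by simp
    show "C > 0" by (rule C(1))
    fix F b assume "seq_unit F b"
    then have F: "finite F" "F \<subseteq> tiling \<delta>" and b: "\<And>Q. 0 \<le> b Q"
      and norm: "lp_enorm q UNIV (\<lambda>k. lp_enorm p (tiling_shell \<delta> k) (\<lambda>Q. if Q \<in> F then ennreal (b Q) else 0)) \<le> 1"
      by (auto simp: seq_unit_def)
    define c0 where "c0 Q = complex_of_real (b Q / (C * \<omega> (fst Q)))" for Q
    have c0: "cmod (c0 Q) = b Q / (C * \<omega> (fst Q))" for Q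
      using b[of Q] C(1) unfolding c0_def norm_of_real by (intro abs_of_nonneg) auto
    obtain A where A: "A \<in> Pow F" "(\<Sum>Q\<in>F. ennreal (cmod (c0 Q) powr s) * emeasure \<mu> (ball (\<zeta> Q) R)) \<le>
      ennreal K * ls_int (\<lambda>z. \<Sum>Q\<in>F. (if Q \<in> A then c0 Q else - c0 Q) * kernel \<alpha> (\<zeta> Q) z)"
      using K(2)[OF F, of c0] by blast
    define c where "c Q = (if Q \<in> A then c0 Q else - c0 Q)" for Q
    have c: "cmod (c Q) = b Q / (C * \<omega> (fst Q))" for Q
      using c0[of Q] by (simp add: c_def)
    have "ennreal (\<omega> k) * lp_enorm p (tiling_shell \<delta> k) (\<lambda>Q. ennreal (cmod (if Q \<in> F then c Q else 0))) =
        ennreal (1 / C) * lp_enorm p (tiling_shell \<delta> k) (\<lambda>Q. if Q \<in> F then ennreal (b Q) else 0)" for k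
    proof -
      have "ennreal (\<omega> k) * ennreal (cmod (if Q \<in> F then c Q else 0)) = ennreal (1 / C) * (if Q \<in> F then ennreal (b Q) else 0)"
        if "Q \<in> tiling_shell \<delta> k" for Q
      proof (cases "Q \<in> F")
        case True
        have k: "fst Q = k" using that by (simp add: tiling_shell_eq)
        have "\<omega> k * (b Q / (C * \<omega> k)) = 1 / C * b Q" by simp
        then have "ennreal (\<omega> k) * ennreal (b Q / (C * \<omega> k)) = ennreal (1 / C) * ennreal (b Q)"
          using b[of Q] C(1) by (simp add: ennreal_mult[symmetric])
        then show ?thesis using True by (simp add: c k)
      qed simp
      then have "lp_enorm p (tiling_shell \<delta> k) (\<lambda>Q. ennreal (\<omega> k) * ennreal (cmod (if Q \<in> F then c Q else 0))) =
          lp_enorm p (tiling_shell \<delta> k) (\<lambda>Q. ennreal (1 / C) * (if Q \<in> F then ennreal (b Q) else 0))"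
        by (intro lp_enorm_cong p_pos)
      then show ?thesis by (simp only: lp_enorm_cmult[OF p_pos])
    qed
    then have "weighted_norm \<delta> p q (\<lambda>Q. if Q \<in> F then c Q else 0) =
        lp_enorm q UNIV (\<lambda>k. ennreal (1 / C) * lp_enorm p (tiling_shell \<delta> k) (\<lambda>Q. if Q \<in> F then ennreal (b Q) else 0))"
      unfolding weighted_norm_def by simp
    also have "\<dots> = ennreal (1 / C) * lp_enorm q UNIV (\<lambda>k. lp_enorm p (tiling_shell \<delta> k) (\<lambda>Q. if Q \<in> F then ennreal (b Q) else 0))"
      by (rule lp_enorm_cmult[OF q_pos])
    also have "\<dots> \<le> ennreal (1 / C) * 1" by (intro mult_left_mono norm) simp
    finally have ball: "(\<lambda>z. \<Sum>Q\<in>F. c Q * kernel \<alpha> (\<zeta> Q) z) \<in> fock_ball"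
      using C(2)[OF F, of c] by simp
    have "(\<Sum>Q\<in>F. enn_powr (ennreal (b Q)) s * u R Q) \<le> (\<Sum>Q\<in>F. ennreal (b' * C powr s) * (ennreal (cmod (c0 Q) powr s) * emeasure \<mu> (ball (\<zeta> Q) R)))"
    proof (rule sum_mono)
      fix Q assume "Q \<in> F"
      then have Q: "\<zeta> Q \<in> annulus (fst Q)" using F center_in_annulus by blast
      let ?k = "fst Q"
      have "enn_powr (ennreal (b Q)) s * u R Q \<le> ennreal (b Q powr s) * (ennreal (b' * (1 + real ?k) powr (- \<tau> * s)) * emeasure \<mu> (ball (\<zeta> Q) R))"
        unfolding pocket_mass_def ball_mass_def enn_powr_ennreal[OF b]
        by (intro mult_left_mono mult_right_mono b'(2)[OF Q]) auto
      also have "\<dots> = (ennreal (b Q powr s) * ennreal (b' * (1 + real ?k) powr (- \<tau> * s))) * emeasure \<mu> (ball (\<zeta> Q) R)"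
        by (simp only: mult.assoc)
      also have "ennreal (b Q powr s) * ennreal (b' * (1 + real ?k) powr (- \<tau> * s)) = ennreal (b Q powr s * (b' * (1 + real ?k) powr (- \<tau> * s)))"
        using b'(1) by (intro ennreal_mult[symmetric]) auto
      also have "b Q powr s * (b' * (1 + real ?k) powr (- \<tau> * s)) = b' * C powr s * cmod (c0 Q) powr s"
      proof -
        have "cmod (c0 Q) powr s = b Q powr s / (C powr s * (1 + real ?k) powr (\<tau> * s))"
          unfolding c0 using C(1) b[of Q] by (simp add: powr_divide powr_mult powr_powr)
        moreover have "(1 + real ?k) powr (- \<tau> * s) = 1 / (1 + real ?k) powr (\<tau> * s)"
          by (simp only: mult_minus_left powr_minus_divide)
        ultimately show ?thesis using C(1) by (simp only:) simp
      qed
      also have "ennreal (b' * C powr s * cmod (c0 Q) powr s) = ennreal (b' * C powr s) * ennreal (cmod (c0 Q) powr s)"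
        using b'(1) by (intro ennreal_mult) auto
      finally show "enn_powr (ennreal (b Q)) s * u R Q \<le> ennreal (b' * C powr s) * (ennreal (cmod (c0 Q) powr s) * emeasure \<mu> (ball (\<zeta> Q) R))"
        by (simp only: mult.assoc)
    qed
    also have "\<dots> = ennreal (b' * C powr s) * (\<Sum>Q\<in>F. ennreal (cmod (c0 Q) powr s) * emeasure \<mu> (ball (\<zeta> Q) R))"
      by (rule sum_distrib_left[symmetric])
    also have "\<dots> \<le> ennreal (b' * C powr s) * (ennreal K * ls_int (\<lambda>z. \<Sum>Q\<in>F. c Q * kernel \<alpha> (\<zeta> Q) z))"
      using A(2) unfolding c_def by (intro mult_left_mono) auto
    also have "\<dots> = ennreal (b' * C powr s * K) * ls_int (\<lambda>z. \<Sum>Q\<in>F. c Q * kernel \<alpha> (\<zeta> Q) z)"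
      using b'(1) K(1) by (subst ennreal_mult) (auto simp: mult.assoc)
    finally show "\<exists>c. (\<forall>Q\<in>F. cmod (c Q) = b Q / (C * \<omega> (fst Q))) \<and>
      (\<lambda>z. \<Sum>Q\<in>F. c Q * kernel \<alpha> (\<zeta> Q) z) \<in> fock_ball \<and>
      (\<Sum>Q\<in>F. enn_powr (ennreal (b Q)) s * u R Q) \<le> ennreal (b' * C powr s * K) * ls_int (\<lambda>z. \<Sum>Q\<in>F. c Q * kernel \<alpha> (\<zeta> Q) z)"
      using c ball by blast
  qed
qed

end

section \<open>Necessity of the mass conditions\<close>

lemma lp_enorm_singleton: "p > 0 \<Longrightarrow> lp_enorm p {j} x = x j"
proof -
  assume "p > 0"
  then show ?thesis
  proof (cases rule: ennreal_pos_cases)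
    case 1
    then show ?thesis by (simp add: lp_enorm_top)
  next
    case (2 r)
    then show ?thesis by (simp add: lp_enorm_finite_exponent nn_integral_count_space_finite)
  qed
qed

lemma lp_enorm_single_support: "p > 0 \<Longrightarrow> lp_enorm p J (\<lambda>i. if i \<in> {j} then x i else 0) \<le> x j"
proof -
  assume p: "p > 0"
  have "lp_enorm p J (\<lambda>i. if i \<in> {j} then x i else 0) = lp_enorm p UNIV (\<lambda>i. if i \<in> J then if i \<in> {j} then x i else 0 else 0)"
    by (rule lp_enorm_restrict[OF p, symmetric])
  also have "\<dots> \<le> lp_enorm p UNIV (\<lambda>i. if i \<in> {j} then x i else 0)"
    by (intro lp_enorm_mono p) simp
  also have "\<dots> = x j" unfolding lp_enorm_restrict[OF p] by (rule lp_enorm_singleton[OF p])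
  finally show ?thesis .
qed

context fock_atomic
begin

lemma seq_unit_shell:
  assumes "\<And>Q. 0 \<le> b Q" "lp_enorm p (tiling_shell \<delta> k) (\<lambda>Q. ennreal (b Q)) \<le> 1"
  shows "seq_unit (tiling_shell \<delta> k) b"
proof -
  let ?b = "\<lambda>Q. if Q \<in> tiling_shell \<delta> k then ennreal (b Q) else 0"
  have "lp_enorm p (tiling_shell \<delta> j) ?b \<le> (if j \<in> {k} then 1 else 0)" for j
  proof (cases "j = k")
    case True
    have "lp_enorm p (tiling_shell \<delta> k) ?b = lp_enorm p (tiling_shell \<delta> k) (\<lambda>Q. ennreal (b Q))"
      by (intro lp_enorm_cong p_pos) simp
    then show ?thesis using True assms(2) by simp
  next
    case False
    have "lp_enorm p (tiling_shell \<delta> j) ?b = lp_enorm p (tiling_shell \<delta> j) (\<lambda>_. 0)"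
      using False by (intro lp_enorm_cong p_pos) (auto simp: tiling_shell_eq)
    then show ?thesis using p_pos by simp
  qed
  then have "lp_enorm q UNIV (\<lambda>j. lp_enorm p (tiling_shell \<delta> j) ?b) \<le> lp_enorm q UNIV (\<lambda>j. if j \<in> {k} then 1 else 0)"
    by (intro lp_enorm_mono q_pos)
  also have "\<dots> \<le> 1" by (rule lp_enorm_single_support[OF q_pos])
  finally show ?thesis
    unfolding seq_unit_def using assms(1) shell_subset by simp
qed

lemma ls_zero: "(\<lambda>_. 0) \<in> Ls"
proof -
  have "ls_int (\<lambda>_. 0) = 0" by (simp add: Ls_integrand_def)
  then have "ls_norm (\<lambda>_. 0) < top" by (simp add: ls_norm_finite_iff)
  then show ?thesis by (simp add: weighted_Ls_def)
qed

lemma ls_dist_zero_less: "f \<in> Ls \<Longrightarrow> r > 0 \<Longrightarrow> ls_dist f (\<lambda>_. 0) < r \<longleftrightarrow> ls_int f < ennreal (r powr (s / min 1 s))"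
  using ls_dist_less_int[OF _ ls_zero, of f r] by (simp add: fun_diff_def)

section \<open>Consequences of compactness for the masses\<close>

context
  assumes vanishing: "vanishing_Carleson \<alpha> p q s \<mu>"
begin

lemma fock_subset_ls: "fock \<subseteq> Ls"
  using vanishing unfolding vanishing_Carleson_def compact_operator_def by blast

lemma ball_cluster_point:
  assumes "\<And>n :: nat. \<sigma> n \<in> fock_ball"
  obtains g where "g \<in> Ls" "\<And>e. e > 0 \<Longrightarrow> infinite {n. ls_dist (\<sigma> n) g < e}"
proof -
  interpret PM: pseudometric "quasinorm_topology Ls ls_norm" Ls ls_dist by (rule ls_pseudometric)
  have comp: "compactin (quasinorm_topology Ls ls_norm) (quasinorm_topology Ls ls_norm closure_of fock_ball)"
    using vanishing unfolding vanishing_Carleson_def compact_operator_def by simp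
  have sub: "fock_ball \<subseteq> Ls" using fock_subset_ls by blast
  obtain g where "g \<in> Ls" "\<And>e. e > 0 \<Longrightarrow> infinite {n. ls_dist (\<sigma> n) g < e}"
    by (rule PM.compactin_closure_cluster[where \<sigma> = \<sigma>, OF comp sub assms]) (rule that; (assumption | blast))
  then show ?thesis by (rule that)
qed

text \<open>Compact sets are bounded, argued with cluster points: along a sequence with integrals
  above n + 1 there would be infinitely many terms within 1 of a fixed g, hence within a fixed
  distance of 0.\<close>

lemma ball_ls_bounded:
  obtains L where "L > 0" "\<And>f. f \<in> fock_ball \<Longrightarrow> ls_int f \<le> ennreal L"
proof (rule ccontr)
  interpret PM: pseudometric "quasinorm_topology Ls ls_norm" Ls ls_dist by (rule ls_pseudometric)
  assume "\<not> thesis"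
  then have "\<exists>f\<in>fock_ball. \<not> ls_int f \<le> ennreal (real n + 1)" for n :: nat
    using that[of "real n + 1"] by auto
  then have "\<forall>n :: nat. \<exists>f. f \<in> fock_ball \<and> \<not> ls_int f \<le> ennreal (real n + 1)" by blast
  then obtain \<sigma> where \<sigma>: "\<And>n :: nat. \<sigma> n \<in> fock_ball" "\<And>n. \<not> ls_int (\<sigma> n) \<le> ennreal (real n + 1)" by metis
  obtain g where g: "g \<in> Ls" "\<And>e. e > 0 \<Longrightarrow> infinite {n. ls_dist (\<sigma> n) g < e}"
    by (rule ball_cluster_point[of \<sigma>, OF \<sigma>(1)]) (rule that; (assumption | blast))
  define D where "D = 1 + ls_dist g (\<lambda>_. 0)"
  have D: "D > 0" using PM.d_nonneg[OF g(1) ls_zero] by (simp add: D_def)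
  obtain m :: nat where m: "D powr (s / min 1 s) < real m" using reals_Archimedean2 by blast
  have "infinite {n. ls_dist (\<sigma> n) g < 1}" by (rule g(2)) simp
  then obtain n where n: "m < n" "ls_dist (\<sigma> n) g < 1"
    unfolding infinite_nat_iff_unbounded by blast
  have \<sigma>L: "\<sigma> n \<in> Ls" using \<sigma>(1)[of n] fock_subset_ls by blast
  have "ls_dist (\<sigma> n) (\<lambda>_. 0) < D"
    using PM.d_triangle[OF \<sigma>L g(1) ls_zero] n(2) by (simp add: D_def)
  then have "ls_int (\<sigma> n) < ennreal (D powr (s / min 1 s))"
    using ls_dist_zero_less[OF \<sigma>L D] by blast
  also have "\<dots> \<le> ennreal (real n + 1)" using m n(1) by (intro ennreal_leI) simp
  finally show False using \<sigma>(2)[of n] by simp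
qed

text \<open>Dual form of the mixed norm bound on u, uniform over the unit ball; the extremal choice
  of b is left to its applications.\<close>

lemma seq_unit_sum_bounded:
  assumes "R > 0"
  obtains X where "X > 0" "\<And>F b. seq_unit F b \<Longrightarrow> (\<Sum>Q\<in>F. enn_powr (ennreal (b Q)) s * u R Q) \<le> ennreal X"
proof -
  obtain K C where K: "K > 0" "C > 0" "\<And>F b. seq_unit F b \<Longrightarrow> \<exists>c.
    (\<forall>Q\<in>F. cmod (c Q) = b Q / (C * \<omega> (fst Q))) \<and>
    (\<lambda>z. \<Sum>Q\<in>F. c Q * kernel \<alpha> (\<zeta> Q) z) \<in> fock_ball \<and>
    (\<Sum>Q\<in>F. enn_powr (ennreal (b Q)) s * u R Q) \<le> ennreal K * ls_int (\<lambda>z. \<Sum>Q\<in>F. c Q * kernel \<alpha> (\<zeta> Q) z)"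
    by (rule test_function[OF assms]) (rule that; (assumption | blast))
  obtain L where L: "L > 0" "\<And>f. f \<in> fock_ball \<Longrightarrow> ls_int f \<le> ennreal L"
    by (rule ball_ls_bounded) (rule that; (assumption | blast))
  show ?thesis
  proof (rule that[of "K * L"])
    show "K * L > 0" using K L by simp
    fix F b assume "seq_unit F b"
    then obtain c where c: "(\<lambda>z. \<Sum>Q\<in>F. c Q * kernel \<alpha> (\<zeta> Q) z) \<in> fock_ball"
      "(\<Sum>Q\<in>F. enn_powr (ennreal (b Q)) s * u R Q) \<le> ennreal K * ls_int (\<lambda>z. \<Sum>Q\<in>F. c Q * kernel \<alpha> (\<zeta> Q) z)"
      using K(3) by blast
    note c(2)
    also have "ennreal K * ls_int (\<lambda>z. \<Sum>Q\<in>F. c Q * kernel \<alpha> (\<zeta> Q) z) \<le> ennreal K * ennreal L"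
      by (intro mult_left_mono L(2) c(1)) simp
    also have "\<dots> = ennreal (K * L)" using K(1) L(1) by (intro ennreal_mult[symmetric]) auto
    finally show "(\<Sum>Q\<in>F. enn_powr (ennreal (b Q)) s * u R Q) \<le> ennreal (K * L)" .
  qed
qed

text \<open>Testing with one kernel. This has to precede the extremal choice, since
  \<open>lp_dual_extremal\<close> asks for finite masses and the measure might give infinite mass to
  a ball.\<close>

lemma pocket_mass_finite:
  assumes "R > 0" "Q \<in> tiling_shell \<delta> k"
  shows "u R Q < top"
proof -
  obtain X where X: "X > 0" "\<And>F b. seq_unit F b \<Longrightarrow> (\<Sum>Q\<in>F. enn_powr (ennreal (b Q)) s * u R Q) \<le> ennreal X"
    by (rule seq_unit_sum_bounded[OF assms(1)]) (rule that; (assumption | blast))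
  define b :: "pocket_index \<Rightarrow> real" where "b Q' = (if Q' = Q then 1 else 0)" for Q'
  have "lp_enorm p (tiling_shell \<delta> k) (\<lambda>Q'. ennreal (b Q')) = lp_enorm p (tiling_shell \<delta> k) (\<lambda>Q'. if Q' \<in> {Q} then 1 else 0)"
    by (intro lp_enorm_cong p_pos) (simp add: b_def)
  also have "\<dots> \<le> 1" by (rule lp_enorm_single_support[OF p_pos])
  finally have "seq_unit (tiling_shell \<delta> k) b" by (intro seq_unit_shell) (simp add: b_def)
  then have sum: "(\<Sum>Q'\<in>tiling_shell \<delta> k. enn_powr (ennreal (b Q')) s * u R Q') \<le> ennreal X" by (rule X(2))
  have "u R Q = enn_powr (ennreal (b Q)) s * u R Q" by (simp add: b_def)
  also have "\<dots> \<le> (\<Sum>Q'\<in>tiling_shell \<delta> k. enn_powr (ennreal (b Q')) s * u R Q')"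
    by (rule member_le_sum[OF assms(2)]) auto
  also note sum
  also have "ennreal X < top" by simp
  finally show ?thesis .
qed

lemma shell_extremal:
  assumes "R > 0"
  obtains b where "\<And>Q. 0 \<le> b Q" "lp_enorm p (tiling_shell \<delta> k) (\<lambda>Q. ennreal (b Q)) \<le> 1"
    "(\<Sum>Q\<in>tiling_shell \<delta> k. enn_powr (ennreal (b Q)) s * u R Q) = shell_mass R k"
proof -
  have fin: "\<And>Q. Q \<in> tiling_shell \<delta> k \<Longrightarrow> u R Q < top"
    by (rule pocket_mass_finite[OF assms])
  obtain b where "\<And>Q. 0 \<le> b Q" "lp_enorm p (tiling_shell \<delta> k) (\<lambda>Q. ennreal (b Q)) \<le> 1"
    "(\<Sum>Q\<in>tiling_shell \<delta> k. enn_powr (ennreal (b Q)) s * u R Q) = lp_enorm (star_exponent s p) (tiling_shell \<delta> k) (u R)"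
    by (rule lp_dual_extremal[where I = "tiling_shell \<delta> k" and m = "u R", OF finite_shell p_pos s_pos])
      (rule fin, assumption, (rule that; (assumption | blast)))
  then show ?thesis by (intro that) (simp_all add: seq_shell_norm_def)
qed

text \<open>Extremals are nested: b k is extremal for the masses on shell k and B for the resulting
  shell norms, and their product is an element of the unit ball whose pairing with u is the mixed
  norm over the shells below n. Truncation keeps the support finite, and the bound does not depend
  on n.\<close>

lemma shell_mass_bounded:
  assumes "R > 0"
  obtains X where "X > 0" "\<And>k. shell_mass R k \<le> ennreal X"
    "\<And>n. lp_enorm (star_exponent s q) {..<n} (shell_mass R) \<le> ennreal X"
proof -
  obtain X where X: "X > 0" "\<And>F b. seq_unit F b \<Longrightarrow> (\<Sum>Q\<in>F. enn_powr (ennreal (b Q)) s * u R Q) \<le> ennreal X"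
    by (rule seq_unit_sum_bounded[OF assms(1)]) (rule that; (assumption | blast))
  have "\<forall>k. \<exists>b. (\<forall>Q. 0 \<le> b Q) \<and> lp_enorm p (tiling_shell \<delta> k) (\<lambda>Q. ennreal (b Q)) \<le> 1 \<and>
    (\<Sum>Q\<in>tiling_shell \<delta> k. enn_powr (ennreal (b Q)) s * u R Q) = shell_mass R k"
  proof
    fix k
    obtain b where "\<And>Q. 0 \<le> b Q" "lp_enorm p (tiling_shell \<delta> k) (\<lambda>Q. ennreal (b Q)) \<le> 1"
      "(\<Sum>Q\<in>tiling_shell \<delta> k. enn_powr (ennreal (b Q)) s * u R Q) = shell_mass R k"
      by (rule shell_extremal[OF assms]) (rule that; (assumption | blast))
    then show "\<exists>b. (\<forall>Q. 0 \<le> b Q) \<and> lp_enorm p (tiling_shell \<delta> k) (\<lambda>Q. ennreal (b Q)) \<le> 1 \<and>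
      (\<Sum>Q\<in>tiling_shell \<delta> k. enn_powr (ennreal (b Q)) s * u R Q) = shell_mass R k"
      by (intro exI[of _ b] conjI allI)
  qed
  from choice[OF this] obtain b where b_all: "\<forall>k. (\<forall>Q. 0 \<le> b k Q) \<and> lp_enorm p (tiling_shell \<delta> k) (\<lambda>Q. ennreal (b k Q)) \<le> 1 \<and>
    (\<Sum>Q\<in>tiling_shell \<delta> k. enn_powr (ennreal (b k Q)) s * u R Q) = shell_mass R k" by (rule exE)
  have b: "\<And>k Q. 0 \<le> b k Q" "\<And>k. lp_enorm p (tiling_shell \<delta> k) (\<lambda>Q. ennreal (b k Q)) \<le> 1"
    "\<And>k. (\<Sum>Q\<in>tiling_shell \<delta> k. enn_powr (ennreal (b k Q)) s * u R Q) = shell_mass R k"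
    by (simp_all only: b_all)
  have bound: "shell_mass R k \<le> ennreal X" for k
    using X(2)[OF seq_unit_shell[OF b(1,2)], of k] b(3)[of k] by simp
  show ?thesis
  proof (rule that[OF X(1) bound])
    fix n :: nat
    have fin: "shell_mass R k < top" for k using le_less_trans[OF bound ennreal_less_top] .
    obtain B :: "nat \<Rightarrow> real" where B: "\<And>k. 0 \<le> B k" "lp_enorm q {..<n} (\<lambda>k. ennreal (B k)) \<le> 1"
      "(\<Sum>k<n. enn_powr (ennreal (B k)) s * shell_mass R k) = lp_enorm (star_exponent s q) {..<n} (shell_mass R)"
      by (rule lp_dual_extremal[where I = "{..<n}" and m = "shell_mass R", OF finite_lessThan q_pos s_pos fin]) (rule that; (assumption | blast))
    define F where "F = (\<Union>k<n. tiling_shell \<delta> k)"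
    define b' where "b' Q = B (fst Q) * b (fst Q) Q" for Q
    have "lp_enorm p (tiling_shell \<delta> k) (\<lambda>Q. if Q \<in> F then ennreal (b' Q) else 0) \<le> (if k \<in> {..<n} then ennreal (B k) else 0)" for k
    proof (cases "k < n")
      case True
      have "lp_enorm p (tiling_shell \<delta> k) (\<lambda>Q. if Q \<in> F then ennreal (b' Q) else 0) = lp_enorm p (tiling_shell \<delta> k) (\<lambda>Q. ennreal (B k) * ennreal (b k Q))"
      proof (intro lp_enorm_cong p_pos)
        fix Q assume Q: "Q \<in> tiling_shell \<delta> k"
        then have "Q \<in> F" using True unfolding F_def by blast
        moreover have "fst Q = k" using Q by (simp add: tiling_shell_eq)
        ultimately show "(if Q \<in> F then ennreal (b' Q) else 0) = ennreal (B k) * ennreal (b k Q)"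
          using B(1) b(1) by (simp add: b'_def ennreal_mult)
      qed
      also have "\<dots> = ennreal (B k) * lp_enorm p (tiling_shell \<delta> k) (\<lambda>Q. ennreal (b k Q))"
        by (rule lp_enorm_cmult[OF p_pos])
      also have "\<dots> \<le> ennreal (B k) * 1" by (intro mult_left_mono b(2)) simp
      finally show ?thesis using True by simp
    next
      case False
      have "lp_enorm p (tiling_shell \<delta> k) (\<lambda>Q. if Q \<in> F then ennreal (b' Q) else 0) = lp_enorm p (tiling_shell \<delta> k) (\<lambda>_. 0)"
        using False by (intro lp_enorm_cong p_pos) (auto simp: F_def tiling_shell_eq)
      then show ?thesis using p_pos by simp
    qed
    then have "lp_enorm q UNIV (\<lambda>k. lp_enorm p (tiling_shell \<delta> k) (\<lambda>Q. if Q \<in> F then ennreal (b' Q) else 0)) \<le>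
        lp_enorm q UNIV (\<lambda>k. if k \<in> {..<n} then ennreal (B k) else 0)"
      by (intro lp_enorm_mono q_pos)
    also have "\<dots> \<le> 1" unfolding lp_enorm_restrict[OF q_pos] by (rule B(2))
    finally have unit: "seq_unit F b'"
      unfolding seq_unit_def using shell_subset B(1) b(1) by (auto simp: F_def b'_def)
    have "lp_enorm (star_exponent s q) {..<n} (shell_mass R) = (\<Sum>k<n. \<Sum>Q\<in>tiling_shell \<delta> k. enn_powr (ennreal (b' Q)) s * u R Q)"
      unfolding B(3)[symmetric]
    proof (intro sum.cong refl)
      fix k
      have "enn_powr (ennreal (B k)) s * shell_mass R k = (\<Sum>Q\<in>tiling_shell \<delta> k. enn_powr (ennreal (B k)) s * (enn_powr (ennreal (b k Q)) s * u R Q))"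
        unfolding b(3)[symmetric] by (rule sum_distrib_left)
      also have "\<dots> = (\<Sum>Q\<in>tiling_shell \<delta> k. enn_powr (ennreal (b' Q)) s * u R Q)"
      proof (intro sum.cong refl)
        fix Q assume "Q \<in> tiling_shell \<delta> k"
        then have "fst Q = k" by (simp add: tiling_shell_eq)
        then have "ennreal (b' Q) = ennreal (B k) * ennreal (b k Q)"
          using B(1) b(1) by (simp add: b'_def ennreal_mult)
        then show "enn_powr (ennreal (B k)) s * (enn_powr (ennreal (b k Q)) s * u R Q) = enn_powr (ennreal (b' Q)) s * u R Q"
          by (simp only: enn_powr_mult mult.assoc)
      qed
      finally show "enn_powr (ennreal (B k)) s * shell_mass R k = (\<Sum>Q\<in>tiling_shell \<delta> k. enn_powr (ennreal (b' Q)) s * u R Q)" .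
    qed
    also have "\<dots> = (\<Sum>Q\<in>F. enn_powr (ennreal (b' Q)) s * u R Q)"
    proof -
      have "tiling_shell \<delta> i \<inter> tiling_shell \<delta> j = {}" if "i \<noteq> j" for i j
        using that by (auto simp: tiling_shell_eq)
      then show ?thesis unfolding F_def by (intro sum.UNION_disjoint[symmetric]) simp_all
    qed
    also have "\<dots> \<le> ennreal X" by (rule X(2)[OF unit])
    finally show "lp_enorm (star_exponent s q) {..<n} (shell_mass R) \<le> ennreal X" .
  qed
qed

text \<open>Relative to a fixed z, the coefficients grow at most polynomially in the shell index
  while the kernels decay like a Gaussian in it; the sum over a whole shell is handled at once by
  \<open>synthesis_pointwise_bound\<close>.\<close>

lemma shell_functions_vanish:
  assumes C: "C > 0" and mono: "strict_mono (\<kappa> :: nat \<Rightarrow> nat)"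
    and c: "\<And>n Q. Q \<in> tiling_shell \<delta> (\<kappa> n) \<Longrightarrow> cmod (c n Q) \<le> 1 / (C * \<omega> (\<kappa> n))"
  shows "(\<lambda>n. \<Sum>Q\<in>tiling_shell \<delta> (\<kappa> n). c n Q * kernel \<alpha> (\<zeta> Q) z) \<longlonglongrightarrow> 0"
proof -
  obtain C1 where C1: "C1 > 0" "\<And>c f z. synthesizes \<alpha> \<delta> c f \<Longrightarrow>
    ennreal (cmod (f z) * exp (- (\<alpha> / 2) * (cmod z)\<^sup>2)) \<le> ennreal C1 * gauss_sup_tiling (\<alpha> / 4) (\<lambda>Q. ennreal (cmod (c Q))) z"
    by (rule synthesis_pointwise_bound) (rule that; (assumption | blast))
  define f where "f n z = (\<Sum>Q\<in>tiling_shell \<delta> (\<kappa> n). c n Q * kernel \<alpha> (\<zeta> Q) z)" for n z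
  define j where "j = nat \<lfloor>cmod z\<rfloor>"
  have zj: "z \<in> annulus j" unfolding j_def by (rule annulus_floor)
  \<comment> \<open>By \<open>shell_distance\<close> the exponent \<alpha>/4 is worth 2 \<gamma> (k
    - j)^2 up to a constant; one half pays for the weight of the coefficients and one half remains
    as decay.\<close>
  define \<gamma> where "\<gamma> = \<alpha> / 16"
  have \<gamma>: "\<gamma> > 0" using \<alpha>_pos by (simp add: \<gamma>_def)
  define H where "H = exp (\<alpha> / 4) * (exp ((- \<tau>)\<^sup>2 / (4 * \<gamma>)) * (1 + real j) powr (- \<tau>)) / C"
  have H: "H \<ge> 0" using C by (simp add: H_def)
  have bound: "cmod (f n z) * exp (- (\<alpha> / 2) * (cmod z)\<^sup>2) \<le> C1 * H * exp (- \<gamma> * (real (\<kappa> n) - real j)\<^sup>2)" for n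
  proof -
    let ?k = "\<kappa> n"
    let ?c = "\<lambda>Q. if Q \<in> tiling_shell \<delta> ?k then c n Q else 0"
    let ?x = "(real ?k - real j)\<^sup>2"
    have syn: "synthesizes \<alpha> \<delta> ?c (f n)"
      unfolding synthesizes_def
    proof
      fix w
      have "((\<lambda>Q. ?c Q * kernel \<alpha> (\<zeta> Q) w) has_sum (\<Sum>Q\<in>tiling_shell \<delta> ?k. ?c Q * kernel \<alpha> (\<zeta> Q) w)) (tiling \<delta>)"
        by (rule has_sum_finite_neutralI[OF finite_shell shell_subset]) auto
      then show "((\<lambda>Q. ?c Q * kernel \<alpha> (\<zeta> Q) w) has_sum f n w) (tiling \<delta>)" by (simp add: f_def)
    qed
    have "gauss_sup_tiling (\<alpha> / 4) (\<lambda>Q. ennreal (cmod (?c Q))) z \<le> ennreal (H * exp (- \<gamma> * ?x))"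
      unfolding gauss_sup_tiling_def
    proof (rule SUP_least)
      fix Q assume "Q \<in> tiling \<delta>"
      show "ennreal (exp (- (\<alpha> / 4) * (dist z (\<zeta> Q))\<^sup>2)) * ennreal (cmod (?c Q)) \<le> ennreal (H * exp (- \<gamma> * ?x))"
      proof (cases "Q \<in> tiling_shell \<delta> ?k")
        case True
        then have "\<zeta> Q \<in> annulus ?k" using center_in_annulus[of Q] by (simp add: tiling_shell_eq)
        from shell_distance[OF this zj] have "?x \<le> 2 * (dist z (\<zeta> Q))\<^sup>2 + 2" by (simp add: dist_commute)
        then have "\<gamma> * 2 * ?x \<le> \<gamma> * 2 * (2 * (dist z (\<zeta> Q))\<^sup>2 + 2)" using \<gamma> by (intro mult_left_mono) auto
        then have "- (\<alpha> / 4) * (dist z (\<zeta> Q))\<^sup>2 \<le> \<alpha> / 4 + - 2 * \<gamma> * ?x" unfolding \<gamma>_def by (simp add: algebra_simps)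
        then have 1: "exp (- (\<alpha> / 4) * (dist z (\<zeta> Q))\<^sup>2) \<le> exp (\<alpha> / 4) * exp (- 2 * \<gamma> * ?x)"
          unfolding exp_add[symmetric] by simp
        have "cmod (c n Q) \<le> 1 / (C * \<omega> ?k)" by (rule c[OF True])
        also have "\<dots> = (1 + real ?k) powr (- \<tau>) / C" by (simp only: powr_minus_divide) simp
        also have "\<dots> \<le> exp ((- \<tau>)\<^sup>2 / (4 * \<gamma>)) * exp (\<gamma> * ?x) * (1 + real j) powr (- \<tau>) / C"
          using C by (intro divide_right_mono weight_ratio \<gamma>) auto
        finally have 2: "cmod (c n Q) \<le> exp ((- \<tau>)\<^sup>2 / (4 * \<gamma>)) * exp (\<gamma> * ?x) * (1 + real j) powr (- \<tau>) / C" .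
        have "exp (- (\<alpha> / 4) * (dist z (\<zeta> Q))\<^sup>2) * cmod (c n Q) \<le>
            (exp (\<alpha> / 4) * exp (- 2 * \<gamma> * ?x)) * (exp ((- \<tau>)\<^sup>2 / (4 * \<gamma>)) * exp (\<gamma> * ?x) * (1 + real j) powr (- \<tau>) / C)"
          by (intro mult_mono 1 2) auto
        also have "\<dots> = H * (exp (- 2 * \<gamma> * ?x) * exp (\<gamma> * ?x))"
          unfolding H_def by (simp only: mult_ac times_divide_eq_left times_divide_eq_right)
        also have "exp (- 2 * \<gamma> * ?x) * exp (\<gamma> * ?x) = exp (- \<gamma> * ?x)"
          by (simp flip: exp_add)
        finally have "exp (- (\<alpha> / 4) * (dist z (\<zeta> Q))\<^sup>2) * cmod (c n Q) \<le> H * exp (- \<gamma> * ?x)" .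
        then show ?thesis using True by (simp add: ennreal_leI flip: ennreal_mult)
      qed simp
    qed
    then have "ennreal (cmod (f n z) * exp (- (\<alpha> / 2) * (cmod z)\<^sup>2)) \<le> ennreal C1 * ennreal (H * exp (- \<gamma> * ?x))"
      by (intro order_trans[OF C1(2)[OF syn]] mult_left_mono) auto
    also have "\<dots> = ennreal (C1 * H * exp (- \<gamma> * ?x))"
      using C1(1) H by (simp add: mult.assoc flip: ennreal_mult)
    finally show ?thesis using C1(1) H by (subst (asm) ennreal_le_iff) auto
  qed
  have "(\<lambda>n. f n z) \<longlonglongrightarrow> 0"
  proof (rule Lim_null_comparison)
    let ?A = "exp (\<alpha> / 2 * (cmod z)\<^sup>2) * (C1 * H)"
    have "(\<lambda>n. exp (- \<gamma>) ^ n) \<longlonglongrightarrow> 0" using \<gamma> by (intro LIMSEQ_power_zero) auto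
    then have "(\<lambda>n. exp (- \<gamma> * real n)) \<longlonglongrightarrow> 0" by (simp add: mult.commute flip: exp_of_nat_mult)
    then have "(\<lambda>n. ?A * exp (\<gamma> * real j) * exp (- \<gamma> * real n)) \<longlonglongrightarrow> ?A * exp (\<gamma> * real j) * 0"
      by (intro tendsto_mult tendsto_const)
    then show "(\<lambda>n. ?A * exp (\<gamma> * real j) * exp (- \<gamma> * real n)) \<longlonglongrightarrow> 0" by simp
    show "\<forall>\<^sub>F n in sequentially. norm (f n z) \<le> ?A * exp (\<gamma> * real j) * exp (- \<gamma> * real n)"
      unfolding eventually_sequentially
    proof (intro exI[of _ "Suc j"] allI impI)
      fix n assume n: "Suc j \<le> n"
      \<comment> \<open>A strictly increasing sequence of indices satisfies this, so decay in the
        shell index is decay in n.\<close>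
      have kn: "n \<le> \<kappa> n" using strict_mono_imp_increasing[OF mono] .
      then have d: "1 \<le> real (\<kappa> n) - real j" "real n - real j \<le> real (\<kappa> n) - real j" using n by auto
      have "(real n - real j) * 1 \<le> (real (\<kappa> n) - real j) * (real (\<kappa> n) - real j)"
        using d by (intro mult_mono) auto
      then have "\<gamma> * (real n - real j) \<le> \<gamma> * (real (\<kappa> n) - real j)\<^sup>2"
        using \<gamma> by (simp add: power2_eq_square)
      then have "exp (- \<gamma> * (real (\<kappa> n) - real j)\<^sup>2) \<le> exp (\<gamma> * real j) * exp (- \<gamma> * real n)"
        unfolding exp_add[symmetric] by (simp add: algebra_simps)
      then have "C1 * H * exp (- \<gamma> * (real (\<kappa> n) - real j)\<^sup>2) \<le> C1 * H * (exp (\<gamma> * real j) * exp (- \<gamma> * real n))"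
        using C1(1) H by (intro mult_left_mono) auto
      then have "cmod (f n z) * exp (- (\<alpha> / 2) * (cmod z)\<^sup>2) \<le> C1 * H * (exp (\<gamma> * real j) * exp (- \<gamma> * real n))"
        using bound[of n] by (rule order_trans[rotated])
      then have "exp (\<alpha> / 2 * (cmod z)\<^sup>2) * (cmod (f n z) * exp (- (\<alpha> / 2) * (cmod z)\<^sup>2)) \<le> exp (\<alpha> / 2 * (cmod z)\<^sup>2) * (C1 * H * (exp (\<gamma> * real j) * exp (- \<gamma> * real n)))"
        by (rule mult_left_mono) simp
      moreover have "exp (\<alpha> / 2 * (cmod z)\<^sup>2) * (cmod (f n z) * exp (- (\<alpha> / 2) * (cmod z)\<^sup>2)) = cmod (f n z)"
      proof -
        have "exp (\<alpha> / 2 * (cmod z)\<^sup>2) * exp (- (\<alpha> / 2) * (cmod z)\<^sup>2) = 1" by (simp flip: exp_add)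
        then show ?thesis by (metis mult.left_commute mult.right_neutral)
      qed
      ultimately show "norm (f n z) \<le> ?A * exp (\<gamma> * real j) * exp (- \<gamma> * real n)"
        by (simp only: mult.assoc)
    qed
  qed
  then show ?thesis by (simp add: f_def)
qed

text \<open>The cluster-point argument makes no distinction between q \<le> s and s < q. For q \<le>
  s this is, together with finiteness, the whole condition.\<close>

lemma shell_mass_tendsto_0:
  assumes R: "R > 0"
  shows "shell_mass R \<longlonglongrightarrow> 0"
proof (rule order_tendstoI)
  fix e :: ennreal assume e: "0 < e"
  interpret PM: pseudometric "quasinorm_topology Ls ls_norm" Ls ls_dist by (rule ls_pseudometric)
  let ?t = "s / min 1 s"
  have t: "?t > 0" using s_pos by simp
  obtain K C where K: "K > 0" "C > 0" "\<And>F b. seq_unit F b \<Longrightarrow> \<exists>c.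
    (\<forall>Q\<in>F. cmod (c Q) = b Q / (C * \<omega> (fst Q))) \<and>
    (\<lambda>z. \<Sum>Q\<in>F. c Q * kernel \<alpha> (\<zeta> Q) z) \<in> fock_ball \<and>
    (\<Sum>Q\<in>F. enn_powr (ennreal (b Q)) s * u R Q) \<le> ennreal K * ls_int (\<lambda>z. \<Sum>Q\<in>F. c Q * kernel \<alpha> (\<zeta> Q) z)"
    by (rule test_function[OF R]) (rule that; (assumption | blast))
  show "\<forall>\<^sub>F k in sequentially. shell_mass R k < e"
  proof (rule ccontr)
    assume not: "\<not> ?thesis"
    obtain \<epsilon> where \<epsilon>: "\<epsilon> > 0" "ennreal \<epsilon> \<le> e"
    proof (cases e)
      case (real x)
      then show ?thesis using e that[of x] by simp
    next
      case top
      then show ?thesis using that[of 1] by simp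
    qed
    have "infinite {k. ennreal \<epsilon> \<le> shell_mass R k}"
      unfolding infinite_nat_iff_unbounded_le
    proof
      fix m
      obtain k where "k \<ge> m" "\<not> shell_mass R k < e" using not unfolding eventually_sequentially by blast
      then show "\<exists>n\<ge>m. n \<in> {k. ennreal \<epsilon> \<le> shell_mass R k}" using \<epsilon>(2) by (auto intro!: exI[of _ k])
    qed
    then obtain \<kappa> :: "nat \<Rightarrow> nat" where \<kappa>: "strict_mono \<kappa>" "\<And>n. \<kappa> n \<in> {k. ennreal \<epsilon> \<le> shell_mass R k}"
      using infinite_enumerate by blast
    have "\<forall>n. \<exists>c. (\<forall>Q\<in>tiling_shell \<delta> (\<kappa> n). cmod (c Q) \<le> 1 / (C * \<omega> (\<kappa> n))) \<and>
      (\<lambda>z. \<Sum>Q\<in>tiling_shell \<delta> (\<kappa> n). c Q * kernel \<alpha> (\<zeta> Q) z) \<in> fock_ball \<and>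
      ennreal \<epsilon> \<le> ennreal K * ls_int (\<lambda>z. \<Sum>Q\<in>tiling_shell \<delta> (\<kappa> n). c Q * kernel \<alpha> (\<zeta> Q) z)"
    proof
      fix n
      obtain b where b: "\<And>Q. 0 \<le> b Q" "lp_enorm p (tiling_shell \<delta> (\<kappa> n)) (\<lambda>Q. ennreal (b Q)) \<le> 1"
        "(\<Sum>Q\<in>tiling_shell \<delta> (\<kappa> n). enn_powr (ennreal (b Q)) s * u R Q) = shell_mass R (\<kappa> n)"
        by (rule shell_extremal[OF R]) (rule that; (assumption | blast))
      obtain c where c: "\<forall>Q\<in>tiling_shell \<delta> (\<kappa> n). cmod (c Q) = b Q / (C * \<omega> (fst Q))"
        "(\<lambda>z. \<Sum>Q\<in>tiling_shell \<delta> (\<kappa> n). c Q * kernel \<alpha> (\<zeta> Q) z) \<in> fock_ball"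
        "(\<Sum>Q\<in>tiling_shell \<delta> (\<kappa> n). enn_powr (ennreal (b Q)) s * u R Q) \<le> ennreal K * ls_int (\<lambda>z. \<Sum>Q\<in>tiling_shell \<delta> (\<kappa> n). c Q * kernel \<alpha> (\<zeta> Q) z)"
        using K(3)[OF seq_unit_shell[OF b(1,2)]] by blast
      have "cmod (c Q) \<le> 1 / (C * \<omega> (\<kappa> n))" if Q: "Q \<in> tiling_shell \<delta> (\<kappa> n)" for Q
      proof -
        have "ennreal (b Q) \<le> 1"
          by (rule order_trans[OF lp_enorm_upper[OF p_pos Q, of "\<lambda>Q. ennreal (b Q)"] b(2)])
        then have "b Q \<le> 1" by simp
        moreover have "fst Q = \<kappa> n" using Q by (simp add: tiling_shell_eq)
        ultimately show ?thesis using c(1) Q K(2) by (simp add: divide_right_mono)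
      qed
      moreover have "ennreal \<epsilon> \<le> ennreal K * ls_int (\<lambda>z. \<Sum>Q\<in>tiling_shell \<delta> (\<kappa> n). c Q * kernel \<alpha> (\<zeta> Q) z)"
        using \<kappa>(2)[of n] c(3) b(3) by (simp add: order_trans)
      ultimately show "\<exists>c. (\<forall>Q\<in>tiling_shell \<delta> (\<kappa> n). cmod (c Q) \<le> 1 / (C * \<omega> (\<kappa> n))) \<and>
        (\<lambda>z. \<Sum>Q\<in>tiling_shell \<delta> (\<kappa> n). c Q * kernel \<alpha> (\<zeta> Q) z) \<in> fock_ball \<and>
        ennreal \<epsilon> \<le> ennreal K * ls_int (\<lambda>z. \<Sum>Q\<in>tiling_shell \<delta> (\<kappa> n). c Q * kernel \<alpha> (\<zeta> Q) z)"
        using c(2) by (intro exI[of _ c] conjI ballI)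
    qed
    from choice[OF this] obtain c where c_all: "\<forall>n. (\<forall>Q\<in>tiling_shell \<delta> (\<kappa> n). cmod (c n Q) \<le> 1 / (C * \<omega> (\<kappa> n))) \<and>
      (\<lambda>z. \<Sum>Q\<in>tiling_shell \<delta> (\<kappa> n). c n Q * kernel \<alpha> (\<zeta> Q) z) \<in> fock_ball \<and>
      ennreal \<epsilon> \<le> ennreal K * ls_int (\<lambda>z. \<Sum>Q\<in>tiling_shell \<delta> (\<kappa> n). c n Q * kernel \<alpha> (\<zeta> Q) z)"
      by (rule exE)
    have c: "\<And>n Q. Q \<in> tiling_shell \<delta> (\<kappa> n) \<Longrightarrow> cmod (c n Q) \<le> 1 / (C * \<omega> (\<kappa> n))"
      "\<And>n. (\<lambda>z. \<Sum>Q\<in>tiling_shell \<delta> (\<kappa> n). c n Q * kernel \<alpha> (\<zeta> Q) z) \<in> fock_ball"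
      "\<And>n. ennreal \<epsilon> \<le> ennreal K * ls_int (\<lambda>z. \<Sum>Q\<in>tiling_shell \<delta> (\<kappa> n). c n Q * kernel \<alpha> (\<zeta> Q) z)"
      using c_all by blast+
    define f where "f n = (\<lambda>z. \<Sum>Q\<in>tiling_shell \<delta> (\<kappa> n). c n Q * kernel \<alpha> (\<zeta> Q) z)" for n
    have f: "f n \<in> fock_ball" "ennreal \<epsilon> \<le> ennreal K * ls_int (f n)" for n
      using c(2,3)[of n] unfolding f_def by blast+
    have fL: "f n \<in> Ls" for n using f(1)[of n] fock_subset_ls by blast
    have f0: "(\<lambda>n. f n z) \<longlonglongrightarrow> 0" for z
      unfolding f_def by (rule shell_functions_vanish[where c = c, OF K(2) \<kappa>(1) c(1)])
    obtain g where g: "g \<in> Ls" "\<And>e. e > 0 \<Longrightarrow> infinite {n. ls_dist (f n) g < e}"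
      by (rule ball_cluster_point[of f, OF f(1)]) (rule that; (assumption | blast))
    \<comment> \<open>Infinitely many f n lie within \<eta> of g and tend to 0 pointwise, so along
      them f n - g tends to -g and Fatou's lemma bounds the integral of g. As \<eta> is arbitrary, g
      vanishes almost everywhere.\<close>
    have g_int: "ls_int g \<le> ennreal (\<eta> powr ?t)" if \<eta>: "\<eta> > 0" for \<eta>
    proof -
      obtain r :: "nat \<Rightarrow> nat" where r: "strict_mono r" "\<And>i. r i \<in> {n. ls_dist (f n) g < \<eta>}"
        using infinite_enumerate[OF g(2)[OF \<eta>]] by blast
      have "(\<integral>\<^sup>+z. ennreal (Ls_integrand \<alpha> s (\<lambda>z. - g z) z) \<partial>\<mu>) \<le> ennreal (\<eta> powr ?t)"
      proof (rule nn_integral_limit_le)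
        fix i
        have "f (r i) - g \<in> borel_measurable \<mu>" using ls_diff[OF fL g(1)] by (simp add: weighted_Ls_def)
        from Ls_integrand_measurable[OF sets_\<mu> this]
        show "(\<lambda>z. ennreal (Ls_integrand \<alpha> s (f (r i) - g) z)) \<in> borel_measurable \<mu>"
          by (rule measurable_compose[OF _ measurable_ennreal])
        show "ls_int (f (r i) - g) \<le> ennreal (\<eta> powr ?t)"
          using r(2)[of i] ls_dist_less_int[OF fL g(1) \<eta>] by (simp add: less_imp_le)
      next
        fix z
        have "(\<lambda>i. f (r i) z) \<longlonglongrightarrow> 0" using LIMSEQ_subseq_LIMSEQ[OF f0 r(1)] by (simp add: o_def)
        then have "(\<lambda>i. (f (r i) - g) z) \<longlonglongrightarrow> - g z"
          using tendsto_diff[OF _ tendsto_const[of "g z"], of "\<lambda>i. f (r i) z" 0] by simp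
        then show "(\<lambda>i. ennreal (Ls_integrand \<alpha> s (f (r i) - g) z)) \<longlonglongrightarrow> ennreal (Ls_integrand \<alpha> s (\<lambda>z. - g z) z)"
          by (rule Ls_integrand_tendsto[OF _ s_pos])
      qed
      then show ?thesis by (simp add: Ls_integrand_def)
    qed
    \<comment> \<open>Chosen so that a distance less than 2 \<eta> from 0 forces the integral of f n
      below \<epsilon> / (2 K), against its lower bound \<epsilon> / K.\<close>
    define \<eta> where "\<eta> = (\<epsilon> / (2 * K)) powr (1 / ?t) / 2"
    have \<eta>: "\<eta> > 0" "(2 * \<eta>) powr ?t = \<epsilon> / (2 * K)"
      using \<epsilon>(1) K(1) t by (auto simp: \<eta>_def powr_powr)
    have "ls_int g < ennreal (\<eta> powr ?t)"
    proof -
      have "ls_int g \<le> ennreal ((\<eta> / 2) powr ?t)" using \<eta> by (intro g_int) simp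
      also have "\<dots> < ennreal (\<eta> powr ?t)"
        using \<eta> t by (intro ennreal_lessI powr_less_mono2) auto
      finally show ?thesis .
    qed
    then have g0: "ls_dist g (\<lambda>_. 0) < \<eta>" using ls_dist_zero_less[OF g(1) \<eta>(1)] by blast
    have "infinite {n. ls_dist (f n) g < \<eta>}" by (rule g(2)[OF \<eta>(1)])
    then obtain n where n: "ls_dist (f n) g < \<eta>" using not_finite_existsD by blast
    have "ls_dist (f n) (\<lambda>_. 0) < 2 * \<eta>" using PM.d_triangle[OF fL g(1) ls_zero, of n] n g0 by simp
    then have "ls_int (f n) < ennreal ((2 * \<eta>) powr ?t)"
      using ls_dist_zero_less[OF fL, of "2 * \<eta>"] \<eta>(1) by simp
    then have "ennreal K * ls_int (f n) \<le> ennreal K * ennreal (\<epsilon> / (2 * K))"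
      unfolding \<eta>(2) by (intro mult_left_mono) auto
    also have "\<dots> = ennreal (\<epsilon> / 2)" using K(1) \<epsilon>(1) by (simp flip: ennreal_mult)
    also have "\<dots> < ennreal \<epsilon>" using \<epsilon>(1) by (intro ennreal_lessI) auto
    finally show False using f(2)[of n] by simp
  qed
qed simp

text \<open>The null sequence is available in all cases. For s < q the truncated norms are bounded
  uniformly in the truncation, and monotone passage to the limit gives the full norm.\<close>

lemma shell_condition_of_vanishing:
  assumes "R > 0"
  shows "shell_condition s q (shell_mass R)"
proof -
  obtain X where X: "X > 0" "\<And>k. shell_mass R k \<le> ennreal X"
    "\<And>n. lp_enorm (star_exponent s q) {..<n} (shell_mass R) \<le> ennreal X"
    by (rule shell_mass_bounded[OF assms]) (rule that; (assumption | blast))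
  have fin: "shell_mass R k < top" for k using le_less_trans[OF X(2) ennreal_less_top] .
  show ?thesis
    unfolding shell_condition_def
  proof (intro conjI impI)
    show "null_norm_sequence (shell_mass R)"
      using fin shell_mass_tendsto_0[OF assms] by (simp add: null_norm_sequence_def)
  next
    assume "ennreal s < q"
    then obtain r where r: "r > 0" "star_exponent s q = ennreal r"
      using star_exponent_finite[OF s_pos] by blast
    have "(\<Sum>k<n. enn_powr (shell_mass R k) r) \<le> enn_powr (ennreal X) r" for n
    proof -
      have "enn_powr (\<Sum>k<n. enn_powr (shell_mass R k) r) (1 / r) \<le> ennreal X"
        using X(3)[of n] r by (simp add: lp_enorm_finite_exponent nn_integral_count_space_finite)
      then show ?thesis using r by (simp add: enn_powr_le_iff)
    qed
    then have "(\<Sum>k. enn_powr (shell_mass R k) r) \<le> enn_powr (ennreal X) r"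
      by (simp add: suminf_eq_SUP SUP_le_iff)
    also have "\<dots> < top" by simp
    finally show "lp_enorm (star_exponent s q) UNIV (shell_mass R) < top"
      using r by (simp add: lp_enorm_finite_exponent nn_integral_count_space_nat)
  qed
qed

end

end

theorem theorem1p5:
  fixes \<alpha> s \<delta>\<^sub>0 \<delta> R c_in C_out :: real
    and p q :: ennreal
    and \<mu> :: "complex measure"
  assumes "\<alpha> > 0" and "p > 0" and "q > 0" and "s > 0"
    and "pocket_ball_constants c_in C_out"
    and "0 < \<delta>\<^sub>0" and "\<delta>\<^sub>0 \<le> 1 / 2"
    and "atomic_decomposition \<alpha> p q \<delta>\<^sub>0"
    and "0 < \<delta>" and "\<delta> < \<delta>\<^sub>0"
    and "R > C_out * \<delta>"
    and "sets \<mu> = sets borel"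
  shows "(vanishing_Carleson \<alpha> p q s \<mu> \<longleftrightarrow>
      (q \<le> ennreal s \<longrightarrow>
        null_norm_sequence (seq_shell_norm \<delta> (star_exponent s p) (pocket_mass \<alpha> p q s \<mu> R \<delta>))) \<and>
      (ennreal s < q \<longrightarrow>
        pocket_mass \<alpha> p q s \<mu> R \<delta> \<in> mixed_seq_space \<delta> (star_exponent s p) (star_exponent s q)))
    \<and> (vanishing_Carleson \<alpha> p q s \<mu> \<longleftrightarrow>
      (q \<le> ennreal s \<longrightarrow>
        null_norm_sequence (fun_shell_norm (star_exponent s p) (ball_mass \<alpha> p q s \<mu> R))) \<and>
      (ennreal s < q \<longrightarrow>
        ball_mass \<alpha> p q s \<mu> R \<in> mixed_shell_space (star_exponent s p) (star_exponent s q)))"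
proof -
  interpret fock_atomic \<delta> c_in C_out \<alpha> s p q \<mu> \<delta>\<^sub>0
    using assms by unfold_locales simp_all
  have "0 < C_out * \<delta>" using c_in_pos c_in_less \<delta>_pos by simp
  then have R: "R > 0" "C_out * \<delta> \<le> R" using assms(11) by linarith+
  have "vanishing_Carleson \<alpha> p q s \<mu> \<longleftrightarrow> shell_condition s q (shell_mass R)"
    using shell_condition_of_vanishing[OF _ R(1)] compact_embedding[OF R(2)] by blast
  moreover have "vanishing_Carleson \<alpha> p q s \<mu> \<longleftrightarrow> shell_condition s q (fun_shell_norm (star_exponent s p) (U R))"
    using calculation shell_condition_ball_mass_iff[OF assms(11)] by simp
  \<comment> \<open>Membership in the shell space includes measurability, which is independent of
    the size of the masses.\<close>
  moreover have "U R \<in> borel_measurable lborel" using ball_mass_measurable by simp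
  ultimately show ?thesis
    by (simp add: shell_condition_def mixed_seq_space_def mixed_shell_space_def)
qed

end
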